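(* Let $(M,g)$ be a Riemannian manifold of dimension $n=2$ of constant sectional curvature, let $\omega=\mathrm{Vol}_g=\sqrt{\det(g)}\,dx\wedge dy$ be the volume form of $g$, and let $\tau$ be a 1-form on $M$ such that $d\tau=c\cdot\omega$ for a certain constant $c$. Assume that $|\tau|_g<1$ at every point, so that $F_{g,\tau}(x,y)=\sqrt{g_x(y,y)}+\tau(y)$ is a Finsler metric. Then, locally (i.e., on a suitable neighborhood of each point), the vector space of almost Killing vector fields of $F_{g,\tau}$ has dimension $\tfrac{n^2-n}{2}+1+1=3$.
   Context: All objects are assumed sufficiently smooth; manifolds are connected. The (generally nonsymmetric) distance associated with a Finsler metric $F$ is $d(p,q)=\inf\{\int_0^1 F(c(t),c'(t))\,dt : c\in C^1([0,1];M),\ c(0)=p,\ c(1)=q\}$. Put $T(p,q,r):=d(p,q)+d(q,r)-d(p,r)$. A diffeomorphism $\phi:U\to V$ with $U,V\subseteq M$ is an almost isometry if $T(p,q,r)=T(\phi(p),\phi(q),\phi(r))$ for all $p,q,r\in U$. A vector field $K$ is almost Killing if its local flow acts by almost isometries; all considerations being local, this means that every point has a neighborhood $U$ such that, for all sufficiently small $|t|$, the time-$t$ flow of $K$ restricted to $U$ is an almost isometry onto its image. $|\tau|_g$ denotes the pointwise $g$-norm of the 1-form $\tau$. $M$ is taken to be oriented so that the volume form is defined. *)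

theory Defs
  imports "HOL-Analysis.Analysis" "HOL-Library.Function_Algebras"
begin

text \<open>Pointwise real vector space structure on functions, so that \<^const>\<open>subspace\<close>,
  \<^const>\<open>independent\<close> and \<^const>\<open>dim\<close> apply to tangent vectors and vector fields.\<close>

instantiation "fun" :: (type, scaleR) scaleR
begin
definition scaleR_fun :: "real \<Rightarrow> ('a \<Rightarrow> 'b) \<Rightarrow> 'a \<Rightarrow> 'b" where
  "scaleR_fun a f = (\<lambda>x. a *\<^sub>R f x)"
instance ..
end

instance "fun" :: (type, real_vector) real_vector
  by standard (simp_all add: scaleR_fun_def plus_fun_def fun_eq_iff algebra_simps)


section \<open>Smooth functions on open subsets of Euclidean spaces\<close>

primrec Ck_on :: "nat \<Rightarrow> 'a::euclidean_space set \<Rightarrow> ('a \<Rightarrow> 'b::real_normed_vector) \<Rightarrow> bool" where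
  "Ck_on 0 S f \<longleftrightarrow> continuous_on S f"
| "Ck_on (Suc k) S f \<longleftrightarrow> (\<forall>x\<in>S. f differentiable (at x)) \<and>
     (\<forall>b\<in>Basis. Ck_on k S (\<lambda>x. frechet_derivative f (at x) b))"

text \<open>Only meant for open \<open>S\<close>.\<close>

definition smooth_on :: "'a::euclidean_space set \<Rightarrow> ('a \<Rightarrow> 'b::real_normed_vector) \<Rightarrow> bool" where
  "smooth_on S f \<longleftrightarrow> (\<forall>k. Ck_on k S f)"

definition partial_deriv :: "'n \<Rightarrow> (real^'n \<Rightarrow> real) \<Rightarrow> real^'n \<Rightarrow> real" where
  "partial_deriv i f x = frechet_derivative f (at x) (axis i 1)"


section \<open>Oriented smooth manifolds\<close>

text \<open>A manifold is the whole type \<open>'m\<close> together with an atlas, which need not be maximal.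
  A chart is its domain together with its coordinate map; the values of the coordinate map
  outside the domain are never used.\<close>

type_synonym ('m, 'n) chart = "'m set \<times> ('m \<Rightarrow> real^'n)"

abbreviation chart_dom :: "('m, 'n::finite) chart \<Rightarrow> 'm set" where "chart_dom \<equiv> fst"
abbreviation chart_map :: "('m, 'n::finite) chart \<Rightarrow> 'm \<Rightarrow> real^'n" where "chart_map \<equiv> snd"

definition chart_inv :: "('m, 'n::finite) chart \<Rightarrow> real^'n \<Rightarrow> 'm" where
  "chart_inv \<kappa> = inv_into (chart_dom \<kappa>) (chart_map \<kappa>)"

definition is_chart :: "('m::topological_space, 'n::finite) chart \<Rightarrow> bool" where
  "is_chart \<kappa> \<longleftrightarrow> open (chart_dom \<kappa>) \<and> open (chart_map \<kappa> ` chart_dom \<kappa>) \<and>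
     homeomorphism (chart_dom \<kappa>) (chart_map \<kappa> ` chart_dom \<kappa>) (chart_map \<kappa>) (chart_inv \<kappa>)"

definition transition :: "('m, 'n::finite) chart \<Rightarrow> ('m, 'n) chart \<Rightarrow> real^'n \<Rightarrow> real^'n" where
  "transition \<kappa> \<kappa>' = chart_map \<kappa>' \<circ> chart_inv \<kappa>"

definition oriented_atlas :: "('m::topological_space, 'n::finite) chart set \<Rightarrow> bool" where
  "oriented_atlas A \<longleftrightarrow>
     (\<forall>\<kappa>\<in>A. is_chart \<kappa>) \<and> (\<Union>\<kappa>\<in>A. chart_dom \<kappa>) = UNIV \<and>
     (\<forall>\<kappa>\<in>A. \<forall>\<kappa>'\<in>A.
        smooth_on (chart_map \<kappa> ` (chart_dom \<kappa> \<inter> chart_dom \<kappa>')) (transition \<kappa> \<kappa>') \<and>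
        (\<forall>x \<in> chart_map \<kappa> ` (chart_dom \<kappa> \<inter> chart_dom \<kappa>').
           det (matrix (frechet_derivative (transition \<kappa> \<kappa>') (at x))) > 0))"

text \<open>A tangent vector at \<open>p\<close> is the family of its coordinate vectors in all charts around \<open>p\<close>,
  related by the derivatives of the transition maps, and \<open>0\<close> at every other index.\<close>

type_synonym ('m, 'n) tangent = "('m, 'n::finite) chart \<Rightarrow> real^'n"

definition charts_at :: "('m, 'n::finite) chart set \<Rightarrow> 'm \<Rightarrow> ('m, 'n) chart set" where
  "charts_at A p = {\<kappa>\<in>A. p \<in> chart_dom \<kappa>}"

definition tangent_space :: "('m, 'n::finite) chart set \<Rightarrow> 'm \<Rightarrow> ('m, 'n) tangent set" where
  "tangent_space A p = {v. (\<forall>\<kappa>. \<kappa> \<notin> charts_at A p \<longrightarrow> v \<kappa> = 0) \<and>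
     (\<forall>\<kappa>\<in>charts_at A p. \<forall>\<kappa>'\<in>charts_at A p.
        v \<kappa>' = frechet_derivative (transition \<kappa> \<kappa>') (at (chart_map \<kappa> p)) (v \<kappa>))}"

text \<open>The coordinate vector \<open>\<partial>\<^sub>i\<close> of the chart \<open>\<kappa>\<close> at \<open>p\<close>.\<close>

definition coord_vec :: "('m, 'n::finite) chart set \<Rightarrow> ('m, 'n) chart \<Rightarrow> 'm \<Rightarrow> 'n \<Rightarrow> ('m, 'n) tangent" where
  "coord_vec A \<kappa> p i = (\<lambda>\<kappa>'. if \<kappa>' \<in> charts_at A p
     then frechet_derivative (transition \<kappa> \<kappa>') (at (chart_map \<kappa> p)) (axis i 1) else 0)"

definition smooth_map_on :: "('m::topological_space, 'n::finite) chart set \<Rightarrow> 'm set \<Rightarrow> ('m \<Rightarrow> 'm) \<Rightarrow> bool" where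
  "smooth_map_on A U \<phi> \<longleftrightarrow> continuous_on U \<phi> \<and>
     (\<forall>\<kappa>\<in>A. \<forall>\<kappa>'\<in>A. smooth_on (chart_map \<kappa> ` {p \<in> U \<inter> chart_dom \<kappa>. \<phi> p \<in> chart_dom \<kappa>'})
        (chart_map \<kappa>' \<circ> \<phi> \<circ> chart_inv \<kappa>))"

definition diffeomorphism ::
    "('m::topological_space, 'n::finite) chart set \<Rightarrow> 'm set \<Rightarrow> 'm set \<Rightarrow> ('m \<Rightarrow> 'm) \<Rightarrow> bool" where
  "diffeomorphism A U V \<phi> \<longleftrightarrow> open U \<and> open V \<and> bij_betw \<phi> U V \<and>
     smooth_map_on A U \<phi> \<and> smooth_map_on A V (inv_into U \<phi>)"

text \<open>Vector fields on \<open>W\<close> are extended by \<open>0\<close> outside \<open>W\<close>, so that they form a subspace of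
  the function space.\<close>

definition vector_fields ::
    "('m, 'n::finite) chart set \<Rightarrow> 'm set \<Rightarrow> ('m \<Rightarrow> ('m, 'n) tangent) set" where
  "vector_fields A W = {K. (\<forall>p\<in>W. K p \<in> tangent_space A p) \<and> (\<forall>p. p \<notin> W \<longrightarrow> K p = 0) \<and>
     (\<forall>\<kappa>\<in>A. smooth_on (chart_map \<kappa> ` (chart_dom \<kappa> \<inter> W)) (\<lambda>x. K (chart_inv \<kappa> x) \<kappa>))}"


section \<open>Riemannian metrics\<close>

type_synonym ('m, 'n) metric = "'m \<Rightarrow> ('m, 'n::finite) tangent \<Rightarrow> ('m, 'n) tangent \<Rightarrow> real"

text \<open>The matrix \<open>g\<^sub>i\<^sub>j\<close> in the chart \<open>\<kappa>\<close>, as a function of the coordinates.\<close>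

definition metric_coeff ::
    "('m, 'n::finite) chart set \<Rightarrow> ('m, 'n) metric \<Rightarrow> ('m, 'n) chart \<Rightarrow> real^'n \<Rightarrow> real^'n^'n" where
  "metric_coeff A g \<kappa> x = (let p = chart_inv \<kappa> x in
     \<chi> i j. g p (coord_vec A \<kappa> p i) (coord_vec A \<kappa> p j))"

definition riemannian_metric :: "('m, 'n::finite) chart set \<Rightarrow> ('m, 'n) metric \<Rightarrow> bool" where
  "riemannian_metric A g \<longleftrightarrow>
     (\<forall>p. \<forall>u\<in>tangent_space A p. \<forall>v\<in>tangent_space A p.
        g p u v = g p v u \<and> (u \<noteq> 0 \<longrightarrow> g p u u > 0) \<and>
        (\<forall>a b. \<forall>w\<in>tangent_space A p. g p (a *\<^sub>R u + b *\<^sub>R v) w = a * g p u w + b * g p v w)) \<and>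
     (\<forall>\<kappa>\<in>A. smooth_on (chart_map \<kappa> ` chart_dom \<kappa>) (metric_coeff A g \<kappa>))"

text \<open>\<open>christoffel A g \<kappa> k i j\<close> is \<open>\<Gamma>\<^sup>k\<^sub>i\<^sub>j\<close>.\<close>

definition christoffel :: "('m, 'n::finite) chart set \<Rightarrow> ('m, 'n) metric \<Rightarrow> ('m, 'n) chart \<Rightarrow>
    'n \<Rightarrow> 'n \<Rightarrow> 'n \<Rightarrow> real^'n \<Rightarrow> real" where
  "christoffel A g \<kappa> k i j x = (let G = metric_coeff A g \<kappa> in
     (1/2) * (\<Sum>l\<in>UNIV. matrix_inv (G x) $ k $ l *
       (partial_deriv i (\<lambda>y. G y $ j $ l) x + partial_deriv j (\<lambda>y. G y $ i $ l) x
        - partial_deriv l (\<lambda>y. G y $ i $ j) x)))"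

text \<open>\<open>riemann_coeff A g \<kappa> l i j k\<close> is the \<open>\<partial>\<^sub>l\<close>-component of \<open>R(\<partial>\<^sub>i,\<partial>\<^sub>j)\<partial>\<^sub>k\<close>, where
  \<open>R(X,Y)Z = \<nabla>\<^sub>X\<nabla>\<^sub>YZ - \<nabla>\<^sub>Y\<nabla>\<^sub>XZ - \<nabla>\<^bsub>[X,Y]\<^esub>Z\<close> and \<open>\<nabla>\<close> is the Levi-Civita connection.\<close>

definition riemann_coeff :: "('m, 'n::finite) chart set \<Rightarrow> ('m, 'n) metric \<Rightarrow> ('m, 'n) chart \<Rightarrow>
    'n \<Rightarrow> 'n \<Rightarrow> 'n \<Rightarrow> 'n \<Rightarrow> real^'n \<Rightarrow> real" where
  "riemann_coeff A g \<kappa> l i j k x = (let \<Gamma> = christoffel A g \<kappa> in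
     partial_deriv i (\<Gamma> l j k) x - partial_deriv j (\<Gamma> l i k) x
     + (\<Sum>m\<in>UNIV. \<Gamma> l i m x * \<Gamma> m j k x - \<Gamma> l j m x * \<Gamma> m i k x))"

text \<open>The sectional curvature \<open>g(R(u,v)v,u) / (g(u,u) g(v,v) - g(u,v)\<^sup>2)\<close> of the plane spanned
  by \<open>u\<close> and \<open>v\<close>, computed in the chart \<open>\<kappa>\<close>.\<close>

definition sectional_curvature :: "('m, 'n::finite) chart set \<Rightarrow> ('m, 'n) metric \<Rightarrow>
    ('m, 'n) chart \<Rightarrow> 'm \<Rightarrow> ('m, 'n) tangent \<Rightarrow> ('m, 'n) tangent \<Rightarrow> real" where
  "sectional_curvature A g \<kappa> p u v = (let x = chart_map \<kappa> p in
     (\<Sum>i\<in>UNIV. \<Sum>j\<in>UNIV. \<Sum>k\<in>UNIV. \<Sum>l\<in>UNIV. \<Sum>m\<in>UNIV.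
        metric_coeff A g \<kappa> x $ l $ m * riemann_coeff A g \<kappa> l i j k x *
        u \<kappa> $ i * v \<kappa> $ j * v \<kappa> $ k * u \<kappa> $ m)
     / (g p u u * g p v v - (g p u v)\<^sup>2))"

definition constant_sectional_curvature ::
    "('m, 'n::finite) chart set \<Rightarrow> ('m, 'n) metric \<Rightarrow> bool" where
  "constant_sectional_curvature A g \<longleftrightarrow>
     (\<exists>\<mu>. \<forall>p. \<forall>\<kappa>\<in>charts_at A p. \<forall>u\<in>tangent_space A p. \<forall>v\<in>tangent_space A p.
        u \<noteq> v \<and> independent {u, v} \<longrightarrow> sectional_curvature A g \<kappa> p u v = \<mu>)"


section \<open>Differential forms\<close>

definition one_form ::
    "('m, 'n::finite) chart set \<Rightarrow> ('m \<Rightarrow> ('m, 'n) tangent \<Rightarrow> real) \<Rightarrow> bool" where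
  "one_form A \<tau> \<longleftrightarrow>
     (\<forall>p a b. \<forall>u\<in>tangent_space A p. \<forall>v\<in>tangent_space A p.
        \<tau> p (a *\<^sub>R u + b *\<^sub>R v) = a * \<tau> p u + b * \<tau> p v) \<and>
     (\<forall>\<kappa>\<in>A. \<forall>i. smooth_on (chart_map \<kappa> ` chart_dom \<kappa>)
        (\<lambda>x. \<tau> (chart_inv \<kappa> x) (coord_vec A \<kappa> (chart_inv \<kappa> x) i)))"

text \<open>\<open>d\<tau>\<close> evaluated on \<open>u\<close>, \<open>v\<close> in the chart \<open>\<kappa>\<close>, with the convention
  \<open>d\<tau> = (\<partial>\<^sub>1\<tau>\<^sub>2 - \<partial>\<^sub>2\<tau>\<^sub>1) dx\<and>dy\<close> in dimension two.\<close>

definition ext_deriv :: "('m, 'n::finite) chart set \<Rightarrow> ('m \<Rightarrow> ('m, 'n) tangent \<Rightarrow> real) \<Rightarrow>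
    ('m, 'n) chart \<Rightarrow> 'm \<Rightarrow> ('m, 'n) tangent \<Rightarrow> ('m, 'n) tangent \<Rightarrow> real" where
  "ext_deriv A \<tau> \<kappa> p u v =
     (let \<tau>c = (\<lambda>j y. \<tau> (chart_inv \<kappa> y) (coord_vec A \<kappa> (chart_inv \<kappa> y) j)); x = chart_map \<kappa> p in
      \<Sum>i\<in>UNIV. \<Sum>j\<in>UNIV. partial_deriv i (\<tau>c j) x * (u \<kappa> $ i * v \<kappa> $ j - v \<kappa> $ i * u \<kappa> $ j))"

text \<open>\<open>\<surd>(det g) dx\<and>dy\<close> evaluated on \<open>u\<close>, \<open>v\<close> in the chart \<open>\<kappa>\<close>.\<close>

definition volume_form :: "('m, 2) chart set \<Rightarrow> ('m, 2) metric \<Rightarrow>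
    ('m, 2) chart \<Rightarrow> 'm \<Rightarrow> ('m, 2) tangent \<Rightarrow> ('m, 2) tangent \<Rightarrow> real" where
  "volume_form A g \<kappa> p u v = sqrt (det (metric_coeff A g \<kappa> (chart_map \<kappa> p))) *
     (u \<kappa> $ 1 * v \<kappa> $ 2 - u \<kappa> $ 2 * v \<kappa> $ 1)"

definition covector_norm :: "('m, 'n::finite) chart set \<Rightarrow> ('m, 'n) metric \<Rightarrow>
    ('m \<Rightarrow> ('m, 'n) tangent \<Rightarrow> real) \<Rightarrow> 'm \<Rightarrow> real" where
  "covector_norm A g \<tau> p = Sup {\<bar>\<tau> p v\<bar> | v. v \<in> tangent_space A p \<and> g p v v \<le> 1}"


section \<open>Finsler distance and almost Killing fields\<close>

definition randers :: "('m, 'n::finite) metric \<Rightarrow> ('m \<Rightarrow> ('m, 'n) tangent \<Rightarrow> real) \<Rightarrow>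
    'm \<Rightarrow> ('m, 'n) tangent \<Rightarrow> real" where
  "randers g \<tau> p v = sqrt (g p v v) + \<tau> p v"

text \<open>The derivative \<open>c'(t)\<close> of a curve on \<open>[0,1]\<close>, one-sided at the end points.\<close>

definition velocity :: "('m, 'n::finite) chart set \<Rightarrow> (real \<Rightarrow> 'm) \<Rightarrow> real \<Rightarrow> ('m, 'n) tangent" where
  "velocity A c t = (\<lambda>\<kappa>. if \<kappa> \<in> charts_at A (c t)
     then vector_derivative (chart_map \<kappa> \<circ> c) (at t within {0..1}) else 0)"

definition C1_curve :: "('m::topological_space, 'n::finite) chart set \<Rightarrow> (real \<Rightarrow> 'm) \<Rightarrow> bool" where
  "C1_curve A c \<longleftrightarrow> continuous_on {0..1} c \<and>
     (\<forall>\<kappa>\<in>A. (\<forall>t\<in>{0..1}. c t \<in> chart_dom \<kappa> \<longrightarrow>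
                (chart_map \<kappa> \<circ> c) differentiable (at t within {0..1})) \<and>
            continuous_on {t\<in>{0..1}. c t \<in> chart_dom \<kappa>} (\<lambda>t. velocity A c t \<kappa>))"

definition finsler_dist :: "('m::topological_space, 'n::finite) chart set \<Rightarrow>
    ('m \<Rightarrow> ('m, 'n) tangent \<Rightarrow> real) \<Rightarrow> 'm \<Rightarrow> 'm \<Rightarrow> real" where
  "finsler_dist A F p q =
     Inf {integral {0..1} (\<lambda>t. F (c t) (velocity A c t)) | c. C1_curve A c \<and> c 0 = p \<and> c 1 = q}"

definition triangle_excess :: "('m::topological_space, 'n::finite) chart set \<Rightarrow>
    ('m \<Rightarrow> ('m, 'n) tangent \<Rightarrow> real) \<Rightarrow> 'm \<Rightarrow> 'm \<Rightarrow> 'm \<Rightarrow> real" where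
  "triangle_excess A F p q r = finsler_dist A F p q + finsler_dist A F q r - finsler_dist A F p r"

definition almost_isometry :: "('m::topological_space, 'n::finite) chart set \<Rightarrow>
    ('m \<Rightarrow> ('m, 'n) tangent \<Rightarrow> real) \<Rightarrow> 'm set \<Rightarrow> 'm set \<Rightarrow> ('m \<Rightarrow> 'm) \<Rightarrow> bool" where
  "almost_isometry A F U V \<phi> \<longleftrightarrow> diffeomorphism A U V \<phi> \<and>
     (\<forall>p\<in>U. \<forall>q\<in>U. \<forall>r\<in>U.
        triangle_excess A F p q r = triangle_excess A F (\<phi> p) (\<phi> q) (\<phi> r))"

definition integral_curve :: "('m::topological_space, 'n::finite) chart set \<Rightarrow> 'm set \<Rightarrow>
    ('m \<Rightarrow> ('m, 'n) tangent) \<Rightarrow> real set \<Rightarrow> (real \<Rightarrow> 'm) \<Rightarrow> bool" where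
  "integral_curve A W K I \<gamma> \<longleftrightarrow> continuous_on I \<gamma> \<and> \<gamma> ` I \<subseteq> W \<and>
     (\<forall>t\<in>I. \<forall>\<kappa>\<in>charts_at A (\<gamma> t).
        ((chart_map \<kappa> \<circ> \<gamma>) has_vector_derivative K (\<gamma> t) \<kappa>) (at t))"

text \<open>\<open>\<Phi> t\<close> is the time-\<open>t\<close> flow of \<open>K\<close>; its values on \<open>U\<close> for \<open>\<bar>t\<bar> < \<epsilon>\<close> are
  determined by \<open>K\<close>.\<close>

definition local_flow :: "('m::topological_space, 'n::finite) chart set \<Rightarrow> 'm set \<Rightarrow>
    ('m \<Rightarrow> ('m, 'n) tangent) \<Rightarrow> 'm set \<Rightarrow> real \<Rightarrow> (real \<Rightarrow> 'm \<Rightarrow> 'm) \<Rightarrow> bool" where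
  "local_flow A W K U \<epsilon> \<Phi> \<longleftrightarrow>
     (\<forall>x\<in>U. \<Phi> 0 x = x \<and> integral_curve A W K {-\<epsilon><..<\<epsilon>} (\<lambda>t. \<Phi> t x))"

definition almost_Killing_fields :: "('m::topological_space, 'n::finite) chart set \<Rightarrow>
    ('m \<Rightarrow> ('m, 'n) tangent \<Rightarrow> real) \<Rightarrow> 'm set \<Rightarrow> ('m \<Rightarrow> ('m, 'n) tangent) set" where
  "almost_Killing_fields A F W = {K \<in> vector_fields A W.
     \<forall>p\<in>W. \<exists>U \<epsilon> \<Phi>. open U \<and> p \<in> U \<and> U \<subseteq> W \<and> \<epsilon> > 0 \<and> local_flow A W K U \<epsilon> \<Phi> \<and>
       (\<forall>t. \<bar>t\<bar> < \<epsilon> \<longrightarrow> almost_isometry A F U (\<Phi> t ` U) (\<Phi> t))}"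

end

theory Submission
  imports Defs
begin

text \<open>On a surface of constant curvature \<open>\<mu>\<close> the equation \<open>Hess f = (a - \<mu> f) g\<close> is a flat linear system. Three of
  its solutions map a neighbourhood of a point isometrically into the quadric \<open>X\<^sup>2 + Y\<^sup>2 = 2 Z - \<mu> Z\<^sup>2\<close> with the
  form \<open>dX\<^sup>2 + dY\<^sup>2 + \<mu> dZ\<^sup>2\<close>. In the chart \<open>(X, Y)\<close> the Killing fields are restrictions of affine fields, with
  explicit flows.

  Every Killing field is almost Killing: its flow \<open>\<phi>\<close> preserves \<open>\<omega>\<close>, so \<open>\<phi>\<^sup>*\<tau> - \<tau>\<close> is closed, locally \<open>df\<close>, hence
  \<open>d(\<phi> p, \<phi> q) = d(p, q) + f q - f p\<close>, and \<open>f\<close> cancels in \<open>T\<close>. Conversely \<open>T(p, q, p) = d(p, q) + d(q, p)\<close> is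
  infinitesimally twice the Riemannian norm of \<open>q - p\<close>, so the flow of an almost Killing field preserves \<open>g\<close>.\<close>

section \<open>Calculus of smooth functions\<close>

text \<open>The Hessian equation is the one satisfied by affine functions restricted to the quadric.
  With the form \<open>dX^2 + dY^2 + \<mu> dZ^2\<close> the quadric is a round sphere touching the
  plane Z = 0 if \<mu> > 0, a paraboloid with a flat metric if \<mu> = 0, and a piece of a
  hyperboloid in Minkowski space if \<mu> < 0. The scaling of Z is what lets one set of formulas
  serve all three signs.

  Three obstacles shape the rest. The distance is an infimum over curves in the whole manifold,
  whereas the flow acts in one chart: almost minimizing curves are confined to a ball by comparing
  the cost of a segment with the cost of leaving the ball. The flow of an almost Killing field is
  smooth in the point only for each fixed time, so differentiating the invariance of
  \<open>g\<close> at time 0 needs its own estimate. Finally, no Killing field beyond the explicit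
  ones exists: after subtracting one with the same value at the centre, the radial component solves
  a linear ODE along rays that forces it to vanish, and only a rotation remains. The dimension 3 is
  two translations and one rotation.\<close>

lemma Ck_on_SucD:
  assumes "Ck_on (Suc k) S f" "x \<in> S"
  shows "(f has_derivative frechet_derivative f (at x)) (at x)"
  using assms by (auto simp: frechet_derivative_works)

lemma Ck_on_cong:
  assumes "open S" "\<And>x. x \<in> S \<Longrightarrow> f x = g x" "Ck_on k S f"
  shows "Ck_on k S g"
  using assms
proof (induction k arbitrary: f g)
  case 0
  then show ?case by (auto cong: continuous_on_cong)
next
  case (Suc k)
  have d: "(g has_derivative frechet_derivative f (at x)) (at x)" if "x \<in> S" for x
    using has_derivative_transform_within_open[OF Ck_on_SucD[OF Suc.prems(3) that] Suc.prems(1) that]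
      Suc.prems(2) by auto
  have e: "frechet_derivative f (at x) = frechet_derivative g (at x)" if "x \<in> S" for x
    using frechet_derivative_at[OF d[OF that]] by simp
  have "Ck_on k S (\<lambda>x. frechet_derivative g (at x) b)" if "b \<in> Basis" for b
    using Suc.IH[OF Suc.prems(1), of "\<lambda>x. frechet_derivative f (at x) b"] Suc.prems(3) that e by simp
  then show ?case using d by (auto simp: differentiable_def)
qed

lemma Ck_on_SucI:
  assumes "open S" "\<And>x. x \<in> S \<Longrightarrow> (f has_derivative f' x) (at x)"
    and "\<And>b. b \<in> Basis \<Longrightarrow> Ck_on k S (\<lambda>x. f' x b)"
  shows "Ck_on (Suc k) S f"
proof -
  have "Ck_on k S (\<lambda>x. frechet_derivative f (at x) b)" if "b \<in> Basis" for b
    by (rule Ck_on_cong[OF assms(1) _ assms(3)[OF that]])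
      (use frechet_derivative_at[OF assms(2)] in simp)
  then show ?thesis using assms(2) by (auto simp: differentiable_def)
qed

lemma Ck_on_subset: "Ck_on k S f \<Longrightarrow> T \<subseteq> S \<Longrightarrow> Ck_on k T f"
  by (induction k arbitrary: f) (auto intro: continuous_on_subset)

lemma Ck_on_Suc_imp: "Ck_on (Suc k) S f \<Longrightarrow> Ck_on k S f"
proof (induction k arbitrary: f)
  case 0
  then show ?case
    by (auto intro!: continuous_at_imp_continuous_on differentiable_imp_continuous_within)
next
  case (Suc k)
  then show ?case using Ck_on.simps(2) by blast
qed

lemma Ck_on_imp_continuous: "Ck_on k S f \<Longrightarrow> continuous_on S f"
  by (induction k) (auto dest: Ck_on_Suc_imp simp del: Ck_on.simps(2))

lemma Ck_on_const: "Ck_on k S (\<lambda>x. c)"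
  by (induction k arbitrary: c) auto

lemma Ck_on_bounded_linear:
  assumes "open S" "bounded_linear L" "Ck_on k S f"
  shows "Ck_on k S (\<lambda>x. L (f x))"
  using assms(3)
proof (induction k arbitrary: f)
  case 0
  then show ?case using assms(2) by (auto intro: bounded_linear.continuous_on)
next
  case (Suc k)
  show ?case
    by (rule Ck_on_SucI[OF assms(1) bounded_linear.has_derivative[OF assms(2) Ck_on_SucD[OF Suc.prems]]])
      (use Suc in auto)
qed

lemma Ck_on_linear: "open S \<Longrightarrow> bounded_linear L \<Longrightarrow> Ck_on k S L"
  by (cases k) (auto intro!: Ck_on_SucI Ck_on_const bounded_linear_imp_has_derivative
      simp: linear_continuous_on simp del: Ck_on.simps(2))

lemma Ck_on_add:
  assumes "open S" "Ck_on k S f" "Ck_on k S g"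
  shows "Ck_on k S (\<lambda>x. f x + g x)"
  using assms(2,3)
proof (induction k arbitrary: f g)
  case 0
  then show ?case by (auto intro: continuous_intros)
next
  case (Suc k)
  show ?case
    by (rule Ck_on_SucI[OF assms(1) has_derivative_add[OF Ck_on_SucD[OF Suc.prems(1)] Ck_on_SucD[OF Suc.prems(2)]]])
      (use Suc in auto)
qed

lemma Ck_on_bilinear:
  assumes "open S" "bounded_bilinear h" "Ck_on k S f" "Ck_on k S g"
  shows "Ck_on k S (\<lambda>x. h (f x) (g x))"
  using assms(3,4)
proof (induction k arbitrary: f g)
  case 0
  then show ?case using bounded_bilinear.continuous_on[OF assms(2)] by auto
next
  case (Suc k)
  let ?f' = "\<lambda>x. frechet_derivative f (at x)" and ?g' = "\<lambda>x. frechet_derivative g (at x)"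
  have "((\<lambda>x. h (f x) (g x)) has_derivative (\<lambda>v. h (f x) (?g' x v) + h (?f' x v) (g x))) (at x)"
    if "x \<in> S" for x
    by (rule bounded_bilinear.FDERIV[OF assms(2) Ck_on_SucD[OF Suc.prems(1) that] Ck_on_SucD[OF Suc.prems(2) that]])
  moreover have "Ck_on k S (\<lambda>x. h (f x) (?g' x b) + h (?f' x b) (g x))" if "b \<in> Basis" for b
    using Suc.prems that Ck_on_Suc_imp[OF Suc.prems(1)] Ck_on_Suc_imp[OF Suc.prems(2)]
    by (intro Ck_on_add[OF assms(1)] Suc.IH) auto
  ultimately show ?case by (rule Ck_on_SucI[OF assms(1)])
qed

lemma Ck_on_sum:
  assumes "open S" "\<And>i. i \<in> I \<Longrightarrow> Ck_on k S (f i)"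
  shows "Ck_on k S (\<lambda>x. \<Sum>i\<in>I. f i x)"
  using assms(2)
  by (induction I rule: infinite_finite_induct) (auto intro: Ck_on_const Ck_on_add[OF assms(1)])

lemma Ck_on_compose:
  fixes g :: "'a::euclidean_space \<Rightarrow> 'b::euclidean_space" and f :: "'b \<Rightarrow> 'c::real_normed_vector"
  assumes "open S" "open T" "g ` S \<subseteq> T" "Ck_on k S g" "Ck_on k T f"
  shows "Ck_on k S (\<lambda>x. f (g x))"
  using assms(4,5)
proof (induction k arbitrary: f)
  case 0
  then show ?case using assms(3) by (auto intro: continuous_on_compose2)
next
  case (Suc k)
  let ?g' = "\<lambda>x. frechet_derivative g (at x)" and ?f' = "\<lambda>x. frechet_derivative f (at x)"
  have g': "(g has_derivative ?g' x) (at x)" if "x \<in> S" for x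
    using Ck_on_SucD[OF Suc.prems(1) that] .
  have f': "(f has_derivative ?f' (g x)) (at (g x))" if "x \<in> S" for x
    using Ck_on_SucD[OF Suc.prems(2)] that assms(3) by auto
  \<comment> \<open>Expanding the inner derivative in a basis turns the chain rule into a finite sum
    of products. In each product one factor is a derivative of \<open>g\<close> and the other a
    derivative of \<open>f\<close> in a fixed direction, composed with \<open>g\<close>; the
    induction hypothesis covers the latter.\<close>
  have "?f' (g x) (?g' x b) = (\<Sum>c\<in>Basis. (?g' x b \<bullet> c) *\<^sub>R ?f' (g x) c)" if "x \<in> S" for x b
  proof -
    have l: "linear (?f' (g x))" using f'[OF that] has_derivative_linear by blast
    have "?f' (g x) (?g' x b) = ?f' (g x) (\<Sum>c\<in>Basis. (?g' x b \<bullet> c) *\<^sub>R c)"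
      by (simp add: euclidean_representation)
    then show ?thesis by (simp add: linear_sum[OF l] linear_cmul[OF l])
  qed
  then have d: "((\<lambda>x. f (g x)) has_derivative (\<lambda>h. \<Sum>c\<in>Basis. (?g' x h \<bullet> c) *\<^sub>R ?f' (g x) c)) (at x)"
    if "x \<in> S" for x
    using has_derivative_compose[OF g'[OF that] f'[OF that]] that by simp
  have "Ck_on k S (\<lambda>x. \<Sum>c\<in>Basis. (?g' x b \<bullet> c) *\<^sub>R ?f' (g x) c)" if "b \<in> Basis" for b
  proof (intro Ck_on_sum[OF assms(1)] Ck_on_bilinear[OF assms(1) bounded_bilinear_scaleR])
    fix c :: 'b assume c: "c \<in> Basis"
    show "Ck_on k S (\<lambda>x. ?g' x b \<bullet> c)"
      by (rule Ck_on_bounded_linear[OF assms(1) bounded_linear_inner_left]) (use Suc.prems(1) that in auto)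
    show "Ck_on k S (\<lambda>x. ?f' (g x) c)"
      using Suc.IH[OF Ck_on_Suc_imp[OF Suc.prems(1)]] Suc.prems(2) c by auto
  qed
  with d show ?case by (rule Ck_on_SucI[OF assms(1)])
qed

text \<open>The derivative of 1/f contains only 1/f itself and the derivative of f, so each order
  already known for 1/f yields the next one. The square root below is treated in the same
  way.\<close>

lemma Ck_on_inverse:
  fixes f :: "'a::euclidean_space \<Rightarrow> real"
  assumes "open S" "\<And>x. x \<in> S \<Longrightarrow> f x \<noteq> 0" "Ck_on k S f"
  shows "Ck_on k S (\<lambda>x. inverse (f x))"
  using assms(3)
proof (induction k)
  case 0
  then show ?case using assms(2) by (auto intro: continuous_intros)
next
  case (Suc k)
  note IH = Suc.IH[OF Ck_on_Suc_imp[OF Suc.prems]]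
  note mult = Ck_on_bilinear[OF assms(1) bounded_bilinear_mult]
  show ?case
    by (rule Ck_on_SucI[OF assms(1) Deriv.has_derivative_inverse[OF assms(2) Ck_on_SucD[OF Suc.prems]]])
      (use IH Suc.prems in \<open>auto intro!: mult Ck_on_bounded_linear[OF assms(1) bounded_linear_minus[OF bounded_linear_ident]]\<close>)
qed

lemma Ck_on_sqrt:
  fixes f :: "'a::euclidean_space \<Rightarrow> real"
  assumes "open S" "\<And>x. x \<in> S \<Longrightarrow> f x > 0" "Ck_on k S f"
  shows "Ck_on k S (\<lambda>x. sqrt (f x))"
  using assms(3)
proof (induction k)
  case 0
  then show ?case by (auto intro: continuous_intros)
next
  case (Suc k)
  note IH = Suc.IH[OF Ck_on_Suc_imp[OF Suc.prems]]
  note mult = Ck_on_bilinear[OF assms(1) bounded_bilinear_mult]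
  have d: "((\<lambda>x. sqrt (f x)) has_derivative
      (\<lambda>h. frechet_derivative f (at x) h * (inverse (sqrt (f x)) * (1 / 2)))) (at x)" if "x \<in> S" for x
    using DERIV_compose_FDERIV[OF DERIV_real_sqrt[OF assms(2)[OF that]] Ck_on_SucD[OF Suc.prems that]] by simp
  have "Ck_on k S (\<lambda>x. inverse (sqrt (f x)))"
    by (rule Ck_on_inverse[OF assms(1) _ IH]) (use assms(2) in \<open>simp add: less_imp_neq[symmetric]\<close>)
  then show ?case
    by (intro Ck_on_SucI[OF assms(1) d] mult Ck_on_const) (use Suc.prems in auto)
qed

lemma Ck_on_Pair:
  assumes "open S" "Ck_on k S f" "Ck_on k S g"
  shows "Ck_on k S (\<lambda>x. (f x, g x))"
  using Ck_on_add[OF assms(1)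
      Ck_on_bounded_linear[OF assms(1) bounded_linear_Pair[OF bounded_linear_ident bounded_linear_zero] assms(2)]
      Ck_on_bounded_linear[OF assms(1) bounded_linear_Pair[OF bounded_linear_zero bounded_linear_ident] assms(3)]]
  by simp

lemma Ck_on_vec:
  fixes f :: "'a::euclidean_space \<Rightarrow> 'b::real_normed_vector ^ 'n"
  assumes "open S" "\<And>i. Ck_on k S (\<lambda>x. f x $ i)"
  shows "Ck_on k S f"
proof -
  have bl: "bounded_linear (\<lambda>y::'b. axis i y :: 'b ^ 'n)" for i
  proof (rule bounded_linear_intro[where K = 1])
    fix y :: 'b
    have "(\<Sum>j\<in>UNIV. (norm (axis i y $ j))\<^sup>2) = (norm y)\<^sup>2"
      by (subst sum.remove[of _ i]) (auto simp: axis_def)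
    then show "norm (axis i y) \<le> norm y * 1" by (simp add: norm_vec_def L2_set_def)
  qed (auto simp: vec_eq_iff axis_def)
  have eq: "(\<Sum>i\<in>UNIV. axis i (f x $ i)) = f x" for x
    by (simp add: vec_eq_iff axis_def)
  have "Ck_on k S (\<lambda>x. \<Sum>i\<in>UNIV. axis i (f x $ i))"
    by (intro Ck_on_sum[OF assms(1)] Ck_on_bounded_linear[OF assms(1) bl] assms(2))
  then show ?thesis by (simp only: eq)
qed

lemma Ck_on_union:
  assumes "\<And>x. x \<in> S \<Longrightarrow> \<exists>T. open T \<and> x \<in> T \<and> Ck_on k T f"
  shows "Ck_on k S f"
  using assms
proof (induction k arbitrary: f)
  case 0
  then show ?case
    by (auto intro!: continuous_at_imp_continuous_on) (metis continuous_on_eq_continuous_at)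
next
  case (Suc k)
  then show ?case by fastforce
qed

subsection \<open>Smooth functions\<close>

lemma smooth_on_derivative:
  assumes "smooth_on S f" "x \<in> S"
  shows "(f has_derivative frechet_derivative f (at x)) (at x)"
  using assms Ck_on_SucD unfolding smooth_on_def by blast

lemma smooth_on_cong: "open S \<Longrightarrow> (\<And>x. x \<in> S \<Longrightarrow> f x = g x) \<Longrightarrow> smooth_on S f \<Longrightarrow> smooth_on S g"
  unfolding smooth_on_def using Ck_on_cong by blast

lemma smooth_on_subset: "smooth_on S f \<Longrightarrow> T \<subseteq> S \<Longrightarrow> smooth_on T f"
  unfolding smooth_on_def using Ck_on_subset by blast

lemma smooth_on_imp_continuous: "smooth_on S f \<Longrightarrow> continuous_on S f"
  unfolding smooth_on_def using Ck_on_imp_continuous by blast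

lemma smooth_on_const: "smooth_on S (\<lambda>x. c)"
  unfolding smooth_on_def using Ck_on_const by blast

lemma smooth_on_linear: "open S \<Longrightarrow> bounded_linear L \<Longrightarrow> smooth_on S L"
  unfolding smooth_on_def using Ck_on_linear by blast

lemma smooth_on_bounded_linear: "open S \<Longrightarrow> bounded_linear L \<Longrightarrow> smooth_on S f \<Longrightarrow> smooth_on S (\<lambda>x. L (f x))"
  unfolding smooth_on_def using Ck_on_bounded_linear by blast

lemma smooth_on_id: "open S \<Longrightarrow> smooth_on S (\<lambda>x. x)"
  by (rule smooth_on_linear[OF _ bounded_linear_ident])

lemma smooth_on_add: "open S \<Longrightarrow> smooth_on S f \<Longrightarrow> smooth_on S g \<Longrightarrow> smooth_on S (\<lambda>x. f x + g x)"
  unfolding smooth_on_def using Ck_on_add by blast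

lemma smooth_on_minus: "open S \<Longrightarrow> smooth_on S f \<Longrightarrow> smooth_on S (\<lambda>x. - f x)"
  by (rule smooth_on_bounded_linear[OF _ bounded_linear_minus[OF bounded_linear_ident]])

lemma smooth_on_diff: "open S \<Longrightarrow> smooth_on S f \<Longrightarrow> smooth_on S g \<Longrightarrow> smooth_on S (\<lambda>x. f x - g x)"
  using smooth_on_add[OF _ _ smooth_on_minus, of S f g] by simp

lemma smooth_on_bilinear:
  "open S \<Longrightarrow> bounded_bilinear h \<Longrightarrow> smooth_on S f \<Longrightarrow> smooth_on S g \<Longrightarrow> smooth_on S (\<lambda>x. h (f x) (g x))"
  unfolding smooth_on_def using Ck_on_bilinear by blast

lemma smooth_on_mult:
  fixes f g :: "'a::euclidean_space \<Rightarrow> real"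
  shows "open S \<Longrightarrow> smooth_on S f \<Longrightarrow> smooth_on S g \<Longrightarrow> smooth_on S (\<lambda>x. f x * g x)"
  by (rule smooth_on_bilinear[OF _ bounded_bilinear_mult])

lemma smooth_on_scaleR:
  "open S \<Longrightarrow> smooth_on S f \<Longrightarrow> smooth_on S g \<Longrightarrow> smooth_on S (\<lambda>x. f x *\<^sub>R g x)"
  by (rule smooth_on_bilinear[OF _ bounded_bilinear_scaleR])

lemma smooth_on_power:
  fixes f :: "'a::euclidean_space \<Rightarrow> real"
  shows "open S \<Longrightarrow> smooth_on S f \<Longrightarrow> smooth_on S (\<lambda>x. f x ^ n)"
  by (induction n) (auto intro: smooth_on_const smooth_on_mult)

lemma smooth_on_inverse:
  fixes f :: "'a::euclidean_space \<Rightarrow> real"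
  shows "open S \<Longrightarrow> smooth_on S f \<Longrightarrow> (\<And>x. x \<in> S \<Longrightarrow> f x \<noteq> 0) \<Longrightarrow> smooth_on S (\<lambda>x. inverse (f x))"
  unfolding smooth_on_def using Ck_on_inverse by blast

lemma smooth_on_divide:
  fixes f g :: "'a::euclidean_space \<Rightarrow> real"
  shows "open S \<Longrightarrow> smooth_on S f \<Longrightarrow> smooth_on S g \<Longrightarrow> (\<And>x. x \<in> S \<Longrightarrow> g x \<noteq> 0) \<Longrightarrow>
    smooth_on S (\<lambda>x. f x / g x)"
  unfolding divide_inverse by (intro smooth_on_mult smooth_on_inverse)

lemma smooth_on_sqrt:
  fixes f :: "'a::euclidean_space \<Rightarrow> real"
  shows "open S \<Longrightarrow> smooth_on S f \<Longrightarrow> (\<And>x. x \<in> S \<Longrightarrow> f x > 0) \<Longrightarrow> smooth_on S (\<lambda>x. sqrt (f x))"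
  unfolding smooth_on_def using Ck_on_sqrt by blast

lemma smooth_on_sum: "open S \<Longrightarrow> (\<And>i. i \<in> I \<Longrightarrow> smooth_on S (f i)) \<Longrightarrow> smooth_on S (\<lambda>x. \<Sum>i\<in>I. f i x)"
  by (simp add: smooth_on_def Ck_on_sum)

lemma smooth_on_Pair: "open S \<Longrightarrow> smooth_on S f \<Longrightarrow> smooth_on S g \<Longrightarrow> smooth_on S (\<lambda>x. (f x, g x))"
  unfolding smooth_on_def using Ck_on_Pair by blast

lemma smooth_on_vec_nth: "open S \<Longrightarrow> smooth_on S f \<Longrightarrow> smooth_on S (\<lambda>x. f x $ i)"
  by (rule smooth_on_bounded_linear[OF _ bounded_linear_vec_nth])

lemma smooth_on_vec:
  fixes f :: "'a::euclidean_space \<Rightarrow> 'b::real_normed_vector ^ 'n"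
  shows "open S \<Longrightarrow> (\<And>i. smooth_on S (\<lambda>x. f x $ i)) \<Longrightarrow> smooth_on S f"
  unfolding smooth_on_def using Ck_on_vec by blast

lemma smooth_on_compose:
  fixes g :: "'a::euclidean_space \<Rightarrow> 'b::euclidean_space" and f :: "'b \<Rightarrow> 'c::real_normed_vector"
  shows "open S \<Longrightarrow> open T \<Longrightarrow> smooth_on T f \<Longrightarrow> smooth_on S g \<Longrightarrow> g ` S \<subseteq> T \<Longrightarrow> smooth_on S (\<lambda>x. f (g x))"
  unfolding smooth_on_def using Ck_on_compose by blast

lemma smooth_on_union:
  assumes "\<And>x. x \<in> S \<Longrightarrow> \<exists>T. open T \<and> x \<in> T \<and> smooth_on T f"
  shows "smooth_on S f"
  unfolding smooth_on_def
proof
  fix k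
  have "\<exists>T. open T \<and> x \<in> T \<and> Ck_on k T f" if "x \<in> S" for x
    using assms[OF that] by (auto simp: smooth_on_def)
  then show "Ck_on k S f" by (rule Ck_on_union)
qed

text \<open>\<open>Ck_on\<close> speaks about derivatives in basis directions only; linearity
  extends this to every fixed direction \<open>h\<close>.\<close>

lemma smooth_on_frechet:
  assumes "open S" "smooth_on S f"
  shows "smooth_on S (\<lambda>x. frechet_derivative f (at x) h)"
proof -
  have b: "smooth_on S (\<lambda>x. frechet_derivative f (at x) b)" if "b \<in> Basis" for b
    using assms that unfolding smooth_on_def using Ck_on.simps(2) by blast
  have "smooth_on S (\<lambda>x. \<Sum>b\<in>Basis. (h \<bullet> b) *\<^sub>R frechet_derivative f (at x) b)"
    by (intro smooth_on_sum smooth_on_scaleR smooth_on_const b assms)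
  moreover have "(\<Sum>b\<in>Basis. (h \<bullet> b) *\<^sub>R frechet_derivative f (at x) b) = frechet_derivative f (at x) h"
    if "x \<in> S" for x
  proof -
    have l: "linear (frechet_derivative f (at x))"
      using smooth_on_derivative[OF assms(2) that] has_derivative_linear by blast
    show ?thesis
      by (subst (2) euclidean_representation[of h, symmetric]) (simp only: linear_sum[OF l] linear_cmul[OF l])
  qed
  ultimately show ?thesis using smooth_on_cong[OF assms(1)] by (metis (no_types, lifting))
qed

text \<open>If the first derivatives of \<open>u\<close> are smooth functions of \<open>x\<close>
  and \<open>u x\<close>, then each order of differentiability of \<open>u\<close> gives one more.
  This gives smoothness both of parallel sections and of inverse maps.\<close>

lemma smooth_on_bootstrap:
  fixes u :: "'a::euclidean_space \<Rightarrow> 'b::euclidean_space"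
  assumes "open S" "open T" "\<And>x. x \<in> S \<Longrightarrow> (x, u x) \<in> T"
    and "\<And>x. x \<in> S \<Longrightarrow> (u has_derivative u' x) (at x)"
    and "\<And>b x. b \<in> Basis \<Longrightarrow> x \<in> S \<Longrightarrow> u' x b = F b (x, u x)"
    and "\<And>b. b \<in> Basis \<Longrightarrow> smooth_on T (F b)"
  shows "smooth_on S u"
  unfolding smooth_on_def
proof
  fix k show "Ck_on k S u"
  proof (induction k)
    case 0
    show ?case using assms(4)
      by (auto intro!: continuous_at_imp_continuous_on has_derivative_continuous)
  next
    case (Suc k)
    have pair: "Ck_on k S (\<lambda>x. (x, u x))"
      by (rule Ck_on_Pair[OF assms(1) Ck_on_linear[OF assms(1) bounded_linear_ident] Suc])
    have "Ck_on k S (\<lambda>x. F b (x, u x))" if "b \<in> Basis" for b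
      by (rule Ck_on_compose[OF assms(1,2) _ pair]) (use assms(3) assms(6)[OF that] in \<open>auto simp: smooth_on_def\<close>)
    then have "Ck_on k S (\<lambda>x. u' x b)" if "b \<in> Basis" for b
      using Ck_on_cong[OF assms(1), of "\<lambda>x. F b (x, u x)" "\<lambda>x. u' x b"] assms(5)[OF that] that by simp
    then show ?case using Ck_on_SucI[OF assms(1,4), where k = k] by simp
  qed
qed

section \<open>Parallel sections of flat connections\<close>

text \<open>Picard iteration for the integral equation along rays,
  \<open>u x = v0 + integral of M (t x) x (u (t x))\<close> over t in [0,1]. The derivatives are
  iterated together with the functions, so that the limit is differentiable. The integral equation
  controls only the radial direction; the hypothesis \<open>flat\<close>, equality of the mixed
  second derivatives of a solution, is what yields the remaining directions.\<close>

lemma flat_solution: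
  fixes M :: "'a::euclidean_space \<Rightarrow> 'a \<Rightarrow>\<^sub>L 'e \<Rightarrow>\<^sub>L ('e::euclidean_space)"
    and M' :: "'a \<Rightarrow> 'a \<Rightarrow>\<^sub>L 'a \<Rightarrow>\<^sub>L 'e \<Rightarrow>\<^sub>L 'e" and v0 :: 'e
  assumes R: "R > 0"
    and dM: "\<And>x. x \<in> ball 0 R \<Longrightarrow> (M has_derivative blinfun_apply (M' x)) (at x)"
    and cM': "continuous_on (ball 0 R) M'"
    and flat: "\<And>x h k w. x \<in> ball 0 R \<Longrightarrow> M' x h k w + M x k (M x h w) = M' x k h w + M x h (M x k w)"
  shows "\<exists>r>0. r \<le> R \<and> (\<exists>u. u 0 = v0 \<and> (\<forall>x\<in>ball 0 r. (u has_derivative (\<lambda>h. M x h (u x))) (at x)))"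
proof -
  define q where "q = R / 2"
  have q: "0 < q" "cball 0 q \<subseteq> ball 0 R" using R by (auto simp: q_def)
  have cM: "continuous_on (ball 0 R) M"
    using dM by (auto intro!: continuous_at_imp_continuous_on has_derivative_continuous)
  obtain C1 where C1: "\<And>x. x \<in> cball 0 q \<Longrightarrow> norm (M x) \<le> C1"
    using compact_imp_bounded[OF compact_continuous_image[OF continuous_on_subset[OF cM q(2)] compact_cball]]
    unfolding bounded_iff by (metis imageI)
  obtain C2 where C2: "\<And>x. x \<in> cball 0 q \<Longrightarrow> norm (M' x) \<le> C2"
    using compact_imp_bounded[OF compact_continuous_image[OF continuous_on_subset[OF cM' q(2)] compact_cball]]
    unfolding bounded_iff by (metis imageI)
  define C where "C = max 1 (max C1 C2)"
  have C: "C \<ge> 1" "\<And>x. x \<in> cball 0 q \<Longrightarrow> norm (M x) \<le> C" "\<And>x. x \<in> cball 0 q \<Longrightarrow> norm (M' x) \<le> C"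
    using C1 C2 by (force simp: C_def)+
  \<comment> \<open>\<open>8 * C * r \<le> 1\<close> makes both \<open>3 * C * r\<close>
    (contraction of the iteration) and \<open>2 * C * r\<close> (contraction of the defect
    \<open>w\<close>) at most 1/2; \<open>r \<le> 1\<close> absorbs the factor \<open>x\<close> next
    to \<open>M'\<close>.\<close>
  define r where "r = min q (min 1 (1 / (8 * C)))"
  have "8 * C * r \<le> 8 * C * (1 / (8 * C))" unfolding r_def using C(1) by (intro mult_left_mono) auto
  moreover have "r \<le> 1" unfolding r_def by (rule order_trans[OF min.cobounded2 min.cobounded1])
  ultimately have r: "0 < r" "r \<le> q" "r \<le> 1" "8 * C * r \<le> 1"
    using q C(1) by (auto simp: r_def)
  define S where "S = ball (0::'a) r"
  have oS: "open S" and cvS: "convex S" and S0: "0 \<in> S" using r by (auto simp: S_def)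
  have SR: "S \<subseteq> ball 0 R" and Sq: "S \<subseteq> cball 0 q" using q r by (auto simp: S_def q_def)
  have tS: "t *\<^sub>R x \<in> S" if "x \<in> S" "t \<in> {0..1}" for t x
  proof -
    have "\<bar>t\<bar> * norm x \<le> 1 * norm x" using that by (intro mult_right_mono) auto
    then show ?thesis using that by (simp add: S_def)
  qed
  have nM: "norm (M x) \<le> C" "norm (M' x) \<le> C" if "x \<in> S" for x using C that Sq by auto
  \<comment> \<open>The derivative in \<open>x\<close> of the integrand
    \<open>M (t x) x (d (t x))\<close>, with \<open>d'\<close> in the place of the derivative of
    \<open>d\<close>. Thus \<open>J d d'\<close> is the derivative of \<open>L d\<close>, but it
    makes sense for any pair \<open>d\<close>, \<open>d'\<close>.\<close>
  define \<Phi> where "\<Phi> = (\<lambda>(d::'a \<Rightarrow> 'e) (d'::'a \<Rightarrow> 'a \<Rightarrow>\<^sub>L 'e) x (t::real).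
      (blinfun.prod_left (d (t *\<^sub>R x)) o\<^sub>L M (t *\<^sub>R x))
      + t *\<^sub>R (blinfun.prod_left (d (t *\<^sub>R x)) o\<^sub>L (blinfun.prod_left x o\<^sub>L M' (t *\<^sub>R x)))
      + t *\<^sub>R (M (t *\<^sub>R x) x o\<^sub>L d' (t *\<^sub>R x)))"
  define J where "J = (\<lambda>d d' x. integral (cbox 0 1) (\<Phi> d d' x))"
  define L where "L = (\<lambda>(d::'a \<Rightarrow> 'e) x. integral (cbox 0 1) (\<lambda>t. M (t *\<^sub>R x) x (d (t *\<^sub>R x))))"
  have map_S: "(\<lambda>z. snd z *\<^sub>R fst z) ` (S \<times> cbox 0 1) \<subseteq> S"
    using tS by auto
  have map_c: "continuous_on (S \<times> cbox (0::real) 1) (\<lambda>z. snd z *\<^sub>R fst z)"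
    by (intro continuous_intros)
  have comp: "continuous_on (S \<times> cbox (0::real) 1) (\<lambda>z. f (snd z *\<^sub>R fst z))"
    if "continuous_on S f" for f :: "'a \<Rightarrow> 'z::topological_space"
    by (rule continuous_on_compose2[OF that map_c map_S])
  note cMS = continuous_on_subset[OF cM SR] continuous_on_subset[OF cM' SR]
  have c\<Phi>: "continuous_on (S \<times> cbox 0 1) (\<lambda>(x, t). \<Phi> d d' x t)"
    if "continuous_on S d" "continuous_on S d'" for d d'
    unfolding \<Phi>_def split_beta
    by (intro continuous_intros comp that cMS)
  have cL: "continuous_on (S \<times> cbox (0::real) 1) (\<lambda>(x, t). M (t *\<^sub>R x) x (d (t *\<^sub>R x)))"
    if "continuous_on S d" for d :: "'a \<Rightarrow> 'e"
    unfolding split_beta by (intro continuous_intros comp that cMS)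
  have slice: "continuous_on {0..1} (f x)" if "continuous_on (S \<times> cbox (0::real) 1) (\<lambda>(x, t). f x t)" "x \<in> S"
    for f :: "'a \<Rightarrow> real \<Rightarrow> 'z::topological_space" and x
  proof -
    have "continuous_on {0..1} (\<lambda>t. (\<lambda>(x, t). f x t) (x, t))"
      by (rule continuous_on_compose2[OF that(1)]) (use that(2) in \<open>auto intro!: continuous_intros\<close>)
    then show ?thesis by simp
  qed
  have i\<Phi>: "\<Phi> d d' x integrable_on cbox 0 1" if "continuous_on S d" "continuous_on S d'" "x \<in> S" for d d' x
    using slice[OF c\<Phi>[OF that(1,2)] that(3)] by (simp add: integrable_continuous_real)
  have cJ: "continuous_on S (J d d')" if "continuous_on S d" "continuous_on S d'" for d d'
    unfolding J_def by (rule integral_continuous_on_param[OF c\<Phi>[OF that]])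
  have dL: "(L d has_derivative J d d' x) (at x)"
    if "continuous_on S d'" "\<And>x. x \<in> S \<Longrightarrow> (d has_derivative d' x) (at x)" "x \<in> S" for d and d' :: "'a \<Rightarrow> 'a \<Rightarrow>\<^sub>L 'e" and x
  proof -
    have cd: "continuous_on S d"
      using that(2) by (auto intro!: continuous_at_imp_continuous_on has_derivative_continuous)
    have "((\<lambda>x. M (t *\<^sub>R x) x (d (t *\<^sub>R x))) has_derivative \<Phi> d d' x t) (at x within S)"
      if x: "x \<in> S" and t: "t \<in> cbox 0 1" for x t
    proof -
      have tx: "t *\<^sub>R x \<in> S" using tS x t by auto
      have 0: "((\<lambda>x. t *\<^sub>R x) has_derivative (\<lambda>h. t *\<^sub>R h)) (at x within S)"
        by (auto intro!: derivative_eq_intros)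
      have 1: "((\<lambda>x. M (t *\<^sub>R x)) has_derivative (\<lambda>h. M' (t *\<^sub>R x) (t *\<^sub>R h))) (at x within S)"
        by (rule has_derivative_compose[OF 0 dM]) (use tx SR in auto)
      have 2: "((\<lambda>x. d (t *\<^sub>R x)) has_derivative (\<lambda>h. d' (t *\<^sub>R x) (t *\<^sub>R h))) (at x within S)"
        by (rule has_derivative_compose[OF 0 \<open>\<And>x. x \<in> S \<Longrightarrow> (d has_derivative d' x) (at x)\<close>[OF tx]])
      show ?thesis
        by (rule has_derivative_eq_rhs[OF blinfun.FDERIV[OF blinfun.FDERIV[OF 1 has_derivative_ident] 2]])
          (auto simp: \<Phi>_def fun_eq_iff blinfun.bilinear_simps)
    qed
    then have "(L d has_derivative J d d' x) (at x within S)"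
      unfolding L_def J_def
      by (intro leibniz_rule cvS \<open>x \<in> S\<close> c\<Phi>[OF cd that(1)])
        (use slice[OF cL[OF cd]] in \<open>auto intro: integrable_continuous_real\<close>)
    then show ?thesis using at_within_open[OF that(3) oS] by simp
  qed
  have bPhi: "norm (\<Phi> d d' x t) \<le> 3 * C * r * b"
    if "x \<in> S" "t \<in> {0..1}" "\<And>y. y \<in> S \<Longrightarrow> norm (d y) \<le> r * b" "\<And>y. y \<in> S \<Longrightarrow> norm (d' y) \<le> b"
    for d and d' :: "'a \<Rightarrow> 'a \<Rightarrow>\<^sub>L 'e" and x t b
  proof (rule norm_blinfun_bound)
    have b: "b \<ge> 0" using that(4)[OF S0] norm_ge_zero order_trans by blast
    then show "0 \<le> 3 * C * r * b" using C r by simp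
    fix h
    let ?y = "t *\<^sub>R x"
    have y: "?y \<in> S" using tS that by auto
    have nx: "norm x \<le> 1" "norm x \<le> r" using that(1) r by (auto simp: S_def)
    have "norm (M ?y h) \<le> C * norm h"
      by (intro order_trans[OF norm_blinfun[of "M ?y" h] mult_right_mono] nM(1)[OF y]) auto
    then have 1: "norm (M ?y h (d ?y)) \<le> C * norm h * (r * b)"
      by (intro order_trans[OF norm_blinfun[of "M ?y h" "d ?y"] mult_mono]) (use C that(3)[OF y] in auto)
    have "norm (M' ?y h) \<le> C * norm h"
      by (intro order_trans[OF norm_blinfun[of "M' ?y" h] mult_right_mono] nM(2)[OF y]) auto
    then have "norm (M' ?y h x) \<le> C * norm h * 1"
      by (intro order_trans[OF norm_blinfun[of "M' ?y h" x] mult_mono]) (use C nx in auto)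
    then have 2: "norm (M' ?y h x (d ?y)) \<le> C * norm h * (r * b)"
      by (intro order_trans[OF norm_blinfun[of "M' ?y h x" "d ?y"] mult_mono]) (use C r that(3)[OF y] in auto)
    have "norm (M ?y x) \<le> C * r"
      by (intro order_trans[OF norm_blinfun[of "M ?y" x] mult_mono]) (use C r nM(1)[OF y] nx in auto)
    moreover have "norm (d' ?y h) \<le> b * norm h"
      by (intro order_trans[OF norm_blinfun[of "d' ?y" h] mult_mono]) (use b that(4)[OF y] in auto)
    ultimately have 3: "norm (M ?y x (d' ?y h)) \<le> (C * r) * (b * norm h)"
      by (intro order_trans[OF norm_blinfun[of "M ?y x" "d' ?y h"] mult_mono]) (use C r in auto)
    have tle: "norm (t *\<^sub>R z) \<le> norm z" for z :: 'e
      using that(2) by (simp add: mult_left_le_one_le)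
    have "norm (\<Phi> d d' x t h) \<le> norm (M ?y h (d ?y)) + norm (t *\<^sub>R M' ?y h x (d ?y)) + norm (t *\<^sub>R M ?y x (d' ?y h))"
      unfolding \<Phi>_def by (simp add: blinfun.bilinear_simps) (metis norm_triangle_ineq norm_triangle_le add_le_cancel_right norm_scaleR real_norm_def)
    also have "\<dots> \<le> C * norm h * (r * b) + C * norm h * (r * b) + (C * r) * (b * norm h)"
      by (intro add_mono 1 order_trans[OF tle 2] order_trans[OF tle 3])
    finally show "norm (\<Phi> d d' x t h) \<le> 3 * C * r * b * norm h" by (simp add: algebra_simps)
  qed
  have bJ: "norm (J d d' x) \<le> 3 * C * r * b"
    if "continuous_on S d" "continuous_on S d'" "x \<in> S" "\<And>y. y \<in> S \<Longrightarrow> norm (d y) \<le> r * b"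
      "\<And>y. y \<in> S \<Longrightarrow> norm (d' y) \<le> b"
    for d d' x b
    using integral_bound[OF _ slice[OF c\<Phi>[OF that(1,2)] that(3)] bPhi[OF that(3) _ that(4,5)]]
    by (simp add: J_def)
  have Jdiff: "J d d' x - J e e' x = J (\<lambda>x. d x - e x) (\<lambda>x. d' x - e' x) x"
    if "continuous_on S d" "continuous_on S d'" "continuous_on S e" "continuous_on S e'" "x \<in> S" for d d' e e' x
  proof -
    have "\<Phi> d d' x t - \<Phi> e e' x t = \<Phi> (\<lambda>x. d x - e x) (\<lambda>x. d' x - e' x) x t" for t
      unfolding \<Phi>_def by (intro blinfun_eqI) (simp add: blinfun.bilinear_simps algebra_simps)
    then show ?thesis
      unfolding J_def using integral_diff[OF i\<Phi>[OF that(1,2,5)] i\<Phi>[OF that(3,4,5)]] by simp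
  qed
  \<comment> \<open>A difference of two iterates vanishes at 0, so its values are controlled by its
    derivative with a factor \<open>r\<close>. Hence only derivatives have to be estimated.\<close>
  have lip: "norm (d x) \<le> r * b"
    if "\<And>x. x \<in> S \<Longrightarrow> (d has_derivative d' x) (at x)" "d 0 = 0" "\<And>y. y \<in> S \<Longrightarrow> norm (d' y) \<le> b" "x \<in> S"
    for d :: "'a \<Rightarrow> 'e" and d' :: "'a \<Rightarrow> 'a \<Rightarrow>\<^sub>L 'e" and x b
  proof -
    have "b \<ge> 0" using that(3)[OF S0] norm_ge_zero order_trans by blast
    have "norm (d x - d 0) \<le> b * norm (x - 0)"
      by (rule differentiable_bound[OF cvS _ _ that(4) S0, of d "\<lambda>x. blinfun_apply (d' x)"])
        (use that(1,3) in \<open>auto intro: has_derivative_at_withinI simp: norm_blinfun.rep_eq[symmetric]\<close>)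
    also have "\<dots> \<le> b * r" using \<open>b \<ge> 0\<close> that(4) by (intro mult_left_mono) (auto simp: S_def)
    finally show ?thesis using that(2) by (simp add: mult.commute)
  qed
  \<comment> \<open>Iterates are pairs of a function and its derivative. The start is the constant
    \<open>v0\<close> with derivative 0.\<close>
  define P where "P n = ((\<lambda>(d, d'). (\<lambda>x. v0 + L d x, J d d')) ^^ n) (\<lambda>x. v0, \<lambda>x. 0)" for n
  define U where "U n = fst (P n)" for n
  define U' where "U' n = snd (P n)" for n
  have U0: "U 0 = (\<lambda>x. v0)" "U' 0 = (\<lambda>x. 0)" by (auto simp: U_def U'_def P_def)
  have USuc: "U (Suc n) = (\<lambda>x. v0 + L (U n) x)" "U' (Suc n) = J (U n) (U' n)" for n
    by (auto simp: U_def U'_def P_def split_beta)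
  have inv: "continuous_on S (U' n) \<and> (\<forall>x\<in>S. (U n has_derivative U' n x) (at x)) \<and> U n 0 = v0" for n
  proof (induction n)
    case 0
    then show ?case by (auto simp: U0)
  next
    case (Suc n)
    then have cU: "continuous_on S (U n)"
      by (auto intro!: continuous_at_imp_continuous_on has_derivative_continuous)
    have "(U (Suc n) has_derivative U' (Suc n) x) (at x)" if "x \<in> S" for x
      using dL[of "U' n" "U n" x] Suc that unfolding USuc by (auto intro!: derivative_eq_intros)
    then show ?case using cJ[OF cU] Suc by (simp add: USuc L_def blinfun.bilinear_simps)
  qed
  have cU: "continuous_on S (U n)" for n
    using inv[of n] by (auto intro!: continuous_at_imp_continuous_on has_derivative_continuous)
  \<comment> \<open>The bound for the first increment of the derivatives: the constant
    \<open>v0\<close> has norm \<open>r * (norm v0 / r)\<close>, which is the form that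
    \<open>bJ\<close> expects.\<close>
  define a where "a = 3 * C * (norm v0 / r) * r"
  have step: "\<forall>x\<in>S. norm (U' (Suc n) x - U' n x) \<le> a * (1/2)^n" for n
  proof (induction n)
    case 0
    have "norm (U' (Suc 0) x - U' 0 x) \<le> 3 * C * r * (norm v0 / r)" if "x \<in> S" for x
      using bJ[of "U 0" "U' 0" x "norm v0 / r"] that r
      unfolding USuc by (auto simp: U0 continuous_on_const)
    then show ?case by (auto simp: a_def mult_ac)
  next
    case (Suc n)
    let ?b = "a * (1/2)^n"
    let ?d = "\<lambda>x. U (Suc n) x - U n x" and ?d' = "\<lambda>x. U' (Suc n) x - U' n x"
    have "((\<lambda>x. U (Suc n) x - U n x) has_derivative ?d' x) (at x)" if "x \<in> S" for x
      using inv[of n] inv[of "Suc n"] that by (auto intro!: derivative_eq_intros simp: blinfun.diff_left)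
    then have "norm (?d x) \<le> r * ?b" if "x \<in> S" for x
      using lip[of ?d ?d' ?b x] Suc that inv[of n] inv[of "Suc n"] by simp
    then have "norm (J ?d ?d' x) \<le> 3 * C * r * ?b" if "x \<in> S" for x
      using bJ[of ?d ?d' x ?b] that Suc inv[of n] inv[of "Suc n"] cU by (auto intro!: continuous_intros)
    moreover have "U' (Suc (Suc n)) x - U' (Suc n) x = J ?d ?d' x" if "x \<in> S" for x
    proof -
      have "U' (Suc (Suc n)) x - U' (Suc n) x = J (U (Suc n)) (U' (Suc n)) x - J (U n) (U' n) x"
        by (simp only: USuc(2))
      also have "\<dots> = J ?d ?d' x" by (rule Jdiff) (use inv cU that in auto)
      finally show ?thesis .
    qed
    moreover have "3 * C * r * ?b \<le> (1/2) * ?b"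
      using r C by (intro mult_right_mono) (auto simp: a_def)
    ultimately show ?case by fastforce
  qed
  define g' where "g' = (\<lambda>x. \<Sum>i. U' (Suc i) x - U' i x)"
  have "uniform_limit S (\<lambda>n x. \<Sum>i<n. U' (Suc i) x - U' i x) g' sequentially"
    unfolding g'_def
    by (rule Weierstrass_m_test[where M = "\<lambda>n. a * (1/2)^n"]) (use step in \<open>auto intro!: summable_mult summable_geometric\<close>)
  moreover have "(\<Sum>i<n. U' (Suc i) x - U' i x) = U' n x" for n x
    using sum_lessThan_telescope[of "\<lambda>i. U' i x" n] by (simp add: U0)
  ultimately have ul: "uniform_limit S U' g' sequentially" by simp
  have cg': "continuous_on S g'"
    by (rule uniform_limit_theorem[OF _ ul]) (use inv in auto)
  have ule: "\<forall>\<^sub>F n in sequentially. \<forall>x\<in>S. norm (U' n x - g' x) \<le> e" if "e > 0" for e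
    using uniform_limitD[OF ul that] by eventually_elim (auto simp: dist_norm less_imp_le)
  have "\<exists>g. \<forall>x\<in>S. (\<lambda>n. U n x) \<longlonglongrightarrow> g x \<and> (g has_derivative g' x) (at x within S)"
  proof (rule has_derivative_sequence[OF cvS _ _ S0])
    show "(U n has_derivative blinfun_apply (U' n x)) (at x within S)" if "x \<in> S" for n x
      using inv that has_derivative_at_withinI by blast
    show "\<forall>\<^sub>F n in sequentially. \<forall>x\<in>S. \<forall>h. norm (U' n x h - g' x h) \<le> e * norm h" if "e > 0" for e
      using ule[OF that]
    proof eventually_elim
      case (elim n)
      then show ?case
        by (auto simp flip: blinfun.diff_left intro: order_trans[OF norm_blinfun mult_right_mono])
    qed
    show "(\<lambda>n. U n 0) \<longlonglongrightarrow> v0" using inv by simp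
  qed
  then obtain u where u: "\<And>x. x \<in> S \<Longrightarrow> (\<lambda>n. U n x) \<longlonglongrightarrow> u x"
    and du: "\<And>x. x \<in> S \<Longrightarrow> (u has_derivative g' x) (at x)"
    using at_within_open[OF _ oS] by metis
  have u0: "u 0 = v0" using LIMSEQ_unique[OF u[OF S0]] inv by simp
  have cu: "continuous_on S u"
    using du by (auto intro!: continuous_at_imp_continuous_on has_derivative_continuous)
  have g'J: "g' x = J u g' x" if x: "x \<in> S" for x
  proof -
    have "norm (g' x - J u g' x) \<le> e" if "e > 0" for e
    proof -
      have "\<forall>\<^sub>F n in sequentially. (\<forall>x\<in>S. norm (U' n x - g' x) \<le> e/2) \<and> (\<forall>x\<in>S. norm (U' (Suc n) x - g' x) \<le> e/2)"
        using that by (intro eventually_conj ule eventually_sequentially_Suc[THEN iffD2, OF ule]) auto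
      then obtain n where n: "\<And>x. x \<in> S \<Longrightarrow> norm (U' n x - g' x) \<le> e/2"
          "\<And>x. x \<in> S \<Longrightarrow> norm (U' (Suc n) x - g' x) \<le> e/2"
        by (auto dest!: eventually_happens)
      let ?d = "\<lambda>x. U n x - u x" and ?d' = "\<lambda>x. U' n x - g' x"
      have "(?d has_derivative ?d' x) (at x)" if "x \<in> S" for x
        using inv[of n] du that by (auto intro!: derivative_eq_intros simp: blinfun.diff_left)
      then have "norm (?d x) \<le> r * (e/2)" if "x \<in> S" for x
        using lip[of ?d ?d' "e/2" x] n that inv[of n] u0 by simp
      then have J1: "norm (J ?d ?d' x) \<le> 3 * C * r * (e/2)"
        using bJ[of ?d ?d' x "e/2"] x n inv[of n] cU cu cg' by (auto intro!: continuous_intros)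
      have J2: "3 * C * r * (e/2) \<le> 1 * (e/2)"
        using r that C by (intro mult_right_mono) auto
      have J3: "U' (Suc n) x - J u g' x = J ?d ?d' x"
        using Jdiff[of "U n" "U' n" u g' x] x inv cU cu cg' unfolding USuc by simp
      have "norm (U' (Suc n) x - J u g' x) \<le> e/2" unfolding J3 using order_trans[OF J1 J2] by simp
      then show ?thesis using n(2)[OF x] norm_triangle_ineq4[of "U' (Suc n) x - J u g' x" "U' (Suc n) x - g' x"] by simp
    qed
    then have "norm (g' x - J u g' x) \<le> 0" by (rule field_le_epsilon) simp
    then show ?thesis by simp
  qed
  \<comment> \<open>The defect of the differential equation. It remains to show that it vanishes,
    which is the point where flatness enters.\<close>
  define w where "w = (\<lambda>x. g' x - (blinfun.prod_left (u x) o\<^sub>L M x))"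
  have w: "w x h = g' x h - M x h (u x)" for x h by (simp add: w_def blinfun.diff_left)
  have cw: "continuous_on S w" unfolding w_def by (intro continuous_intros cg' cu cMS)
  \<comment> \<open>Two expressions are subtracted under the integral: the derivative of
    \<open>u\<close> in direction \<open>h\<close> from the integral equation, and the t-derivative
    of \<open>t M (t x) h (u (t x))\<close>. Flatness exchanges the derivatives of \<open>M\<close>,
    so that everything left is linear in \<open>w\<close>.\<close>
  have wint: "w x h = integral {0..1} (\<lambda>t. t *\<^sub>R (M (t *\<^sub>R x) x (w (t *\<^sub>R x) h) - M (t *\<^sub>R x) h (w (t *\<^sub>R x) x)))"
    (is "_ = integral _ ?k") if x: "x \<in> S" for x h
  proof -
    let ?\<psi>' = "\<lambda>t. M (t *\<^sub>R x) h (u (t *\<^sub>R x)) + t *\<^sub>R (M' (t *\<^sub>R x) x h (u (t *\<^sub>R x)) + M (t *\<^sub>R x) h (g' (t *\<^sub>R x) x))"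
    have "(?\<psi>' has_integral (1 *\<^sub>R M (1 *\<^sub>R x) h (u (1 *\<^sub>R x)) - 0 *\<^sub>R M (0 *\<^sub>R x) h (u (0 *\<^sub>R x)))) {0..1}"
    proof (rule fundamental_theorem_of_calculus)
      fix t :: real assume t: "t \<in> {0..1}"
      have tx: "t *\<^sub>R x \<in> S" using tS x t by auto
      have 0: "((\<lambda>t. t *\<^sub>R x) has_derivative (\<lambda>s. s *\<^sub>R x)) (at t within {0..1})"
        by (auto intro!: derivative_eq_intros)
      have 1: "((\<lambda>t. M (t *\<^sub>R x)) has_derivative (\<lambda>s. M' (t *\<^sub>R x) (s *\<^sub>R x))) (at t within {0..1})"
        by (rule has_derivative_compose[OF 0 dM]) (use tx SR in auto)
      have 2: "((\<lambda>t. u (t *\<^sub>R x)) has_derivative (\<lambda>s. g' (t *\<^sub>R x) (s *\<^sub>R x))) (at t within {0..1})"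
        by (rule has_derivative_compose[OF 0 du[OF tx]])
      show "((\<lambda>t. t *\<^sub>R M (t *\<^sub>R x) h (u (t *\<^sub>R x))) has_vector_derivative ?\<psi>' t) (at t within {0..1})"
        unfolding has_vector_derivative_def
        by (rule has_derivative_eq_rhs[OF has_derivative_scaleR[OF has_derivative_ident
                blinfun.FDERIV[OF blinfun.FDERIV[OF 1 has_derivative_const] 2]]])
          (auto simp: fun_eq_iff blinfun.bilinear_simps algebra_simps)
    qed simp
    then have 1: "(?\<psi>' has_integral M x h (u x)) {0..1}" by simp
    have "((\<lambda>t. \<Phi> u g' x t h) has_integral J u g' x h) {0..1}"
      using has_integral_linear[OF integrable_integral[OF i\<Phi>[OF cu cg' x]] bounded_linear_apply_blinfun[of h]]
      by (simp add: J_def o_def blinfun.bounded_linear_left)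
    then have 2: "((\<lambda>t. \<Phi> u g' x t h) has_integral g' x h) {0..1}" using g'J[OF x] by simp
    have "\<Phi> u g' x t h - ?\<psi>' t = ?k t" if "t \<in> {0..1}" for t
    proof -
      let ?y = "t *\<^sub>R x"
      have y: "?y \<in> ball 0 R" using tS[OF x that] SR by auto
      have f: "M' ?y h x (u ?y) - M' ?y x h (u ?y) = M ?y h (M ?y x (u ?y)) - M ?y x (M ?y h (u ?y))"
        using flat[OF y, of h x "u ?y"] by (simp add: algebra_simps)
      have "\<Phi> u g' x t h - ?\<psi>' t = t *\<^sub>R ((M' ?y h x (u ?y) - M' ?y x h (u ?y)) + M ?y x (g' ?y h) - M ?y h (g' ?y x))"
        by (simp add: \<Phi>_def blinfun.bilinear_simps algebra_simps)
      also have "\<dots> = ?k t" unfolding f by (simp add: w blinfun.bilinear_simps algebra_simps)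
      finally show ?thesis .
    qed
    then have "(?k has_integral (g' x h - M x h (u x))) {0..1}"
      by (intro has_integral_eq[OF _ has_integral_diff[OF 2 1]])
    then show ?thesis by (simp add: w integral_unique)
  qed
  \<comment> \<open>The homogeneous equation \<open>wint\<close> halves any bound for
    \<open>w\<close>. On a compact ball the maximum of the norm is attained and must therefore be 0;
    this is why the radius drops to \<open>r / 2\<close>.\<close>
  have wb: "norm (w x) \<le> B / 2" if B: "\<And>y. y \<in> cball 0 (r/2) \<Longrightarrow> norm (w y) \<le> B" and x: "x \<in> cball 0 (r/2)" for x B
  proof (rule norm_blinfun_bound)
    have "norm (w 0) \<le> B" using r by (intro B) simp
    then have "B \<ge> 0" using norm_ge_zero order_trans by blast
    then show "0 \<le> B / 2" by simp
    fix h
    have xS: "x \<in> S" using x r by (simp add: S_def)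
    let ?k = "\<lambda>t. t *\<^sub>R (M (t *\<^sub>R x) x (w (t *\<^sub>R x) h) - M (t *\<^sub>R x) h (w (t *\<^sub>R x) x))"
    have "norm (?k t) \<le> 2 * C * r * B * norm h" if t: "t \<in> {0..1}" for t
    proof -
      let ?y = "t *\<^sub>R x"
      have y: "?y \<in> S" using tS[OF xS t] .
      have "norm ?y \<le> norm x" using t by (simp add: mult_left_le_one_le)
      then have wy: "norm (w ?y) \<le> B" using B x by simp
      have nx: "norm x \<le> r" using xS by (simp add: S_def)
      have "norm (w ?y k) \<le> B * norm k" for k
        by (intro order_trans[OF norm_blinfun[of "w ?y" k] mult_right_mono] wy) auto
      moreover have "norm (M ?y k) \<le> C * norm k" for k
        by (intro order_trans[OF norm_blinfun[of "M ?y" k] mult_right_mono] nM(1)[OF y]) auto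
      ultimately have *: "norm (M ?y k (w ?y l)) \<le> (C * norm k) * (B * norm l)" for k l
        by (intro order_trans[OF norm_blinfun[of "M ?y k" "w ?y l"] mult_mono]) (use C in auto)
      have "norm (M ?y x (w ?y h) - M ?y h (w ?y x)) \<le> (C * norm x) * (B * norm h) + (C * norm h) * (B * norm x)"
        by (intro order_trans[OF norm_triangle_ineq4 add_mono] *)
      also have "\<dots> = (2 * C * B * norm h) * norm x" by (simp add: algebra_simps)
      also have "\<dots> \<le> (2 * C * B * norm h) * r" using nx C \<open>B \<ge> 0\<close> by (intro mult_left_mono) auto
      finally have "norm (M ?y x (w ?y h) - M ?y h (w ?y x)) \<le> 2 * C * r * B * norm h" by (simp add: mult_ac)
      then show ?thesis using t by (auto intro: order_trans[OF mult_left_le_one_le])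
    qed
    moreover have "continuous_on {0..1} ?k"
    proof -
      have cx: "continuous_on {0..1} (\<lambda>t. f (t *\<^sub>R x))" if "continuous_on S f" for f :: "'a \<Rightarrow> 'z::topological_space"
        by (rule continuous_on_compose2[OF that]) (use tS[OF xS] in \<open>auto intro!: continuous_intros\<close>)
      show ?thesis by (intro continuous_intros cx cw cMS)
    qed
    ultimately have "norm (w x h) \<le> 2 * C * r * B * norm h"
      using integral_bound[of 0 1 ?k "2 * C * r * B * norm h"] wint[OF xS, of h] by simp
    also have "\<dots> = (2 * C * r) * (B * norm h)" by simp
    also have "\<dots> \<le> (1/2) * (B * norm h)" using r \<open>B \<ge> 0\<close> by (intro mult_right_mono) auto
    finally show "norm (w x h) \<le> B / 2 * norm h" by simp
  qed
  have "compact (cball (0::'a) (r/2))" "cball (0::'a) (r/2) \<noteq> {}" using r by auto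
  moreover have "continuous_on (cball 0 (r/2)) (\<lambda>x. norm (w x))"
    by (intro continuous_intros continuous_on_subset[OF cw]) (use r in \<open>auto simp: S_def\<close>)
  ultimately obtain y where y: "y \<in> cball 0 (r/2)" "\<And>x. x \<in> cball 0 (r/2) \<Longrightarrow> norm (w x) \<le> norm (w y)"
    using continuous_attains_sup by metis
  have "norm (w y) \<le> norm (w y) / 2" by (rule wb[OF y(2) y(1)])
  then have w0: "w x = 0" if "x \<in> cball 0 (r/2)" for x using y(2)[OF that] by (simp add: order_antisym)
  have "(u has_derivative (\<lambda>h. M x h (u x))) (at x)" if "x \<in> ball 0 (r/2)" for x
  proof -
    have "blinfun_apply (g' x) = (\<lambda>h. M x h (u x))" using w[of x] w0[of x] that by (auto simp: fun_eq_iff)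
    then show ?thesis using du[of x] that r by (simp add: S_def)
  qed
  then show ?thesis using u0 r q by (intro exI[of _ "r/2"]) (auto simp: q_def)
qed

lemma smooth_on_blinfun_derivative:
  assumes "open S" "smooth_on S f"
  obtains f' :: "'a::euclidean_space \<Rightarrow> 'a \<Rightarrow>\<^sub>L 'b::real_normed_vector"
  where "\<And>x. x \<in> S \<Longrightarrow> (f has_derivative blinfun_apply (f' x)) (at x)" "continuous_on S f'"
proof
  define f' where "f' x = Blinfun (frechet_derivative f (at x))" for x
  have f': "blinfun_apply (f' x) = frechet_derivative f (at x)" if "x \<in> S" for x
    unfolding f'_def
    by (rule bounded_linear_Blinfun_apply[OF has_derivative_bounded_linear[OF smooth_on_derivative[OF assms(2) that]]])
  show "(f has_derivative blinfun_apply (f' x)) (at x)" if "x \<in> S" for x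
    using smooth_on_derivative[OF assms(2) that] f'[OF that] by simp
  have "continuous_on S (\<lambda>x. f' x i)" for i
    using smooth_on_imp_continuous[OF smooth_on_frechet[OF assms, of i]]
    by (rule continuous_on_eq) (simp add: f')
  then show "continuous_on S f'" by (intro continuous_on_blinfun_componentwise)
qed

text \<open>Translation of the base point to 0, conversion of the bilinear maps \<open>B x\<close>
  into bounded linear operators, and then the bootstrap for smoothness.\<close>

lemma flat_solution_smooth:
  fixes B :: "'a::euclidean_space \<Rightarrow> 'a \<Rightarrow> 'e::euclidean_space \<Rightarrow> 'e"
  assumes S: "open S" "x0 \<in> S"
    and bil: "\<And>x. x \<in> S \<Longrightarrow> bilinear (B x)"
    and smooth: "\<And>h u. smooth_on S (\<lambda>x. B x h u)"
    and flat: "\<And>x h k w. x \<in> S \<Longrightarrow> frechet_derivative (\<lambda>y. B y k w) (at x) h + B x k (B x h w)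
      = frechet_derivative (\<lambda>y. B y h w) (at x) k + B x h (B x k w)"
  shows "\<exists>r>0. ball x0 r \<subseteq> S \<and> (\<exists>u. u x0 = v0 \<and> smooth_on (ball x0 r) u \<and>
    (\<forall>x\<in>ball x0 r. (u has_derivative (\<lambda>h. B x h (u x))) (at x)))"
proof -
  obtain R where R: "R > 0" "ball x0 R \<subseteq> S" using S open_contains_ball by blast
  \<comment> \<open>Rank-one bilinear maps. As fixed basis elements they reduce the regularity of
    the operator-valued \<open>M\<close> to that of finitely many real coefficient
    functions.\<close>
  define T :: "'a \<Rightarrow> 'e \<Rightarrow> 'e \<Rightarrow> 'a \<Rightarrow>\<^sub>L 'e \<Rightarrow>\<^sub>L 'e" where
    "T h u v = blinfun_scaleR_left (blinfun_scaleR_left v o\<^sub>L blinfun_inner_left u) o\<^sub>L blinfun_inner_left h" for h u v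
  have T: "T h u v k w = (k \<bullet> h) *\<^sub>R (w \<bullet> u) *\<^sub>R v" for h u v k w
    by (simp add: T_def blinfun.scaleR_left)
  define M where "M x = (\<Sum>h\<in>Basis. \<Sum>u\<in>Basis. \<Sum>v\<in>Basis. (B x h u \<bullet> v) *\<^sub>R T h u v)" for x
  have MB: "M x k w = B x k w" if "x \<in> S" for x k w
  proof -
    note l = bil[OF that, unfolded bilinear_def]
    have l1: "linear (\<lambda>k. B x k w)" for w using l by blast
    have l2: "linear (\<lambda>w. B x k w)" for k using l by blast
    have "M x k w = (\<Sum>h\<in>Basis. \<Sum>u\<in>Basis. \<Sum>v\<in>Basis. (B x h u \<bullet> v) *\<^sub>R (k \<bullet> h) *\<^sub>R (w \<bullet> u) *\<^sub>R v)"
      by (simp add: M_def blinfun.sum_left blinfun.scaleR_left T)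
    also have "\<dots> = (\<Sum>h\<in>Basis. (k \<bullet> h) *\<^sub>R (\<Sum>u\<in>Basis. (w \<bullet> u) *\<^sub>R (\<Sum>v\<in>Basis. (B x h u \<bullet> v) *\<^sub>R v)))"
      by (simp add: scaleR_sum_right mult_ac)
    also have "\<dots> = (\<Sum>h\<in>Basis. (k \<bullet> h) *\<^sub>R (\<Sum>u\<in>Basis. (w \<bullet> u) *\<^sub>R B x h u))"
      by (simp add: euclidean_representation)
    also have "\<dots> = (\<Sum>h\<in>Basis. (k \<bullet> h) *\<^sub>R B x h (\<Sum>u\<in>Basis. (w \<bullet> u) *\<^sub>R u))"
      by (simp add: linear_sum[OF l2] linear_cmul[OF l2])
    also have "\<dots> = B x (\<Sum>h\<in>Basis. (k \<bullet> h) *\<^sub>R h) (\<Sum>u\<in>Basis. (w \<bullet> u) *\<^sub>R u)"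
      by (simp only: linear_sum[OF l1] linear_cmul[OF l1])
    finally show ?thesis by (simp add: euclidean_representation)
  qed
  have "\<exists>D. (\<forall>x\<in>S. ((\<lambda>x. B x h u \<bullet> v) has_derivative blinfun_apply (D x)) (at x)) \<and> continuous_on S D" for h u v
    using smooth_on_blinfun_derivative[OF S(1) smooth_on_bounded_linear[OF S(1) bounded_linear_inner_left smooth]]
    by metis
  then obtain D where D: "\<And>h u v x. x \<in> S \<Longrightarrow> ((\<lambda>x. B x h u \<bullet> v) has_derivative blinfun_apply (D h u v x)) (at x)"
      "\<And>h u v. continuous_on S (D h u v)" by metis
  define M' where "M' x = (\<Sum>h\<in>Basis. \<Sum>u\<in>Basis. \<Sum>v\<in>Basis. blinfun_scaleR_left (T h u v) o\<^sub>L D h u v x)" for x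
  have dM: "(M has_derivative M' x) (at x)" if "x \<in> S" for x
  proof -
    have "(M has_derivative (\<lambda>k. \<Sum>h\<in>Basis. \<Sum>u\<in>Basis. \<Sum>v\<in>Basis. D h u v x k *\<^sub>R T h u v)) (at x)"
      unfolding M_def by (intro has_derivative_sum has_derivative_scaleR_left D that)
    then show ?thesis by (rule has_derivative_eq_rhs) (simp add: M'_def blinfun.sum_left fun_eq_iff)
  qed
  have cM': "continuous_on S M'" unfolding M'_def by (intro continuous_intros D)
  have fr: "frechet_derivative (\<lambda>y. B y k w) (at x) h = M' x h k w" if "x \<in> S" for x h k w
  proof -
    have "((\<lambda>y. M y k w) has_derivative (\<lambda>h. M' x h k w)) (at x)"
      by (rule has_derivative_eq_rhs[OF blinfun.FDERIV[OF blinfun.FDERIV[OF dM[OF that] has_derivative_const] has_derivative_const]])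
        (auto simp: blinfun.bilinear_simps)
    then have "((\<lambda>y. B y k w) has_derivative (\<lambda>h. M' x h k w)) (at x)"
      by (rule has_derivative_transform_within_open[OF _ S(1) that]) (simp add: MB)
    then show ?thesis using frechet_derivative_at by metis
  qed
  have tr: "((\<lambda>y. x0 + y) has_derivative (\<lambda>h. h)) (at y)" for y by (auto intro!: derivative_eq_intros)
  have inS: "x0 + y \<in> S" if "y \<in> ball 0 R" for y
    using that R(2) by (auto simp: subset_iff dist_norm)
  obtain r u where r: "r > 0" "r \<le> R" and u: "u 0 = v0"
      "\<And>y. y \<in> ball 0 r \<Longrightarrow> (u has_derivative (\<lambda>h. M (x0 + y) h (u y))) (at y)"
  proof -
    have "\<exists>r>0. r \<le> R \<and> (\<exists>u. u 0 = v0 \<and> (\<forall>y\<in>ball 0 r. (u has_derivative (\<lambda>h. M (x0 + y) h (u y))) (at y)))"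
    proof (rule flat_solution[where M' = "\<lambda>y. M' (x0 + y)"])
      show "((\<lambda>y. M (x0 + y)) has_derivative M' (x0 + y)) (at y)" if "y \<in> ball 0 R" for y
        using has_derivative_compose[OF tr dM[OF inS[OF that]]] .
      show "continuous_on (ball 0 R) (\<lambda>y. M' (x0 + y))"
      proof (rule continuous_on_compose2[OF cM'])
        show "(\<lambda>y. x0 + y) ` ball 0 R \<subseteq> S" using inS by blast
      qed (intro continuous_intros)
      show "M' (x0 + y) h k w + M (x0 + y) k (M (x0 + y) h w) = M' (x0 + y) k h w + M (x0 + y) h (M (x0 + y) k w)"
        if "y \<in> ball 0 R" for y h k w
        using flat[OF inS[OF that], of k w h] by (simp add: MB inS[OF that] fr)
    qed (use R in auto)
    then show ?thesis using that by blast
  qed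
  have tr': "((\<lambda>y. y - x0) has_derivative (\<lambda>h. h)) (at y)" for y by (auto intro!: derivative_eq_intros)
  define U where "U x = u (x - x0)" for x
  have br: "ball x0 r \<subseteq> S" using r R by (meson order_trans subset_ball)
  have dU: "(U has_derivative (\<lambda>h. B x h (U x))) (at x)" if "x \<in> ball x0 r" for x
  proof -
    have "x - x0 \<in> ball 0 r" using that by (simp add: dist_norm norm_minus_commute)
    then have "(U has_derivative (\<lambda>h. M x h (U x))) (at x)"
      using has_derivative_compose[OF tr' u(2)] by (simp add: U_def[abs_def])
    then show ?thesis by (rule has_derivative_eq_rhs) (use MB br that in \<open>auto simp: fun_eq_iff\<close>)
  qed
  have "smooth_on (ball x0 r) U"
  proof (rule smooth_on_bootstrap[where T = "S \<times> UNIV" and F = "\<lambda>b (x, w). B x b w", OF _ _ _ dU])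
    fix b :: 'a assume b: "b \<in> Basis"
    have oT: "open (S \<times> (UNIV :: 'e set))" by (intro open_Times S open_UNIV)
    have "smooth_on (S \<times> UNIV) (\<lambda>z. \<Sum>e\<in>Basis. (snd z \<bullet> e) *\<^sub>R B (fst z) b e)"
    proof (intro smooth_on_sum smooth_on_scaleR oT)
      fix e :: 'e
      show "smooth_on (S \<times> UNIV) (\<lambda>z :: 'a \<times> 'e. snd z \<bullet> e)"
        by (rule smooth_on_bounded_linear[OF oT bounded_linear_inner_left smooth_on_linear[OF oT bounded_linear_snd]])
      show "smooth_on (S \<times> UNIV) (\<lambda>z :: 'a \<times> 'e. B (fst z) b e)"
        by (rule smooth_on_compose[OF oT S(1) smooth smooth_on_linear[OF oT bounded_linear_fst]]) auto
    qed
    then show "smooth_on (S \<times> UNIV) (\<lambda>(x, w). B x b w)"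
    proof (rule smooth_on_cong[OF oT, rotated], clarify)
      fix x w assume x: "x \<in> S"
      have l2: "linear (\<lambda>w. B x b w)" using bil[OF x] unfolding bilinear_def by blast
      show "(\<Sum>e\<in>Basis. (snd (x, w) \<bullet> e) *\<^sub>R B (fst (x, w)) b e) = B x b w"
        by (subst (2) euclidean_representation[of w, symmetric]) (simp add: linear_sum[OF l2] linear_cmul[OF l2])
    qed
  qed (use br S in \<open>auto intro: open_Times\<close>)
  then show ?thesis using r br dU u(1) by (intro exI[of _ r]) (auto intro!: exI[of _ U] simp: U_def[of x0])
qed

section \<open>Partial derivatives in the plane\<close>

lemma has_derivative_partials:
  assumes "f differentiable (at x)"
  shows "(f has_derivative (\<lambda>h. h $ 1 * partial_deriv 1 f x + h $ 2 * partial_deriv 2 f x)) (at (x :: real^2))"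
proof -
  have d: "(f has_derivative frechet_derivative f (at x)) (at x)"
    using assms by (simp add: frechet_derivative_works)
  then have l: "linear (frechet_derivative f (at x))" using has_derivative_linear by blast
  have h: "h = h $ 1 *\<^sub>R axis 1 1 + h $ 2 *\<^sub>R axis 2 1" for h :: "real^2"
    by (auto simp: vec_eq_iff axis_def forall_2)
  have "frechet_derivative f (at x) h = h $ 1 * partial_deriv 1 f x + h $ 2 * partial_deriv 2 f x" for h
    by (subst h) (simp add: linear_add[OF l] linear_cmul[OF l] partial_deriv_def)
  then have "frechet_derivative f (at x) = (\<lambda>h. h $ 1 * partial_deriv 1 f x + h $ 2 * partial_deriv 2 f x)"
    by blast
  with d show ?thesis by simp
qed

lemma partial_deriv_eq:
  assumes "(f has_derivative f') (at x)"
  shows "partial_deriv i f x = f' (axis i 1)"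
  using frechet_derivative_at[OF assms] by (simp add: partial_deriv_def)

lemma smooth_on_partials:
  assumes "smooth_on S f" "x \<in> S"
  shows "(f has_derivative (\<lambda>h. h $ 1 * partial_deriv 1 f x + h $ 2 * partial_deriv 2 f x)) (at (x :: real^2))"
  using smooth_on_derivative[OF assms] by (intro has_derivative_partials) (auto simp: differentiable_def)

lemmas smooth_intros = smooth_on_const smooth_on_add smooth_on_mult smooth_on_diff smooth_on_minus
  smooth_on_Pair smooth_on_vec_nth

section \<open>Coordinates on surfaces of constant curvature\<close>

text \<open>The Christoffel symbols are a parameter, characterized by torsion-freeness
  \<open>sym_\<Gamma>\<close> and metric compatibility \<open>compat\<close>. The axiom
  \<open>curv\<close> is \<open>R(X,Y)Z = \<mu> (g(Y,Z) X - g(X,Z) Y)\<close> for X, Y the two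
  coordinate fields and Z a coordinate field. Note that \<open>sym_\<Gamma>\<close> is an equality
  of functions on the whole plane, not just on \<open>\<Omega>\<close>.\<close>

locale space_form_chart =
  fixes \<Omega> :: "(real^2) set" and G :: "real^2 \<Rightarrow> real^2^2" and \<Gamma> :: "2 \<Rightarrow> 2 \<Rightarrow> 2 \<Rightarrow> real^2 \<Rightarrow> real" and \<mu> :: real
  assumes open_\<Omega>: "open \<Omega>"
    and smooth_G: "smooth_on \<Omega> (\<lambda>x. G x $ i $ j)"
    and smooth_\<Gamma>: "smooth_on \<Omega> (\<Gamma> k i j)"
    and sym_G: "x \<in> \<Omega> \<Longrightarrow> G x $ 2 $ 1 = G x $ 1 $ 2"
    and sym_\<Gamma>: "\<Gamma> k 2 1 = \<Gamma> k 1 2"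
    and pos_G: "x \<in> \<Omega> \<Longrightarrow> G x $ 1 $ 1 > 0"
    and det_G: "x \<in> \<Omega> \<Longrightarrow> G x $ 1 $ 1 * G x $ 2 $ 2 - (G x $ 1 $ 2)\<^sup>2 > 0"
    and compat: "x \<in> \<Omega> \<Longrightarrow> partial_deriv k (\<lambda>y. G y $ i $ j) x =
      (\<Sum>m\<in>UNIV. G x $ i $ m * \<Gamma> m k j x + G x $ j $ m * \<Gamma> m k i x)"
    and curv: "x \<in> \<Omega> \<Longrightarrow> partial_deriv 1 (\<Gamma> l 2 j) x - partial_deriv 2 (\<Gamma> l 1 j) x
      + (\<Sum>m\<in>UNIV. \<Gamma> l 1 m x * \<Gamma> m 2 j x - \<Gamma> l 2 m x * \<Gamma> m 1 j x)
      = \<mu> * ((if l = 1 then G x $ 2 $ j else 0) - (if l = 2 then G x $ 1 $ j else 0))"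
begin

text \<open>A solution of \<open>Hess f = (a - \<mu> f) g\<close> with constant \<open>a\<close> is a parallel section
  \<open>(f, grad f, a)\<close> of the following connection, which is flat because \<open>\<mu>\<close> is the curvature.\<close>

definition conn :: "real^2 \<Rightarrow> real^2 \<Rightarrow> real \<times> real \<times> real \<times> real \<Rightarrow> real \<times> real \<times> real \<times> real" where
  "conn x h = (\<lambda>(f, p, q, a).
     (h $ 1 * (G x $ 1 $ 1 * p + G x $ 1 $ 2 * q) + h $ 2 * (G x $ 1 $ 2 * p + G x $ 2 $ 2 * q),
      (a - \<mu> * f) * h $ 1 - (h $ 1 * (\<Gamma> 1 1 1 x * p + \<Gamma> 1 1 2 x * q) + h $ 2 * (\<Gamma> 1 1 2 x * p + \<Gamma> 1 2 2 x * q)),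
      (a - \<mu> * f) * h $ 2 - (h $ 1 * (\<Gamma> 2 1 1 x * p + \<Gamma> 2 1 2 x * q) + h $ 2 * (\<Gamma> 2 1 2 x * p + \<Gamma> 2 2 2 x * q)),
      0))"

lemma dG: "x \<in> \<Omega> \<Longrightarrow> ((\<lambda>y. G y $ i $ j) has_derivative (\<lambda>h. h $ 1 *
      (G x $ i $ 1 * \<Gamma> 1 1 j x + G x $ j $ 1 * \<Gamma> 1 1 i x + G x $ i $ 2 * \<Gamma> 2 1 j x + G x $ j $ 2 * \<Gamma> 2 1 i x)
    + h $ 2 *
      (G x $ i $ 1 * \<Gamma> 1 2 j x + G x $ j $ 1 * \<Gamma> 1 2 i x + G x $ i $ 2 * \<Gamma> 2 2 j x + G x $ j $ 2 * \<Gamma> 2 2 i x))) (at x)"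
  by (rule has_derivative_eq_rhs[OF smooth_on_partials[OF smooth_G]]) (auto simp: compat sum_2 add_ac)

text \<open>In the gradient components the commutator of second derivatives is the curvature tensor
  applied to the gradient, and the contribution of \<open>- \<mu> f\<close> is exactly its negative.
  In the component of \<open>f\<close>, compatibility and symmetry suffice.\<close>

lemma conn_flat:
  assumes x: "x \<in> \<Omega>"
  shows "frechet_derivative (\<lambda>y. conn y k w) (at x) h + conn x k (conn x h w)
      = frechet_derivative (\<lambda>y. conn y h w) (at x) k + conn x h (conn x k w)"
proof -
  obtain f p q a where w: "w = (f, p, q, a)" by (metis prod_cases4)
  note d\<Gamma> = smooth_on_partials[OF smooth_\<Gamma> x]
  let ?d = "\<lambda>i k l m. partial_deriv i (\<Gamma> k l m) x"
  have curv': "?d 1 l 2 j = ?d 2 l 1 j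
      - (\<Sum>m\<in>UNIV. \<Gamma> l 1 m x * \<Gamma> m 2 j x - \<Gamma> l 2 m x * \<Gamma> m 1 j x)
      + \<mu> * ((if l = 1 then G x $ 2 $ j else 0) - (if l = 2 then G x $ 1 $ j else 0))" for l j
    using curv[OF x, of l j] by simp
  have "((\<lambda>y. conn y k w) has_derivative (\<lambda>h.
     (k $ 1 * ((h $ 1 * partial_deriv 1 (\<lambda>y. G y $ 1 $ 1) x + h $ 2 * partial_deriv 2 (\<lambda>y. G y $ 1 $ 1) x) * p
        + (h $ 1 * partial_deriv 1 (\<lambda>y. G y $ 1 $ 2) x + h $ 2 * partial_deriv 2 (\<lambda>y. G y $ 1 $ 2) x) * q)
      + k $ 2 * ((h $ 1 * partial_deriv 1 (\<lambda>y. G y $ 1 $ 2) x + h $ 2 * partial_deriv 2 (\<lambda>y. G y $ 1 $ 2) x) * p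
        + (h $ 1 * partial_deriv 1 (\<lambda>y. G y $ 2 $ 2) x + h $ 2 * partial_deriv 2 (\<lambda>y. G y $ 2 $ 2) x) * q),
      - (k $ 1 * ((h $ 1 * ?d 1 1 1 1 + h $ 2 * ?d 2 1 1 1) * p + (h $ 1 * ?d 1 1 1 2 + h $ 2 * ?d 2 1 1 2) * q)
       + k $ 2 * ((h $ 1 * ?d 1 1 1 2 + h $ 2 * ?d 2 1 1 2) * p + (h $ 1 * ?d 1 1 2 2 + h $ 2 * ?d 2 1 2 2) * q)),
      - (k $ 1 * ((h $ 1 * ?d 1 2 1 1 + h $ 2 * ?d 2 2 1 1) * p + (h $ 1 * ?d 1 2 1 2 + h $ 2 * ?d 2 2 1 2) * q)
       + k $ 2 * ((h $ 1 * ?d 1 2 1 2 + h $ 2 * ?d 2 2 1 2) * p + (h $ 1 * ?d 1 2 2 2 + h $ 2 * ?d 2 2 2 2) * q)),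
      0))) (at x)" for k
    unfolding conn_def w prod.case
    by (intro has_derivative_Pair has_derivative_const)
      (rule has_derivative_eq_rhs, (rule derivative_intros d\<Gamma> smooth_on_partials[OF smooth_G x])+, simp add: fun_eq_iff)+
  note fr = frechet_derivative_at[OF this, symmetric]
  \<comment> \<open>The four components of the curvature identity, solved for the derivatives in
    direction 1. Used as rewrite rules they leave a polynomial identity.\<close>
  have c1: "?d 1 1 1 2 = ?d 2 1 1 1 - (\<Gamma> 1 1 1 x * \<Gamma> 1 1 2 x + \<Gamma> 1 1 2 x * \<Gamma> 2 1 2 x - \<Gamma> 1 1 2 x * \<Gamma> 1 1 1 x - \<Gamma> 1 2 2 x * \<Gamma> 2 1 1 x) + \<mu> * G x $ 1 $ 2"
    using curv'[of 1 1] by (simp add: sum_2 sym_\<Gamma> sym_G[OF x])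
  have c2: "?d 1 1 2 2 = ?d 2 1 1 2 - (\<Gamma> 1 1 1 x * \<Gamma> 1 2 2 x + \<Gamma> 1 1 2 x * \<Gamma> 2 2 2 x - \<Gamma> 1 1 2 x * \<Gamma> 1 1 2 x - \<Gamma> 1 2 2 x * \<Gamma> 2 1 2 x) + \<mu> * G x $ 2 $ 2"
    using curv'[of 1 2] by (simp add: sum_2 sym_\<Gamma> sym_G[OF x])
  have c3: "?d 1 2 1 2 = ?d 2 2 1 1 - (\<Gamma> 2 1 1 x * \<Gamma> 1 1 2 x + \<Gamma> 2 1 2 x * \<Gamma> 2 1 2 x - \<Gamma> 2 1 2 x * \<Gamma> 1 1 1 x - \<Gamma> 2 2 2 x * \<Gamma> 2 1 1 x) - \<mu> * G x $ 1 $ 1"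
    using curv'[of 2 1] by (simp add: sum_2 sym_\<Gamma> sym_G[OF x])
  have c4: "?d 1 2 2 2 = ?d 2 2 1 2 - (\<Gamma> 2 1 1 x * \<Gamma> 1 2 2 x + \<Gamma> 2 1 2 x * \<Gamma> 2 2 2 x - \<Gamma> 2 1 2 x * \<Gamma> 1 1 2 x - \<Gamma> 2 2 2 x * \<Gamma> 2 1 2 x) - \<mu> * G x $ 1 $ 2"
    using curv'[of 2 2] by (simp add: sum_2 sym_\<Gamma> sym_G[OF x])
  show ?thesis
    by (simp only: fr) (simp add: conn_def w compat[OF x] sum_2 sym_\<Gamma> sym_G[OF x] c1 c2 c3 c4 algebra_simps)
qed

definition hess_solution :: "(real^2) set \<Rightarrow> real \<Rightarrow> (real^2 \<Rightarrow> real) \<Rightarrow> (real^2 \<Rightarrow> real) \<Rightarrow> (real^2 \<Rightarrow> real) \<Rightarrow> bool" where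
  "hess_solution D a f p q \<longleftrightarrow> smooth_on D f \<and> smooth_on D p \<and> smooth_on D q \<and> (\<forall>x\<in>D.
     (f has_derivative (\<lambda>h. fst (conn x h (f x, p x, q x, a)))) (at x) \<and>
     (p has_derivative (\<lambda>h. fst (snd (conn x h (f x, p x, q x, a))))) (at x) \<and>
     (q has_derivative (\<lambda>h. fst (snd (snd (conn x h (f x, p x, q x, a)))))) (at x))"

lemma hess_solution_subset: "hess_solution D a f p q \<Longrightarrow> D' \<subseteq> D \<Longrightarrow> hess_solution D' a f p q"
  unfolding hess_solution_def by (meson smooth_on_subset subset_iff)

lemma hess_solution_exists:
  assumes "x0 \<in> \<Omega>"
  shows "\<exists>r>0. ball x0 r \<subseteq> \<Omega> \<and> (\<exists>f p q. hess_solution (ball x0 r) a f p q \<and> f x0 = f0 \<and> p x0 = p0 \<and> q x0 = q0)"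
proof -
  have bil: "bilinear (conn x)" for x
    unfolding bilinear_def by (auto intro!: linearI simp: conn_def algebra_simps split: prod.splits)
  have sm: "smooth_on \<Omega> (\<lambda>x. conn x h u)" for h u
    unfolding conn_def split_beta
    by (intro smooth_on_Pair smooth_on_add smooth_on_diff smooth_on_mult smooth_on_const open_\<Omega> smooth_G smooth_\<Gamma>)
  obtain r u where r: "r > 0" "ball x0 r \<subseteq> \<Omega>" and u: "u x0 = (f0, p0, q0, a)" "smooth_on (ball x0 r) u"
      "\<And>x. x \<in> ball x0 r \<Longrightarrow> (u has_derivative (\<lambda>h. conn x h (u x))) (at x)"
    using flat_solution_smooth[OF open_\<Omega> assms bil sm conn_flat, of "(f0, p0, q0, a)"] by blast
  let ?D = "ball x0 r"
  let ?f = "\<lambda>x. fst (u x)" and ?p = "\<lambda>x. fst (snd (u x))" and ?q = "\<lambda>x. fst (snd (snd (u x)))"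
    and ?a = "\<lambda>x. snd (snd (snd (u x)))"
  have d: "(?f has_derivative (\<lambda>h. fst (conn x h (u x)))) (at x)"
    "(?p has_derivative (\<lambda>h. fst (snd (conn x h (u x))))) (at x)"
    "(?q has_derivative (\<lambda>h. fst (snd (snd (conn x h (u x)))))) (at x)"
    "(?a has_derivative (\<lambda>h. snd (snd (snd (conn x h (u x)))))) (at x)" if "x \<in> ?D" for x
    by (intro has_derivative_fst has_derivative_snd u(3) that)+
  \<comment> \<open>The last component of \<open>conn\<close> is 0, so the last component of a
    parallel section is constant on the ball.\<close>
  have "?a x = a" if "x \<in> ?D" for x
  proof -
    have "\<exists>c. \<forall>x\<in>?D. ?a x = c"
    proof (rule has_derivative_zero_constant[OF convex_ball])
      show "(?a has_derivative (\<lambda>h. 0)) (at x within ?D)" if "x \<in> ?D" for x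
        using d(4)[OF that] by (auto simp: conn_def split_beta intro: has_derivative_at_withinI)
    qed
    then show ?thesis using that r u(1) by (metis centre_in_ball snd_conv)
  qed
  then have ux: "u x = (?f x, ?p x, ?q x, a)" if "x \<in> ?D" for x using that by (metis prod.collapse)
  have sms: "smooth_on ?D ?f" "smooth_on ?D ?p" "smooth_on ?D ?q"
    by (intro smooth_on_bounded_linear[OF open_ball bounded_linear_fst]
        smooth_on_bounded_linear[OF open_ball bounded_linear_snd] u(2))+
  have "hess_solution ?D a ?f ?p ?q"
    unfolding hess_solution_def
  proof (intro conjI ballI sms)
    fix x assume x: "x \<in> ?D"
    note eq = ux[OF x, symmetric]
    show "(?f has_derivative (\<lambda>h. fst (conn x h (?f x, ?p x, ?q x, a)))) (at x)"
      "(?p has_derivative (\<lambda>h. fst (snd (conn x h (?f x, ?p x, ?q x, a))))) (at x)"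
      "(?q has_derivative (\<lambda>h. fst (snd (snd (conn x h (?f x, ?p x, ?q x, a)))))) (at x)"
      unfolding eq using d(1-3)[OF x] .
  qed
  then have "hess_solution ?D a ?f ?p ?q \<and> ?f x0 = f0 \<and> ?p x0 = p0 \<and> ?q x0 = q0" using u(1) by simp
  then show ?thesis
    by (intro exI[of _ r] conjI r) (rule exI[of _ ?f], rule exI[of _ ?p], rule exI[of _ ?q])
qed

text \<open>The derivative of \<open>g(grad f, grad g)\<close> is
  \<open>(a - \<mu> f) dg + (b - \<mu> g) df\<close>, which the remaining terms of \<open>I\<close>
  cancel. For two equal solutions this is the conservation of
  \<open>|grad f|^2 - 2 a f + \<mu> f^2\<close>. The values at \<open>x0\<close> then give all inner
  products of the gradients of the coordinates as functions of the coordinates alone.\<close>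

lemma hess_solution_conserved:
  assumes r: "r > 0" "ball x0 r \<subseteq> \<Omega>" and s: "hess_solution (ball x0 r) a f p q" "hess_solution (ball x0 r) b g u v"
    and x: "x \<in> ball x0 r"
  defines "I \<equiv> \<lambda>x. G x $ 1 $ 1 * (p x * u x) + G x $ 1 $ 2 * (p x * v x + q x * u x) + G x $ 2 $ 2 * (q x * v x)
      - a * g x - b * f x + \<mu> * (f x * g x)"
  shows "I x = I x0"
proof -
  have "\<exists>c. \<forall>x\<in>ball x0 r. I x = c"
  proof (rule has_derivative_zero_constant[OF convex_ball])
    fix x assume x: "x \<in> ball x0 r"
    then have xO: "x \<in> \<Omega>" using r by auto
    note d = s[unfolded hess_solution_def, THEN conjunct2, THEN conjunct2, THEN conjunct2, rule_format, OF x]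
    have "(I has_derivative (\<lambda>h. 0)) (at x)"
      unfolding I_def
      apply (rule has_derivative_eq_rhs)
       apply (rule derivative_intros dG[OF xO] d[THEN conjunct1] d[THEN conjunct2, THEN conjunct1] d[THEN conjunct2, THEN conjunct2])+
      apply (simp add: fun_eq_iff conn_def sym_\<Gamma> sym_G[OF xO] algebra_simps)
      done
    then show "(I has_derivative (\<lambda>h. 0)) (at x within ball x0 r)" by (rule has_derivative_at_withinI)
  qed
  then show ?thesis using x r by (metis centre_in_ball)
qed

end

lemma eventually_nhds_pos:
  fixes f :: "'a::t2_space \<Rightarrow> real"
  shows "isCont f a \<Longrightarrow> f a > 0 \<Longrightarrow> \<forall>\<^sub>F x in nhds a. f x > 0"
  by (simp add: eventually_nhds_conv_at isCont_def order_tendstoD)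

text \<open>Here \<open>E\<close>, \<open>F\<close>, \<open>H\<close> are metric coefficients, and
  \<open>(p, q)\<close>, \<open>(u, v)\<close>, \<open>(z, w)\<close> are the gradients of X, Y, Z,
  whose Gram matrix is \<open>c1\<close> to \<open>c6\<close>. In a plane the third gradient depends
  on the first two, and this dependence is the quadric. The second claim is checked on combinations
  of the first two gradients, where all terms are entries of the Gram matrix;
  \<open>E * p + F * q\<close> and its analogues are the covector components of the
  differentials.\<close>

lemma gram_plane:
  fixes E F H p q u v z w X Y Z \<mu> :: real
  assumes c1: "E * (p * p) + F * (p * q + q * p) + H * (q * q) = 1 - \<mu> * X\<^sup>2"
    and c2: "E * (p * u) + F * (p * v + q * u) + H * (q * v) = - \<mu> * X * Y"
    and c3: "E * (u * u) + F * (u * v + v * u) + H * (v * v) = 1 - \<mu> * Y\<^sup>2"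
    and c4: "E * (p * z) + F * (p * w + q * z) + H * (q * w) = X * (1 - \<mu> * Z)"
    and c5: "E * (u * z) + F * (u * w + v * z) + H * (v * w) = Y * (1 - \<mu> * Z)"
    and c6: "E * (z * z) + F * (z * w + w * z) + H * (w * w) = 2 * Z - \<mu> * Z\<^sup>2"
    and d: "p * v - q * u \<noteq> 0"
  shows "X\<^sup>2 + Y\<^sup>2 = 2 * Z - \<mu> * Z\<^sup>2"
    and "E * (h * h) + F * (h * k + k * h) + H * (k * k) =
      (h * (E * p + F * q) + k * (F * p + H * q))\<^sup>2 + (h * (E * u + F * v) + k * (F * u + H * v))\<^sup>2
      + \<mu> * (h * (E * z + F * w) + k * (F * z + H * w))\<^sup>2"
proof -
  have ex: "\<exists>a b. h = a * p + b * u \<and> k = a * q + b * v" for h k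
  proof (intro exI conjI)
    have "(h * v - k * u) * p + (p * k - q * h) * u = h * (p * v - q * u)"
      "(h * v - k * u) * q + (p * k - q * h) * v = k * (p * v - q * u)" by algebra+
    then show "h = (h * v - k * u) / (p * v - q * u) * p + (p * k - q * h) / (p * v - q * u) * u"
      "k = (h * v - k * u) / (p * v - q * u) * q + (p * k - q * h) / (p * v - q * u) * v"
      using d by (simp_all add: add_divide_distrib[symmetric])
  qed
  obtain a b where ab: "z = a * p + b * u" "w = a * q + b * v" using ex by blast
  have e4: "a * (1 - \<mu> * X\<^sup>2) + b * (- \<mu> * X * Y) = X * (1 - \<mu> * Z)"
    unfolding c1[symmetric] c2[symmetric] c4[symmetric] ab by (simp add: algebra_simps)
  have e5: "a * (- \<mu> * X * Y) + b * (1 - \<mu> * Y\<^sup>2) = Y * (1 - \<mu> * Z)"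
    unfolding c3[symmetric] c2[symmetric] c5[symmetric] ab by (simp add: algebra_simps)
  have e6: "2 * Z - \<mu> * Z\<^sup>2 = a * (X * (1 - \<mu> * Z)) + b * (Y * (1 - \<mu> * Z))"
    unfolding c4[symmetric] c5[symmetric] c6[symmetric] by (simp add: ab algebra_simps)
  show R: "X\<^sup>2 + Y\<^sup>2 = 2 * Z - \<mu> * Z\<^sup>2"
    using e4 e5 e6 by algebra
  then have m2: "(1 - \<mu> * Z)\<^sup>2 = 1 - \<mu> * X\<^sup>2 - \<mu> * Y\<^sup>2" by algebra
  obtain a b where ab: "h = a * p + b * u" "k = a * q + b * v" using ex by blast
  have 1: "h * (E * p + F * q) + k * (F * p + H * q) = a * (1 - \<mu> * X\<^sup>2) + b * (- \<mu> * X * Y)"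
    unfolding c1[symmetric] c2[symmetric] ab by (simp add: algebra_simps)
  have 2: "h * (E * u + F * v) + k * (F * u + H * v) = a * (- \<mu> * X * Y) + b * (1 - \<mu> * Y\<^sup>2)"
    unfolding c3[symmetric] c2[symmetric] ab by (simp add: algebra_simps)
  have 3: "h * (E * z + F * w) + k * (F * z + H * w) = a * (X * (1 - \<mu> * Z)) + b * (Y * (1 - \<mu> * Z))"
    unfolding c4[symmetric] c5[symmetric] ab by (simp add: algebra_simps)
  have 4: "E * (h * h) + F * (h * k + k * h) + H * (k * k) =
      a\<^sup>2 * (1 - \<mu> * X\<^sup>2) + 2 * a * b * (- \<mu> * X * Y) + b\<^sup>2 * (1 - \<mu> * Y\<^sup>2)"
    unfolding c1[symmetric] c2[symmetric] c3[symmetric] ab by (simp add: algebra_simps power2_eq_square)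
  show "E * (h * h) + F * (h * k + k * h) + H * (k * k) =
      (h * (E * p + F * q) + k * (F * p + H * q))\<^sup>2 + (h * (E * u + F * v) + k * (F * u + H * v))\<^sup>2
      + \<mu> * (h * (E * z + F * w) + k * (F * z + H * w))\<^sup>2"
    unfolding 1 2 3 4 using m2 by algebra
qed

context space_form_chart
begin

text \<open>X, Y, Z are solutions with a = 0, 0, 1 whose values vanish at \<open>x0\<close>; the
  gradients of X and Y are orthonormal there and that of Z is 0, as at the point where the quadric
  touches the plane Z = 0. The ball is shrunk to keep \<open>1 - \<mu> Z > 0\<close>, which singles
  out the part of the quadric that is a graph over the (X, Y)-plane, and to keep the gradients of X
  and Y independent.\<close>

lemma model_coordinates:
  assumes x0: "x0 \<in> \<Omega>"
  shows "\<exists>r>0. ball x0 r \<subseteq> \<Omega> \<and> (\<exists>X Y Z. smooth_on (ball x0 r) X \<and> smooth_on (ball x0 r) Y \<and>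
    X x0 = 0 \<and> Y x0 = 0 \<and> Z x0 = 0 \<and> smooth_on (ball x0 r) Z \<and>
    (\<forall>x\<in>ball x0 r. 1 - \<mu> * Z x > 0 \<and> (X x)\<^sup>2 + (Y x)\<^sup>2 = 2 * Z x - \<mu> * (Z x)\<^sup>2 \<and>
      partial_deriv 1 X x * partial_deriv 2 Y x - partial_deriv 2 X x * partial_deriv 1 Y x > 0 \<and>
      (\<forall>h. (\<Sum>i\<in>UNIV. \<Sum>j\<in>UNIV. G x $ i $ j * h $ i * h $ j) = (frechet_derivative X (at x) h)\<^sup>2
        + (frechet_derivative Y (at x) h)\<^sup>2 + \<mu> * (frechet_derivative Z (at x) h)\<^sup>2)))"
proof -
  let ?E = "G x0 $ 1 $ 1" and ?F = "G x0 $ 1 $ 2" and ?H = "G x0 $ 2 $ 2"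
  let ?\<Delta> = "?E * ?H - ?F\<^sup>2"
  have E: "?E > 0" and \<Delta>: "?\<Delta> > 0" using pos_G[OF x0] det_G[OF x0] by auto
  \<comment> \<open>Normalizing factors of Gram-Schmidt: the orthonormal frame consists of the
    coordinate vectors with components \<open>(1, 0) / s\<close> and \<open>(- F, E) / t\<close>. It
    is positively oriented.\<close>
  define s where "s = sqrt ?E"
  define t where "t = sqrt (?E * ?\<Delta>)"
  have s: "s > 0" "s * s = ?E" and t: "t > 0" "t * t = ?E * ?\<Delta>" using E \<Delta> by (auto simp: s_def t_def)
  obtain r1 X p q where 1: "r1 > 0" "ball x0 r1 \<subseteq> \<Omega>" "hess_solution (ball x0 r1) 0 X p q"
      "X x0 = 0" "p x0 = 1 / s" "q x0 = 0"
    using hess_solution_exists[OF x0, of 0 0 "1 / s" 0] by blast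
  obtain r2 Y u v where 2: "r2 > 0" "ball x0 r2 \<subseteq> \<Omega>" "hess_solution (ball x0 r2) 0 Y u v"
      "Y x0 = 0" "u x0 = - ?F / t" "v x0 = ?E / t"
    using hess_solution_exists[OF x0, of 0 0 "- ?F / t" "?E / t"] by blast
  \<comment> \<open>The only solution with a = 1: its Hessian at \<open>x0\<close> is
    \<open>g\<close>, so Z behaves like half the squared distance from \<open>x0\<close>.\<close>
  obtain r3 Z z w where 3: "r3 > 0" "ball x0 r3 \<subseteq> \<Omega>" "hess_solution (ball x0 r3) 1 Z z w"
      "Z x0 = 0" "z x0 = 0" "w x0 = 0"
    using hess_solution_exists[OF x0, of 1 0 0 0] by blast
  define r4 where "r4 = min r1 (min r2 r3)"
  have r4: "r4 > 0" "ball x0 r4 \<subseteq> \<Omega>" using 1 2 3 by (auto simp: r4_def)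
  have S4: "hess_solution (ball x0 r4) 0 X p q" "hess_solution (ball x0 r4) 0 Y u v" "hess_solution (ball x0 r4) 1 Z z w"
    by (rule hess_solution_subset[OF 1(3)] hess_solution_subset[OF 2(3)] hess_solution_subset[OF 3(3)]; simp add: r4_def subset_ball)+
  have "continuous_on (ball x0 r4) X" "continuous_on (ball x0 r4) Z" "continuous_on (ball x0 r4) p" "continuous_on (ball x0 r4) q"
    "continuous_on (ball x0 r4) u" "continuous_on (ball x0 r4) v"
    using S4 by (auto simp: hess_solution_def intro: smooth_on_imp_continuous)
  then have c: "isCont Z x0" "isCont p x0" "isCont q x0" "isCont u x0" "isCont v x0"
    using r4(1) by (auto simp: continuous_on_eq_continuous_at)
  have "\<forall>\<^sub>F x in nhds x0. 1 - \<mu> * Z x > 0"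
    by (intro eventually_nhds_pos continuous_intros c) (simp add: 3)
  moreover have "\<forall>\<^sub>F x in nhds x0. p x * v x - q x * u x > 0"
    by (intro eventually_nhds_pos continuous_intros c) (use 1 2 s t E in simp)
  ultimately have "\<forall>\<^sub>F x in nhds x0. 1 - \<mu> * Z x > 0 \<and> p x * v x - q x * u x > 0"
    by (rule eventually_conj)
  then obtain e where e: "e > 0" "\<And>x. dist x x0 < e \<Longrightarrow> 1 - \<mu> * Z x > 0 \<and> p x * v x - q x * u x > 0"
    unfolding eventually_nhds_metric by blast
  define r where "r = min r4 e"
  have r: "r > 0" "ball x0 r \<subseteq> \<Omega>" "ball x0 r \<subseteq> ball x0 r4" using r4 e(1) by (auto simp: r_def)
  note S = S4[THEN hess_solution_subset, OF r(3)]
  have main: "1 - \<mu> * Z x > 0 \<and> (X x)\<^sup>2 + (Y x)\<^sup>2 = 2 * Z x - \<mu> * (Z x)\<^sup>2 \<and>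
      partial_deriv 1 X x * partial_deriv 2 Y x - partial_deriv 2 X x * partial_deriv 1 Y x > 0 \<and>
      (\<forall>h. (\<Sum>i\<in>UNIV. \<Sum>j\<in>UNIV. G x $ i $ j * h $ i * h $ j) = (frechet_derivative X (at x) h)\<^sup>2
        + (frechet_derivative Y (at x) h)\<^sup>2 + \<mu> * (frechet_derivative Z (at x) h)\<^sup>2)"
    if x: "x \<in> ball x0 r" for x
  proof -
    have xO: "x \<in> \<Omega>" using x r by blast
    have xe: "1 - \<mu> * Z x > 0" "p x * v x - q x * u x > 0"
      using e(2)[of x] x by (auto simp: r_def dist_commute)
    have dX: "(X has_derivative (\<lambda>h. fst (conn x h (X x, p x, q x, 0)))) (at x)"
      and dY: "(Y has_derivative (\<lambda>h. fst (conn x h (Y x, u x, v x, 0)))) (at x)"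
      and dZ: "(Z has_derivative (\<lambda>h. fst (conn x h (Z x, z x, w x, 1)))) (at x)"
      using S x unfolding hess_solution_def by auto
    note cons = hess_solution_conserved[OF r(1,2) _ _ x]
    let ?e = "G x $ 1 $ 1" and ?f = "G x $ 1 $ 2" and ?h = "G x $ 2 $ 2"
    have sst: "?E * (1 / s * (1 / s)) = 1" using s E by (simp add: divide_simps)
    have t3: "?E * (?F * ?F) - ?F * (2 * ?F * ?E) + ?H * (?E * ?E) = t * t"
      unfolding t by (simp add: algebra_simps power2_eq_square)
    have c1: "?e * (p x * p x) + ?f * (p x * q x + q x * p x) + ?h * (q x * q x) = 1 - \<mu> * (X x)\<^sup>2"
      using cons[OF S(1) S(1)] sst E by (simp add: 1 power2_eq_square)
    have c2: "?e * (p x * u x) + ?f * (p x * v x + q x * u x) + ?h * (q x * v x) = - \<mu> * X x * Y x"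
      using cons[OF S(1) S(2)] by (simp add: 1 2)
    have c3: "?e * (u x * u x) + ?f * (u x * v x + v x * u x) + ?h * (v x * v x) = 1 - \<mu> * (Y x)\<^sup>2"
    proof -
      have "?E * (- ?F / t * (- ?F / t)) + ?F * (- ?F / t * (?E / t) + ?E / t * (- ?F / t)) + ?H * (?E / t * (?E / t))
        = (?E * (?F * ?F) - ?F * (2 * ?F * ?E) + ?H * (?E * ?E)) / (t * t)"
        by (simp add: add_divide_distrib diff_divide_distrib)
      also have "\<dots> = 1" unfolding t3 using t(1) by simp
      finally show ?thesis using cons[OF S(2) S(2)] by (simp add: 2 power2_eq_square)
    qed
    have c4: "?e * (p x * z x) + ?f * (p x * w x + q x * z x) + ?h * (q x * w x) = X x * (1 - \<mu> * Z x)"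
      using cons[OF S(1) S(3)] by (simp add: 1 3 algebra_simps)
    have c5: "?e * (u x * z x) + ?f * (u x * w x + v x * z x) + ?h * (v x * w x) = Y x * (1 - \<mu> * Z x)"
      using cons[OF S(2) S(3)] by (simp add: 2 3 algebra_simps)
    have c6: "?e * (z x * z x) + ?f * (z x * w x + w x * z x) + ?h * (w x * w x) = 2 * Z x - \<mu> * (Z x)\<^sup>2"
      using cons[OF S(3) S(3)] by (simp add: 3 algebra_simps power2_eq_square)
    note gp = gram_plane[OF c1 c2 c3 c4 c5 c6 less_imp_neq[OF xe(2), symmetric]]
    have "(\<Sum>i\<in>UNIV. \<Sum>j\<in>UNIV. G x $ i $ j * h $ i * h $ j) = (frechet_derivative X (at x) h)\<^sup>2
        + (frechet_derivative Y (at x) h)\<^sup>2 + \<mu> * (frechet_derivative Z (at x) h)\<^sup>2" for h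
      unfolding frechet_derivative_at[OF dX, symmetric] frechet_derivative_at[OF dY, symmetric] frechet_derivative_at[OF dZ, symmetric]
      using gp(2)[of "h $ 1" "h $ 2"] by (simp add: conn_def sum_2 sym_G[OF xO] algebra_simps)
    \<comment> \<open>Differentials arise from gradients by applying the matrix \<open>G\<close>,
      hence the factor \<open>det G\<close>.\<close>
    moreover have "partial_deriv 1 X x * partial_deriv 2 Y x - partial_deriv 2 X x * partial_deriv 1 Y x
        = (?e * ?h - ?f\<^sup>2) * (p x * v x - q x * u x)"
      by (simp add: partial_deriv_eq[OF dX] partial_deriv_eq[OF dY] conn_def axis_def algebra_simps power2_eq_square)
    ultimately show ?thesis using gp(1) xe det_G[OF xO] by simp
  qed
  have "smooth_on (ball x0 r) X" "smooth_on (ball x0 r) Y" "smooth_on (ball x0 r) Z"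
    using S by (auto simp: hess_solution_def)
  then show ?thesis using r(1,2) main 1(4) 2(4) 3(4) by (intro exI[of _ r]) blast
qed

end

section \<open>The model surfaces and their Killing flows\<close>

text \<open>The coefficients of \<open>exp (t B) = 1 + s B + c B\<^sup>2\<close> and of its integrals when \<open>B\<^sup>3 = - \<nu> B\<close>.\<close>

definition cf1 :: "real \<Rightarrow> real \<Rightarrow> real" where
  "cf1 \<nu> t = (if \<nu> = 0 then t else if \<nu> > 0 then sin (sqrt \<nu> * t) / sqrt \<nu> else sinh (sqrt (-\<nu>) * t) / sqrt (-\<nu>))"

definition cf2 :: "real \<Rightarrow> real \<Rightarrow> real" where
  "cf2 \<nu> t = (if \<nu> = 0 then t\<^sup>2 / 2 else if \<nu> > 0 then (1 - cos (sqrt \<nu> * t)) / \<nu> else (1 - cosh (sqrt (-\<nu>) * t)) / \<nu>)"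

definition cf3 :: "real \<Rightarrow> real \<Rightarrow> real" where
  "cf3 \<nu> t = (if \<nu> = 0 then t ^ 3 / 6 else (t - cf1 \<nu> t) / \<nu>)"

lemma cf_zero [simp]: "cf1 \<nu> 0 = 0" "cf2 \<nu> 0 = 0" "cf3 \<nu> 0 = 0"
  by (auto simp: cf1_def cf2_def cf3_def)

lemma cf_deriv:
  "(cf1 \<nu> has_real_derivative 1 - \<nu> * cf2 \<nu> t) (at t)"
  "(cf2 \<nu> has_real_derivative cf1 \<nu> t) (at t)"
  "(cf3 \<nu> has_real_derivative cf2 \<nu> t) (at t)"
proof -
  consider "\<nu> = 0" | "\<nu> > 0" | "\<nu> < 0" by linarith
  then have "(cf1 \<nu> has_real_derivative 1 - \<nu> * cf2 \<nu> t) (at t) \<and> (cf2 \<nu> has_real_derivative cf1 \<nu> t) (at t)"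
  proof cases
    case 1
    then have "cf1 \<nu> = (\<lambda>t. t)" "cf2 \<nu> = (\<lambda>t. t\<^sup>2 / 2)" by (auto simp: cf1_def cf2_def)
    then show ?thesis using 1 by (auto intro!: derivative_eq_intros)
  next
    case 2
    define a where "a = sqrt \<nu>"
    have a: "a > 0" "\<nu> = a * a" using 2 by (auto simp: a_def)
    then have e: "cf1 \<nu> = (\<lambda>t. sin (a * t) / a)" "cf2 \<nu> = (\<lambda>t. (1 - cos (a * t)) / (a * a))"
      by (auto simp: cf1_def cf2_def)
    show ?thesis unfolding e using a by (auto intro!: derivative_eq_intros simp: field_simps)
  next
    case 3
    define a where "a = sqrt (-\<nu>)"
    have a: "a > 0" "\<nu> = - (a * a)" using 3 by (auto simp: a_def)
    then have e: "cf1 \<nu> = (\<lambda>t. sinh (a * t) / a)" "cf2 \<nu> = (\<lambda>t. (1 - cosh (a * t)) / (- (a * a)))"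
      by (auto simp: cf1_def cf2_def)
    show ?thesis unfolding e using a by (auto intro!: derivative_eq_intros simp: field_simps)
  qed
  then show c1: "(cf1 \<nu> has_real_derivative 1 - \<nu> * cf2 \<nu> t) (at t)" and "(cf2 \<nu> has_real_derivative cf1 \<nu> t) (at t)" by auto
  show "(cf3 \<nu> has_real_derivative cf2 \<nu> t) (at t)"
  proof (cases "\<nu> = 0")
    case True
    then have "cf3 \<nu> = (\<lambda>t. t ^ 3 / 6)" by (auto simp: cf3_def)
    then show ?thesis using True by (auto intro!: derivative_eq_intros simp: cf2_def)
  next
    case False
    then have "cf3 \<nu> = (\<lambda>t. (t - cf1 \<nu> t) / \<nu>)" by (auto simp: cf3_def)
    then show ?thesis using False by (auto intro!: derivative_eq_intros c1)
  qed
qed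

lemma cf_minus: "cf1 \<nu> (-t) = - cf1 \<nu> t" "cf2 \<nu> (-t) = cf2 \<nu> t" "cf3 \<nu> (-t) = - cf3 \<nu> t"
  by (auto simp: cf1_def cf2_def cf3_def field_simps power3_eq_cube)

lemma cf13: "cf1 \<nu> t = t - \<nu> * cf3 \<nu> t"
  by (auto simp: cf3_def) (simp add: cf1_def)

text \<open>The relations \<open>sin^2 + cos^2 = 1\<close> and \<open>cosh^2 - sinh^2 = 1\<close> in
  one formula. Both sides agree at 0 and have the same derivative, so the sign of \<nu> does not
  matter.\<close>

lemma cf_square: "(cf1 \<nu> t)\<^sup>2 = 2 * cf2 \<nu> t - \<nu> * (cf2 \<nu> t)\<^sup>2"
proof -
  have "((\<lambda>t. (cf1 \<nu> t)\<^sup>2 - 2 * cf2 \<nu> t + \<nu> * (cf2 \<nu> t)\<^sup>2) has_real_derivative 0) (at t)" for t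
    by (auto intro!: derivative_eq_intros cf_deriv simp: algebra_simps power2_eq_square)
  from DERIV_isconst_all[OF allI[OF this], of t 0] show ?thesis by simp
qed

lemma cf_continuous: "continuous_on S (cf1 \<nu>)" "continuous_on S (cf2 \<nu>)" "continuous_on S (cf3 \<nu>)"
  using cf_deriv by (auto intro!: continuous_at_imp_continuous_on DERIV_isCont)

section \<open>The model surface as a graph over the plane\<close>

definition mroot :: "real \<Rightarrow> real^2 \<Rightarrow> real" where
  "mroot \<mu> x = sqrt (1 - \<mu> * ((x $ 1)\<^sup>2 + (x $ 2)\<^sup>2))"

text \<open>The root of the quadric equation that vanishes at the origin, rationalized: the form
  \<open>(1 - mroot) / \<mu>\<close> would exclude \<mu> = 0. On the graph \<open>mroot\<close>
  equals \<open>1 - \<mu> Z\<close>.\<close>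

definition mheight :: "real \<Rightarrow> real^2 \<Rightarrow> real" where
  "mheight \<mu> x = ((x $ 1)\<^sup>2 + (x $ 2)\<^sup>2) / (1 + mroot \<mu> x)"

definition mdom :: "real \<Rightarrow> (real^2) set" where
  "mdom \<mu> = {x. \<mu> * ((x $ 1)\<^sup>2 + (x $ 2)\<^sup>2) < 1}"

lemma mdom_open: "open (mdom \<mu>)"
  unfolding mdom_def by (intro open_Collect_less continuous_intros)

lemma mroot_pos: "x \<in> mdom \<mu> \<Longrightarrow> mroot \<mu> x > 0"
  by (simp add: mdom_def mroot_def)

lemma mroot_sq: "x \<in> mdom \<mu> \<Longrightarrow> (mroot \<mu> x)\<^sup>2 = 1 - \<mu> * ((x $ 1)\<^sup>2 + (x $ 2)\<^sup>2)"
  by (simp add: mdom_def mroot_def)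

lemma mroot_height:
  assumes "x \<in> mdom \<mu>"
  shows "mroot \<mu> x = 1 - \<mu> * mheight \<mu> x"
proof -
  have "\<mu> * ((x $ 1)\<^sup>2 + (x $ 2)\<^sup>2) = (1 - mroot \<mu> x) * (1 + mroot \<mu> x)"
    using mroot_sq[OF assms] by algebra
  then show ?thesis using mroot_pos[OF assms] by (simp add: mheight_def)
qed

lemma mheight_quadric:
  assumes "x \<in> mdom \<mu>"
  shows "(x $ 1)\<^sup>2 + (x $ 2)\<^sup>2 = 2 * mheight \<mu> x - \<mu> * (mheight \<mu> x)\<^sup>2"
proof -
  have "(x $ 1)\<^sup>2 + (x $ 2)\<^sup>2 = mheight \<mu> x * (1 + mroot \<mu> x)"
    using mroot_pos[OF assms] by (simp add: mheight_def)
  then show ?thesis by (simp add: mroot_height[OF assms] algebra_simps power2_eq_square)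
qed

text \<open>Over a point of the plane the quadric may have two points;
  \<open>1 - \<mu> * z > 0\<close> selects the one on the graph, because
  \<open>(1 - \<mu> z)^2\<close> is determined by the point of the plane.\<close>

lemma mheight_unique:
  assumes "(x $ 1)\<^sup>2 + (x $ 2)\<^sup>2 = 2 * z - \<mu> * z\<^sup>2" "1 - \<mu> * z > 0"
  shows "x \<in> mdom \<mu>" "mheight \<mu> x = z" "mroot \<mu> x = 1 - \<mu> * z"
proof -
  have e: "1 - \<mu> * ((x $ 1)\<^sup>2 + (x $ 2)\<^sup>2) = (1 - \<mu> * z)\<^sup>2" using assms(1) by algebra
  then have "1 - \<mu> * ((x $ 1)\<^sup>2 + (x $ 2)\<^sup>2) > 0" using assms(2) by simp
  then show "x \<in> mdom \<mu>" by (simp add: mdom_def)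
  show m: "mroot \<mu> x = 1 - \<mu> * z" unfolding mroot_def e using assms(2) by simp
  have "(x $ 1)\<^sup>2 + (x $ 2)\<^sup>2 = z * (1 + mroot \<mu> x)" using assms(1) by (simp add: m algebra_simps power2_eq_square)
  then show "mheight \<mu> x = z" using assms(2) by (simp add: mheight_def m)
qed

lemma mroot_smooth: "smooth_on (mdom \<mu>) (mroot \<mu>)"
  unfolding mroot_def
  by (rule smooth_on_sqrt[OF mdom_open], intro smooth_on_diff smooth_on_mult smooth_on_add smooth_on_const smooth_on_power
      smooth_on_linear bounded_linear_vec_nth mdom_open) (simp add: mdom_def)

lemma mheight_smooth: "smooth_on (mdom \<mu>) (mheight \<mu>)"
proof -
  have "1 + mroot \<mu> x \<noteq> 0" if "x \<in> mdom \<mu>" for x using mroot_pos[OF that] by simp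
  then show ?thesis
    unfolding mheight_def
    by (intro smooth_on_divide smooth_on_add smooth_on_const smooth_on_power smooth_on_linear
        bounded_linear_vec_nth mdom_open mroot_smooth) auto
qed

lemma mroot_deriv:
  assumes "x \<in> mdom \<mu>"
  shows "(mroot \<mu> has_derivative (\<lambda>v. - \<mu> * (x \<bullet> v) / mroot \<mu> x)) (at x)"
proof -
  have p: "1 - \<mu> * ((x $ 1)\<^sup>2 + (x $ 2)\<^sup>2) > 0" using assms by (simp add: mdom_def)
  have d: "((\<lambda>x :: real^2. 1 - \<mu> * ((x $ 1)\<^sup>2 + (x $ 2)\<^sup>2)) has_derivative (\<lambda>v. - 2 * \<mu> * (x \<bullet> v))) (at x)"
    by (rule has_derivative_eq_rhs, (rule derivative_intros bounded_linear.has_derivative[OF bounded_linear_vec_nth])+)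
      (simp add: fun_eq_iff inner_vec_def sum_2 algebra_simps)
  show ?thesis
    unfolding mroot_def[abs_def]
    by (rule has_derivative_eq_rhs[OF DERIV_compose_FDERIV[OF DERIV_real_sqrt[OF p] d]])
      (simp add: fun_eq_iff divide_simps)
qed

lemma mheight_deriv:
  assumes "x \<in> mdom \<mu>"
  shows "(mheight \<mu> has_derivative (\<lambda>v. (x \<bullet> v) / mroot \<mu> x)) (at x)"
proof -
  let ?m = "mroot \<mu> x"
  have m: "?m > 0" by (rule mroot_pos[OF assms])
  have d: "((\<lambda>x :: real^2. (x $ 1)\<^sup>2 + (x $ 2)\<^sup>2) has_derivative (\<lambda>v. 2 * (x \<bullet> v))) (at x)"
    by (rule has_derivative_eq_rhs, (rule derivative_intros bounded_linear.has_derivative[OF bounded_linear_vec_nth])+)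
      (simp add: fun_eq_iff inner_vec_def sum_2 algebra_simps)
  have R: "\<mu> * ((x $ 1)\<^sup>2 + (x $ 2)\<^sup>2) = (1 - ?m) * (1 + ?m)" using mroot_sq[OF assms] by algebra
  have "(2 * w * (1 + ?m) - ((x $ 1)\<^sup>2 + (x $ 2)\<^sup>2) * (- \<mu> * w / ?m)) / ((1 + ?m) * (1 + ?m)) = w / ?m" for w
  proof -
    have "(2 * w * (1 + ?m) - ((x $ 1)\<^sup>2 + (x $ 2)\<^sup>2) * (- \<mu> * w / ?m)) = 2 * w * (1 + ?m) + (\<mu> * ((x $ 1)\<^sup>2 + (x $ 2)\<^sup>2)) * (w / ?m)"
      by (simp add: algebra_simps)
    also have "\<dots> = w / ?m * ((1 + ?m) * (1 + ?m))" unfolding R using m by (simp add: field_simps)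
    finally show ?thesis using m by (simp add: divide_simps)
  qed
  moreover have "((\<lambda>x. ((x $ 1)\<^sup>2 + (x $ 2)\<^sup>2) / (1 + mroot \<mu> x)) has_derivative (\<lambda>w.
      (2 * (x \<bullet> w) * (1 + ?m) - ((x $ 1)\<^sup>2 + (x $ 2)\<^sup>2) * (0 + - \<mu> * (x \<bullet> w) / ?m)) / ((1 + ?m) * (1 + ?m)))) (at x)"
    by (rule has_derivative_divide'[OF d has_derivative_add[OF has_derivative_const mroot_deriv[OF assms]]]) (use m in simp)
  ultimately show ?thesis
    unfolding mheight_def[abs_def] by (simp only: add_0)
qed

text \<open>The form \<open>dX^2 + dY^2 + \<mu> dZ^2\<close> restricted to the graph, where
  \<open>dZ\<close> is the functional \<open>(x \<bullet> v) / mroot \<mu> x\<close>.\<close>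

definition mmetric :: "real \<Rightarrow> real^2 \<Rightarrow> real^2 \<Rightarrow> real" where
  "mmetric \<mu> x v = (v $ 1)\<^sup>2 + (v $ 2)\<^sup>2 + \<mu> * ((x \<bullet> v) / mroot \<mu> x)\<^sup>2"

text \<open>The Killing field of the model surface \<open>X\<^sup>2 + Y\<^sup>2 = 2 Z - \<mu> Z\<^sup>2\<close>, seen as a graph over the
  \<open>(X, Y)\<close>-plane; it is the restriction of an affine vector field of the ambient space.\<close>

definition mkilling :: "real \<Rightarrow> real \<Rightarrow> real \<Rightarrow> real \<Rightarrow> real^2 \<Rightarrow> real^2" where
  "mkilling \<mu> \<alpha> \<beta> \<gamma> x = vector [\<alpha> * mroot \<mu> x - \<gamma> * x $ 2, \<beta> * mroot \<mu> x + \<gamma> * x $ 1]"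

definition memb :: "real \<Rightarrow> real^2 \<Rightarrow> real \<times> real \<times> real" where
  "memb \<mu> x = (x $ 1, x $ 2, mheight \<mu> x)"

section \<open>Affine flows of the ambient space and the flows they induce on the graph\<close>

context
  fixes \<mu> \<alpha> \<beta> \<gamma> :: real
begin

definition afield :: "real \<times> real \<times> real \<Rightarrow> real \<times> real \<times> real" where
  "afield = (\<lambda>(X, Y, Z). (\<alpha> * (1 - \<mu> * Z) - \<gamma> * Y, \<beta> * (1 - \<mu> * Z) + \<gamma> * X, \<alpha> * X + \<beta> * Y))"

definition alin :: "real \<times> real \<times> real \<Rightarrow> real \<times> real \<times> real" where
  "alin = (\<lambda>(X, Y, Z). (- \<alpha> * \<mu> * Z - \<gamma> * Y, - \<beta> * \<mu> * Z + \<gamma> * X, \<alpha> * X + \<beta> * Y))"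

definition afreq :: real where "afreq = \<mu> * (\<alpha>\<^sup>2 + \<beta>\<^sup>2) + \<gamma>\<^sup>2"

text \<open>The flow of the affine field \<open>afield\<close>, whose linear part is
  \<open>alin\<close>. Since \<open>alin\<close> satisfies a cubic equation (\<open>alin3\<close>),
  the exponential series collapses to three terms, with coefficients obtained by integrating those
  of \<open>aexp\<close>, the exponential of \<open>t alin\<close>.\<close>

definition aflow :: "real \<Rightarrow> real \<times> real \<times> real \<Rightarrow> real \<times> real \<times> real" where
  "aflow t P = P + t *\<^sub>R afield P + cf2 afreq t *\<^sub>R alin (afield P) + cf3 afreq t *\<^sub>R alin (alin (afield P))"

definition aexp :: "real \<Rightarrow> real \<times> real \<times> real \<Rightarrow> real \<times> real \<times> real" where
  "aexp t u = u + cf1 afreq t *\<^sub>R alin u + cf2 afreq t *\<^sub>R alin (alin u)"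

definition mflow :: "real \<Rightarrow> real^2 \<Rightarrow> real^2" where
  "mflow t x = vector [fst (aflow t (memb \<mu> x)), fst (snd (aflow t (memb \<mu> x)))]"

lemma alin_bounded_linear: "bounded_linear alin"
  unfolding linear_conv_bounded_linear[symmetric]
  by (auto intro!: linearI simp: alin_def algebra_simps split: prod.splits)

lemmas alin_simps = linear_add[OF bounded_linear.linear[OF alin_bounded_linear]]
  linear_cmul[OF bounded_linear.linear[OF alin_bounded_linear]]
  linear_diff[OF bounded_linear.linear[OF alin_bounded_linear]]
  linear_neg[OF bounded_linear.linear[OF alin_bounded_linear]]

text \<open>Cayley-Hamilton: \<open>alin\<close> has trace and determinant 0, and
  \<open>afreq\<close> is the sum of its principal 2-minors.\<close>

lemma alin3: "alin (alin (alin u)) = - afreq *\<^sub>R alin u"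
  by (cases u) (simp add: alin_def afreq_def algebra_simps power2_eq_square)

lemma afield_add: "afield (P + u) = afield P + alin u"
  by (cases P; cases u) (simp add: afield_def alin_def algebra_simps)

lemma afield_deriv: "(afield has_derivative alin) (at P)"
proof -
  have "afield P = afield 0 + alin P" for P using afield_add[of 0 P] by simp
  then have eq: "afield = (\<lambda>P. afield 0 + alin P)" by (rule ext)
  have "((\<lambda>P. afield 0 + alin P) has_derivative (\<lambda>u. 0 + alin u)) (at P)"
    by (intro has_derivative_add has_derivative_const bounded_linear_imp_has_derivative alin_bounded_linear)
  then show ?thesis by (subst eq) simp
qed

lemma afield_aflow: "afield (aflow t P) = aexp t (afield P)"
proof -
  have "afield (aflow t P) = afield P + t *\<^sub>R alin (afield P) + cf2 afreq t *\<^sub>R alin (alin (afield P))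
      + cf3 afreq t *\<^sub>R alin (alin (alin (afield P)))"
    using afield_add[of P "t *\<^sub>R afield P + cf2 afreq t *\<^sub>R alin (afield P) + cf3 afreq t *\<^sub>R alin (alin (afield P))"]
    by (simp add: aflow_def alin_simps add_ac)
  also have "\<dots> = aexp t (afield P)"
    unfolding alin3 aexp_def cf13 by (simp add: algebra_simps)
  finally show ?thesis .
qed

lemma aflow_deriv_time: "((\<lambda>t. aflow t P) has_vector_derivative afield (aflow t P)) (at t)"
proof -
  have "((\<lambda>t. aflow t P) has_vector_derivative
      afield P + cf1 afreq t *\<^sub>R alin (afield P) + cf2 afreq t *\<^sub>R alin (alin (afield P))) (at t)"
    unfolding aflow_def[abs_def]
    by (auto intro!: derivative_eq_intros cf_deriv simp: has_real_derivative_iff_has_vector_derivative[symmetric])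
  then show ?thesis by (simp add: afield_aflow aexp_def)
qed

lemma aexp_deriv_time: "((\<lambda>t. aexp t u) has_vector_derivative alin (aexp t u)) (at t)"
proof -
  have "((\<lambda>t. aexp t u) has_vector_derivative (1 - afreq * cf2 afreq t) *\<^sub>R alin u + cf1 afreq t *\<^sub>R alin (alin u)) (at t)"
    unfolding aexp_def[abs_def]
    by (auto intro!: derivative_eq_intros cf_deriv simp: has_real_derivative_iff_has_vector_derivative[symmetric])
  moreover have "(1 - afreq * cf2 afreq t) *\<^sub>R alin u + cf1 afreq t *\<^sub>R alin (alin u) = alin (aexp t u)"
    by (simp add: aexp_def alin_simps alin3 algebra_simps)
  ultimately show ?thesis by simp
qed

lemma aflow_deriv: "(aflow t has_derivative aexp t) (at P)"
proof -
  note al = bounded_linear.has_derivative[OF alin_bounded_linear]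
  have "(aflow t has_derivative (\<lambda>u. u + t *\<^sub>R alin u + cf2 afreq t *\<^sub>R alin (alin u) + cf3 afreq t *\<^sub>R alin (alin (alin u)))) (at P)"
    unfolding aflow_def[abs_def]
    by (intro has_derivative_add has_derivative_ident has_derivative_scaleR_right al afield_deriv)
  then show ?thesis
    by (rule has_derivative_eq_rhs) (simp add: fun_eq_iff alin3 aexp_def cf13[of _ t] algebra_simps)
qed

text \<open>The field \<open>afield\<close> is tangent to every level set of \<open>q\<close>, not
  only to the quadric itself. Invariance at all points is needed when \<open>aflow_normal\<close>
  differentiates it in arbitrary directions.\<close>

lemma aflow_quadric:
  defines "q \<equiv> \<lambda>(X, Y, Z). X\<^sup>2 + Y\<^sup>2 - 2 * Z + \<mu> * Z\<^sup>2"
  shows "q (aflow t P) = q P"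
proof -
  have "((\<lambda>t. q (aflow t P)) has_real_derivative 0) (at t)" for t
  proof -
    have 1: "((\<lambda>t. fst (aflow t P)) has_real_derivative fst (afield (aflow t P))) (at t)"
      "((\<lambda>t. fst (snd (aflow t P))) has_real_derivative fst (snd (afield (aflow t P)))) (at t)"
      "((\<lambda>t. snd (snd (aflow t P))) has_real_derivative snd (snd (afield (aflow t P)))) (at t)"
      unfolding has_real_derivative_iff_has_vector_derivative
      using aflow_deriv_time[of P t] by (auto simp: has_vector_derivative_def intro: has_derivative_eq_rhs[OF has_derivative_fst]
          has_derivative_eq_rhs[OF has_derivative_snd] has_derivative_eq_rhs[OF has_derivative_fst[OF has_derivative_snd]]
          has_derivative_eq_rhs[OF has_derivative_snd[OF has_derivative_snd]])
    show ?thesis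
      unfolding q_def split_beta
      by (auto intro!: derivative_eq_intros 1 simp: afield_def split_beta algebra_simps power2_eq_square)
  qed
  then have "q (aflow t P) = q (aflow 0 P)" by (rule DERIV_isconst_all[OF allI])
  then show ?thesis by (simp add: aflow_def)
qed

text \<open>The generator \<open>alin\<close> is skew with respect to the form
  \<open>X^2 + Y^2 + \<mu> Z^2\<close>.\<close>

lemma aexp_isometry:
  defines "q \<equiv> \<lambda>(X, Y, Z). X\<^sup>2 + Y\<^sup>2 + \<mu> * Z\<^sup>2"
  shows "q (aexp t u) = q u"
proof -
  have "((\<lambda>t. q (aexp t u)) has_real_derivative 0) (at t)" for t
  proof -
    have 1: "((\<lambda>t. fst (aexp t u)) has_real_derivative fst (alin (aexp t u))) (at t)"
      "((\<lambda>t. fst (snd (aexp t u))) has_real_derivative fst (snd (alin (aexp t u)))) (at t)"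
      "((\<lambda>t. snd (snd (aexp t u))) has_real_derivative snd (snd (alin (aexp t u)))) (at t)"
      unfolding has_real_derivative_iff_has_vector_derivative
      using aexp_deriv_time[of u t] by (auto simp: has_vector_derivative_def intro: has_derivative_eq_rhs[OF has_derivative_fst]
          has_derivative_eq_rhs[OF has_derivative_snd] has_derivative_eq_rhs[OF has_derivative_fst[OF has_derivative_snd]]
          has_derivative_eq_rhs[OF has_derivative_snd[OF has_derivative_snd]])
    show ?thesis
      unfolding q_def split_beta
      by (auto intro!: derivative_eq_intros 1 simp: alin_def split_beta algebra_simps power2_eq_square)
  qed
  then have "q (aexp t u) = q (aexp 0 u)" by (rule DERIV_isconst_all[OF allI])
  then show ?thesis by (simp add: aexp_def)
qed

text \<open>A comparison of the coefficients of \<open>alin ?v\<close> and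
  \<open>alin (alin ?v)\<close>; they cancel by \<open>cf13\<close> and
  \<open>cf_square\<close>.\<close>

lemma aflow_inverse: "aflow (-t) (aflow t P) = P"
proof -
  let ?v = "afield P" and ?s = "cf1 afreq t" and ?c = "cf2 afreq t" and ?d = "cf3 afreq t"
  have a: "afield (aflow t P) = ?v + ?s *\<^sub>R alin ?v + ?c *\<^sub>R alin (alin ?v)"
    unfolding afield_aflow aexp_def ..
  have two: "(2 * c) *\<^sub>R w = c *\<^sub>R w + c *\<^sub>R w" for c and w :: "real \<times> real \<times> real"
    by (simp add: scaleR_left_distrib[symmetric])
  have "aflow (-t) (aflow t P) = P + (?c - t * ?s + ?c - ?c * ?c * afreq + ?d * ?s * afreq) *\<^sub>R alin ?v
      + (?d - t * ?c + ?c * ?s - ?d + ?d * ?c * afreq) *\<^sub>R alin (alin ?v)"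
    unfolding aflow_def[of "-t"] a cf_minus
    by (simp add: aflow_def alin_simps alin3 algebra_simps two)
  moreover have "?c - t * ?s + ?c - ?c * ?c * afreq + ?d * ?s * afreq = 0"
    using cf13[of afreq t] cf_square[of afreq t] by algebra
  moreover have "?d - t * ?c + ?c * ?s - ?d + ?d * ?c * afreq = 0"
    using cf13[of afreq t] by algebra
  ultimately show ?thesis by simp
qed

text \<open>The pairing \<open>N\<close> is half the differential of the quadric function, so the
  identity is the derivative of the invariance \<open>aflow_quadric\<close>.\<close>

lemma aflow_normal:
  defines "N \<equiv> \<lambda>(X, Y, Z) (u, v, w). X * u + Y * v - (1 - \<mu> * Z) * w"
  shows "N (aflow t P) (aexp t u) = N P u"
proof -
  define q where "q = (\<lambda>(X :: real, Y :: real, Z :: real). X\<^sup>2 + Y\<^sup>2 - 2 * Z + \<mu> * Z\<^sup>2)"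
  have dq: "(q has_derivative (\<lambda>u. 2 * N P u)) (at P)" for P
    unfolding q_def N_def split_beta
    by (auto intro!: derivative_eq_intros simp: fun_eq_iff algebra_simps)
  have "((\<lambda>P. q (aflow t P)) has_derivative (\<lambda>u. 2 * N (aflow t P) (aexp t u))) (at P)"
    by (rule has_derivative_compose[OF aflow_deriv dq])
  moreover have "(\<lambda>P. q (aflow t P)) = q" using aflow_quadric by (intro ext) (simp add: q_def)
  ultimately have "(\<lambda>u. 2 * N (aflow t P) (aexp t u)) = (\<lambda>u. 2 * N P u)"
    by (intro has_derivative_unique[OF _ dq]) simp
  from fun_cong[OF this, of u] show ?thesis by simp
qed

lemma memb_deriv:
  assumes "x \<in> mdom \<mu>"
  shows "(memb \<mu> has_derivative (\<lambda>v. (v $ 1, v $ 2, (x \<bullet> v) / mroot \<mu> x))) (at x)"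
  unfolding memb_def[abs_def]
  by (intro has_derivative_Pair mheight_deriv[OF assms] bounded_linear_imp_has_derivative bounded_linear_vec_nth)

lemma memb_smooth: "smooth_on (mdom \<mu>) (memb \<mu>)"
  unfolding memb_def[abs_def]
  by (intro smooth_on_Pair mheight_smooth smooth_on_linear bounded_linear_vec_nth mdom_open)

lemma plane_bounded_linear: "bounded_linear (\<lambda>u :: real \<times> real \<times> real. vector [fst u, fst (snd u)] :: real^2)"
  unfolding linear_conv_bounded_linear[symmetric]
  by (auto intro!: linearI simp: vec_eq_iff forall_2)

text \<open>The ambient flow exists for all times, but it may carry a point of the graph to the
  other side of the quadric, where the plane coordinates no longer determine the point. The
  inequality excludes this.\<close>

definition mgood :: "real \<Rightarrow> real^2 \<Rightarrow> bool" where
  "mgood t x \<longleftrightarrow> x \<in> mdom \<mu> \<and> 1 - \<mu> * snd (snd (aflow t (memb \<mu> x))) > 0"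

lemma mflow_memb:
  assumes "mgood t x"
  shows "mflow t x \<in> mdom \<mu>" "memb \<mu> (mflow t x) = aflow t (memb \<mu> x)"
    "mroot \<mu> (mflow t x) = 1 - \<mu> * snd (snd (aflow t (memb \<mu> x)))"
proof -
  have x: "x \<in> mdom \<mu>" using assms by (simp add: mgood_def)
  obtain X Y Z where P: "aflow t (memb \<mu> x) = (X, Y, Z)" by (metis prod_cases3)
  have "X\<^sup>2 + Y\<^sup>2 - 2 * Z + \<mu> * Z\<^sup>2 = 0"
    using aflow_quadric[of t "memb \<mu> x"] mheight_quadric[OF x] unfolding P by (simp add: memb_def)
  then have q: "(mflow t x $ 1)\<^sup>2 + (mflow t x $ 2)\<^sup>2 = 2 * Z - \<mu> * Z\<^sup>2" by (simp add: mflow_def P)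
  have p: "1 - \<mu> * Z > 0" using assms by (simp add: mgood_def P)
  note u = mheight_unique[OF q p]
  show "mflow t x \<in> mdom \<mu>" by (rule u)
  show "memb \<mu> (mflow t x) = aflow t (memb \<mu> x)"
    using u(2) unfolding memb_def[of _ "mflow t x"] P by (simp add: mflow_def P)
  show "mroot \<mu> (mflow t x) = 1 - \<mu> * snd (snd (aflow t (memb \<mu> x)))" using u(3) by (simp add: P)
qed

lemma mflow_zero: "mflow 0 x = x"
  by (simp add: mflow_def aflow_def memb_def vec_eq_iff forall_2)

lemma mflow_inverse: "mgood t x \<Longrightarrow> mflow (-t) (mflow t x) = x"
  by (simp add: mflow_def[of "-t"] mflow_memb aflow_inverse) (simp add: memb_def vec_eq_iff forall_2)

lemma mflow_time:
  assumes "mgood t x"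
  shows "((\<lambda>s. mflow s x) has_vector_derivative mkilling \<mu> \<alpha> \<beta> \<gamma> (mflow t x)) (at t)"
proof -
  have "((\<lambda>s. mflow s x) has_vector_derivative
      vector [fst (afield (aflow t (memb \<mu> x))), fst (snd (afield (aflow t (memb \<mu> x))))]) (at t)"
    unfolding mflow_def
    by (rule bounded_linear.has_vector_derivative[OF plane_bounded_linear aflow_deriv_time])
  moreover have "vector [fst (afield (aflow t (memb \<mu> x))), fst (snd (afield (aflow t (memb \<mu> x))))]
      = mkilling \<mu> \<alpha> \<beta> \<gamma> (mflow t x)"
    unfolding mflow_memb(2)[OF assms, symmetric]
    by (simp add: afield_def memb_def mkilling_def mroot_height[OF mflow_memb(1)[OF assms]])
  ultimately show ?thesis by simp
qed

lemma mflow_smooth: "smooth_on (mdom \<mu>) (mflow t)"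
proof -
  have "smooth_on UNIV (aflow t)"
  proof -
    \<comment> \<open>For fixed time the ambient flow is an affine map with linear part
      \<open>aexp t\<close>.\<close>
    have "smooth_on UNIV (\<lambda>u. aflow t 0 + aexp t u)"
      unfolding aexp_def
      by (intro smooth_on_add smooth_on_const smooth_on_scaleR open_UNIV smooth_on_id
          smooth_on_linear alin_bounded_linear bounded_linear_compose[OF alin_bounded_linear alin_bounded_linear])
    moreover have "aflow t 0 + aexp t u = aflow t u" for u
      using afield_add[of 0 u]
      by (simp add: aflow_def aexp_def cf13[of _ t] alin_simps alin3 algebra_simps)
    ultimately show ?thesis by simp
  qed
  then show ?thesis
    unfolding mflow_def[abs_def]
    by (intro smooth_on_bounded_linear[OF mdom_open plane_bounded_linear] smooth_on_compose[OF mdom_open open_UNIV _ memb_smooth]) auto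
qed

lemma mflow_deriv:
  assumes "x \<in> mdom \<mu>"
  shows "(mflow t has_derivative (\<lambda>v. let u = aexp t (v $ 1, v $ 2, (x \<bullet> v) / mroot \<mu> x) in vector [fst u, fst (snd u)])) (at x)"
  unfolding mflow_def[abs_def] Let_def
  by (rule bounded_linear.has_derivative[OF plane_bounded_linear has_derivative_compose[OF memb_deriv[OF assms] aflow_deriv]])

text \<open>Vectors tangent to the graph are annihilated by the pairing of
  \<open>aflow_normal\<close>, and so are their images. Hence the third component of an image vector
  is the differential of the height at the image point, evaluated on the first two
  components.\<close>

lemma mflow_tangent:
  assumes "mgood t x"
  defines "u \<equiv> \<lambda>v. aexp t (v $ 1, v $ 2, (x \<bullet> v) / mroot \<mu> x)"
  shows "mflow t x \<bullet> vector [fst (u v), fst (snd (u v))] = mroot \<mu> (mflow t x) * snd (snd (u v))"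
proof -
  have x: "x \<in> mdom \<mu>" using assms by (simp add: mgood_def)
  have "(case memb \<mu> x of (X, Y, Z) \<Rightarrow> \<lambda>(u, v, w). X * u + Y * v - (1 - \<mu> * Z) * w) (v $ 1, v $ 2, (x \<bullet> v) / mroot \<mu> x) = 0"
    using mroot_pos[OF x] by (simp add: memb_def mroot_height[OF x, symmetric] inner_vec_def sum_2)
  then show ?thesis
    using aflow_normal[of t "memb \<mu> x" "(v $ 1, v $ 2, (x \<bullet> v) / mroot \<mu> x)"] mflow_memb(3)[OF assms(1)]
    by (simp add: u_def split_beta inner_vec_def sum_2 mflow_def)
qed

lemma mflow_isometry:
  assumes "mgood t x"
  shows "mmetric \<mu> (mflow t x) (frechet_derivative (mflow t) (at x) v) = mmetric \<mu> x v"
proof -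
  have x: "x \<in> mdom \<mu>" using assms by (simp add: mgood_def)
  let ?u = "aexp t (v $ 1, v $ 2, (x \<bullet> v) / mroot \<mu> x)"
  have D: "frechet_derivative (mflow t) (at x) v = vector [fst ?u, fst (snd ?u)]"
    using frechet_derivative_at[OF mflow_deriv[OF x, of t], symmetric] by (simp add: Let_def)
  have "(mflow t x \<bullet> vector [fst ?u, fst (snd ?u)]) / mroot \<mu> (mflow t x) = snd (snd ?u)"
    using mflow_tangent[OF assms, of v] mroot_pos[OF mflow_memb(1)[OF assms]] by simp
  then show ?thesis
    using aexp_isometry[of t "(v $ 1, v $ 2, (x \<bullet> v) / mroot \<mu> x)"]
    by (simp add: D mmetric_def split_beta)
qed

text \<open>In the plane coordinates the area form of the graph is \<open>dx dy / mroot\<close>, so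
  this is the invariance of area. The quotient of Jacobian and \<open>mroot\<close> has zero time
  derivative, which also settles the sign of the Jacobian, left open by the isometry
  property.\<close>

lemma mflow_det:
  assumes good: "\<And>s. \<bar>s\<bar> < \<epsilon> \<Longrightarrow> mgood s x" and t: "\<bar>t\<bar> < \<epsilon>"
  defines "D \<equiv> frechet_derivative (mflow t) (at x)"
  shows "D (axis 1 1) $ 1 * D (axis 2 1) $ 2 - D (axis 2 1) $ 1 * D (axis 1 1) $ 2 = mroot \<mu> (mflow t x) / mroot \<mu> x"
proof -
  have x: "x \<in> mdom \<mu>" using good[OF t] by (simp add: mgood_def)
  define u where "u = (\<lambda>v :: real^2. (v $ 1, v $ 2, (x \<bullet> v) / mroot \<mu> x))"
  define a where "a s = aexp s (u (axis 1 1))" for s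
  define b where "b s = aexp s (u (axis 2 1))" for s
  define J where "J s = fst (a s) * fst (snd (b s)) - fst (snd (a s)) * fst (b s)" for s
  define m where "m s = 1 - \<mu> * snd (snd (aflow s (memb \<mu> x)))" for s
  have comp: "((\<lambda>t. fst (f t)) has_real_derivative fst f') (at t)"
      "((\<lambda>t. fst (snd (f t))) has_real_derivative fst (snd f')) (at t)"
      "((\<lambda>t. snd (snd (f t))) has_real_derivative snd (snd f')) (at t)"
    if "(f has_vector_derivative f') (at t)" for f and f' :: "real \<times> real \<times> real" and t
    unfolding has_real_derivative_iff_has_vector_derivative
    using that by (auto simp: has_vector_derivative_def intro: has_derivative_eq_rhs[OF has_derivative_fst]
        has_derivative_eq_rhs[OF has_derivative_snd] has_derivative_eq_rhs[OF has_derivative_fst[OF has_derivative_snd]]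
        has_derivative_eq_rhs[OF has_derivative_snd[OF has_derivative_snd]])
  note da = comp[OF aexp_deriv_time[of "u (axis 1 1)", folded a_def]]
  note db = comp[OF aexp_deriv_time[of "u (axis 2 1)", folded b_def]]
  note dP = comp[OF aflow_deriv_time[of "memb \<mu> x"]]
  have "((\<lambda>s. J s / m s) has_real_derivative 0) (at s)" if s: "\<bar>s\<bar> < \<epsilon>" for s
  proof -
    have m0: "m s > 0" using good[OF s] by (simp add: m_def mgood_def)
    let ?y = "mflow s x"
    have ms: "m s = mroot \<mu> ?y" using mflow_memb(3)[OF good[OF s]] by (simp add: m_def)
    have ta: "?y $ 1 * fst (a s) + ?y $ 2 * fst (snd (a s)) = m s * snd (snd (a s))"
      using mflow_tangent[OF good[OF s], of "axis 1 1"] by (simp add: a_def u_def ms inner_vec_def sum_2)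
    have tb: "?y $ 1 * fst (b s) + ?y $ 2 * fst (snd (b s)) = m s * snd (snd (b s))"
      using mflow_tangent[OF good[OF s], of "axis 2 1"] by (simp add: b_def u_def ms inner_vec_def sum_2)
    let ?J' = "\<mu> * (\<alpha> * (snd (snd (b s)) * fst (snd (a s)) - snd (snd (a s)) * fst (snd (b s)))
       + \<beta> * (snd (snd (a s)) * fst (b s) - fst (a s) * snd (snd (b s))))"
    have dJ: "(J has_real_derivative ?J') (at s)"
      unfolding J_def[abs_def]
      by (auto intro!: derivative_eq_intros da db simp: alin_def split_beta algebra_simps)
    have dm: "(m has_real_derivative - \<mu> * (\<alpha> * ?y $ 1 + \<beta> * ?y $ 2)) (at s)"
      unfolding m_def[abs_def]
      by (auto intro!: derivative_eq_intros dP simp: afield_def split_beta mflow_def algebra_simps)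
    \<comment> \<open>The tangency relations \<open>ta\<close> and \<open>tb\<close> eliminate the
      third components, which occur in \<open>?J'\<close> but not in \<open>J\<close>.\<close>
    have "m s * ?J' = J s * (- \<mu> * (\<alpha> * ?y $ 1 + \<beta> * ?y $ 2))"
      using ta tb unfolding J_def by algebra
    then have "(?J' * m s - J s * (- \<mu> * (\<alpha> * ?y $ 1 + \<beta> * ?y $ 2))) / (m s * m s) = 0" by (simp add: mult.commute)
    then show ?thesis
      using DERIV_divide[OF dJ dm] m0 by simp
  qed
  then have "\<exists>c. \<forall>s\<in>{-\<epsilon><..<\<epsilon>}. J s / m s = c"
    by (intro has_field_derivative_zero_constant) (auto intro: has_field_derivative_at_within)
  then have "J t / m t = J 0 / m 0" using t by (metis abs_less_iff greaterThanLessThan_iff abs_zero dual_order.strict_trans abs_ge_zero le_less_trans minus_less_iff)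
  moreover have "J 0 = 1" "m 0 = mroot \<mu> x"
    by (auto simp: J_def a_def b_def u_def aexp_def m_def aflow_def axis_def memb_def mroot_height[OF x])
  moreover have "m t = mroot \<mu> (mflow t x)" "m t > 0"
    using mflow_memb(3)[OF good[OF t]] good[OF t] by (auto simp: m_def mgood_def)
  moreover have "D v = vector [fst (aexp t (u v)), fst (snd (aexp t (u v)))]" for v
    using frechet_derivative_at[OF mflow_deriv[OF x, of t], symmetric] by (simp add: D_def Let_def u_def)
  ultimately show ?thesis by (simp add: J_def a_def b_def field_simps)
qed

text \<open>The ambient flow is jointly continuous in time and point, so the required conditions
  hold on an open set containing (0, x0); a product neighbourhood inside it gives a common time for
  all points of a ball.\<close>

lemma mflow_local:
  assumes "open D" "D \<subseteq> mdom \<mu>" "x0 \<in> D"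
  shows "\<exists>\<rho>>0. \<exists>\<epsilon>>0. ball x0 \<rho> \<subseteq> D \<and> (\<forall>t x. \<bar>t\<bar> < \<epsilon> \<longrightarrow> x \<in> ball x0 \<rho> \<longrightarrow> mgood t x \<and> mflow t x \<in> D)"
proof -
  have ca: "continuous_on UNIV alin" by (rule linear_continuous_on[OF alin_bounded_linear])
  have cf: "continuous_on UNIV afield"
    using afield_deriv by (auto intro!: continuous_at_imp_continuous_on has_derivative_continuous)
  have cm: "continuous_on (mdom \<mu>) (memb \<mu>)" by (rule smooth_on_imp_continuous[OF memb_smooth])
  define g where "g z = aflow (fst z) (memb \<mu> (snd z))" for z
  have oU: "open (UNIV \<times> mdom \<mu> :: (real \<times> (real^2)) set)" by (intro open_Times open_UNIV mdom_open)
  have "continuous_on (UNIV \<times> mdom \<mu>) (\<lambda>z :: real \<times> (real^2). memb \<mu> (snd z))"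
    by (rule continuous_on_compose2[OF cm]) (auto intro!: continuous_intros)
  moreover have "continuous_on (UNIV \<times> mdom \<mu>) (\<lambda>z :: real \<times> (real^2). cf2 afreq (fst z))"
    "continuous_on (UNIV \<times> mdom \<mu>) (\<lambda>z :: real \<times> (real^2). cf3 afreq (fst z))"
    by (rule continuous_on_compose2[OF cf_continuous(2)[of UNIV]] continuous_on_compose2[OF cf_continuous(3)[of UNIV]];
        auto intro!: continuous_intros)+
  ultimately have cg: "continuous_on (UNIV \<times> mdom \<mu>) g"
    unfolding g_def[abs_def] aflow_def
    by (intro continuous_intros continuous_on_compose2[OF ca] continuous_on_compose2[OF cf]) auto
  have cfl: "continuous_on (UNIV \<times> mdom \<mu>) (\<lambda>z. vector [fst (g z), fst (snd (g z))] :: real^2)"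
    by (rule continuous_on_compose2[OF linear_continuous_on[OF plane_bounded_linear, of UNIV] cg]) auto
  have cgz: "continuous_on (UNIV \<times> mdom \<mu>) (\<lambda>z. 1 - \<mu> * snd (snd (g z)))" by (intro continuous_intros cg)
  define W where "W = ((UNIV \<times> mdom \<mu>) \<inter> (\<lambda>z. 1 - \<mu> * snd (snd (g z))) -` {0<..}) \<inter>
      ((UNIV \<times> mdom \<mu>) \<inter> (\<lambda>z. vector [fst (g z), fst (snd (g z))] :: real^2) -` D) \<inter> (UNIV \<times> D)"
  have "open W"
    unfolding W_def
    by (intro open_Int continuous_open_preimage[OF cgz oU open_greaterThan] continuous_open_preimage[OF cfl oU assms(1)]
        open_Times open_UNIV assms(1))
  moreover have x0: "x0 \<in> mdom \<mu>" using assms by auto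
  have "(0, x0) \<in> W"
    using x0 assms(3) mroot_pos[OF x0] mroot_height[OF x0] mflow_zero[of x0]
    by (auto simp: W_def g_def aflow_def memb_def mflow_def)
  ultimately obtain A B where AB: "open A" "open B" "(0, x0) \<in> A \<times> B" "A \<times> B \<subseteq> W"
    by (rule open_prod_elim)
  obtain \<epsilon> where e: "\<epsilon> > 0" "ball 0 \<epsilon> \<subseteq> A" using AB open_contains_ball by blast
  obtain \<rho> where r: "\<rho> > 0" "ball x0 \<rho> \<subseteq> B" using AB open_contains_ball by blast
  have W: "(t, x) \<in> W" if "\<bar>t\<bar> < \<epsilon>" "x \<in> ball x0 \<rho>" for t x
  proof -
    have "t \<in> A" using that e by (auto simp: dist_real_def)
    then show ?thesis using that r AB(4) by auto
  qed
  have "mgood t x \<and> mflow t x \<in> D \<and> x \<in> D" if "\<bar>t\<bar> < \<epsilon>" "x \<in> ball x0 \<rho>" for t x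
    using W[OF that] by (simp add: W_def mgood_def g_def mflow_def)
  moreover from this[of 0] have "ball x0 \<rho> \<subseteq> D" using e by auto
  ultimately show ?thesis using e r by blast
qed

end

section \<open>Killing fields of the model surfaces\<close>

text \<open>Half the derivative of \<open>mmetric \<mu> x v\<close> when \<open>x\<close> moves with velocity \<open>k\<close> and \<open>v\<close> with velocity \<open>w\<close>.\<close>

definition mlie :: "real \<Rightarrow> real^2 \<Rightarrow> real^2 \<Rightarrow> real^2 \<Rightarrow> real^2 \<Rightarrow> real" where
  "mlie \<mu> x k v w = v \<bullet> w + \<mu> * ((x \<bullet> v) / mroot \<mu> x) *
     ((k \<bullet> v + x \<bullet> w) / mroot \<mu> x + \<mu> * (x \<bullet> v) * (x \<bullet> k) / mroot \<mu> x ^ 3)"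

lemma mlie_diff: "mlie \<mu> x (k - k') v (w - w') = mlie \<mu> x k v w - mlie \<mu> x k' v w'"
  by (simp add: mlie_def inner_diff_left inner_diff_right algebra_simps add_divide_distrib diff_divide_distrib)

lemma mkilling_deriv:
  assumes "x \<in> mdom \<mu>"
  shows "(mkilling \<mu> \<alpha> \<beta> \<gamma> has_derivative (\<lambda>v. vector [\<alpha> * (- \<mu> * (x \<bullet> v) / mroot \<mu> x) - \<gamma> * v $ 2,
      \<beta> * (- \<mu> * (x \<bullet> v) / mroot \<mu> x) + \<gamma> * v $ 1])) (at x)"
proof -
  have bl: "bounded_linear (\<lambda>u :: real \<times> real. vector [fst u, snd u] :: real^2)"
    unfolding linear_conv_bounded_linear[symmetric] by (auto intro!: linearI simp: vec_eq_iff forall_2)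
  have "((\<lambda>x. (\<alpha> * mroot \<mu> x - \<gamma> * x $ 2, \<beta> * mroot \<mu> x + \<gamma> * x $ 1)) has_derivative
      (\<lambda>v. (\<alpha> * (- \<mu> * (x \<bullet> v) / mroot \<mu> x) - \<gamma> * v $ 2, \<beta> * (- \<mu> * (x \<bullet> v) / mroot \<mu> x) + \<gamma> * v $ 1))) (at x)"
    by (intro has_derivative_Pair has_derivative_add has_derivative_diff has_derivative_mult_right mroot_deriv[OF assms]
        bounded_linear_imp_has_derivative bounded_linear_vec_nth)
  from bounded_linear.has_derivative[OF bl this] show ?thesis by (simp add: mkilling_def[abs_def])
qed

lemma mkilling_smooth: "smooth_on (mdom \<mu>) (mkilling \<mu> \<alpha> \<beta> \<gamma>)"
proof (rule smooth_on_vec[OF mdom_open])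
  have "smooth_on (mdom \<mu>) (\<lambda>x. \<alpha> * mroot \<mu> x - \<gamma> * x $ 2)" "smooth_on (mdom \<mu>) (\<lambda>x. \<beta> * mroot \<mu> x + \<gamma> * x $ 1)"
    by (intro smooth_on_add smooth_on_diff smooth_on_mult smooth_on_const mroot_smooth mdom_open
        smooth_on_linear bounded_linear_vec_nth)+
  then show "smooth_on (mdom \<mu>) (\<lambda>x. mkilling \<mu> \<alpha> \<beta> \<gamma> x $ i)" for i
    using exhaust_2[of i] by (auto simp: mkilling_def)
qed

lemma mkilling_lie:
  assumes "x \<in> mdom \<mu>"
  shows "mlie \<mu> x (mkilling \<mu> \<alpha> \<beta> \<gamma> x) v (frechet_derivative (mkilling \<mu> \<alpha> \<beta> \<gamma>) (at x) v) = 0"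
proof -
  have m: "mroot \<mu> x \<noteq> 0" using mroot_pos[OF assms] by simp
  show ?thesis
    unfolding frechet_derivative_at[OF mkilling_deriv[OF assms], symmetric] using m
    by (simp add: mlie_def mkilling_def inner_vec_def sum_2 field_simps power3_eq_cube)
qed

text \<open>A Killing field vanishing at 0 is tangent to the circles around 0, and then the Killing
  equation loses its \<mu>-terms and leaves a Euclidean infinitesimal rotation. The general case is
  reduced to this one by subtracting the explicit field with the same value at 0.\<close>

lemma mkilling_unique:
  assumes \<rho>: "ball 0 \<rho> \<subseteq> mdom \<mu>" "\<rho> > 0" and sm: "smooth_on (ball 0 \<rho>) k"
    and lie: "\<And>x v. x \<in> ball 0 \<rho> \<Longrightarrow> mlie \<mu> x (k x) v (frechet_derivative k (at x) v) = 0"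
  shows "\<exists>\<alpha> \<beta> \<gamma>. \<forall>x\<in>ball 0 \<rho>. k x = mkilling \<mu> \<alpha> \<beta> \<gamma> x"
proof -
  let ?B = "ball (0 :: real^2) \<rho>"
  \<comment> \<open>At 0 the root is 1, so this field has the value \<open>k 0\<close> there. Its
    rotation part is 0; the rotation is recovered at the end as \<open>c 0\<close>.\<close>
  define l where "l = mkilling \<mu> (k 0 $ 1) (k 0 $ 2) 0"
  define f where "f x = k x - l x" for x
  define f' where "f' x = frechet_derivative f (at x)" for x
  have sl: "smooth_on ?B l" unfolding l_def by (rule smooth_on_subset[OF mkilling_smooth \<rho>(1)])
  have sf: "smooth_on ?B f" unfolding f_def[abs_def] by (intro smooth_on_diff open_ball sm sl)
  have df: "(f has_derivative f' x) (at x)" if "x \<in> ?B" for x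
    unfolding f'_def by (rule smooth_on_derivative[OF sf that])
  have linf: "f' x v = v $ 1 *\<^sub>R f' x (axis 1 1) + v $ 2 *\<^sub>R f' x (axis 2 1)" if "x \<in> ?B" for x v
  proof -
    have li: "linear (f' x)" using df[OF that] has_derivative_linear by blast
    have "v = v $ 1 *\<^sub>R axis 1 1 + v $ 2 *\<^sub>R axis 2 1" by (auto simp: vec_eq_iff axis_def forall_2)
    then have "f' x v = f' x (v $ 1 *\<^sub>R axis 1 1 + v $ 2 *\<^sub>R axis 2 1)" by simp
    then show ?thesis by (simp add: linear_add[OF li] linear_cmul[OF li])
  qed
  have m0: "mroot \<mu> 0 = 1" by (simp add: mroot_def)
  have f0: "f 0 = 0" by (simp add: f_def l_def mkilling_def m0 vec_eq_iff forall_2)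
  have lief: "mlie \<mu> x (f x) v (f' x v) = 0" if x: "x \<in> ?B" for x v
  proof -
    have "(f has_derivative (\<lambda>v. frechet_derivative k (at x) v - frechet_derivative l (at x) v)) (at x)"
      unfolding f_def[abs_def]
      by (intro has_derivative_diff smooth_on_derivative[OF sm x] smooth_on_derivative[OF sl x])
    then have "f' x = (\<lambda>v. frechet_derivative k (at x) v - frechet_derivative l (at x) v)"
      using has_derivative_unique df[OF x] by blast
    then show ?thesis
      using lie[OF x, of v] mkilling_lie[of x \<mu> "k 0 $ 1" "k 0 $ 2" 0 v] x \<rho>(1)
      by (simp add: f_def mlie_diff l_def subset_iff)
  qed
  define q where "q x = x \<bullet> f x" for x
  have dq: "(q has_derivative (\<lambda>v. f x \<bullet> v + x \<bullet> f' x v)) (at x)" if "x \<in> ?B" for x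
    unfolding q_def[abs_def]
    by (rule has_derivative_eq_rhs[OF has_derivative_inner[OF has_derivative_ident df[OF that]]])
      (simp add: fun_eq_iff inner_commute add.commute)
  \<comment> \<open>The Killing equation contracted with the position vector, \<open>v = x\<close>:
    a first-order linear ODE for \<open>q\<close> along each ray.\<close>
  have radial: "f x \<bullet> x + x \<bullet> f' x x = q x * (1 - \<mu> * (x \<bullet> x) / (mroot \<mu> x)\<^sup>2)" if x: "x \<in> ?B" for x
  proof -
    let ?m = "mroot \<mu> x" and ?A = "x \<bullet> f' x x" and ?R = "x \<bullet> x"
    have xd: "x \<in> mdom \<mu>" using x \<rho> by auto
    have m: "?m > 0" by (rule mroot_pos[OF xd])
    have mR: "?m\<^sup>2 = 1 - \<mu> * ?R" using mroot_sq[OF xd] by (simp add: inner_vec_def sum_2 power2_eq_square)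
    have "?A + \<mu> * (?R / ?m) * ((q x + ?A) / ?m + \<mu> * ?R * q x / ?m ^ 3) = 0"
      using lief[OF x, of x] by (simp add: mlie_def q_def inner_commute)
    then have z: "(?A + \<mu> * (?R / ?m) * ((q x + ?A) / ?m + \<mu> * ?R * q x / ?m ^ 3)) * ?m ^ 4 = 0"
      by (simp only: mult_zero_left)
    have "(?A + \<mu> * (?R / ?m) * ((q x + ?A) / ?m + \<mu> * ?R * q x / ?m ^ 3)) * ?m ^ 4
        = ?A * ?m ^ 4 + \<mu> * ?R * ?m\<^sup>2 * (q x + ?A) + \<mu>\<^sup>2 * ?R\<^sup>2 * q x"
      using m by (simp add: field_simps power2_eq_square power3_eq_cube power4_eq_xxxx)
    with z have "?A * ?m ^ 4 + \<mu> * ?R * ?m\<^sup>2 * (q x + ?A) + \<mu>\<^sup>2 * ?R\<^sup>2 * q x = 0" by (simp only:)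
    then have "?A * ?m\<^sup>2 + \<mu> * ?R * q x = 0"
      using mR by algebra
    then show ?thesis using m by (simp add: q_def inner_commute field_simps)
  qed
  \<comment> \<open>By \<open>radial\<close>, \<open>q\<close> along a ray is a constant multiple of
    \<open>t * M t\<close>. Its derivative at t = 0 is \<open>f 0 \<bullet> v = 0\<close> while
    \<open>M 0 = 1\<close>, so the constant is 0.\<close>
  have q0: "q v = 0" if v: "v \<in> ?B" for v
  proof -
    have tv: "t *\<^sub>R v \<in> ?B" if "t \<in> {0..1}" for t
    proof -
      have "\<bar>t\<bar> * norm v \<le> 1 * norm v" using that by (intro mult_right_mono) auto
      then show ?thesis using v by simp
    qed
    define h where "h t = q (t *\<^sub>R v)" for t
    define M where "M t = mroot \<mu> (t *\<^sub>R v)" for t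
    have dv: "((\<lambda>t. t *\<^sub>R v) has_derivative (\<lambda>s. s *\<^sub>R v)) (at t)" for t by (auto intro!: derivative_eq_intros)
    have dh: "(h has_real_derivative f (t *\<^sub>R v) \<bullet> v + (t *\<^sub>R v) \<bullet> f' (t *\<^sub>R v) v) (at t)" if "t \<in> {0..1}" for t
    proof -
      have li: "linear (f' (t *\<^sub>R v))" using df[OF tv[OF that]] has_derivative_linear by blast
      show ?thesis
        unfolding h_def[abs_def] has_field_derivative_def
        by (rule has_derivative_eq_rhs[OF has_derivative_compose[OF dv dq[OF tv[OF that]]]])
          (simp add: fun_eq_iff linear_cmul[OF li] algebra_simps)
    qed
    have dM: "(M has_real_derivative - \<mu> * ((t *\<^sub>R v) \<bullet> v) / M t) (at t)" if "t \<in> {0..1}" for t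
      unfolding M_def[abs_def] has_field_derivative_def
      by (rule has_derivative_eq_rhs[OF has_derivative_compose[OF dv mroot_deriv]])
        (use tv[OF that] \<rho> in \<open>auto simp: fun_eq_iff\<close>)
    have Mp: "M t > 0" if "t \<in> {0..1}" for t
      unfolding M_def by (rule mroot_pos) (use tv[OF that] \<rho>(1) in blast)
    have "((\<lambda>t. h t / (t * M t)) has_real_derivative 0) (at t)" if t: "t \<in> {0<..1}" for t
    proof -
      have t': "t \<in> {0..1}" and tp: "t > 0" using t by auto
      let ?h' = "f (t *\<^sub>R v) \<bullet> v + (t *\<^sub>R v) \<bullet> f' (t *\<^sub>R v) v"
      have li: "linear (f' (t *\<^sub>R v))" using df[OF tv[OF t']] has_derivative_linear by blast
      have "t * ?h' = h t * (1 - \<mu> * (t *\<^sub>R v \<bullet> t *\<^sub>R v) / (M t)\<^sup>2)"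
        using radial[OF tv[OF t']] by (simp add: h_def M_def linear_cmul[OF li] algebra_simps)
      then have e: "?h' * (t * M t) = h t * (M t - t * (\<mu> * (t *\<^sub>R v \<bullet> v) / M t))"
        using Mp[OF t'] by (simp add: field_simps power2_eq_square)
      have d: "((\<lambda>t. t * M t) has_real_derivative M t + t * (- \<mu> * ((t *\<^sub>R v) \<bullet> v) / M t)) (at t)"
        by (auto intro!: derivative_eq_intros dM[OF t'])
      show ?thesis
        using DERIV_divide[OF dh[OF t'] d] Mp[OF t'] tp e by simp
    qed
    then have "\<exists>c. \<forall>t\<in>{0<..1}. h t / (t * M t) = c"
      by (intro has_field_derivative_zero_constant) (auto intro: has_field_derivative_at_within)
    then obtain c where c: "\<And>t. t \<in> {0<..1} \<Longrightarrow> h t / (t * M t) = c" by blast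
    have hc: "h t / t = c * M t" if "t \<in> {0<..1}" for t
      using c[OF that] Mp[of t] that by (auto simp: field_simps)
    have "(h has_real_derivative 0) (at 0)" using dh[of 0] f0 by simp
    then have "((\<lambda>t. (h t - h 0) / (t - 0)) \<longlongrightarrow> 0) (at 0)" by (simp add: has_field_derivative_iff)
    moreover have "h 0 = 0" by (simp add: h_def q_def)
    ultimately have "((\<lambda>t. h t / t) \<longlongrightarrow> 0) (at 0)" by (simp del: divide_eq_0_iff)
    then have "((\<lambda>t. h t / t) \<longlongrightarrow> 0) (at 0 within {0<..1})"
      by (rule tendsto_within_subset) simp
    moreover have "((\<lambda>t. c * M t) \<longlongrightarrow> c * M 0) (at 0 within {0<..1})"
      using DERIV_isCont[OF dM[of 0]] by (intro tendsto_intros) (auto simp: isCont_def intro: tendsto_within_subset)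
    then have "((\<lambda>t. h t / t) \<longlongrightarrow> c * M 0) (at 0 within {0<..1})"
      by (rule Lim_transform_eventually) (auto simp: eventually_at_filter hc)
    moreover have "at (0::real) within {0<..1} \<noteq> bot"
      by (simp add: trivial_limit_within islimpt_greaterThanLessThan1 islimpt_Ioc)
    ultimately have "c * M 0 = 0" using tendsto_unique by blast
    then have "c = 0" using m0 by (simp add: M_def)
    then show ?thesis using hc[of 1] by (simp add: h_def)
  qed
  have q': "f x \<bullet> v + x \<bullet> f' x v = 0" if x: "x \<in> ?B" for x v
  proof -
    have "(q has_derivative (\<lambda>v. 0)) (at x)"
      by (rule has_derivative_transform_within_open[OF has_derivative_const open_ball x]) (simp add: q0)
    then have "(\<lambda>v. f x \<bullet> v + x \<bullet> f' x v) = (\<lambda>v. 0)" using dq[OF x] has_derivative_unique by blast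
    then show ?thesis by (rule fun_cong)
  qed
  \<comment> \<open>Every \<mu>-term of \<open>mlie\<close> contains \<open>x \<bullet> f x\<close>
    or the derivative of this function, and both vanish.\<close>
  have flat: "v \<bullet> f' x v = 0" if x: "x \<in> ?B" for x v
    using lief[OF x, of v] q'[OF x, of v] q0[OF x] by (simp add: mlie_def q_def)
  define c where "c x = f' x (axis 1 1) $ 2" for x
  have e11: "f' x (axis 1 1) $ 1 = 0" and e22: "f' x (axis 2 1) $ 2 = 0" and e12: "f' x (axis 2 1) $ 1 = - c x"
    if x: "x \<in> ?B" for x
  proof -
    show 1: "f' x (axis 1 1) $ 1 = 0" "f' x (axis 2 1) $ 2 = 0"
      using flat[OF x, of "axis 1 1"] flat[OF x, of "axis 2 1"] by (auto simp: inner_vec_def sum_2 axis_def)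
    then show "f' x (axis 2 1) $ 1 = - c x"
      using flat[OF x, of "axis 1 1 + axis 2 1"] linf[OF x, of "axis 1 1 + axis 2 1"]
      by (simp add: inner_vec_def sum_2 axis_def c_def)
  qed
  \<comment> \<open>The derivative of \<open>x \<bullet> f x = 0\<close> expresses
    \<open>f x\<close> through the skew matrix \<open>f' x\<close>, that is, through its single
    entry \<open>c x\<close>.\<close>
  have fc: "f x $ 1 = - x $ 2 * c x" "f x $ 2 = x $ 1 * c x" if x: "x \<in> ?B" for x
    using q'[OF x, of "axis 1 1"] q'[OF x, of "axis 2 1"] e11[OF x] e22[OF x] e12[OF x]
    by (auto simp: inner_vec_def sum_2 axis_def c_def)
  have sc: "smooth_on ?B c"
    unfolding c_def[abs_def] f'_def by (intro smooth_on_vec_nth open_ball smooth_on_frechet sf)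
  \<comment> \<open>Differentiating \<open>fc\<close> and comparing with the entries of
    \<open>f'\<close> leaves the position vector times the derivative of \<open>c\<close>; this
    gives no information at the origin, which is therefore excluded.\<close>
  have dc: "(c has_derivative (\<lambda>h. 0)) (at x)" if x: "x \<in> ?B - {0}" for x
  proof -
    have xB: "x \<in> ?B" using x by simp
    obtain c' where c': "(c has_derivative c') (at x)" using smooth_on_derivative[OF sc xB] by blast
    have nth: "((\<lambda>x. f x $ i) has_derivative (\<lambda>v. f' x v $ i)) (at x)" for i
      by (rule bounded_linear.has_derivative[OF bounded_linear_vec_nth df[OF xB]])
    have x1: "((\<lambda>x :: real^2. x $ i) has_derivative (\<lambda>v. v $ i)) (at x)" for i
      by (rule bounded_linear_imp_has_derivative[OF bounded_linear_vec_nth])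
    have "((\<lambda>x. f x $ 2) has_derivative (\<lambda>v. x $ 1 * c' v + v $ 1 * c x)) (at x)"
      by (rule has_derivative_transform_within_open[OF has_derivative_mult[OF x1 c'] open_ball xB]) (simp add: fc)
    then have "(\<lambda>v. f' x v $ 2) = (\<lambda>v. x $ 1 * c' v + v $ 1 * c x)" using nth has_derivative_unique by blast
    then have a: "f' x v $ 2 = x $ 1 * c' v + v $ 1 * c x" for v by (rule fun_cong)
    have "((\<lambda>x. - f x $ 1) has_derivative (\<lambda>v. x $ 2 * c' v + v $ 2 * c x)) (at x)"
      by (rule has_derivative_transform_within_open[OF has_derivative_mult[OF x1 c'] open_ball xB]) (simp add: fc)
    then have "(\<lambda>v. - f' x v $ 1) = (\<lambda>v. x $ 2 * c' v + v $ 2 * c x)"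
      using has_derivative_minus[OF nth] has_derivative_unique by blast
    then have b: "- f' x v $ 1 = x $ 2 * c' v + v $ 2 * c x" for v by (rule fun_cong)
    have "x $ 1 * c' v = 0" "x $ 2 * c' v = 0" for v
      using a[of v] b[of v] linf[OF xB, of v] e11[OF xB] e22[OF xB] e12[OF xB] by (auto simp: c_def)
    moreover have "x $ 1 \<noteq> 0 \<or> x $ 2 \<noteq> 0" using x by (auto simp: vec_eq_iff forall_2)
    ultimately have "c' v = 0" for v by auto
    then show ?thesis using c' by (auto intro: has_derivative_eq_rhs)
  qed
  \<comment> \<open>The origin is a finite exceptional set, admissible because \<open>c\<close> is
    continuous there.\<close>
  have cc: "c x = c 0" if "x \<in> ?B" for x
    by (rule has_derivative_zero_unique_strong_connected[of ?B "{0}" c 0 "c 0"])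
      (use dc that \<rho> smooth_on_imp_continuous[OF sc] in \<open>auto intro: has_derivative_at_withinI\<close>)
  have "k x = mkilling \<mu> (k 0 $ 1) (k 0 $ 2) (c 0) x" if "x \<in> ?B" for x
    using fc[OF that] cc[OF that] by (auto simp: f_def l_def mkilling_def vec_eq_iff forall_2 algebra_simps)
  then show ?thesis by blast
qed

section \<open>Closed one-forms in the plane\<close>

lemma smooth_on_partial_deriv: "open S \<Longrightarrow> smooth_on S f \<Longrightarrow> smooth_on S (partial_deriv i f)"
  unfolding partial_deriv_def[abs_def] by (rule smooth_on_frechet)

text \<open>The second difference of \<open>f\<close> over a small square is written in two ways by
  applying the mean value theorem twice, in either order of the variables. Letting the side of the
  square tend to 0 gives the equality.\<close>

lemma partial_deriv_commute:
  fixes f :: "real^2 \<Rightarrow> real"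
  assumes S: "open S" "x \<in> S" and f: "smooth_on S f"
  shows "partial_deriv 1 (partial_deriv 2 f) x = partial_deriv 2 (partial_deriv 1 f) x"
proof -
  let ?f12 = "partial_deriv 1 (partial_deriv 2 f)" and ?f21 = "partial_deriv 2 (partial_deriv 1 f)"
  let ?p = "\<lambda>s t. x + s *\<^sub>R axis 1 1 + t *\<^sub>R axis 2 1 :: real^2"
  obtain r where r: "r > 0" "ball x r \<subseteq> S" using S open_contains_ball by blast
  have pS: "?p s t \<in> S" if "\<bar>s\<bar> < r / 2" "\<bar>t\<bar> < r / 2" for s t
  proof -
    have "norm (s *\<^sub>R axis 1 1 + t *\<^sub>R axis 2 1 :: real^2) \<le> \<bar>s\<bar> + \<bar>t\<bar>"
      by (rule order_trans[OF norm_triangle_ineq]) (simp add: norm_axis_1)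
    moreover have "dist x (?p s t) = norm (s *\<^sub>R axis 1 1 + t *\<^sub>R axis 2 1 :: real^2)"
      by (subst dist_commute) (simp add: dist_norm add.assoc)
    ultimately have "?p s t \<in> ball x r" using that by simp
    then show ?thesis using r by blast
  qed
  have d1: "((\<lambda>s. h (?p s t)) has_real_derivative partial_deriv 1 h (?p s t)) (at s)"
    and d2: "((\<lambda>t. h (?p s t)) has_real_derivative partial_deriv 2 h (?p s t)) (at t)"
    if "smooth_on S h" "\<bar>s\<bar> < r / 2" "\<bar>t\<bar> < r / 2" for h s t
  proof -
    have ax: "axis 1 1 $ (2 :: 2) = (0 :: real)" "axis 2 1 $ (1 :: 2) = (0 :: real)" by (auto simp: axis_def)
    note dh = smooth_on_partials[OF that(1) pS[OF that(2,3)]]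
    have "((\<lambda>s. ?p s t) has_derivative (\<lambda>u. u *\<^sub>R axis 1 1)) (at s)" "((\<lambda>t. ?p s t) has_derivative (\<lambda>u. u *\<^sub>R axis 2 1)) (at t)"
      by (auto intro!: derivative_eq_intros)
    from this[THEN has_derivative_compose, OF dh]
    show "((\<lambda>s. h (?p s t)) has_real_derivative partial_deriv 1 h (?p s t)) (at s)"
      "((\<lambda>t. h (?p s t)) has_real_derivative partial_deriv 2 h (?p s t)) (at t)"
      by (auto simp: has_field_derivative_def mult_commute_abs ax intro: has_derivative_eq_rhs)
  qed
  note f1 = smooth_on_partial_deriv[OF S(1) f, of 1] and f2 = smooth_on_partial_deriv[OF S(1) f, of 2]
  have ex: "\<exists>a b c d. a \<in> {0<..<h} \<and> b \<in> {0<..<h} \<and> c \<in> {0<..<h} \<and> d \<in> {0<..<h} \<and> ?f21 (?p a b) = ?f12 (?p c d)"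
    if h: "0 < h" "h < r / 2" for h
  proof -
    have "\<exists>a. 0 < a \<and> a < h \<and> (f (?p h h) - f (?p h 0)) - (f (?p 0 h) - f (?p 0 0))
        = (h - 0) * (partial_deriv 1 f (?p a h) - partial_deriv 1 f (?p a 0))"
      by (rule MVT2[OF h(1)], intro DERIV_diff d1 f) (use h in auto)
    then obtain a where a: "0 < a" "a < h" and ea: "(f (?p h h) - f (?p h 0)) - (f (?p 0 h) - f (?p 0 0))
        = h * (partial_deriv 1 f (?p a h) - partial_deriv 1 f (?p a 0))" by auto
    have "\<exists>b. 0 < b \<and> b < h \<and> partial_deriv 1 f (?p a h) - partial_deriv 1 f (?p a 0) = (h - 0) * ?f21 (?p a b)"
      by (rule MVT2) (use h a in \<open>auto intro!: d2 f1\<close>)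
    then obtain b where b: "0 < b" "b < h" and eb: "partial_deriv 1 f (?p a h) - partial_deriv 1 f (?p a 0) = h * ?f21 (?p a b)"
      by auto
    have "\<exists>d. 0 < d \<and> d < h \<and> (f (?p h h) - f (?p 0 h)) - (f (?p h 0) - f (?p 0 0))
        = (h - 0) * (partial_deriv 2 f (?p h d) - partial_deriv 2 f (?p 0 d))"
      by (rule MVT2[OF h(1)], intro DERIV_diff d2 f) (use h in auto)
    then obtain d where d: "0 < d" "d < h" and ed: "(f (?p h h) - f (?p 0 h)) - (f (?p h 0) - f (?p 0 0))
        = h * (partial_deriv 2 f (?p h d) - partial_deriv 2 f (?p 0 d))" by auto
    have "\<exists>c. 0 < c \<and> c < h \<and> partial_deriv 2 f (?p h d) - partial_deriv 2 f (?p 0 d) = (h - 0) * ?f12 (?p c d)"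
      by (rule MVT2) (use h d in \<open>auto intro!: d1 f2\<close>)
    then obtain c where c: "0 < c" "c < h" and ec: "partial_deriv 2 f (?p h d) - partial_deriv 2 f (?p 0 d) = h * ?f12 (?p c d)"
      by auto
    have "h * (h * ?f21 (?p a b)) = h * (h * ?f12 (?p c d))"
      by (simp only: eb[symmetric] ec[symmetric] ea[symmetric] ed[symmetric])
    then have "?f21 (?p a b) = ?f12 (?p c d)" using h by simp
    then show ?thesis using a b c d by (intro exI[of _ a] exI[of _ b] exI[of _ c] exI[of _ d]) simp
  qed
  define h where "h n = r / 2 / (real n + 2)" for n
  have h: "0 < h n" "h n < r / 2" for n
  proof -
    show "0 < h n" using r by (simp add: h_def)
    have "r / 2 / (real n + 2) < r / 2 / 1" using r by (intro divide_strict_left_mono) auto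
    then show "h n < r / 2" by (simp add: h_def)
  qed
  have "\<forall>n. \<exists>z. fst z \<in> {0<..<h n} \<times> {0<..<h n} \<and> snd z \<in> {0<..<h n} \<times> {0<..<h n} \<and>
      ?f21 (?p (fst (fst z)) (snd (fst z))) = ?f12 (?p (fst (snd z)) (snd (snd z)))"
  proof
    fix n
    obtain a b c d where "a \<in> {0<..<h n}" "b \<in> {0<..<h n}" "c \<in> {0<..<h n}" "d \<in> {0<..<h n}" "?f21 (?p a b) = ?f12 (?p c d)"
      using ex[OF h[of n]] by blast
    then show "\<exists>z. fst z \<in> {0<..<h n} \<times> {0<..<h n} \<and> snd z \<in> {0<..<h n} \<times> {0<..<h n} \<and>
      ?f21 (?p (fst (fst z)) (snd (fst z))) = ?f12 (?p (fst (snd z)) (snd (snd z)))"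
      by (intro exI[of _ "((a, b), (c, d))"]) simp
  qed
  from choice[OF this] obtain z where "\<forall>n. fst (z n) \<in> {0<..<h n} \<times> {0<..<h n} \<and> snd (z n) \<in> {0<..<h n} \<times> {0<..<h n} \<and>
      ?f21 (?p (fst (fst (z n))) (snd (fst (z n)))) = ?f12 (?p (fst (snd (z n))) (snd (snd (z n))))"
    by (elim exE)
  then have z: "fst (z n) \<in> {0<..<h n} \<times> {0<..<h n}" "snd (z n) \<in> {0<..<h n} \<times> {0<..<h n}"
      "?f21 (?p (fst (fst (z n))) (snd (fst (z n)))) = ?f12 (?p (fst (snd (z n))) (snd (snd (z n))))" for n
    by blast+
  have h0: "h \<longlonglongrightarrow> 0"
    using LIMSEQ_ignore_initial_segment[OF lim_const_over_n[of "r / 2"], of 2] by (simp add: h_def[abs_def] add_ac)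
  have lim: "(\<lambda>n. g (?p (s n) (t n))) \<longlonglongrightarrow> g x"
    if "smooth_on S g" "\<And>n. s n \<in> {0<..<h n}" "\<And>n. t n \<in> {0<..<h n}" for g :: "real^2 \<Rightarrow> real" and s t
  proof -
    have "s \<longlonglongrightarrow> 0" "t \<longlonglongrightarrow> 0"
      by (rule tendsto_sandwich[OF _ _ tendsto_const h0]; use that in \<open>auto intro!: always_eventually less_imp_le\<close>)+
    then have "(\<lambda>n. ?p (s n) (t n)) \<longlonglongrightarrow> ?p 0 0" by (intro tendsto_intros)
    moreover have "isCont g x" using smooth_on_imp_continuous[OF that(1)] S by (simp add: continuous_on_eq_continuous_at)
    ultimately show ?thesis using isCont_tendsto_compose[of x g] by simp
  qed
  have "(\<lambda>n. ?f21 (?p (fst (fst (z n))) (snd (fst (z n))))) \<longlonglongrightarrow> ?f21 x"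
    by (rule lim) (use z(1) in \<open>auto simp: mem_Times_iff intro!: smooth_on_partial_deriv S f\<close>)
  moreover have "(\<lambda>n. ?f12 (?p (fst (snd (z n))) (snd (snd (z n))))) \<longlonglongrightarrow> ?f12 x"
    by (rule lim) (use z(2) in \<open>auto simp: mem_Times_iff intro!: smooth_on_partial_deriv S f\<close>)
  ultimately show ?thesis using LIMSEQ_unique by (simp only: z(3)) blast
qed

definition curl :: "(real^2 \<Rightarrow> real^2) \<Rightarrow> real^2 \<Rightarrow> real" where
  "curl \<theta> x = partial_deriv 1 (\<lambda>y. \<theta> y $ 2) x - partial_deriv 2 (\<lambda>y. \<theta> y $ 1) x"

definition jacobian :: "(real^2 \<Rightarrow> real^2) \<Rightarrow> real^2 \<Rightarrow> real" where
  "jacobian \<phi> x = frechet_derivative \<phi> (at x) (axis 1 1) $ 1 * frechet_derivative \<phi> (at x) (axis 2 1) $ 2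
    - frechet_derivative \<phi> (at x) (axis 2 1) $ 1 * frechet_derivative \<phi> (at x) (axis 1 1) $ 2"

text \<open>A 1-form is represented by a vector field through the Euclidean inner product; its
  pullback is therefore the transposed derivative applied to that field.\<close>

definition form_pullback :: "(real^2 \<Rightarrow> real^2) \<Rightarrow> (real^2 \<Rightarrow> real^2) \<Rightarrow> real^2 \<Rightarrow> real^2" where
  "form_pullback \<phi> \<theta> x = (\<chi> i. \<theta> (\<phi> x) \<bullet> frechet_derivative \<phi> (at x) (axis i 1))"

lemma form_pullback_inner:
  assumes "(\<phi> has_derivative \<phi>') (at x)"
  shows "form_pullback \<phi> \<theta> x \<bullet> v = \<theta> (\<phi> x) \<bullet> \<phi>' v"
proof -
  have li: "linear \<phi>'" using assms has_derivative_linear by blast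
  have v: "v = v $ 1 *\<^sub>R axis 1 1 + v $ 2 *\<^sub>R axis 2 1" by (auto simp: vec_eq_iff axis_def forall_2)
  have "\<phi>' v = v $ 1 *\<^sub>R \<phi>' (axis 1 1) + v $ 2 *\<^sub>R \<phi>' (axis 2 1)"
    by (subst v) (simp add: linear_add[OF li] linear_cmul[OF li])
  then show ?thesis
    using frechet_derivative_at[OF assms, symmetric]
    by (simp add: form_pullback_def inner_vec_def[of _ v] sum_2 inner_add_right mult.commute)
qed

lemma form_pullback_smooth:
  assumes "open S" "open T" "smooth_on S \<phi>" "\<phi> ` S \<subseteq> T" "smooth_on T \<theta>"
  shows "smooth_on S (form_pullback \<phi> \<theta>)"
  by (rule smooth_on_vec[OF assms(1)]) (simp add: form_pullback_def smooth_on_bilinear[OF assms(1) bounded_bilinear_inner]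
      smooth_on_compose[OF assms(1,2,5,3,4)] smooth_on_frechet[OF assms(1,3)])

text \<open>Exterior derivative and pullback commute: the second derivatives of \<phi> cancel by
  symmetry, and the first derivatives assemble into the Jacobian determinant.\<close>

lemma curl_pullback:
  assumes S: "open S" "open T" "smooth_on S \<phi>" "\<phi> ` S \<subseteq> T" "smooth_on T \<theta>" and x: "x \<in> S"
  shows "curl (form_pullback \<phi> \<theta>) x = curl \<theta> (\<phi> x) * jacobian \<phi> x"
proof -
  have \<phi>x: "\<phi> x \<in> T" using S x by auto
  have nth: "frechet_derivative \<phi> (at y) (axis i 1) $ j = partial_deriv i (\<lambda>z. \<phi> z $ j) y" if "y \<in> S" for y i j
    using partial_deriv_eq[OF bounded_linear.has_derivative[OF bounded_linear_vec_nth smooth_on_derivative[OF S(3) that]]] by simp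
  have sj: "smooth_on S (\<lambda>z. \<phi> z $ j)" for j by (intro smooth_on_vec_nth S)
  have st: "smooth_on T (\<lambda>z. \<theta> z $ j)" for j by (intro smooth_on_vec_nth S)
  have d\<phi>: "(\<phi> has_derivative frechet_derivative \<phi> (at x)) (at x)" by (rule smooth_on_derivative[OF S(3) x])
  have dt: "partial_deriv k (\<lambda>y. \<theta> (\<phi> y) $ j) x = partial_deriv 1 (\<lambda>z. \<theta> z $ j) (\<phi> x) * partial_deriv k (\<lambda>z. \<phi> z $ 1) x
      + partial_deriv 2 (\<lambda>z. \<theta> z $ j) (\<phi> x) * partial_deriv k (\<lambda>z. \<phi> z $ 2) x" for k j
    using partial_deriv_eq[OF has_derivative_compose[OF d\<phi> smooth_on_partials[OF st[of j] \<phi>x]], of k]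
    by (simp add: nth[OF x])
  have std: "((\<lambda>y. \<theta> (\<phi> y) $ j) has_derivative (\<lambda>h. h $ 1 * partial_deriv 1 (\<lambda>y. \<theta> (\<phi> y) $ j) x + h $ 2 * partial_deriv 2 (\<lambda>y. \<theta> (\<phi> y) $ j) x)) (at x)" for j
    by (rule smooth_on_partials[OF smooth_on_compose[OF S(1,2) st[of j] S(3,4)] x])
  have pd: "partial_deriv k (\<lambda>y. form_pullback \<phi> \<theta> y $ i) x =
      (\<Sum>j\<in>UNIV. partial_deriv k (\<lambda>y. \<theta> (\<phi> y) $ j) x * partial_deriv i (\<lambda>z. \<phi> z $ j) x
        + \<theta> (\<phi> x) $ j * partial_deriv k (partial_deriv i (\<lambda>z. \<phi> z $ j)) x)" for k i
  proof -
    have "((\<lambda>y. \<Sum>j\<in>UNIV. \<theta> (\<phi> y) $ j * partial_deriv i (\<lambda>z. \<phi> z $ j) y) has_derivative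
        (\<lambda>h. \<Sum>j\<in>UNIV. \<theta> (\<phi> x) $ j * (h $ 1 * partial_deriv 1 (partial_deriv i (\<lambda>z. \<phi> z $ j)) x + h $ 2 * partial_deriv 2 (partial_deriv i (\<lambda>z. \<phi> z $ j)) x)
          + (h $ 1 * partial_deriv 1 (\<lambda>y. \<theta> (\<phi> y) $ j) x + h $ 2 * partial_deriv 2 (\<lambda>y. \<theta> (\<phi> y) $ j) x) * partial_deriv i (\<lambda>z. \<phi> z $ j) x)) (at x)"
      by (intro has_derivative_sum has_derivative_mult std smooth_on_partials[OF smooth_on_partial_deriv[OF S(1) sj] x])
    then have "((\<lambda>y. form_pullback \<phi> \<theta> y $ i) has_derivative
        (\<lambda>h. \<Sum>j\<in>UNIV. \<theta> (\<phi> x) $ j * (h $ 1 * partial_deriv 1 (partial_deriv i (\<lambda>z. \<phi> z $ j)) x + h $ 2 * partial_deriv 2 (partial_deriv i (\<lambda>z. \<phi> z $ j)) x)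
          + (h $ 1 * partial_deriv 1 (\<lambda>y. \<theta> (\<phi> y) $ j) x + h $ 2 * partial_deriv 2 (\<lambda>y. \<theta> (\<phi> y) $ j) x) * partial_deriv i (\<lambda>z. \<phi> z $ j) x)) (at x)"
      by (rule has_derivative_transform_within_open[OF _ S(1) x]) (simp add: form_pullback_def inner_vec_def nth)
    from partial_deriv_eq[OF this, of k] show ?thesis
      using exhaust_2[of k] by (auto simp: axis_def sum_2)
  qed
  show ?thesis
    unfolding curl_def pd jacobian_def nth[OF x] sum_2 dt partial_deriv_commute[OF S(1) x sj]
    by (simp add: algebra_simps)
qed

text \<open>The Poincare lemma on a ball; the potential is the integral of the form along the
  segment from the centre.\<close>

lemma closed_form_exact:
  fixes \<sigma> :: "'a::euclidean_space \<Rightarrow> 'a"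
  assumes smooth: "smooth_on (ball x0 r) \<sigma>"
    and sym: "\<And>x h k. x \<in> ball x0 r \<Longrightarrow> frechet_derivative \<sigma> (at x) h \<bullet> k = frechet_derivative \<sigma> (at x) k \<bullet> h"
  shows "\<exists>f. \<forall>x\<in>ball x0 r. (f has_derivative (\<lambda>h. \<sigma> x \<bullet> h)) (at x)"
proof -
  let ?B = "ball x0 r"
  obtain \<sigma>' where d\<sigma>: "\<And>x. x \<in> ?B \<Longrightarrow> (\<sigma> has_derivative blinfun_apply (\<sigma>' x)) (at x)" and c\<sigma>': "continuous_on ?B \<sigma>'"
    using smooth_on_blinfun_derivative[OF open_ball smooth] by metis
  have sym': "\<sigma>' x h \<bullet> k = \<sigma>' x k \<bullet> h" if "x \<in> ?B" for x h k
    using sym[OF that, of h k] frechet_derivative_at[OF d\<sigma>[OF that]] by simp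
  have c\<sigma>: "continuous_on ?B \<sigma>" by (rule smooth_on_imp_continuous[OF smooth])
  let ?y = "\<lambda>x t. x0 + t *\<^sub>R (x - x0)"
  have yB: "?y x t \<in> ?B" if "x \<in> ?B" "t \<in> {0..1}" for x t
  proof -
    have "\<bar>t\<bar> * norm (x - x0) \<le> 1 * norm (x - x0)" using that by (intro mult_right_mono) auto
    then show ?thesis using that by (simp add: dist_norm norm_minus_commute)
  qed
  define f where "f x = integral (cbox 0 1) (\<lambda>t. \<sigma> (?y x t) \<bullet> (x - x0))" for x
  define F where "F x t = blinfun_inner_right (\<sigma> (?y x t)) + t *\<^sub>R (blinfun_inner_left (x - x0) o\<^sub>L \<sigma>' (?y x t))" for x t
  have map_c: "continuous_on (?B \<times> cbox (0::real) 1) (\<lambda>z. ?y (fst z) (snd z))" by (intro continuous_intros)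
  have map_S: "(\<lambda>z. ?y (fst z) (snd z)) ` (?B \<times> cbox 0 1) \<subseteq> ?B" using yB by auto
  note comp = continuous_on_compose2[OF _ map_c map_S]
  have cF: "continuous_on (?B \<times> cbox 0 1) (\<lambda>(x, t). F x t)"
    unfolding F_def split_beta
    by (intro continuous_intros comp[OF c\<sigma>] comp[OF c\<sigma>'] bounded_linear.continuous_on[OF bounded_linear_blinfun_inner_right]
        bounded_linear.continuous_on[OF bounded_linear_blinfun_inner_left])
  have ct: "continuous_on {0..1} (\<lambda>t. s (?y x t))" if "continuous_on ?B s" "x \<in> ?B" for x and s :: "'a \<Rightarrow> 'z::topological_space"
    by (rule continuous_on_compose2[OF that(1)]) (use yB[OF that(2)] in \<open>auto intro!: continuous_intros\<close>)
  have "(f has_derivative (\<lambda>h. \<sigma> x \<bullet> h)) (at x)" if x: "x \<in> ?B" for x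
  proof -
    have "(f has_derivative integral (cbox 0 1) (F x)) (at x within ?B)"
      unfolding f_def
    proof (rule leibniz_rule[OF _ _ cF x convex_ball])
      fix z and t :: real assume z: "z \<in> ?B" and t: "t \<in> cbox 0 1"
      have 0: "((\<lambda>x. ?y x t) has_derivative (\<lambda>h. t *\<^sub>R h)) (at z within ?B)"
        by (auto intro!: derivative_eq_intros)
      have 1: "((\<lambda>x. \<sigma> (?y x t)) has_derivative (\<lambda>h. \<sigma>' (?y z t) (t *\<^sub>R h))) (at z within ?B)"
        by (rule has_derivative_compose[OF 0 d\<sigma>]) (use yB z t in auto)
      have 2: "((\<lambda>x. x - x0) has_derivative (\<lambda>h. h)) (at z within ?B)" by (auto intro!: derivative_eq_intros)
      show "((\<lambda>x. \<sigma> (?y x t) \<bullet> (x - x0)) has_derivative F z t) (at z within ?B)"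
        by (rule has_derivative_eq_rhs[OF has_derivative_inner[OF 1 2]])
          (simp add: F_def fun_eq_iff blinfun.bilinear_simps)
    next
      fix z assume z: "z \<in> ?B"
      show "(\<lambda>t. \<sigma> (?y z t) \<bullet> (z - x0)) integrable_on cbox 0 1"
        by (intro integrable_continuous continuous_intros) (use ct[OF c\<sigma> z] in simp)
    qed
    moreover have "integral (cbox 0 1) (F x) h = \<sigma> x \<bullet> h" for h
    proof -
      have "continuous_on {0..1} (F x)"
        unfolding F_def
        by (intro continuous_intros ct[OF c\<sigma> x] ct[OF c\<sigma>' x] bounded_linear.continuous_on[OF bounded_linear_blinfun_inner_right])
      then have iF: "F x integrable_on cbox 0 1" by (simp add: integrable_continuous_real)
      \<comment> \<open>By the symmetry of the derivative of \<sigma>, the differentiated integrand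
        is the t-derivative of \<open>t * (\<sigma> (?y x t) \<bullet> h)\<close>, so the integral
        is a boundary term.\<close>
      have "((\<lambda>t. F x t h) has_integral (1 *\<^sub>R (\<sigma> (?y x 1) \<bullet> h) - 0 *\<^sub>R (\<sigma> (?y x 0) \<bullet> h))) {0..1}"
      proof (rule fundamental_theorem_of_calculus)
        fix t :: real assume t: "t \<in> {0..1}"
        have 0: "((\<lambda>t. ?y x t) has_derivative (\<lambda>s. s *\<^sub>R (x - x0))) (at t within {0..1})"
          by (auto intro!: derivative_eq_intros)
        have 1: "((\<lambda>t. \<sigma> (?y x t)) has_derivative (\<lambda>s. \<sigma>' (?y x t) (s *\<^sub>R (x - x0)))) (at t within {0..1})"
          by (rule has_derivative_compose[OF 0 d\<sigma>]) (use yB x t in auto)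
        have Fh: "F x t h = \<sigma> (?y x t) \<bullet> h + t * (\<sigma>' (?y x t) (x - x0) \<bullet> h)"
          using sym'[OF yB[OF x t], of h "x - x0"] by (simp add: F_def blinfun.add_left blinfun.scaleR_left)
        show "((\<lambda>t. t *\<^sub>R (\<sigma> (?y x t) \<bullet> h)) has_vector_derivative F x t h) (at t within {0..1})"
          unfolding has_vector_derivative_def
          by (rule has_derivative_eq_rhs[OF has_derivative_scaleR[OF has_derivative_ident has_derivative_inner_left[OF 1]]])
            (simp add: fun_eq_iff Fh blinfun.scaleR_right distrib_left mult_ac)
      qed simp
      then show ?thesis using blinfun_apply_integral[OF iF, of h] by (simp add: integral_unique)
    qed
    ultimately have "(f has_derivative (\<lambda>h. \<sigma> x \<bullet> h)) (at x within ?B)"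
      by (auto intro: has_derivative_eq_rhs)
    then show ?thesis using at_within_open[OF x open_ball] by simp
  qed
  then show ?thesis by blast
qed

lemma curl_free_exact:
  assumes smooth: "smooth_on (ball x0 r) \<sigma>" and curl: "\<And>x. x \<in> ball x0 r \<Longrightarrow> curl \<sigma> x = 0"
  shows "\<exists>f. \<forall>x\<in>ball x0 r. (f has_derivative (\<lambda>h. \<sigma> x \<bullet> h)) (at x)"
proof (rule closed_form_exact[OF smooth])
  fix x h k assume x: "x \<in> ball x0 r"
  let ?D = "frechet_derivative \<sigma> (at x)"
  have d: "(\<sigma> has_derivative ?D) (at x)" by (rule smooth_on_derivative[OF smooth x])
  have nth: "?D v $ j = v $ 1 * partial_deriv 1 (\<lambda>z. \<sigma> z $ j) x + v $ 2 * partial_deriv 2 (\<lambda>z. \<sigma> z $ j) x" for v j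
    using has_derivative_unique[OF bounded_linear.has_derivative[OF bounded_linear_vec_nth d]
        smooth_on_partials[OF smooth_on_vec_nth[OF open_ball smooth] x]] by (rule fun_cong)
  show "?D h \<bullet> k = ?D k \<bullet> h"
    using curl[OF x] by (simp add: inner_vec_def sum_2 nth curl_def algebra_simps)
qed

section \<open>Working in a single chart\<close>

lemma is_chartD:
  assumes "is_chart \<kappa>"
  shows "open (chart_dom \<kappa>)" "open (chart_map \<kappa> ` chart_dom \<kappa>)"
    "p \<in> chart_dom \<kappa> \<Longrightarrow> chart_inv \<kappa> (chart_map \<kappa> p) = p"
    "x \<in> chart_map \<kappa> ` chart_dom \<kappa> \<Longrightarrow> chart_map \<kappa> (chart_inv \<kappa> x) = x"
    "x \<in> chart_map \<kappa> ` chart_dom \<kappa> \<Longrightarrow> chart_inv \<kappa> x \<in> chart_dom \<kappa>"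
    "continuous_on (chart_dom \<kappa>) (chart_map \<kappa>)"
    "continuous_on (chart_map \<kappa> ` chart_dom \<kappa>) (chart_inv \<kappa>)"
  using assms unfolding is_chart_def homeomorphism_def by auto

lemma chart_image_open:
  assumes "is_chart \<kappa>" "open U" "U \<subseteq> chart_dom \<kappa>"
  shows "open (chart_map \<kappa> ` U)"
proof -
  have "chart_map \<kappa> ` U = (chart_map \<kappa> ` chart_dom \<kappa>) \<inter> chart_inv \<kappa> -` U"
    using assms(3) is_chartD(3-5)[OF assms(1)] by force
  then show ?thesis
    using continuous_open_preimage[OF is_chartD(7,2)[OF assms(1)] assms(2)] by simp
qed

lemma chart_preimage_open:
  assumes "is_chart \<kappa>" "open D" "D \<subseteq> chart_map \<kappa> ` chart_dom \<kappa>"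
  shows "open (chart_inv \<kappa> ` D)"
proof -
  have "chart_inv \<kappa> ` D = chart_dom \<kappa> \<inter> chart_map \<kappa> -` D"
    using assms(3) is_chartD(3-5)[OF assms(1)] by force
  then show ?thesis
    using continuous_open_preimage[OF is_chartD(6,1)[OF assms(1)] assms(2)] by simp
qed

definition smooth_charts :: "('m::topological_space, 'n::finite) chart \<Rightarrow> ('m, 'n) chart \<Rightarrow> bool" where
  "smooth_charts \<kappa> \<kappa>' \<longleftrightarrow> is_chart \<kappa> \<and> is_chart \<kappa>' \<and>
     smooth_on (chart_map \<kappa> ` (chart_dom \<kappa> \<inter> chart_dom \<kappa>')) (transition \<kappa> \<kappa>') \<and>
     smooth_on (chart_map \<kappa>' ` (chart_dom \<kappa> \<inter> chart_dom \<kappa>')) (transition \<kappa>' \<kappa>)"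

text \<open>The model chart does not belong to the atlas \<open>A\<close>, and tangent vectors have
  the value 0 at charts outside \<open>A\<close>. All work in the model chart therefore goes through
  the transition maps to atlas charts. Orientation is not part of this notion.\<close>

definition compatible :: "('m::topological_space, 'n::finite) chart set \<Rightarrow> ('m, 'n) chart \<Rightarrow> bool" where
  "compatible A \<kappa> \<longleftrightarrow> is_chart \<kappa> \<and> (\<forall>\<kappa>'\<in>A. smooth_charts \<kappa> \<kappa>')"

definition tderiv :: "('m::topological_space, 'n::finite) chart \<Rightarrow> ('m, 'n) chart \<Rightarrow> 'm \<Rightarrow> real^'n \<Rightarrow> real^'n" where
  "tderiv \<kappa> \<kappa>' p = frechet_derivative (transition \<kappa> \<kappa>') (at (chart_map \<kappa> p))"

text \<open>The tangent vector with coordinates \<open>y\<close> in the chart \<kappa>, meaningful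
  also for compatible charts outside \<open>A\<close>.\<close>

definition tvec :: "('m::topological_space, 'n::finite) chart set \<Rightarrow> ('m, 'n) chart \<Rightarrow> 'm \<Rightarrow> real^'n \<Rightarrow> ('m, 'n) tangent" where
  "tvec A \<kappa> p y = (\<lambda>\<kappa>'. if \<kappa>' \<in> charts_at A p then tderiv \<kappa> \<kappa>' p y else 0)"

lemma smooth_charts_sym: "smooth_charts \<kappa> \<kappa>' \<Longrightarrow> smooth_charts \<kappa>' \<kappa>"
  by (simp add: smooth_charts_def Int_commute)

lemma smooth_chartsD:
  assumes "smooth_charts \<kappa> \<kappa>'"
  shows "is_chart \<kappa>" "is_chart \<kappa>'"
    "smooth_on (chart_map \<kappa> ` (chart_dom \<kappa> \<inter> chart_dom \<kappa>')) (transition \<kappa> \<kappa>')"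
    "open (chart_map \<kappa> ` (chart_dom \<kappa> \<inter> chart_dom \<kappa>'))"
  using assms chart_image_open[of \<kappa> "chart_dom \<kappa> \<inter> chart_dom \<kappa>'"] is_chartD(1)[of \<kappa>] is_chartD(1)[of \<kappa>']
  by (auto simp: smooth_charts_def open_Int)

lemma atlas_compatible: "oriented_atlas A \<Longrightarrow> \<kappa> \<in> A \<Longrightarrow> compatible A \<kappa>"
  unfolding oriented_atlas_def compatible_def smooth_charts_def by (metis Int_commute)

lemma atlas_charts_at:
  assumes "oriented_atlas A"
  obtains \<kappa> where "\<kappa> \<in> charts_at A p"
proof -
  have "p \<in> (\<Union>\<kappa>\<in>A. chart_dom \<kappa>)" using assms by (simp add: oriented_atlas_def)
  then show ?thesis using that by (auto simp: charts_at_def)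
qed

lemma compatible_charts_at: "compatible A \<kappa> \<Longrightarrow> \<kappa>' \<in> charts_at A p \<Longrightarrow> smooth_charts \<kappa> \<kappa>' \<and> p \<in> chart_dom \<kappa>'"
  by (auto simp: compatible_def charts_at_def)

lemma transition_map: "is_chart \<kappa> \<Longrightarrow> p \<in> chart_dom \<kappa> \<Longrightarrow> transition \<kappa> \<kappa>' (chart_map \<kappa> p) = chart_map \<kappa>' p"
  by (simp add: transition_def is_chartD(3))

lemma tderiv_works:
  assumes "smooth_charts \<kappa> \<kappa>'" "p \<in> chart_dom \<kappa>" "p \<in> chart_dom \<kappa>'"
  shows "(transition \<kappa> \<kappa>' has_derivative tderiv \<kappa> \<kappa>' p) (at (chart_map \<kappa> p))"
  unfolding tderiv_def by (rule smooth_on_derivative[OF smooth_chartsD(3)[OF assms(1)]]) (use assms in auto)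

lemma tderiv_compose:
  assumes 1: "smooth_charts \<kappa>1 \<kappa>2" and 2: "smooth_charts \<kappa>2 \<kappa>3"
    and p: "p \<in> chart_dom \<kappa>1" "p \<in> chart_dom \<kappa>2" "p \<in> chart_dom \<kappa>3"
  shows "tderiv \<kappa>2 \<kappa>3 p (tderiv \<kappa>1 \<kappa>2 p v) = tderiv \<kappa>1 \<kappa>3 p v"
proof -
  let ?U = "chart_dom \<kappa>1 \<inter> chart_dom \<kappa>2 \<inter> chart_dom \<kappa>3"
  note c = smooth_chartsD(1)[OF 1] smooth_chartsD(1)[OF 2] smooth_chartsD(2)[OF 2]
  have oU: "open (chart_map \<kappa>1 ` ?U)" by (intro chart_image_open[OF c(1)] open_Int is_chartD(1) c) auto
  have d: "(transition \<kappa>2 \<kappa>3 has_derivative tderiv \<kappa>2 \<kappa>3 p) (at (transition \<kappa>1 \<kappa>2 (chart_map \<kappa>1 p)))"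
    using tderiv_works[OF 2 p(2,3)] by (simp add: transition_map[OF c(1) p(1)])
  have "((\<lambda>x. transition \<kappa>2 \<kappa>3 (transition \<kappa>1 \<kappa>2 x)) has_derivative (\<lambda>v. tderiv \<kappa>2 \<kappa>3 p (tderiv \<kappa>1 \<kappa>2 p v))) (at (chart_map \<kappa>1 p))"
    by (rule has_derivative_compose[OF tderiv_works[OF 1 p(1,2)] d])
  then have "(transition \<kappa>1 \<kappa>3 has_derivative (\<lambda>v. tderiv \<kappa>2 \<kappa>3 p (tderiv \<kappa>1 \<kappa>2 p v))) (at (chart_map \<kappa>1 p))"
    by (rule has_derivative_transform_within_open[OF _ oU]) (use p c in \<open>auto simp: transition_map\<close>)
  from fun_cong[OF frechet_derivative_at[OF this], of v] show ?thesis by (simp add: tderiv_def)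
qed

lemma tderiv_self:
  assumes "is_chart \<kappa>" "p \<in> chart_dom \<kappa>"
  shows "tderiv \<kappa> \<kappa> p v = v"
proof -
  have "(transition \<kappa> \<kappa> has_derivative (\<lambda>v. v)) (at (chart_map \<kappa> p))"
    by (rule has_derivative_transform_within_open[OF has_derivative_ident is_chartD(2)[OF assms(1)]])
      (use assms in \<open>auto simp: transition_map\<close>)
  from fun_cong[OF frechet_derivative_at[OF this], of v] show ?thesis by (simp add: tderiv_def)
qed

lemma coord_vec_tvec: "coord_vec A \<kappa> p i = tvec A \<kappa> p (axis i 1)"
  by (auto simp: fun_eq_iff coord_vec_def tvec_def tderiv_def)

lemma tvec_linear:
  assumes "compatible A \<kappa>" "p \<in> chart_dom \<kappa>"
  shows "tvec A \<kappa> p (a *\<^sub>R y + b *\<^sub>R z) = a *\<^sub>R tvec A \<kappa> p y + b *\<^sub>R tvec A \<kappa> p z"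
proof -
  have "tderiv \<kappa> \<kappa>' p (a *\<^sub>R y + b *\<^sub>R z) = a *\<^sub>R tderiv \<kappa> \<kappa>' p y + b *\<^sub>R tderiv \<kappa> \<kappa>' p z"
    if "\<kappa>' \<in> charts_at A p" for \<kappa>'
  proof -
    have l: "linear (tderiv \<kappa> \<kappa>' p)"
      using tderiv_works compatible_charts_at[OF assms(1) that] assms(2) has_derivative_linear by blast
    show ?thesis by (simp add: linear_add[OF l] linear_cmul[OF l])
  qed
  then show ?thesis by (auto simp: tvec_def fun_eq_iff scaleR_fun_def plus_fun_def)
qed

lemma tvec_tangent:
  assumes "oriented_atlas A" "compatible A \<kappa>" "p \<in> chart_dom \<kappa>"
  shows "tvec A \<kappa> p y \<in> tangent_space A p"
proof -
  have *: "tvec A \<kappa> p y \<kappa>2 = tderiv \<kappa>1 \<kappa>2 p (tvec A \<kappa> p y \<kappa>1)"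
    if 1: "\<kappa>1 \<in> charts_at A p" and 2: "\<kappa>2 \<in> charts_at A p" for \<kappa>1 \<kappa>2
  proof -
    have "compatible A \<kappa>1" using atlas_compatible[OF assms(1)] 1 by (simp add: charts_at_def)
    then show ?thesis
      using compatible_charts_at[OF assms(2) 1] compatible_charts_at[OF _ 2, of \<kappa>1] 1 2 assms(3)
      by (simp add: tvec_def tderiv_compose charts_at_def)
  qed
  show ?thesis
    unfolding tangent_space_def mem_Collect_eq
  proof (intro conjI allI ballI impI)
    show "tvec A \<kappa> p y \<kappa>' = 0" if "\<kappa>' \<notin> charts_at A p" for \<kappa>' using that by (simp add: tvec_def)
  qed (rule *[unfolded tderiv_def])
qed

lemma tangent_spaceD:
  assumes "v \<in> tangent_space A p"
  shows "\<kappa> \<in> charts_at A p \<Longrightarrow> \<kappa>' \<in> charts_at A p \<Longrightarrow> v \<kappa>' = tderiv \<kappa> \<kappa>' p (v \<kappa>)"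
    and "\<kappa> \<notin> charts_at A p \<Longrightarrow> v \<kappa> = 0"
  using assms unfolding tangent_space_def tderiv_def mem_Collect_eq by blast+

lemma tangent_tvec:
  assumes "oriented_atlas A" "compatible A \<kappa>" "p \<in> chart_dom \<kappa>" "v \<in> tangent_space A p" "\<kappa>' \<in> charts_at A p"
  shows "v = tvec A \<kappa> p (tderiv \<kappa>' \<kappa> p (v \<kappa>'))"
proof
  fix \<kappa>2
  show "v \<kappa>2 = tvec A \<kappa> p (tderiv \<kappa>' \<kappa> p (v \<kappa>')) \<kappa>2"
  proof (cases "\<kappa>2 \<in> charts_at A p")
    case True
    have "v \<kappa>2 = tderiv \<kappa>' \<kappa>2 p (v \<kappa>')"
      by (rule tangent_spaceD(1)[OF assms(4,5) True])
    moreover have "tderiv \<kappa> \<kappa>2 p (tderiv \<kappa>' \<kappa> p (v \<kappa>')) = tderiv \<kappa>' \<kappa>2 p (v \<kappa>')"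
      using compatible_charts_at[OF assms(2) True] compatible_charts_at[OF assms(2,5)] assms(3)
      by (intro tderiv_compose) (auto intro: smooth_charts_sym)
    ultimately show ?thesis using True by (simp add: tvec_def)
  next
    case False
    then show ?thesis using tangent_spaceD(2)[OF assms(4)] by (simp add: tvec_def)
  qed
qed

lemma tvec_rep:
  assumes "compatible A \<kappa>" "p \<in> chart_dom \<kappa>" "\<kappa>' \<in> charts_at A p"
  shows "tderiv \<kappa>' \<kappa> p (tvec A \<kappa> p y \<kappa>') = y"
proof -
  have sc: "smooth_charts \<kappa> \<kappa>'" and p': "p \<in> chart_dom \<kappa>'" using compatible_charts_at[OF assms(1,3)] by auto
  show ?thesis
    using tderiv_compose[OF sc smooth_charts_sym[OF sc] assms(2) p' assms(2)] assms(3)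
    by (simp add: tvec_def tderiv_self[OF smooth_chartsD(1)[OF sc] assms(2)])
qed

lemma tvec_atlas:
  assumes "oriented_atlas A" "\<kappa> \<in> charts_at A p"
  shows "tvec A \<kappa> p y \<kappa> = y"
  using assms tderiv_self[of \<kappa> p] by (auto simp: tvec_def charts_at_def oriented_atlas_def)

lemma tvec_inj:
  assumes "oriented_atlas A" "compatible A \<kappa>" "p \<in> chart_dom \<kappa>" "tvec A \<kappa> p y = tvec A \<kappa> p z"
  shows "y = z"
proof -
  obtain \<kappa>' where "\<kappa>' \<in> charts_at A p" using atlas_charts_at[OF assms(1)] by blast
  then show ?thesis using tvec_rep[OF assms(2,3)] assms(4) by metis
qed

lemma tvec_change:
  assumes "oriented_atlas A" "compatible A \<kappa>" "compatible A \<kappa>'" "smooth_charts \<kappa> \<kappa>'" "p \<in> chart_dom \<kappa>" "p \<in> chart_dom \<kappa>'"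
  shows "tvec A \<kappa> p y = tvec A \<kappa>' p (tderiv \<kappa> \<kappa>' p y)"
proof -
  have "tderiv \<kappa>' \<kappa>2 p (tderiv \<kappa> \<kappa>' p y) = tderiv \<kappa> \<kappa>2 p y" if "\<kappa>2 \<in> charts_at A p" for \<kappa>2
    using compatible_charts_at[OF assms(3) that] assms by (intro tderiv_compose) auto
  then show ?thesis by (auto simp: tvec_def)
qed

lemma continuous_on_frechet_apply:
  assumes "open S" "smooth_on S T" "continuous_on I x" "x ` I \<subseteq> S" "continuous_on I w"
  shows "continuous_on I (\<lambda>t. frechet_derivative T (at (x t)) (w t))"
proof -
  have c: "continuous_on I (\<lambda>t. frechet_derivative T (at (x t)) b)" for b
    by (rule continuous_on_compose2[OF smooth_on_imp_continuous[OF smooth_on_frechet[OF assms(1,2)]] assms(3,4)])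
  have "continuous_on I (\<lambda>t. \<Sum>b\<in>Basis. (w t \<bullet> b) *\<^sub>R frechet_derivative T (at (x t)) b)"
    by (intro continuous_intros c assms(5))
  then show ?thesis
  proof (rule continuous_on_eq)
    fix t assume "t \<in> I"
    then have l: "linear (frechet_derivative T (at (x t)))"
      using smooth_on_derivative[OF assms(2)] assms(4) has_derivative_linear by blast
    show "(\<Sum>b\<in>Basis. (w t \<bullet> b) *\<^sub>R frechet_derivative T (at (x t)) b) = frechet_derivative T (at (x t)) (w t)"
      by (subst (2) euclidean_representation[of "w t", symmetric]) (simp only: linear_sum[OF l] linear_cmul[OF l])
  qed
qed

lemma smooth_on_frechet_apply:
  assumes "open S" "smooth_on S T" "smooth_on S w"
  shows "smooth_on S (\<lambda>x. frechet_derivative T (at x) (w x))"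
proof (rule smooth_on_cong[OF assms(1)])
  show "smooth_on S (\<lambda>x. \<Sum>b\<in>Basis. (w x \<bullet> b) *\<^sub>R frechet_derivative T (at x) b)"
    by (intro smooth_on_sum smooth_on_scaleR assms smooth_on_frechet smooth_on_bounded_linear[OF assms(1) bounded_linear_inner_left])
  fix x assume x: "x \<in> S"
  have l: "linear (frechet_derivative T (at x))"
    using smooth_on_derivative[OF assms(2) x] has_derivative_linear by blast
  show "(\<Sum>b\<in>Basis. (w x \<bullet> b) *\<^sub>R frechet_derivative T (at x) b) = frechet_derivative T (at x) (w x)"
    by (subst (2) euclidean_representation[of "w x", symmetric]) (simp only: linear_sum[OF l] linear_cmul[OF l])
qed

subsection \<open>Curves\<close>

lemma eventually_in_dom:
  assumes "continuous (at t within I) c" "open U" "c t \<in> U"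
  shows "\<forall>\<^sub>F s in at t within I. c s \<in> U"
  using assms by (simp add: continuous_within topological_tendstoD)

lemma curve_chart_change:
  assumes sc: "smooth_charts \<kappa> \<kappa>'" and t: "t \<in> I" "c t \<in> chart_dom \<kappa>" "c t \<in> chart_dom \<kappa>'"
    and c: "continuous (at t within I) c"
    and d: "((chart_map \<kappa> \<circ> c) has_vector_derivative y) (at t within I)"
  shows "((chart_map \<kappa>' \<circ> c) has_vector_derivative tderiv \<kappa> \<kappa>' (c t) y) (at t within I)"
proof -
  note ch = smooth_chartsD(1,2)[OF sc]
  have l: "linear (tderiv \<kappa> \<kappa>' (c t))" using tderiv_works[OF sc t(2,3)] has_derivative_linear by blast
  have "((\<lambda>s. transition \<kappa> \<kappa>' ((chart_map \<kappa> \<circ> c) s)) has_derivative (\<lambda>s. tderiv \<kappa> \<kappa>' (c t) (s *\<^sub>R y))) (at t within I)"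
    by (rule has_derivative_compose[OF d[unfolded has_vector_derivative_def]])
      (use tderiv_works[OF sc t(2,3)] in simp)
  then have "((chart_map \<kappa>' \<circ> c) has_derivative (\<lambda>s. tderiv \<kappa> \<kappa>' (c t) (s *\<^sub>R y))) (at t within I)"
  proof (rule has_derivative_transform_eventually)
    show "\<forall>\<^sub>F s in at t within I. transition \<kappa> \<kappa>' ((chart_map \<kappa> \<circ> c) s) = (chart_map \<kappa>' \<circ> c) s"
      using eventually_in_dom[OF c is_chartD(1)[OF ch(1)] t(2)]
      by eventually_elim (simp add: transition_map[OF ch(1)])
  qed (use t in \<open>auto simp: transition_map[OF ch(1)]\<close>)
  then show ?thesis by (simp add: has_vector_derivative_def linear_cmul[OF l])
qed

text \<open>\<open>C1_curve\<close> and \<open>velocity\<close> test a curve only in atlas charts;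
  the chain rule transfers both to a compatible chart, where lengths are computed later.\<close>

lemma C1_curve_chart:
  assumes A: "oriented_atlas A" and \<kappa>: "compatible A \<kappa>" and c: "C1_curve A c" and t: "t \<in> {0..1}" "c t \<in> chart_dom \<kappa>"
  shows "((chart_map \<kappa> \<circ> c) has_vector_derivative vector_derivative (chart_map \<kappa> \<circ> c) (at t within {0..1})) (at t within {0..1})"
    and "velocity A c t = tvec A \<kappa> (c t) (vector_derivative (chart_map \<kappa> \<circ> c) (at t within {0..1}))"
    and "\<kappa>' \<in> charts_at A (c t) \<Longrightarrow> vector_derivative (chart_map \<kappa> \<circ> c) (at t within {0..1}) = tderiv \<kappa>' \<kappa> (c t) (velocity A c t \<kappa>')"
proof -
  let ?v = "\<lambda>\<kappa>. vector_derivative (chart_map \<kappa> \<circ> c) (at t within {0..1})"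
  have cc: "continuous (at t within {0..1}) c"
    using c t(1) by (auto simp: C1_curve_def continuous_on_eq_continuous_within)
  have v: "((chart_map \<kappa>' \<circ> c) has_vector_derivative ?v \<kappa>') (at t within {0..1})" if "\<kappa>' \<in> charts_at A (c t)" for \<kappa>'
    using c t(1) that by (auto simp: C1_curve_def charts_at_def vector_derivative_works[symmetric])
  have w: "((chart_map \<kappa> \<circ> c) has_vector_derivative tderiv \<kappa>' \<kappa> (c t) (?v \<kappa>')) (at t within {0..1})" if "\<kappa>' \<in> charts_at A (c t)" for \<kappa>'
    using compatible_charts_at[OF \<kappa> that] by (intro curve_chart_change[OF _ t(1) _ t(2) cc v[OF that]]) (auto intro: smooth_charts_sym)
  obtain \<kappa>0 where \<kappa>0: "\<kappa>0 \<in> charts_at A (c t)" using atlas_charts_at[OF A] by blast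
  show W: "((chart_map \<kappa> \<circ> c) has_vector_derivative ?v \<kappa>) (at t within {0..1})"
    using w[OF \<kappa>0] vector_derivative_works by (metis differentiableI_vector)
  show "velocity A c t = tvec A \<kappa> (c t) (?v \<kappa>)"
  proof
    fix \<kappa>'
    show "velocity A c t \<kappa>' = tvec A \<kappa> (c t) (?v \<kappa>) \<kappa>'"
    proof (cases "\<kappa>' \<in> charts_at A (c t)")
      case True
      have "((chart_map \<kappa>' \<circ> c) has_vector_derivative tderiv \<kappa> \<kappa>' (c t) (?v \<kappa>)) (at t within {0..1})"
        using compatible_charts_at[OF \<kappa> True] by (intro curve_chart_change[OF _ t _ cc W]) auto
      from vector_derivative_within_closed_interval[OF _ _ this] t(1) True show ?thesis
        by (simp add: velocity_def tvec_def)
    qed (simp add: velocity_def tvec_def)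
  qed
  show "?v \<kappa> = tderiv \<kappa>' \<kappa> (c t) (velocity A c t \<kappa>')" if "\<kappa>' \<in> charts_at A (c t)"
    using vector_derivative_within_closed_interval[OF _ _ w[OF that]] t(1) that by (simp add: velocity_def)
qed

lemma continuous_on_local:
  fixes f :: "real \<Rightarrow> 'a::topological_space"
  assumes "\<And>t. t \<in> S \<Longrightarrow> \<exists>T. open T \<and> t \<in> T \<and> continuous_on (S \<inter> T) f"
  shows "continuous_on S f"
  unfolding continuous_on_eq_continuous_within
proof
  fix t assume t: "t \<in> S"
  then obtain T where T: "open T" "t \<in> T" "continuous_on (S \<inter> T) f" using assms by blast
  then have "continuous (at t within S \<inter> T) f" using t by (simp add: continuous_on_eq_continuous_within)
  moreover have "at t within S \<inter> T = at t within S" by (rule at_within_nhd[OF T(2,1)]) auto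
  ultimately show "continuous (at t within S) f" by (simp add: continuous_within)
qed

lemma C1_curve_chart_continuous:
  assumes A: "oriented_atlas A" and \<kappa>: "compatible A \<kappa>" and c: "C1_curve A c"
  shows "continuous_on {t\<in>{0..1}. c t \<in> chart_dom \<kappa>} (\<lambda>t. vector_derivative (chart_map \<kappa> \<circ> c) (at t within {0..1}))"
proof (rule continuous_on_local)
  fix t0 assume t0: "t0 \<in> {t\<in>{0..1}. c t \<in> chart_dom \<kappa>}"
  obtain \<kappa>' where \<kappa>': "\<kappa>' \<in> charts_at A (c t0)" using atlas_charts_at[OF A] by blast
  have sc: "smooth_charts \<kappa>' \<kappa>" using compatible_charts_at[OF \<kappa> \<kappa>'] smooth_charts_sym by blast
  note ch = smooth_chartsD(1)[OF sc]
  have "\<kappa>' \<in> A" using \<kappa>' by (simp add: charts_at_def)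
  have cc: "continuous_on {0..1} c" using c by (simp add: C1_curve_def)
  obtain T where T: "open T" "T \<inter> {0..1} = c -` chart_dom \<kappa>' \<inter> {0..1}"
    using cc is_chartD(1)[OF ch] unfolding continuous_on_open_invariant by blast
  let ?S = "{t\<in>{0..1}. c t \<in> chart_dom \<kappa>} \<inter> T"
  have dom: "c t \<in> chart_dom \<kappa>'" "\<kappa>' \<in> charts_at A (c t)" "t \<in> {0..1}" "c t \<in> chart_dom \<kappa>" if "t \<in> ?S" for t
  proof -
    have "t \<in> c -` chart_dom \<kappa>' \<inter> {0..1}" using that unfolding T(2)[symmetric] by simp
    then show "c t \<in> chart_dom \<kappa>'" "\<kappa>' \<in> charts_at A (c t)" "t \<in> {0..1}" "c t \<in> chart_dom \<kappa>"
      using that \<open>\<kappa>' \<in> A\<close> by (auto simp: charts_at_def)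
  qed
  have "continuous_on ?S (\<lambda>t. frechet_derivative (transition \<kappa>' \<kappa>) (at (chart_map \<kappa>' (c t))) (velocity A c t \<kappa>'))"
  proof (rule continuous_on_frechet_apply[OF smooth_chartsD(4,3)[OF sc]])
    show "continuous_on ?S (\<lambda>t. chart_map \<kappa>' (c t))"
      by (rule continuous_on_compose2[OF is_chartD(6)[OF ch] continuous_on_subset[OF cc]]) (use dom in blast)+
    have "continuous_on {t\<in>{0..1}. c t \<in> chart_dom \<kappa>'} (\<lambda>t. velocity A c t \<kappa>')"
      using c \<open>\<kappa>' \<in> A\<close> unfolding C1_curve_def by blast
    then show "continuous_on ?S (\<lambda>t. velocity A c t \<kappa>')"
      by (rule continuous_on_subset) (use dom in blast)
    show "(\<lambda>t. chart_map \<kappa>' (c t)) ` ?S \<subseteq> chart_map \<kappa>' ` (chart_dom \<kappa>' \<inter> chart_dom \<kappa>)"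
      using dom by blast
  qed
  then have "continuous_on ?S (\<lambda>t. vector_derivative (chart_map \<kappa> \<circ> c) (at t within {0..1}))"
  proof (rule continuous_on_eq)
    fix t assume "t \<in> ?S"
    note dom = dom[OF this]
    show "frechet_derivative (transition \<kappa>' \<kappa>) (at (chart_map \<kappa>' (c t))) (velocity A c t \<kappa>')
        = vector_derivative (chart_map \<kappa> \<circ> c) (at t within {0..1})"
      using C1_curve_chart(3)[OF A \<kappa> c dom(3,4,2)] by (simp add: tderiv_def)
  qed
  moreover have "t0 \<in> T" using T(2) t0 \<kappa>' by (auto simp: charts_at_def)
  ultimately show "\<exists>T. open T \<and> t0 \<in> T \<and> continuous_on ({t\<in>{0..1}. c t \<in> chart_dom \<kappa>} \<inter> T) (\<lambda>t. vector_derivative (chart_map \<kappa> \<circ> c) (at t within {0..1}))"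
    using T(1) by blast
qed

lemma C1_curve_lift:
  assumes A: "oriented_atlas A" and \<kappa>: "compatible A \<kappa>"
    and \<gamma>: "\<And>t. t \<in> {0..1} \<Longrightarrow> \<gamma> t \<in> chart_map \<kappa> ` chart_dom \<kappa>"
    and d: "\<And>t. t \<in> {0..1} \<Longrightarrow> (\<gamma> has_vector_derivative \<gamma>' t) (at t within {0..1})"
    and c': "continuous_on {0..1} \<gamma>'"
  shows "C1_curve A (chart_inv \<kappa> \<circ> \<gamma>)"
    and "t \<in> {0..1} \<Longrightarrow> velocity A (chart_inv \<kappa> \<circ> \<gamma>) t = tvec A \<kappa> (chart_inv \<kappa> (\<gamma> t)) (\<gamma>' t)"
proof -
  let ?c = "chart_inv \<kappa> \<circ> \<gamma>"
  have ch: "is_chart \<kappa>" using \<kappa> by (simp add: compatible_def)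
  have c\<gamma>: "continuous_on {0..1} \<gamma>"
    unfolding continuous_on_eq_continuous_within using has_vector_derivative_continuous[OF d] by blast
  have cc: "continuous_on {0..1} ?c"
    unfolding o_def by (rule continuous_on_compose2[OF is_chartD(7)[OF ch] c\<gamma>]) (use \<gamma> in auto)
  have dom: "?c t \<in> chart_dom \<kappa>" and m: "chart_map \<kappa> (?c t) = \<gamma> t" if "t \<in> {0..1}" for t
    using is_chartD(4,5)[OF ch \<gamma>[OF that]] by auto
  have d\<kappa>: "((chart_map \<kappa> \<circ> ?c) has_vector_derivative \<gamma>' t) (at t within {0..1})" if "t \<in> {0..1}" for t
    by (rule has_vector_derivative_transform[OF that _ d[OF that]]) (use m in auto)
  have d': "((chart_map \<kappa>' \<circ> ?c) has_vector_derivative tderiv \<kappa> \<kappa>' (?c t) (\<gamma>' t)) (at t within {0..1})"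
    if "t \<in> {0..1}" "\<kappa>' \<in> charts_at A (?c t)" for t \<kappa>'
  proof (rule curve_chart_change[OF _ that(1) dom[OF that(1)] _ _ d\<kappa>[OF that(1)]])
    show "smooth_charts \<kappa> \<kappa>'" "?c t \<in> chart_dom \<kappa>'" using compatible_charts_at[OF \<kappa> that(2)] by auto
    show "continuous (at t within {0..1}) ?c" using cc that(1) unfolding continuous_on_eq_continuous_within by blast
  qed
  have vel: "velocity A ?c t \<kappa>' = tderiv \<kappa> \<kappa>' (?c t) (\<gamma>' t)" if "t \<in> {0..1}" "\<kappa>' \<in> charts_at A (?c t)" for t \<kappa>'
    using vector_derivative_within_closed_interval[OF _ _ d'[OF that]] that by (simp add: velocity_def)
  show "velocity A ?c t = tvec A \<kappa> (chart_inv \<kappa> (\<gamma> t)) (\<gamma>' t)" if "t \<in> {0..1}"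
    using vel[OF that] by (auto simp: tvec_def fun_eq_iff) (simp add: velocity_def)
  show "C1_curve A ?c"
    unfolding C1_curve_def
  proof (intro conjI cc ballI impI)
    fix \<kappa>' t assume "\<kappa>' \<in> A" "t \<in> {0..1::real}" "?c t \<in> chart_dom \<kappa>'"
    then show "(chart_map \<kappa>' \<circ> ?c) differentiable (at t within {0..1})"
      using d'[of t \<kappa>'] by (auto simp: charts_at_def intro: differentiableI_vector)
  next
    fix \<kappa>' assume k: "\<kappa>' \<in> A"
    let ?S = "{t\<in>{0..1}. ?c t \<in> chart_dom \<kappa>'}"
    have sc: "smooth_charts \<kappa> \<kappa>'" using \<kappa> k by (simp add: compatible_def)
    have "continuous_on ?S (\<lambda>t. frechet_derivative (transition \<kappa> \<kappa>') (at (\<gamma> t)) (\<gamma>' t))"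
    proof (rule continuous_on_frechet_apply[OF smooth_chartsD(4,3)[OF sc]])
      show "\<gamma> ` ?S \<subseteq> chart_map \<kappa> ` (chart_dom \<kappa> \<inter> chart_dom \<kappa>')"
      proof
        fix x assume "x \<in> \<gamma> ` ?S"
        then obtain t where "t \<in> {0..1}" "?c t \<in> chart_dom \<kappa>'" "x = \<gamma> t" by auto
        then show "x \<in> chart_map \<kappa> ` (chart_dom \<kappa> \<inter> chart_dom \<kappa>')"
          using dom[of t] m[of t] by (intro image_eqI[of _ _ "?c t"]) auto
      qed
      show "continuous_on ?S \<gamma>" by (rule continuous_on_subset[OF c\<gamma>]) blast
      show "continuous_on ?S \<gamma>'" by (rule continuous_on_subset[OF c']) blast
    qed
    then show "continuous_on ?S (\<lambda>t. velocity A ?c t \<kappa>')"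
    proof (rule continuous_on_eq)
      fix t assume "t \<in> ?S"
      then have t: "t \<in> {0..1}" "\<kappa>' \<in> charts_at A (?c t)" using k by (auto simp: charts_at_def)
      show "frechet_derivative (transition \<kappa> \<kappa>') (at (\<gamma> t)) (\<gamma>' t) = velocity A ?c t \<kappa>'"
        unfolding vel[OF t] tderiv_def m[OF t(1)] ..
    qed
  qed
qed

subsection \<open>Vector fields and maps in a chart\<close>

definition vfield :: "('m::topological_space, 'n::finite) chart set \<Rightarrow> ('m, 'n) chart \<Rightarrow> 'm set \<Rightarrow> (real^'n \<Rightarrow> real^'n) \<Rightarrow>
    'm \<Rightarrow> ('m, 'n) tangent" where
  "vfield A \<kappa> W k = (\<lambda>p. if p \<in> W then tvec A \<kappa> p (k (chart_map \<kappa> p)) else 0)"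

lemma chart_image_mem:
  assumes "is_chart \<kappa>" "x \<in> chart_map \<kappa> ` U" "U \<subseteq> chart_dom \<kappa>"
  shows "chart_inv \<kappa> x \<in> U" "chart_map \<kappa> (chart_inv \<kappa> x) = x"
  using assms is_chartD(3)[OF assms(1)] by auto

lemma vfield_in_vector_fields:
  assumes A: "oriented_atlas A" and \<kappa>: "compatible A \<kappa>" and W: "open W" "W \<subseteq> chart_dom \<kappa>"
    and k: "smooth_on (chart_map \<kappa> ` W) k"
  shows "vfield A \<kappa> W k \<in> vector_fields A W"
proof -
  have "smooth_on (chart_map \<kappa>' ` (chart_dom \<kappa>' \<inter> W)) (\<lambda>x. vfield A \<kappa> W k (chart_inv \<kappa>' x) \<kappa>')" if k': "\<kappa>' \<in> A" for \<kappa>'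
  proof -
    have sc: "smooth_charts \<kappa> \<kappa>'" using \<kappa> k' unfolding compatible_def by blast
    note ch = smooth_chartsD(1,2)[OF sc]
    let ?U = "W \<inter> chart_dom \<kappa>'"
    let ?S = "chart_map \<kappa> ` ?U" and ?S' = "chart_map \<kappa>' ` (chart_dom \<kappa>' \<inter> W)"
    have oS: "open ?S" by (rule chart_image_open[OF ch(1)]) (use W is_chartD(1)[OF ch(2)] in \<open>auto intro: open_Int\<close>)
    have oS': "open ?S'" by (rule chart_image_open[OF ch(2)]) (use W is_chartD(1)[OF ch(2)] in \<open>auto intro: open_Int\<close>)
    have "smooth_on ?S (\<lambda>z. frechet_derivative (transition \<kappa> \<kappa>') (at z) (k z))"
      by (rule smooth_on_frechet_apply[OF oS smooth_on_subset[OF smooth_chartsD(3)[OF sc]] smooth_on_subset[OF k]])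
        (use W in auto)
    moreover have "smooth_on ?S' (transition \<kappa>' \<kappa>)"
      by (rule smooth_on_subset[OF smooth_chartsD(3)[OF smooth_charts_sym[OF sc]]]) (use W in auto)
    moreover have "transition \<kappa>' \<kappa> ` ?S' \<subseteq> ?S"
      using W transition_map[OF ch(2), of _ \<kappa>] by auto
    ultimately have "smooth_on ?S' (\<lambda>x. frechet_derivative (transition \<kappa> \<kappa>') (at (transition \<kappa>' \<kappa> x)) (k (transition \<kappa>' \<kappa> x)))"
      by (rule smooth_on_compose[OF oS' oS])
    then show ?thesis
    proof (rule smooth_on_cong[OF oS', rotated])
      fix x assume x: "x \<in> ?S'"
      define p where "p = chart_inv \<kappa>' x"
      have p: "p \<in> chart_dom \<kappa>'" "p \<in> W" "chart_map \<kappa>' p = x"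
        using chart_image_mem[OF ch(2) x] by (auto simp: p_def)
      show "frechet_derivative (transition \<kappa> \<kappa>') (at (transition \<kappa>' \<kappa> x)) (k (transition \<kappa>' \<kappa> x)) = vfield A \<kappa> W k (chart_inv \<kappa>' x) \<kappa>'"
        using p k' transition_map[OF ch(2) p(1), of \<kappa>]
        by (simp add: p_def[symmetric] vfield_def tvec_def charts_at_def tderiv_def)
    qed
  qed
  moreover have "vfield A \<kappa> W k p \<in> tangent_space A p" if "p \<in> W" for p
    using tvec_tangent[OF A \<kappa>] that W by (auto simp: vfield_def)
  moreover have "vfield A \<kappa> W k p = 0" if "p \<notin> W" for p
    using that by (simp add: vfield_def)
  ultimately show ?thesis unfolding vector_fields_def by blast
qed

lemma vector_field_chart:
  assumes A: "oriented_atlas A" and \<kappa>: "compatible A \<kappa>" and W: "open W" "W \<subseteq> chart_dom \<kappa>"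
    and K: "K \<in> vector_fields A W"
  shows "\<exists>k. smooth_on (chart_map \<kappa> ` W) k \<and> K = vfield A \<kappa> W k"
proof -
  have ch: "is_chart \<kappa>" using \<kappa> by (simp add: compatible_def)
  have K': "K p \<in> tangent_space A p" if "p \<in> W" for p using K that unfolding vector_fields_def by blast
  have K0: "K p = 0" if "p \<notin> W" for p using K that unfolding vector_fields_def by blast
  have Ks: "smooth_on (chart_map \<kappa>' ` (chart_dom \<kappa>' \<inter> W)) (\<lambda>x. K (chart_inv \<kappa>' x) \<kappa>')" if "\<kappa>' \<in> A" for \<kappa>'
    using K that unfolding vector_fields_def by blast
  \<comment> \<open>An arbitrary atlas chart is chosen at each point. By \<open>Kk\<close> the
    result is the coordinate vector of \<open>K\<close> in \<kappa> whatever the choice, so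
    smoothness may be checked near a point with one fixed chart.\<close>
  define k where "k x = (let p = chart_inv \<kappa> x; \<kappa>' = (SOME \<kappa>'. \<kappa>' \<in> charts_at A p) in tderiv \<kappa>' \<kappa> p (K p \<kappa>'))" for x
  have Kk: "K p = tvec A \<kappa> p (k (chart_map \<kappa> p))" if p: "p \<in> W" for p
  proof -
    have "(SOME \<kappa>'. \<kappa>' \<in> charts_at A p) \<in> charts_at A p" using atlas_charts_at[OF A] someI_ex by metis
    from tangent_tvec[OF A \<kappa> _ K'[OF p] this] show ?thesis
      using p W is_chartD(3)[OF ch] by (auto simp: k_def Let_def subset_iff)
  qed
  have "smooth_on (chart_map \<kappa> ` W) k"
  proof (rule smooth_on_union)
    fix x assume "x \<in> chart_map \<kappa> ` W"
    then obtain p where p: "p \<in> W" "x = chart_map \<kappa> p" by blast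
    obtain \<kappa>' where k': "\<kappa>' \<in> charts_at A p" using atlas_charts_at[OF A] by blast
    have sc: "smooth_charts \<kappa>' \<kappa>" using compatible_charts_at[OF \<kappa> k'] smooth_charts_sym by blast
    note ch' = smooth_chartsD(1)[OF sc]
    let ?U = "W \<inter> chart_dom \<kappa>'"
    let ?S = "chart_map \<kappa> ` ?U" and ?S' = "chart_map \<kappa>' ` (chart_dom \<kappa>' \<inter> W)"
    have k'A: "\<kappa>' \<in> A" using k' by (simp add: charts_at_def)
    have oS: "open ?S" by (rule chart_image_open[OF ch]) (use W is_chartD(1)[OF ch'] in \<open>auto intro: open_Int\<close>)
    have oS': "open ?S'" by (rule chart_image_open[OF ch']) (use W is_chartD(1)[OF ch'] in \<open>auto intro: open_Int\<close>)
    have "smooth_on ?S' (\<lambda>z. frechet_derivative (transition \<kappa>' \<kappa>) (at z) (K (chart_inv \<kappa>' z) \<kappa>'))"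
      by (rule smooth_on_frechet_apply[OF oS' smooth_on_subset[OF smooth_chartsD(3)[OF sc]] Ks[OF k'A]]) (use W in auto)
    moreover have "smooth_on ?S (transition \<kappa> \<kappa>')"
      by (rule smooth_on_subset[OF smooth_chartsD(3)[OF smooth_charts_sym[OF sc]]]) (use W in auto)
    moreover have "transition \<kappa> \<kappa>' ` ?S \<subseteq> ?S'"
      using W transition_map[OF ch, of _ \<kappa>'] by auto
    ultimately have "smooth_on ?S (\<lambda>x. frechet_derivative (transition \<kappa>' \<kappa>) (at (transition \<kappa> \<kappa>' x)) (K (chart_inv \<kappa>' (transition \<kappa> \<kappa>' x)) \<kappa>'))"
      by (rule smooth_on_compose[OF oS oS'])
    then have "smooth_on ?S k"
    proof (rule smooth_on_cong[OF oS, rotated])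
      fix x assume x: "x \<in> ?S"
      define q where "q = chart_inv \<kappa> x"
      have q: "q \<in> chart_dom \<kappa>" "q \<in> chart_dom \<kappa>'" "q \<in> W" "chart_map \<kappa> q = x"
        using chart_image_mem[OF ch x] W by (auto simp: q_def)
      have "q \<in> chart_dom \<kappa>'" "\<kappa>' \<in> charts_at A q" using q k'A by (auto simp: charts_at_def)
      then show "frechet_derivative (transition \<kappa>' \<kappa>) (at (transition \<kappa> \<kappa>' x)) (K (chart_inv \<kappa>' (transition \<kappa> \<kappa>' x)) \<kappa>') = k x"
        using tvec_rep[OF \<kappa> q(1), of \<kappa>' "k x"] Kk[OF q(3)] transition_map[OF ch q(1), of \<kappa>'] is_chartD(3)[OF ch' q(2)]
        by (simp add: q(4) tderiv_def)
    qed
    then show "\<exists>T. open T \<and> x \<in> T \<and> smooth_on T k"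
      using oS p k' by (intro exI[of _ ?S]) (auto simp: charts_at_def)
  qed
  moreover have "K = vfield A \<kappa> W k" using Kk K0 by (auto simp: vfield_def)
  ultimately show ?thesis by blast
qed

lemma integral_curve_chart:
  assumes A: "oriented_atlas A" and \<kappa>: "compatible A \<kappa>" and W: "W \<subseteq> chart_dom \<kappa>"
    and \<gamma>: "integral_curve A W (vfield A \<kappa> W k) I \<gamma>" and I: "open I" "t \<in> I"
  shows "((chart_map \<kappa> \<circ> \<gamma>) has_vector_derivative k (chart_map \<kappa> (\<gamma> t))) (at t)"
proof -
  have c: "continuous_on I \<gamma>" and W': "\<gamma> t \<in> W" using \<gamma> I by (auto simp: integral_curve_def)
  obtain \<kappa>' where k': "\<kappa>' \<in> charts_at A (\<gamma> t)" using atlas_charts_at[OF A] by blast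
  have sc: "smooth_charts \<kappa>' \<kappa>" "\<gamma> t \<in> chart_dom \<kappa>'" using compatible_charts_at[OF \<kappa> k'] smooth_charts_sym[of \<kappa> \<kappa>'] by auto
  have d: "((chart_map \<kappa>' \<circ> \<gamma>) has_vector_derivative vfield A \<kappa> W k (\<gamma> t) \<kappa>') (at t)"
    using \<gamma> I(2) k' unfolding integral_curve_def by blast
  have "((chart_map \<kappa> \<circ> \<gamma>) has_vector_derivative tderiv \<kappa>' \<kappa> (\<gamma> t) (vfield A \<kappa> W k (\<gamma> t) \<kappa>')) (at t)"
    by (rule curve_chart_change[OF sc(1) _ sc(2) _ _ d]) (use W W' c I in \<open>auto simp: continuous_on_eq_continuous_at\<close>)
  then show ?thesis using tvec_rep[OF \<kappa> _ k'] W W' by (auto simp: vfield_def)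
qed

lemma integral_curve_lift:
  assumes A: "oriented_atlas A" and \<kappa>: "compatible A \<kappa>" and W: "W \<subseteq> chart_dom \<kappa>" and I: "open I"
    and z: "\<And>t. t \<in> I \<Longrightarrow> z t \<in> chart_map \<kappa> ` W" "\<And>t. t \<in> I \<Longrightarrow> (z has_vector_derivative k (z t)) (at t)"
  shows "integral_curve A W (vfield A \<kappa> W k) I (chart_inv \<kappa> \<circ> z)"
proof -
  let ?c = "chart_inv \<kappa> \<circ> z"
  have ch: "is_chart \<kappa>" using \<kappa> by (simp add: compatible_def)
  have cW: "?c t \<in> W" and m: "chart_map \<kappa> (?c t) = z t" if "t \<in> I" for t
    using chart_image_mem[OF ch z(1)[OF that] W] by auto
  have cz: "continuous_on I z"
    unfolding continuous_on_eq_continuous_at[OF I] using has_vector_derivative_continuous[OF z(2)] by blast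
  have cc: "continuous_on I ?c"
    unfolding o_def by (rule continuous_on_compose2[OF is_chartD(7)[OF ch] cz]) (use z(1) W in auto)
  have "((chart_map \<kappa>' \<circ> ?c) has_vector_derivative vfield A \<kappa> W k (?c t) \<kappa>') (at t)"
    if t: "t \<in> I" and k': "\<kappa>' \<in> charts_at A (?c t)" for t \<kappa>'
  proof -
    have "((chart_map \<kappa> \<circ> ?c) has_vector_derivative k (z t)) (at t)"
      by (rule has_vector_derivative_transform_within_open[OF z(2)[OF t] I t]) (use m in auto)
    then have "((chart_map \<kappa>' \<circ> ?c) has_vector_derivative tderiv \<kappa> \<kappa>' (?c t) (k (z t))) (at t)"
      using compatible_charts_at[OF \<kappa> k'] cW[OF t] W continuous_on_eq_continuous_at[OF I, of ?c] cc t
      by (intro curve_chart_change[of \<kappa> \<kappa>' t UNIV ?c "k (z t)"]) blast+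
    then show ?thesis using cW[OF t] m[OF t] k' by (simp add: vfield_def tvec_def)
  qed
  then show ?thesis unfolding integral_curve_def using cc cW by auto
qed

lemma smooth_map_lift:
  assumes A: "oriented_atlas A" and \<kappa>: "compatible A \<kappa>" and U: "open U" "U \<subseteq> chart_dom \<kappa>"
    and f: "smooth_on (chart_map \<kappa> ` U) f" "f ` chart_map \<kappa> ` U \<subseteq> chart_map \<kappa> ` chart_dom \<kappa>"
    and \<phi>: "\<And>p. p \<in> U \<Longrightarrow> \<phi> p = chart_inv \<kappa> (f (chart_map \<kappa> p))"
  shows "smooth_map_on A U \<phi>"
proof -
  have ch: "is_chart \<kappa>" using \<kappa> by (simp add: compatible_def)
  have fD: "f (chart_map \<kappa> p) \<in> chart_map \<kappa> ` chart_dom \<kappa>" if "p \<in> U" for p using f(2) that by blast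
  have \<phi>d: "\<phi> p \<in> chart_dom \<kappa>" and \<phi>m: "chart_map \<kappa> (\<phi> p) = f (chart_map \<kappa> p)" if "p \<in> U" for p
    using is_chartD(4,5)[OF ch fD[OF that]] \<phi>[OF that] by auto
  have cU: "continuous_on U (chart_map \<kappa>)" by (rule continuous_on_subset[OF is_chartD(6)[OF ch] U(2)])
  have cf: "continuous_on U (\<lambda>p. f (chart_map \<kappa> p))"
    by (rule continuous_on_compose2[OF smooth_on_imp_continuous[OF f(1)] cU]) blast
  have "continuous_on U (\<lambda>p. chart_inv \<kappa> (f (chart_map \<kappa> p)))"
    by (rule continuous_on_compose2[OF is_chartD(7)[OF ch] cf]) (use fD in blast)
  then have c\<phi>: "continuous_on U \<phi>" by (rule continuous_on_eq) (simp add: \<phi>)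
  have "smooth_on (chart_map \<kappa>1 ` {p \<in> U \<inter> chart_dom \<kappa>1. \<phi> p \<in> chart_dom \<kappa>2}) (chart_map \<kappa>2 \<circ> \<phi> \<circ> chart_inv \<kappa>1)"
    if 1: "\<kappa>1 \<in> A" and 2: "\<kappa>2 \<in> A" for \<kappa>1 \<kappa>2
  proof -
    have s1: "smooth_charts \<kappa> \<kappa>1" and s2: "smooth_charts \<kappa> \<kappa>2" using \<kappa> 1 2 unfolding compatible_def by blast+
    note c1 = smooth_chartsD(2)[OF s1] and c2 = smooth_chartsD(2)[OF s2]
    let ?U = "{p \<in> U \<inter> chart_dom \<kappa>1. \<phi> p \<in> chart_dom \<kappa>2}"
    have "open (U \<inter> \<phi> -` chart_dom \<kappa>2)" by (rule continuous_open_preimage[OF c\<phi> U(1) is_chartD(1)[OF c2]])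
    moreover have "?U = (U \<inter> \<phi> -` chart_dom \<kappa>2) \<inter> chart_dom \<kappa>1" by auto
    ultimately have oU: "open ?U" using is_chartD(1)[OF c1] by (simp add: open_Int)
    let ?S = "chart_map \<kappa>1 ` ?U" and ?T = "chart_map \<kappa> ` ?U" and ?V = "chart_map \<kappa> ` (chart_dom \<kappa> \<inter> chart_dom \<kappa>2)"
    have oS: "open ?S" by (rule chart_image_open[OF c1 oU]) blast
    have oT: "open ?T" by (rule chart_image_open[OF ch oU]) (use U(2) in blast)
    have a: "smooth_on ?S (transition \<kappa>1 \<kappa>)"
      by (rule smooth_on_subset[OF smooth_chartsD(3)[OF smooth_charts_sym[OF s1]]]) (use U(2) in blast)
    have b: "smooth_on ?T f" by (rule smooth_on_subset[OF f(1)]) blast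
    have ab: "transition \<kappa>1 \<kappa> ` ?S \<subseteq> ?T" using transition_map[OF c1, of _ \<kappa>] by auto
    have bc: "f ` ?T \<subseteq> ?V"
    proof
      fix y assume "y \<in> f ` ?T"
      then obtain p where p: "p \<in> ?U" "y = f (chart_map \<kappa> p)" by blast
      then have "y = chart_map \<kappa> (\<phi> p)" "\<phi> p \<in> chart_dom \<kappa> \<inter> chart_dom \<kappa>2" using \<phi>m \<phi>d by auto
      then show "y \<in> ?V" by blast
    qed
    have "smooth_on ?T (\<lambda>x. transition \<kappa> \<kappa>2 (f x))"
      by (rule smooth_on_compose[OF oT smooth_chartsD(4)[OF s2] smooth_chartsD(3)[OF s2] b bc])
    from smooth_on_compose[OF oS oT this a ab]
    have "smooth_on ?S (\<lambda>x. transition \<kappa> \<kappa>2 (f (transition \<kappa>1 \<kappa> x)))" .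
    then show ?thesis
    proof (rule smooth_on_cong[OF oS, rotated])
      fix x assume "x \<in> ?S"
      then obtain p where p: "p \<in> ?U" "x = chart_map \<kappa>1 p" by blast
      have "transition \<kappa> \<kappa>2 (f (chart_map \<kappa> p)) = chart_map \<kappa>2 (\<phi> p)"
        using p \<phi>m \<phi>d transition_map[OF ch, of "\<phi> p" \<kappa>2] by simp
      then show "transition \<kappa> \<kappa>2 (f (transition \<kappa>1 \<kappa> x)) = (chart_map \<kappa>2 \<circ> \<phi> \<circ> chart_inv \<kappa>1) x"
        using p transition_map[OF c1, of p \<kappa>] is_chartD(3)[OF c1, of p] by simp
    qed
  qed
  then show ?thesis unfolding smooth_map_on_def using c\<phi> by blast
qed

text \<open>Near a point the map is a composition through two atlas charts, one around the point and
  one around its image; only for such pairs does \<open>smooth_map_on\<close> give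
  information.\<close>

lemma smooth_map_chart:
  assumes A: "oriented_atlas A" and \<kappa>: "compatible A \<kappa>" and U: "open U" "U \<subseteq> chart_dom \<kappa>"
    and \<phi>: "smooth_map_on A U \<phi>" "\<phi> ` U \<subseteq> chart_dom \<kappa>"
  shows "smooth_on (chart_map \<kappa> ` U) (\<lambda>x. chart_map \<kappa> (\<phi> (chart_inv \<kappa> x)))"
proof (rule smooth_on_union)
  fix x assume "x \<in> chart_map \<kappa> ` U"
  then obtain p where p: "p \<in> U" "x = chart_map \<kappa> p" by blast
  have ch: "is_chart \<kappa>" using \<kappa> by (simp add: compatible_def)
  have c\<phi>: "continuous_on U \<phi>" using \<phi> by (simp add: smooth_map_on_def)
  obtain \<kappa>1 where 1: "\<kappa>1 \<in> charts_at A p" using atlas_charts_at[OF A] by blast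
  obtain \<kappa>2 where 2: "\<kappa>2 \<in> charts_at A (\<phi> p)" using atlas_charts_at[OF A] by blast
  have s1: "smooth_charts \<kappa> \<kappa>1" and s2: "smooth_charts \<kappa>2 \<kappa>"
    using compatible_charts_at[OF \<kappa> 1] compatible_charts_at[OF \<kappa> 2] smooth_charts_sym[of \<kappa> \<kappa>2] by auto
  note c1 = smooth_chartsD(2)[OF s1] and c2 = smooth_chartsD(1)[OF s2]
  let ?U = "{p \<in> U \<inter> chart_dom \<kappa>1. \<phi> p \<in> chart_dom \<kappa>2}"
  have "open (U \<inter> \<phi> -` chart_dom \<kappa>2)" by (rule continuous_open_preimage[OF c\<phi> U(1) is_chartD(1)[OF c2]])
  moreover have "?U = (U \<inter> \<phi> -` chart_dom \<kappa>2) \<inter> chart_dom \<kappa>1" by auto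
  ultimately have oU: "open ?U" using is_chartD(1)[OF c1] by (simp add: open_Int)
  let ?S = "chart_map \<kappa> ` ?U" and ?T = "chart_map \<kappa>1 ` ?U" and ?V = "chart_map \<kappa>2 ` (chart_dom \<kappa>2 \<inter> chart_dom \<kappa>)"
  have oS: "open ?S" by (rule chart_image_open[OF ch oU]) (use U(2) in blast)
  have oT: "open ?T" by (rule chart_image_open[OF c1 oU]) blast
  have a: "smooth_on ?S (transition \<kappa> \<kappa>1)"
    by (rule smooth_on_subset[OF smooth_chartsD(3)[OF s1]]) (use U(2) in blast)
  have ab: "transition \<kappa> \<kappa>1 ` ?S \<subseteq> ?T" using transition_map[OF ch, of _ \<kappa>1] U(2) by auto
  have b: "smooth_on ?T (chart_map \<kappa>2 \<circ> \<phi> \<circ> chart_inv \<kappa>1)"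
    using \<phi>(1) 1 2 unfolding smooth_map_on_def charts_at_def by blast
  have bc: "(chart_map \<kappa>2 \<circ> \<phi> \<circ> chart_inv \<kappa>1) ` ?T \<subseteq> ?V"
    using is_chartD(3)[OF c1] \<phi>(2) by auto
  have "smooth_on ?T (\<lambda>x. transition \<kappa>2 \<kappa> ((chart_map \<kappa>2 \<circ> \<phi> \<circ> chart_inv \<kappa>1) x))"
    by (rule smooth_on_compose[OF oT smooth_chartsD(4)[OF s2] smooth_chartsD(3)[OF s2] b bc])
  from smooth_on_compose[OF oS oT this a ab]
  have "smooth_on ?S (\<lambda>x. transition \<kappa>2 \<kappa> ((chart_map \<kappa>2 \<circ> \<phi> \<circ> chart_inv \<kappa>1) (transition \<kappa> \<kappa>1 x)))" .
  then have "smooth_on ?S (\<lambda>x. chart_map \<kappa> (\<phi> (chart_inv \<kappa> x)))"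
  proof (rule smooth_on_cong[OF oS, rotated])
    fix x assume "x \<in> ?S"
    then obtain q where q: "q \<in> ?U" "x = chart_map \<kappa> q" by blast
    then have "q \<in> chart_dom \<kappa>" using U(2) by blast
    then show "transition \<kappa>2 \<kappa> ((chart_map \<kappa>2 \<circ> \<phi> \<circ> chart_inv \<kappa>1) (transition \<kappa> \<kappa>1 x)) = chart_map \<kappa> (\<phi> (chart_inv \<kappa> x))"
      using q transition_map[OF ch, of q \<kappa>1] transition_map[OF c2, of "\<phi> q" \<kappa>] is_chartD(3)[OF ch, of q] is_chartD(3)[OF c1, of q]
      by simp
  qed
  moreover have "x \<in> ?S" using p 1 2 by (auto simp: charts_at_def)
  ultimately show "\<exists>T. open T \<and> x \<in> T \<and> smooth_on T (\<lambda>x. chart_map \<kappa> (\<phi> (chart_inv \<kappa> x)))" using oS by blast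
qed

subsection \<open>Metrics and one-forms in a chart\<close>

lemma tvec_expand:
  assumes "compatible A \<kappa>" "p \<in> chart_dom \<kappa>"
  shows "tvec A \<kappa> p (y :: real^2) = y $ 1 *\<^sub>R coord_vec A \<kappa> p 1 + y $ 2 *\<^sub>R coord_vec A \<kappa> p 2"
proof -
  have "y = y $ 1 *\<^sub>R axis 1 1 + y $ 2 *\<^sub>R axis 2 1" by (auto simp: vec_eq_iff axis_def forall_2)
  then have "tvec A \<kappa> p y = tvec A \<kappa> p (y $ 1 *\<^sub>R axis 1 1 + y $ 2 *\<^sub>R axis 2 1)" by simp
  then show ?thesis unfolding tvec_linear[OF assms] coord_vec_tvec .
qed

lemma tvec_zero: "compatible A \<kappa> \<Longrightarrow> p \<in> chart_dom \<kappa> \<Longrightarrow> tvec A \<kappa> p 0 = 0"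
  using tvec_linear[of A \<kappa> p 0 0 0 0] by simp

lemma coord_vec_tangent:
  "oriented_atlas A \<Longrightarrow> compatible A \<kappa> \<Longrightarrow> p \<in> chart_dom \<kappa> \<Longrightarrow> coord_vec A \<kappa> p i \<in> tangent_space A p"
  unfolding coord_vec_tvec by (rule tvec_tangent)

lemma metricD:
  assumes "riemannian_metric A g" "u \<in> tangent_space A p" "v \<in> tangent_space A p" "w \<in> tangent_space A p"
  shows "g p u v = g p v u" "u \<noteq> 0 \<Longrightarrow> g p u u > 0"
    "g p (a *\<^sub>R u + b *\<^sub>R v) w = a * g p u w + b * g p v w"
  using assms unfolding riemannian_metric_def by blast+

lemma metric_chart:
  fixes g :: "('m::topological_space, 2) metric"
  assumes A: "oriented_atlas A" and g: "riemannian_metric A g" and \<kappa>: "compatible A \<kappa>" and p: "p \<in> chart_dom \<kappa>"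
  shows "g p (tvec A \<kappa> p y) (tvec A \<kappa> p z) =
    (\<Sum>i\<in>UNIV. \<Sum>j\<in>UNIV. metric_coeff A g \<kappa> (chart_map \<kappa> p) $ i $ j * y $ i * z $ j)"
proof -
  have ch: "is_chart \<kappa>" using \<kappa> by (simp add: compatible_def)
  let ?c = "coord_vec A \<kappa> p"
  note t = coord_vec_tangent[OF A \<kappa> p]
  have tz: "tvec A \<kappa> p z \<in> tangent_space A p" by (rule tvec_tangent[OF A \<kappa> p])
  have m: "metric_coeff A g \<kappa> (chart_map \<kappa> p) $ i $ j = g p (?c i) (?c j)" for i j
    by (simp add: metric_coeff_def Let_def is_chartD(3)[OF ch p])
  have s: "g p (?c i) (tvec A \<kappa> p z) = z $ 1 * g p (?c i) (?c 1) + z $ 2 * g p (?c i) (?c 2)" for i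
    using metricD(1)[OF g t[of i] tz t[of i]] metricD(3)[OF g t[of 1] t[of 2] t[of i], of "z $ 1" "z $ 2"]
      metricD(1)[OF g t[of i] t[of 1] tz] metricD(1)[OF g t[of i] t[of 2] tz]
    unfolding tvec_expand[OF \<kappa> p, of z] by simp
  have "g p (tvec A \<kappa> p y) (tvec A \<kappa> p z) = y $ 1 * g p (?c 1) (tvec A \<kappa> p z) + y $ 2 * g p (?c 2) (tvec A \<kappa> p z)"
    unfolding tvec_expand[OF \<kappa> p, of y] by (rule metricD(3)[OF g t t tz])
  then show ?thesis by (simp add: s m sum_2 algebra_simps)
qed

lemma one_form_chart:
  assumes A: "oriented_atlas A" and \<tau>: "one_form A \<tau>" and \<kappa>: "compatible A \<kappa>" and p: "p \<in> chart_dom \<kappa>"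
  shows "\<tau> p (tvec A \<kappa> p (y :: real^2)) = (\<chi> i. \<tau> p (coord_vec A \<kappa> p i)) \<bullet> y"
proof -
  have "\<tau> p (a *\<^sub>R u + b *\<^sub>R v) = a * \<tau> p u + b * \<tau> p v"
    if "u \<in> tangent_space A p" "v \<in> tangent_space A p" for a b u v
    using \<tau> that unfolding one_form_def by blast
  then show ?thesis
    unfolding tvec_expand[OF \<kappa> p, of y]
    using coord_vec_tangent[OF A \<kappa> p] by (simp add: inner_vec_def sum_2 mult.commute)
qed

lemma tvec_independent:
  assumes A: "oriented_atlas A" and \<kappa>: "compatible A \<kappa>" and p: "p \<in> chart_dom \<kappa>"
    and d: "y $ 1 * z $ 2 - y $ 2 * z $ 1 \<noteq> (0 :: real)"
  shows "tvec A \<kappa> p (y :: real^2) \<noteq> tvec A \<kappa> p z" "independent {tvec A \<kappa> p y, tvec A \<kappa> p z}"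
proof -
  have n: "y \<noteq> c *\<^sub>R z" for c using d by auto
  have ns: "tvec A \<kappa> p y \<noteq> c *\<^sub>R tvec A \<kappa> p z" for c
    using n[of c] tvec_inj[OF A \<kappa> p, of y "c *\<^sub>R z"] tvec_linear[OF \<kappa> p, of c z 0 z] by auto
  show "tvec A \<kappa> p y \<noteq> tvec A \<kappa> p z" using ns[of 1] by simp
  have "z \<noteq> 0" using d by auto
  then have "tvec A \<kappa> p z \<noteq> 0" using tvec_inj[OF A \<kappa> p, of z 0] tvec_zero[OF \<kappa> p] by auto
  then show "independent {tvec A \<kappa> p y, tvec A \<kappa> p z}"
    using ns by (auto simp: independent_insert span_insert span_empty)
qed

lemma cramer_symmetric:
  fixes E F H u v a b :: real
  assumes "E * u + F * v = a" "F * u + H * v = b"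
  shows "u * (E * H - F\<^sup>2) = H * a - F * b" "v * (E * H - F\<^sup>2) = E * b - F * a"
  unfolding assms[symmetric] by (simp_all add: algebra_simps power2_eq_square)

text \<open>In dimension two, antisymmetry in the first two arguments leaves only
  \<open>R(\<partial>1, \<partial>2)\<close>, and the sectional curvatures of a few bases of the
  tangent plane determine all its components.\<close>

lemma space_form_chart_metric:
  fixes g :: "('m::topological_space, 2) metric"
  assumes A: "oriented_atlas A" and g: "riemannian_metric A g" and k: "\<kappa> \<in> A"
    and curv: "\<And>p u v. p \<in> chart_dom \<kappa> \<Longrightarrow> u \<in> tangent_space A p \<Longrightarrow> v \<in> tangent_space A p \<Longrightarrow>
      u \<noteq> v \<Longrightarrow> independent {u, v} \<Longrightarrow> sectional_curvature A g \<kappa> p u v = \<mu>"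
  shows "\<exists>\<Gamma>. space_form_chart (chart_map \<kappa> ` chart_dom \<kappa>) (metric_coeff A g \<kappa>) \<Gamma> \<mu>"
proof -
  define G where "G = metric_coeff A g \<kappa>"
  define \<Gamma> where "\<Gamma> = christoffel A g \<kappa>"
  let ?\<Omega> = "chart_map \<kappa> ` chart_dom \<kappa>"
  have \<kappa>: "compatible A \<kappa>" by (rule atlas_compatible[OF A k])
  then have ch: "is_chart \<kappa>" by (simp add: compatible_def)
  have o: "open ?\<Omega>" by (rule is_chartD(2)[OF ch])
  have sG: "smooth_on ?\<Omega> G" using g k unfolding riemannian_metric_def G_def by blast
  have sGij: "smooth_on ?\<Omega> (\<lambda>x. G x $ i $ j)" for i j by (intro smooth_on_vec_nth o sG)
  have Gg: "g p (tvec A \<kappa> p y) (tvec A \<kappa> p z) = (\<Sum>i\<in>UNIV. \<Sum>j\<in>UNIV. G (chart_map \<kappa> p) $ i $ j * y $ i * z $ j)"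
    if "p \<in> chart_dom \<kappa>" for p y z
    unfolding G_def by (rule metric_chart[OF A g \<kappa> that])
  have symG: "G x $ i $ j = G x $ j $ i" if "x \<in> ?\<Omega>" for x i j
  proof -
    have p: "chart_inv \<kappa> x \<in> chart_dom \<kappa>" using is_chartD(5)[OF ch that] .
    show ?thesis
      using metricD(1)[OF g coord_vec_tangent[OF A \<kappa> p] coord_vec_tangent[OF A \<kappa> p] coord_vec_tangent[OF A \<kappa> p], of i j]
      by (simp add: G_def metric_coeff_def Let_def)
  qed
  have pos: "(\<Sum>i\<in>UNIV. \<Sum>j\<in>UNIV. G x $ i $ j * y $ i * y $ j) > 0" if x: "x \<in> ?\<Omega>" and y: "y \<noteq> 0" for x y
  proof -
    let ?p = "chart_inv \<kappa> x"
    have p: "?p \<in> chart_dom \<kappa>" "chart_map \<kappa> ?p = x" using is_chartD(4,5)[OF ch x] by auto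
    have "tvec A \<kappa> ?p y \<noteq> 0" using tvec_inj[OF A \<kappa> p(1), of y 0] tvec_zero[OF \<kappa> p(1)] y by auto
    then show ?thesis using Gg[OF p(1), of y y] p(2) metricD(2)[OF g] tvec_tangent[OF A \<kappa> p(1)] by metis
  qed
  have pos1: "G x $ 1 $ 1 > 0" if x: "x \<in> ?\<Omega>" for x
    using pos[OF x, of "axis 1 1"] by (auto simp: sum_2 axis_def vec_eq_iff forall_2)
  have det: "G x $ 1 $ 1 * G x $ 2 $ 2 - (G x $ 1 $ 2)\<^sup>2 > 0" if x: "x \<in> ?\<Omega>" for x
  proof -
    let ?y = "vector [- G x $ 1 $ 2, G x $ 1 $ 1] :: real^2"
    have "?y \<noteq> 0" using pos1[OF x] by (auto simp: vec_eq_iff forall_2)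
    then have "G x $ 1 $ 1 * (G x $ 1 $ 1 * G x $ 2 $ 2 - (G x $ 1 $ 2)\<^sup>2) > 0"
      using pos[OF x, of ?y] symG[OF x, of 2 1] by (simp add: sum_2 algebra_simps power2_eq_square)
    then show ?thesis using pos1[OF x] by (simp add: zero_less_mult_iff)
  qed
  define \<Delta> where "\<Delta> x = G x $ 1 $ 1 * G x $ 2 $ 2 - (G x $ 1 $ 2)\<^sup>2" for x
  have inv: "(\<Sum>m\<in>UNIV. G x $ i $ m * matrix_inv (G x) $ m $ l) = (if i = l then 1 else 0)" if x: "x \<in> ?\<Omega>" for x i l
  proof -
    have "det (G x) \<noteq> 0" using det[OF x] symG[OF x, of 2 1] by (simp add: det_2 power2_eq_square)
    then have "\<exists>B. G x ** B = mat 1 \<and> B ** G x = mat 1" by (simp add: invertible_det_nz[symmetric] invertible_def)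
    then have "G x ** matrix_inv (G x) = mat 1" unfolding matrix_inv_def by (rule someI2_ex) blast
    then have "(G x ** matrix_inv (G x)) $ i $ l = mat 1 $ i $ l" by simp
    then show ?thesis by (simp add: matrix_matrix_mult_def mat_def)
  qed
  have inv_eq: "matrix_inv (G x) $ 1 $ l = (if l = 1 then G x $ 2 $ 2 / \<Delta> x else - G x $ 1 $ 2 / \<Delta> x)"
    "matrix_inv (G x) $ 2 $ l = (if l = 1 then - G x $ 1 $ 2 / \<Delta> x else G x $ 1 $ 1 / \<Delta> x)" if x: "x \<in> ?\<Omega>" for x l
  proof -
    have D: "\<Delta> x \<noteq> 0" using det[OF x] by (simp add: \<Delta>_def)
    have e: "G x $ 1 $ 1 * matrix_inv (G x) $ 1 $ l + G x $ 1 $ 2 * matrix_inv (G x) $ 2 $ l = (if l = 1 then 1 else 0)"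
      "G x $ 1 $ 2 * matrix_inv (G x) $ 1 $ l + G x $ 2 $ 2 * matrix_inv (G x) $ 2 $ l = (if l = 1 then 0 else 1)"
      using inv[OF x, of 1 l] inv[OF x, of 2 l] exhaust_2[of l] by (auto simp: sum_2 symG[OF x, of 2 1])
    define a b where "a = (if l = 1 then 1 else 0 :: real)" and "b = (if l = 1 then 0 else 1 :: real)"
    have "matrix_inv (G x) $ 1 $ l * \<Delta> x = G x $ 2 $ 2 * a - G x $ 1 $ 2 * b"
      unfolding \<Delta>_def by (rule cramer_symmetric[OF e[folded a_def b_def]])
    moreover have "matrix_inv (G x) $ 2 $ l * \<Delta> x = G x $ 1 $ 1 * b - G x $ 1 $ 2 * a"
      unfolding \<Delta>_def by (rule cramer_symmetric[OF e[folded a_def b_def]])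
    ultimately have "matrix_inv (G x) $ 1 $ l * \<Delta> x = (if l = 1 then G x $ 2 $ 2 else - G x $ 1 $ 2)"
      "matrix_inv (G x) $ 2 $ l * \<Delta> x = (if l = 1 then - G x $ 1 $ 2 else G x $ 1 $ 1)"
      by (auto simp: a_def b_def)
    then show "matrix_inv (G x) $ 1 $ l = (if l = 1 then G x $ 2 $ 2 / \<Delta> x else - G x $ 1 $ 2 / \<Delta> x)"
      "matrix_inv (G x) $ 2 $ l = (if l = 1 then - G x $ 1 $ 2 / \<Delta> x else G x $ 1 $ 1 / \<Delta> x)"
      using D by (auto simp: field_simps)
  qed
  have \<Gamma>: "\<Gamma> k i j x = (1/2) * (\<Sum>l\<in>UNIV. matrix_inv (G x) $ k $ l *
       (partial_deriv i (\<lambda>y. G y $ j $ l) x + partial_deriv j (\<lambda>y. G y $ i $ l) x - partial_deriv l (\<lambda>y. G y $ i $ j) x))" for k i j x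
    by (simp add: \<Gamma>_def G_def christoffel_def Let_def)
  have pd_cong: "partial_deriv k (\<lambda>y. G y $ i $ j) x = partial_deriv k (\<lambda>y. G y $ j $ i) x" if x: "x \<in> ?\<Omega>" for x i j k
  proof -
    have "((\<lambda>y. G y $ j $ i) has_derivative frechet_derivative (\<lambda>y. G y $ i $ j) (at x)) (at x)"
      by (rule has_derivative_transform_within_open[OF smooth_on_derivative[OF sGij x] o x]) (rule symG)
    from partial_deriv_eq[OF this, of k] show ?thesis by (simp add: partial_deriv_def)
  qed
  \<comment> \<open>Christoffel symbols of the first kind; the sum of two of them is the metric
    compatibility demanded by \<open>space_form_chart\<close>.\<close>
  have low: "(\<Sum>m\<in>UNIV. G x $ i $ m * \<Gamma> m k j x) =
      (1/2) * (partial_deriv k (\<lambda>y. G y $ j $ i) x + partial_deriv j (\<lambda>y. G y $ k $ i) x - partial_deriv i (\<lambda>y. G y $ k $ j) x)"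
    if x: "x \<in> ?\<Omega>" for x i j k
  proof -
    let ?t = "\<lambda>l. partial_deriv k (\<lambda>y. G y $ j $ l) x + partial_deriv j (\<lambda>y. G y $ k $ l) x - partial_deriv l (\<lambda>y. G y $ k $ j) x"
    have "(\<Sum>m\<in>UNIV. G x $ i $ m * \<Gamma> m k j x) = (1/2) * (\<Sum>l\<in>UNIV. (\<Sum>m\<in>UNIV. G x $ i $ m * matrix_inv (G x) $ m $ l) * ?t l)"
      unfolding \<Gamma> by (simp add: sum_2 field_simps)
    also have "\<dots> = (1/2) * ?t i"
      unfolding inv[OF x] by (simp add: if_distrib if_distribR cong: if_cong)
    finally show ?thesis .
  qed
  have R: "riemann_coeff A g \<kappa> l i j k x = partial_deriv i (\<Gamma> l j k) x - partial_deriv j (\<Gamma> l i k) x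
     + (\<Sum>m\<in>UNIV. \<Gamma> l i m x * \<Gamma> m j k x - \<Gamma> l j m x * \<Gamma> m i k x)" for l i j k x
    by (simp add: riemann_coeff_def Let_def \<Gamma>_def)
  have curv12: "riemann_coeff A g \<kappa> l 1 2 j x = \<mu> * ((if l = 1 then G x $ 2 $ j else 0) - (if l = 2 then G x $ 1 $ j else 0))"
    if x: "x \<in> ?\<Omega>" for l j x
  proof -
    let ?p = "chart_inv \<kappa> x" and ?R = "\<lambda>l k. riemann_coeff A g \<kappa> l 1 2 k x"
    have p: "?p \<in> chart_dom \<kappa>" "chart_map \<kappa> ?p = x" using is_chartD(4,5)[OF ch x] by auto
    have at: "\<kappa> \<in> charts_at A ?p" using k p by (simp add: charts_at_def)
    have R0: "riemann_coeff A g \<kappa> l 1 1 k x = 0" "riemann_coeff A g \<kappa> l 2 2 k x = 0"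
      "riemann_coeff A g \<kappa> l 2 1 k x = - ?R l k" for l k
      unfolding R by (simp_all add: sum_2)
    have D: "\<Delta> x > 0" using det[OF x] by (simp add: \<Delta>_def)
    have main: "(\<Sum>k\<in>UNIV. \<Sum>l\<in>UNIV. \<Sum>m\<in>UNIV. G x $ l $ m * ?R l k * z $ k * y $ m) * (y $ 1 * z $ 2 - y $ 2 * z $ 1)
        = \<mu> * (\<Delta> x * (y $ 1 * z $ 2 - y $ 2 * z $ 1)\<^sup>2)" if d: "y $ 1 * z $ 2 - y $ 2 * z $ 1 \<noteq> 0" for y z :: "real^2"
    proof -
      let ?u = "tvec A \<kappa> ?p y" and ?v = "tvec A \<kappa> ?p z"
      have u: "?u \<kappa> = y" "?v \<kappa> = z" by (rule tvec_atlas[OF A at])+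
      have den: "g ?p ?u ?u * g ?p ?v ?v - (g ?p ?u ?v)\<^sup>2 = \<Delta> x * (y $ 1 * z $ 2 - y $ 2 * z $ 1)\<^sup>2"
        unfolding Gg[OF p(1)] p(2) \<Delta>_def by (simp add: sum_2 symG[OF x, of 2 1] algebra_simps power2_eq_square)
      have num: "(\<Sum>i\<in>UNIV. \<Sum>j\<in>UNIV. \<Sum>k\<in>UNIV. \<Sum>l\<in>UNIV. \<Sum>m\<in>UNIV.
          G x $ l $ m * riemann_coeff A g \<kappa> l i j k x * y $ i * z $ j * z $ k * y $ m)
        = (\<Sum>k\<in>UNIV. \<Sum>l\<in>UNIV. \<Sum>m\<in>UNIV. G x $ l $ m * ?R l k * z $ k * y $ m) * (y $ 1 * z $ 2 - y $ 2 * z $ 1)"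
        unfolding sum_2[where 'a = real] R0 by (simp add: algebra_simps)
      have "sectional_curvature A g \<kappa> ?p ?u ?v = \<mu>"
        using tvec_independent[OF A \<kappa> p(1) d] tvec_tangent[OF A \<kappa> p(1)] by (intro curv p(1))
      then have "(\<Sum>k\<in>UNIV. \<Sum>l\<in>UNIV. \<Sum>m\<in>UNIV. G x $ l $ m * ?R l k * z $ k * y $ m) * (y $ 1 * z $ 2 - y $ 2 * z $ 1)
          / (\<Delta> x * (y $ 1 * z $ 2 - y $ 2 * z $ 1)\<^sup>2) = \<mu>"
        unfolding sectional_curvature_def Let_def p(2) u den G_def[symmetric] num .
      then show ?thesis using D d by (simp add: field_simps)
    qed
    \<comment> \<open>The lowered components \<open>?b k m\<close> have no assumed symmetry. The
      pairs \<open>(e1, e2)\<close> and \<open>(e2, e1)\<close> give the off-diagonal ones, the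
      pairs \<open>(e1, e1 + e2)\<close> and \<open>(e1 + e2, e2)\<close> show that the diagonal
      ones vanish; Cramer's rule then raises the index again.\<close>
    let ?e1 = "axis 1 1 :: real^2" and ?e2 = "axis 2 1 :: real^2"
    let ?b = "\<lambda>k m. G x $ 1 $ m * ?R 1 k + G x $ 2 $ m * ?R 2 k"
    have b21: "?b 2 1 = \<mu> * \<Delta> x" using main[of ?e1 ?e2] by (simp add: sum_2 axis_def)
    have b12: "?b 1 2 = - \<mu> * \<Delta> x" using main[of ?e2 ?e1] by (simp add: sum_2 axis_def)
    have "?b 1 1 + ?b 2 1 = \<mu> * \<Delta> x" using main[of ?e1 "?e1 + ?e2"] by (simp add: sum_2 axis_def algebra_simps)
    then have b11: "?b 1 1 = 0" using b21 by simp
    have "?b 2 1 + ?b 2 2 = \<mu> * \<Delta> x" using main[of "?e1 + ?e2" ?e2] by (simp add: sum_2 axis_def algebra_simps)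
    then have b22: "?b 2 2 = 0" using b21 by simp
    have s: "G x $ 2 $ 1 = G x $ 1 $ 2" by (rule symG[OF x])
    have q: "\<Delta> x * ?R 1 1 = \<Delta> x * (\<mu> * G x $ 1 $ 2)" "\<Delta> x * ?R 2 1 = \<Delta> x * (- \<mu> * G x $ 1 $ 1)"
      "\<Delta> x * ?R 1 2 = \<Delta> x * (\<mu> * G x $ 2 $ 2)" "\<Delta> x * ?R 2 2 = \<Delta> x * (- \<mu> * G x $ 1 $ 2)"
      using b11 b12 b21 b22 unfolding s \<Delta>_def by algebra+
    have "\<Delta> x \<noteq> 0" using D by simp
    note c = mult_left_cancel[OF this, THEN iffD1]
    show ?thesis using c[OF q(1)] c[OF q(2)] c[OF q(3)] c[OF q(4)] s exhaust_2[of l] exhaust_2[of j] by auto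
  qed
  have s\<Gamma>: "smooth_on ?\<Omega> (\<Gamma> k i j)" for k i j
  proof -
    let ?t = "\<lambda>l x. partial_deriv i (\<lambda>y. G y $ j $ l) x + partial_deriv j (\<lambda>y. G y $ i $ l) x - partial_deriv l (\<lambda>y. G y $ i $ j) x"
    have t: "smooth_on ?\<Omega> (?t l)" for l
      by (intro smooth_on_add smooth_on_diff o smooth_on_partial_deriv sGij)
    have s\<Delta>: "smooth_on ?\<Omega> \<Delta>" unfolding \<Delta>_def[abs_def] by (intro smooth_on_diff smooth_on_mult smooth_on_power o sGij)
    have D: "\<Delta> x \<noteq> 0" if "x \<in> ?\<Omega>" for x using det[OF that] by (simp add: \<Delta>_def)
    have i: "smooth_on ?\<Omega> (\<lambda>x. matrix_inv (G x) $ k $ l)" for l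
    proof (rule smooth_on_cong[OF o])
      show "smooth_on ?\<Omega> (\<lambda>x. (if k = 1 then if l = 1 then G x $ 2 $ 2 else - G x $ 1 $ 2
          else if l = 1 then - G x $ 1 $ 2 else G x $ 1 $ 1) / \<Delta> x)"
        by (cases "k = 1"; cases "l = 1") (auto intro!: smooth_on_divide smooth_on_minus o s\<Delta> sGij D)
    qed (use exhaust_2[of k] inv_eq in auto)
    show ?thesis
      unfolding \<Gamma>[abs_def] by (intro smooth_on_mult smooth_on_sum smooth_on_const o t i)
  qed
  \<comment> \<open>The locale requires symmetry as an equality of functions, but the metric
    coefficients are symmetric only on the image of the chart. Outside it the symbols are changed to
    enforce the symmetry.\<close>
  define \<Gamma>' where "\<Gamma>' k i j = (if i = 2 \<and> j = 1 then \<Gamma> k 1 2 else \<Gamma> k i j)" for k i j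
  have \<Gamma>': "\<Gamma>' k i j x = \<Gamma> k i j x" if x: "x \<in> ?\<Omega>" for k i j x
    using pd_cong[OF x, of _ 1 2] by (auto simp: \<Gamma>'_def \<Gamma> add_ac)
  have pd\<Gamma>': "partial_deriv a (\<Gamma>' k i j) x = partial_deriv a (\<Gamma> k i j) x" if x: "x \<in> ?\<Omega>" for a k i j x
  proof -
    have "(\<Gamma>' k i j has_derivative frechet_derivative (\<Gamma> k i j) (at x)) (at x)"
      by (rule has_derivative_transform_within_open[OF smooth_on_derivative[OF s\<Gamma> x] o x]) (rule \<Gamma>'[symmetric])
    from partial_deriv_eq[OF this, of a] show ?thesis by (simp add: partial_deriv_def)
  qed
  have "space_form_chart ?\<Omega> G \<Gamma>' \<mu>"
  proof
    show "open ?\<Omega>" by (rule o)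
    show "smooth_on ?\<Omega> (\<lambda>x. G x $ i $ j)" for i j by (rule sGij)
    show "smooth_on ?\<Omega> (\<Gamma>' k i j)" for k i j using s\<Gamma> by (simp add: \<Gamma>'_def)
    show "\<Gamma>' k 2 1 = \<Gamma>' k 1 2" for k by (simp add: \<Gamma>'_def)
    show "x \<in> ?\<Omega> \<Longrightarrow> G x $ 2 $ 1 = G x $ 1 $ 2" for x by (rule symG)
    show "x \<in> ?\<Omega> \<Longrightarrow> G x $ 1 $ 1 > 0" for x by (rule pos1)
    show "x \<in> ?\<Omega> \<Longrightarrow> G x $ 1 $ 1 * G x $ 2 $ 2 - (G x $ 1 $ 2)\<^sup>2 > 0" for x by (rule det)
    show "partial_deriv k (\<lambda>y. G y $ i $ j) x = (\<Sum>m\<in>UNIV. G x $ i $ m * \<Gamma>' m k j x + G x $ j $ m * \<Gamma>' m k i x)"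
      if "x \<in> ?\<Omega>" for x i j k
      unfolding sum.distrib \<Gamma>'[OF that] low[OF that]
      using pd_cong[OF that, of k j i] pd_cong[OF that, of j i k] pd_cong[OF that, of i j k] by (simp add: field_simps)
    show "partial_deriv 1 (\<Gamma>' l 2 j) x - partial_deriv 2 (\<Gamma>' l 1 j) x
      + (\<Sum>m\<in>UNIV. \<Gamma>' l 1 m x * \<Gamma>' m 2 j x - \<Gamma>' l 2 m x * \<Gamma>' m 1 j x)
      = \<mu> * ((if l = 1 then G x $ 2 $ j else 0) - (if l = 2 then G x $ 1 $ j else 0))" if "x \<in> ?\<Omega>" for x l j
      using curv12[OF that, of l j] unfolding R \<Gamma>'[OF that] pd\<Gamma>'[OF that] .
  qed
  then show ?thesis unfolding G_def by blast
qed

section \<open>Charts in which the metric has the model form\<close>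

text \<open>Coordinates obtained from an atlas chart by a plane diffeomorphism form a compatible
  chart: transitions to other atlas charts factor through \<open>\<kappa>0\<close>.\<close>

lemma chart_compose:
  assumes A: "oriented_atlas A" and k: "\<kappa>0 \<in> A" and U: "open U" "U \<subseteq> chart_map \<kappa>0 ` chart_dom \<kappa>0" and V: "open V"
    and hom: "homeomorphism U V \<psi> \<zeta>" and sm: "smooth_on U \<psi>" "smooth_on V \<zeta>"
  defines "\<kappa> \<equiv> (chart_inv \<kappa>0 ` U, \<psi> \<circ> chart_map \<kappa>0)"
  shows "compatible A \<kappa>" "chart_map \<kappa> ` chart_dom \<kappa> = V" "chart_dom \<kappa> \<subseteq> chart_dom \<kappa>0"
    "\<And>y. y \<in> V \<Longrightarrow> transition \<kappa> \<kappa>0 y = \<zeta> y" "\<And>p. p \<in> chart_dom \<kappa> \<Longrightarrow> chart_map \<kappa>0 p \<in> U \<and> chart_map \<kappa> p = \<psi> (chart_map \<kappa>0 p)"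
proof -
  have \<kappa>0: "compatible A \<kappa>0" by (rule atlas_compatible[OF A k])
  then have c0: "is_chart \<kappa>0" by (simp add: compatible_def)
  have h: "\<And>x. x \<in> U \<Longrightarrow> \<zeta> (\<psi> x) = x" "\<And>y. y \<in> V \<Longrightarrow> \<psi> (\<zeta> y) = y" "\<psi> ` U = V" "\<zeta> ` V = U"
    "continuous_on U \<psi>" "continuous_on V \<zeta>"
    using hom by (auto simp: homeomorphism_def)
  have dom: "chart_dom \<kappa> = chart_inv \<kappa>0 ` U" "chart_map \<kappa> = \<psi> \<circ> chart_map \<kappa>0" by (simp_all add: \<kappa>_def)
  have m0: "chart_map \<kappa>0 (chart_inv \<kappa>0 x) = x" "chart_inv \<kappa>0 x \<in> chart_dom \<kappa>0" if "x \<in> U" for x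
    using is_chartD(4,5)[OF c0] that U(2) by auto
  show sub: "chart_dom \<kappa> \<subseteq> chart_dom \<kappa>0" using m0 by (auto simp: dom)
  show pm: "chart_map \<kappa>0 p \<in> U \<and> chart_map \<kappa> p = \<psi> (chart_map \<kappa>0 p)" if "p \<in> chart_dom \<kappa>" for p
    using that m0 by (auto simp: dom)
  show im: "chart_map \<kappa> ` chart_dom \<kappa> = V"
    unfolding h(3)[symmetric] dom image_comp using m0 by (auto simp: image_iff)
  have inj: "inj_on (chart_map \<kappa>) (chart_dom \<kappa>)"
  proof (rule inj_onI)
    fix p q assume p: "p \<in> chart_dom \<kappa>" and q: "q \<in> chart_dom \<kappa>" and e: "chart_map \<kappa> p = chart_map \<kappa> q"
    then have "chart_map \<kappa>0 p = chart_map \<kappa>0 q" using pm[OF p] pm[OF q] h(1) by metis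
    then show "p = q" using is_chartD(3)[OF c0] p q sub by (metis subsetD)
  qed
  have inv: "chart_inv \<kappa> y = chart_inv \<kappa>0 (\<zeta> y)" if y: "y \<in> V" for y
  proof -
    have "\<zeta> y \<in> U" using h(4) y by blast
    then have d: "chart_inv \<kappa>0 (\<zeta> y) \<in> chart_dom \<kappa>" and "chart_map \<kappa> (chart_inv \<kappa>0 (\<zeta> y)) = y"
      using m0 h(2)[OF y] by (auto simp: dom)
    then show ?thesis unfolding chart_inv_def[of \<kappa>] using inv_into_f_f[OF inj d] by simp
  qed
  have oD: "open (chart_dom \<kappa>)" unfolding dom by (rule chart_preimage_open[OF c0 U])
  have c: "is_chart \<kappa>"
    unfolding is_chart_def
  proof (intro conjI homeomorphismI)
    show "open (chart_dom \<kappa>)" by (rule oD)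
    show "open (chart_map \<kappa> ` chart_dom \<kappa>)" unfolding im by (rule V)
    show "continuous_on (chart_dom \<kappa>) (chart_map \<kappa>)"
      unfolding dom(2) o_def
      by (rule continuous_on_compose2[OF h(5) continuous_on_subset[OF is_chartD(6)[OF c0] sub]]) (use pm in blast)
    have "continuous_on V (\<lambda>y. chart_inv \<kappa>0 (\<zeta> y))"
      by (rule continuous_on_compose2[OF is_chartD(7)[OF c0] h(6)]) (use U(2) h(4) in blast)
    then show "continuous_on (chart_map \<kappa> ` chart_dom \<kappa>) (chart_inv \<kappa>)"
      unfolding im by (rule continuous_on_eq) (simp add: inv)
    show "chart_inv \<kappa> ` (chart_map \<kappa> ` chart_dom \<kappa>) \<subseteq> chart_dom \<kappa>"
    proof (rule image_subsetI)
      fix y assume "y \<in> chart_map \<kappa> ` chart_dom \<kappa>"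
      then show "chart_inv \<kappa> y \<in> chart_dom \<kappa>" unfolding chart_inv_def by (rule inv_into_into)
    qed
    show "chart_inv \<kappa> (chart_map \<kappa> p) = p" if "p \<in> chart_dom \<kappa>" for p
      unfolding chart_inv_def by (rule inv_into_f_f[OF inj that])
    show "chart_map \<kappa> (chart_inv \<kappa> y) = y" if "y \<in> chart_map \<kappa> ` chart_dom \<kappa>" for y
      unfolding chart_inv_def by (rule f_inv_into_f[OF that])
  qed (rule order_refl)
  show tr: "transition \<kappa> \<kappa>0 y = \<zeta> y" if "y \<in> V" for y
  proof -
    have "\<zeta> y \<in> U" using h(4) that by blast
    then show ?thesis using inv[OF that] m0 by (simp add: transition_def)
  qed
  have "smooth_charts \<kappa> \<kappa>'" if k': "\<kappa>' \<in> A" for \<kappa>'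
  proof -
    have s0: "smooth_charts \<kappa>0 \<kappa>'" using \<kappa>0 k' unfolding compatible_def by blast
    note c' = smooth_chartsD(2)[OF s0]
    let ?D = "chart_dom \<kappa> \<inter> chart_dom \<kappa>'"
    let ?S = "chart_map \<kappa> ` ?D" and ?T = "chart_map \<kappa>0 ` (chart_dom \<kappa>0 \<inter> chart_dom \<kappa>')" and ?S' = "chart_map \<kappa>' ` ?D"
    have oS: "open ?S" by (rule chart_image_open[OF c open_Int[OF oD is_chartD(1)[OF c']]]) blast
    have oS': "open ?S'" by (rule chart_image_open[OF c' open_Int[OF oD is_chartD(1)[OF c']]]) blast
    have "?S \<subseteq> V" using im by blast
    then have a: "smooth_on ?S \<zeta>" by (rule smooth_on_subset[OF sm(2)])
    have "\<zeta> ` ?S \<subseteq> ?T"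
    proof
      fix x assume "x \<in> \<zeta> ` ?S"
      then obtain p where p: "p \<in> ?D" "x = \<zeta> (chart_map \<kappa> p)" by blast
      then have "x = chart_map \<kappa>0 p" using pm[of p] h(1) by simp
      then show "x \<in> ?T" using p(1) sub by blast
    qed
    from smooth_on_compose[OF oS smooth_chartsD(4,3)[OF s0] a this]
    have 1: "smooth_on ?S (transition \<kappa> \<kappa>')"
    proof (rule smooth_on_cong[OF oS, rotated])
      fix y assume "y \<in> ?S"
      then have y: "y \<in> V" using im by blast
      show "transition \<kappa>0 \<kappa>' (\<zeta> y) = transition \<kappa> \<kappa>' y" by (simp add: transition_def inv[OF y])
    qed
    have b: "smooth_on ?S' (transition \<kappa>' \<kappa>0)"
      by (rule smooth_on_subset[OF smooth_chartsD(3)[OF smooth_charts_sym[OF s0]]]) (use sub in blast)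
    have "transition \<kappa>' \<kappa>0 ` ?S' \<subseteq> U"
    proof
      fix x assume "x \<in> transition \<kappa>' \<kappa>0 ` ?S'"
      then obtain p where "p \<in> ?D" "x = transition \<kappa>' \<kappa>0 (chart_map \<kappa>' p)" by blast
      then show "x \<in> U" using transition_map[OF c', of p \<kappa>0] pm[of p] by simp
    qed
    from smooth_on_compose[OF oS' U(1) sm(1) b this]
    have 2: "smooth_on ?S' (transition \<kappa>' \<kappa>)" by (simp add: transition_def o_def dom(2))
    show ?thesis unfolding smooth_charts_def using c c' 1 2 by blast
  qed
  then show "compatible A \<kappa>" unfolding compatible_def using c by blast
qed

lemma det_linear_inj:
  assumes "linear f" "f (axis 1 1) $ 1 * f (axis 2 1) $ 2 - f (axis 2 1) $ 1 * f (axis 1 1) $ 2 \<noteq> (0 :: real)"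
  shows "inj (f :: real^2 \<Rightarrow> real^2)"
proof (rule linear_injective_0[THEN iffD2, OF assms(1)], intro allI impI)
  fix v assume v: "f v = 0"
  have "v = v $ 1 *\<^sub>R axis 1 1 + v $ 2 *\<^sub>R axis 2 1" by (auto simp: vec_eq_iff axis_def forall_2)
  then have "f v = f (v $ 1 *\<^sub>R axis 1 1 + v $ 2 *\<^sub>R axis 2 1)" by simp
  then have "f v = v $ 1 *\<^sub>R f (axis 1 1) + v $ 2 *\<^sub>R f (axis 2 1)"
    by (simp add: linear_add[OF assms(1)] linear_cmul[OF assms(1)])
  then have e: "v $ 1 * f (axis 1 1) $ 1 + v $ 2 * f (axis 2 1) $ 1 = 0" "v $ 1 * f (axis 1 1) $ 2 + v $ 2 * f (axis 2 1) $ 2 = 0"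
    using v by (auto simp: vec_eq_iff forall_2)
  have "v $ 1 * (f (axis 1 1) $ 1 * f (axis 2 1) $ 2 - f (axis 2 1) $ 1 * f (axis 1 1) $ 2)
      = (v $ 1 * f (axis 1 1) $ 1 + v $ 2 * f (axis 2 1) $ 1) * f (axis 2 1) $ 2 - (v $ 1 * f (axis 1 1) $ 2 + v $ 2 * f (axis 2 1) $ 2) * f (axis 2 1) $ 1"
    "v $ 2 * (f (axis 1 1) $ 1 * f (axis 2 1) $ 2 - f (axis 2 1) $ 1 * f (axis 1 1) $ 2)
      = (v $ 1 * f (axis 1 1) $ 2 + v $ 2 * f (axis 2 1) $ 2) * f (axis 1 1) $ 1 - (v $ 1 * f (axis 1 1) $ 1 + v $ 2 * f (axis 2 1) $ 1) * f (axis 1 1) $ 2"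
    by (simp_all add: algebra_simps)
  then show "v = 0" using e assms(2) by (auto simp: vec_eq_iff forall_2)
qed

text \<open>The inverse function theorem supplies a differentiable inverse. Its derivative is the
  inverse matrix of \<open>\<psi>'\<close> at \<open>\<zeta> y\<close>, a smooth function of
  \<open>\<zeta> y\<close>, so \<open>smooth_on_bootstrap\<close> applies.\<close>

lemma smooth_inverse_plane:
  fixes \<psi> :: "real^2 \<Rightarrow> real^2"
  assumes S: "open S" "x0 \<in> S" and sm: "smooth_on S \<psi>" and jac: "\<And>x. x \<in> S \<Longrightarrow> jacobian \<psi> x \<noteq> 0"
  obtains U V \<zeta> where "open U" "U \<subseteq> S" "x0 \<in> U" "open V" "\<psi> x0 \<in> V" "homeomorphism U V \<psi> \<zeta>" "smooth_on V \<zeta>"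
proof -
  obtain \<psi>' where d: "\<And>x. x \<in> S \<Longrightarrow> (\<psi> has_derivative blinfun_apply (\<psi>' x)) (at x)" and c: "continuous_on S \<psi>'"
    using smooth_on_blinfun_derivative[OF S(1) sm] by metis
  have fr: "frechet_derivative \<psi> (at x) = blinfun_apply (\<psi>' x)" if "x \<in> S" for x
    using frechet_derivative_at[OF d[OF that]] by simp
  have inj: "inj (blinfun_apply (\<psi>' x))" if "x \<in> S" for x
    by (rule det_linear_inj) (use jac[OF that] in \<open>auto simp: jacobian_def fr[OF that] intro: bounded_linear.linear blinfun.bounded_linear_right\<close>)
  obtain h where h: "linear h" "h \<circ> blinfun_apply (\<psi>' x0) = id"
    using linear_injective_left_inverse[OF bounded_linear.linear[OF blinfun.bounded_linear_right] inj[OF S(2)]] by blast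
  have "Blinfun h o\<^sub>L \<psi>' x0 = id_blinfun"
    by (rule blinfun_eqI) (use h in \<open>auto simp: bounded_linear_Blinfun_apply linear_conv_bounded_linear fun_eq_iff\<close>)
  from inverse_function_theorem[OF S(1) d c S(2) this]
  obtain U V \<zeta> \<zeta>' where uv: "open U" "U \<subseteq> S" "x0 \<in> U" "open V" "\<psi> x0 \<in> V" "homeomorphism U V \<psi> \<zeta>"
    "\<And>y. y \<in> V \<Longrightarrow> (\<zeta> has_derivative \<zeta>' y) (at y)" "\<And>y. y \<in> V \<Longrightarrow> \<zeta>' y = inv (blinfun_apply (\<psi>' (\<zeta> y)))"
    by metis
  define J where "J = jacobian \<psi>"
  define a where "a i j x = frechet_derivative \<psi> (at x) (axis i 1) $ j" for i j :: 2 and x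
  have sa: "smooth_on S (a i j)" for i j
    unfolding a_def[abs_def] by (intro smooth_on_vec_nth S smooth_on_frechet sm)
  have J: "J x = a 1 1 x * a 2 2 x - a 2 1 x * a 1 2 x" for x by (simp add: J_def jacobian_def a_def)
  have sJ: "smooth_on S J" unfolding J[abs_def] by (intro smooth_on_diff smooth_on_mult S sa)
  \<comment> \<open>The inverse of the derivative of \<psi>, applied to \<open>b\<close>, by
    Cramer's rule.\<close>
  define N where "N (b :: real^2) x = (vector [(a 2 2 x * b $ 1 - a 2 1 x * b $ 2) / J x, (a 1 1 x * b $ 2 - a 1 2 x * b $ 1) / J x] :: real^2)" for b x
  have sN: "smooth_on S (N b)" for b
  proof (rule smooth_on_vec[OF S(1)])
    have "smooth_on S (\<lambda>x. (a 2 2 x * b $ 1 - a 2 1 x * b $ 2) / J x)" "smooth_on S (\<lambda>x. (a 1 1 x * b $ 2 - a 1 2 x * b $ 1) / J x)"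
      using jac unfolding J_def[symmetric]
      by (intro smooth_on_divide smooth_on_diff smooth_on_mult smooth_on_const S sa sJ; blast)+
    then show "smooth_on S (\<lambda>x. N b x $ i)" for i using exhaust_2[of i] by (auto simp: N_def)
  qed
  have N: "\<psi>' x (N b x) = b" if x: "x \<in> S" for x b
  proof -
    have l: "linear (blinfun_apply (\<psi>' x))" by (rule bounded_linear.linear[OF blinfun.bounded_linear_right])
    have "N b x = N b x $ 1 *\<^sub>R axis 1 1 + N b x $ 2 *\<^sub>R axis 2 1" by (auto simp: vec_eq_iff axis_def forall_2)
    then have "\<psi>' x (N b x) = \<psi>' x (N b x $ 1 *\<^sub>R axis 1 1 + N b x $ 2 *\<^sub>R axis 2 1)" by simp
    then have "\<psi>' x (N b x) $ j = N b x $ 1 * a 1 j x + N b x $ 2 * a 2 j x" for j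
      by (simp add: linear_add[OF l] linear_cmul[OF l] a_def fr[OF x])
    moreover have "J x \<noteq> 0" using jac[OF x] by (simp add: J_def)
    then have "N b x $ 1 * a 1 j x + N b x $ 2 * a 2 j x = b $ j" for j
      using exhaust_2[of j] by (auto simp: N_def add_divide_distrib[symmetric] divide_eq_eq) (auto simp: J algebra_simps)
    ultimately show ?thesis by (simp add: vec_eq_iff)
  qed
  have \<zeta>S: "\<zeta> y \<in> S" if "y \<in> V" for y using uv(2,6) that by (auto simp: homeomorphism_def)
  have "smooth_on V \<zeta>"
  proof (rule smooth_on_bootstrap[where T = "UNIV \<times> S" and F = "\<lambda>b z. N b (snd z)", OF uv(4) _ _ uv(7)])
    show o: "open (UNIV \<times> S :: ((real^2) \<times> (real^2)) set)" by (intro open_Times open_UNIV S)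
    show "smooth_on (UNIV \<times> S :: ((real^2) \<times> (real^2)) set) (\<lambda>z. N b (snd z))" for b
      by (rule smooth_on_compose[OF o S(1) sN smooth_on_linear[OF o bounded_linear_snd]]) auto
    show "\<zeta>' y b = N b (snd (y, \<zeta> y))" if "y \<in> V" for y b
      using uv(8)[OF that] inv_f_eq[OF inj[OF \<zeta>S[OF that]] N[OF \<zeta>S[OF that], of b]] by simp
  qed (use \<zeta>S in auto)
  then show ?thesis using that uv by blast
qed

text \<open>The left-hand determinant is a Gram determinant of two vectors in three-space. By
  Lagrange's identity it is a combination of squares of 2-minors; tangency reduces the minors
  involving \<open>P\<close> and \<open>Q\<close> to multiples of the plane minor \<open>d\<close>,
  and the relation for \<open>m\<close> collects them.\<close>

lemma det_algebra:
  fixes m P Q x y a1 a2 b1 b2 \<mu> :: real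
  assumes "m * P = x * a1 + y * a2" "m * Q = x * b1 + y * b2" "m\<^sup>2 = 1 - \<mu> * (x\<^sup>2 + y\<^sup>2)"
  shows "m\<^sup>2 * ((a1\<^sup>2 + a2\<^sup>2 + \<mu> * P\<^sup>2) * (b1\<^sup>2 + b2\<^sup>2 + \<mu> * Q\<^sup>2)
      - (a1 * b1 + a2 * b2 + \<mu> * P * Q) * (a1 * b1 + a2 * b2 + \<mu> * P * Q)) = (a1 * b2 - b1 * a2)\<^sup>2"
proof -
  define d where "d = a1 * b2 - b1 * a2"
  have "m * (a1 * Q - b1 * P) = a1 * (m * Q) - b1 * (m * P)" by (simp add: algebra_simps)
  then have 1: "m * (a1 * Q - b1 * P) = d * y" unfolding assms(1,2) by (simp add: d_def algebra_simps)
  have "m * (a2 * Q - b2 * P) = a2 * (m * Q) - b2 * (m * P)" by (simp add: algebra_simps)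
  then have 2: "m * (a2 * Q - b2 * P) = - d * x" unfolding assms(1,2) by (simp add: d_def algebra_simps)
  have "m\<^sup>2 * ((a1\<^sup>2 + a2\<^sup>2 + \<mu> * P\<^sup>2) * (b1\<^sup>2 + b2\<^sup>2 + \<mu> * Q\<^sup>2)
      - (a1 * b1 + a2 * b2 + \<mu> * P * Q) * (a1 * b1 + a2 * b2 + \<mu> * P * Q))
      = m\<^sup>2 * d\<^sup>2 + \<mu> * ((m * (a1 * Q - b1 * P))\<^sup>2 + (m * (a2 * Q - b2 * P))\<^sup>2)"
    by (simp add: d_def power2_eq_square algebra_simps)
  also have "\<dots> = d\<^sup>2 * (m\<^sup>2 + \<mu> * (x\<^sup>2 + y\<^sup>2))"
    unfolding 1 2 by (simp add: power2_eq_square algebra_simps)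
  also have "\<dots> = d\<^sup>2" unfolding assms(3) by simp
  finally show ?thesis by (simp add: d_def)
qed

text \<open>The new chart is \<open>\<psi> = (X, Y)\<close> after an atlas chart. Its curl is
  computed from \<open>sqrt (det G) = jacobian \<psi> / mroot\<close> and from the fact that the
  Jacobians of \<psi> and its inverse are reciprocal: the volume form becomes
  \<open>dx dy / mroot\<close>.\<close>

lemma model_chart_exists:
  fixes A :: "('m::topological_space, 2) chart set"
  assumes A: "oriented_atlas A" and g: "riemannian_metric A g" and cs: "constant_sectional_curvature A g"
    and \<tau>: "one_form A \<tau>"
    and d\<tau>: "\<And>p \<kappa> u v. \<kappa> \<in> charts_at A p \<Longrightarrow> u \<in> tangent_space A p \<Longrightarrow> v \<in> tangent_space A p \<Longrightarrow>
      ext_deriv A \<tau> \<kappa> p u v = c * volume_form A g \<kappa> p u v"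
  shows "\<exists>\<mu> \<kappa> \<rho> \<theta>. compatible A \<kappa> \<and> p0 \<in> chart_dom \<kappa> \<and> chart_map \<kappa> ` chart_dom \<kappa> = ball 0 \<rho> \<and> \<rho> > 0 \<and> ball 0 \<rho> \<subseteq> mdom \<mu> \<and>
    (\<forall>p\<in>chart_dom \<kappa>. \<forall>y. g p (tvec A \<kappa> p y) (tvec A \<kappa> p y) = mmetric \<mu> (chart_map \<kappa> p) y) \<and>
    smooth_on (ball 0 \<rho>) \<theta> \<and> (\<forall>p\<in>chart_dom \<kappa>. \<forall>y. \<tau> p (tvec A \<kappa> p y) = \<theta> (chart_map \<kappa> p) \<bullet> y) \<and>
    (\<forall>x\<in>ball 0 \<rho>. curl \<theta> x = c / mroot \<mu> x)"
proof -
  obtain \<mu> where "\<forall>p. \<forall>\<kappa>\<in>charts_at A p. \<forall>u\<in>tangent_space A p. \<forall>v\<in>tangent_space A p.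
      u \<noteq> v \<and> independent {u, v} \<longrightarrow> sectional_curvature A g \<kappa> p u v = \<mu>"
    using cs unfolding constant_sectional_curvature_def by (elim exE)
  then have \<mu>: "sectional_curvature A g \<kappa> p u v = \<mu>"
    if "\<kappa> \<in> charts_at A p" "u \<in> tangent_space A p" "v \<in> tangent_space A p" "u \<noteq> v" "independent {u, v}" for p \<kappa> u v
    using that by blast
  obtain \<kappa>0 where k0: "\<kappa>0 \<in> charts_at A p0" using atlas_charts_at[OF A] by blast
  then have k: "\<kappa>0 \<in> A" and p0: "p0 \<in> chart_dom \<kappa>0" by (auto simp: charts_at_def)
  have \<kappa>0: "compatible A \<kappa>0" by (rule atlas_compatible[OF A k])
  then have c0: "is_chart \<kappa>0" by (simp add: compatible_def)
  let ?\<Omega> = "chart_map \<kappa>0 ` chart_dom \<kappa>0" and ?x0 = "chart_map \<kappa>0 p0" and ?G = "metric_coeff A g \<kappa>0"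
  have at: "\<kappa>0 \<in> charts_at A p" if "p \<in> chart_dom \<kappa>0" for p using that k by (simp add: charts_at_def)
  have "\<exists>\<Gamma>. space_form_chart ?\<Omega> ?G \<Gamma> \<mu>"
    by (rule space_form_chart_metric[OF A g k \<mu>[OF at]])
  then obtain \<Gamma> where sf: "space_form_chart ?\<Omega> ?G \<Gamma> \<mu>" by (elim exE)
  have "?x0 \<in> ?\<Omega>" using p0 by blast
  from space_form_chart.model_coordinates[OF sf this]
  obtain r X Y Z where r: "r > 0" "ball ?x0 r \<subseteq> ?\<Omega>" and sX: "smooth_on (ball ?x0 r) X" and sY: "smooth_on (ball ?x0 r) Y"
    and z0: "X ?x0 = 0" "Y ?x0 = 0" "Z ?x0 = 0" and sZ: "smooth_on (ball ?x0 r) Z"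
    and main': "\<forall>x\<in>ball ?x0 r. 1 - \<mu> * Z x > 0 \<and> (X x)\<^sup>2 + (Y x)\<^sup>2 = 2 * Z x - \<mu> * (Z x)\<^sup>2 \<and>
      partial_deriv 1 X x * partial_deriv 2 Y x - partial_deriv 2 X x * partial_deriv 1 Y x > 0 \<and>
      (\<forall>h. (\<Sum>i\<in>UNIV. \<Sum>j\<in>UNIV. ?G x $ i $ j * h $ i * h $ j) = (frechet_derivative X (at x) h)\<^sup>2
        + (frechet_derivative Y (at x) h)\<^sup>2 + \<mu> * (frechet_derivative Z (at x) h)\<^sup>2)"
    by (elim exE conjE) (rule that)
  note main = bspec[OF main']
  let ?B = "ball ?x0 r"
  define \<psi> where "\<psi> x = (vector [X x, Y x] :: real^2)" for x
  have nth: "\<psi> x $ 1 = X x" "\<psi> x $ 2 = Y x" for x by (simp_all add: \<psi>_def)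
  have s\<psi>: "smooth_on ?B \<psi>"
  proof (rule smooth_on_vec[OF open_ball])
    show "smooth_on ?B (\<lambda>x. \<psi> x $ i)" for i using exhaust_2[of i] sX sY by (auto simp: \<psi>_def)
  qed
  have d\<psi>: "(\<psi> has_derivative frechet_derivative \<psi> (at x)) (at x)" if "x \<in> ?B" for x
    by (rule smooth_on_derivative[OF s\<psi> that])
  have D\<psi>: "frechet_derivative \<psi> (at x) h $ 1 = frechet_derivative X (at x) h"
    "frechet_derivative \<psi> (at x) h $ 2 = frechet_derivative Y (at x) h" if "x \<in> ?B" for x h
    using frechet_derivative_at[OF bounded_linear.has_derivative[OF bounded_linear_vec_nth d\<psi>[OF that]], of 1]
      frechet_derivative_at[OF bounded_linear.has_derivative[OF bounded_linear_vec_nth d\<psi>[OF that]], of 2]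
    by (auto simp: nth fun_eq_iff)
  have jac: "jacobian \<psi> x > 0" if "x \<in> ?B" for x
    using main[OF that] by (simp add: jacobian_def D\<psi>[OF that] partial_deriv_def mult.commute)
  have mu: "\<psi> x \<in> mdom \<mu>" "mheight \<mu> (\<psi> x) = Z x" "mroot \<mu> (\<psi> x) = 1 - \<mu> * Z x" if "x \<in> ?B" for x
    using mheight_unique[of "\<psi> x" "Z x" \<mu>] main[OF that] by (auto simp: nth)
  \<comment> \<open>The third coordinate is the height of the point \<open>\<psi> x\<close>, so its
    differential is that of \<open>mheight\<close>; this turns the ambient form into
    \<open>mmetric\<close>.\<close>
  have DZ: "frechet_derivative Z (at x) h = (\<psi> x \<bullet> frechet_derivative \<psi> (at x) h) / mroot \<mu> (\<psi> x)" if "x \<in> ?B" for x h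
  proof -
    have "((\<lambda>x. mheight \<mu> (\<psi> x)) has_derivative (\<lambda>h. (\<psi> x \<bullet> frechet_derivative \<psi> (at x) h) / mroot \<mu> (\<psi> x))) (at x)"
      by (rule has_derivative_compose[OF d\<psi>[OF that] mheight_deriv[OF mu(1)[OF that]]])
    then have "(Z has_derivative (\<lambda>h. (\<psi> x \<bullet> frechet_derivative \<psi> (at x) h) / mroot \<mu> (\<psi> x))) (at x)"
      by (rule has_derivative_transform_within_open[OF _ open_ball that]) (rule mu(2))
    from fun_cong[OF frechet_derivative_at[OF this], of h] show ?thesis by simp
  qed
  have metric: "(\<Sum>i\<in>UNIV. \<Sum>j\<in>UNIV. ?G x $ i $ j * h $ i * h $ j) = mmetric \<mu> (\<psi> x) (frechet_derivative \<psi> (at x) h)"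
    if "x \<in> ?B" for x h
    using main[OF that] by (simp add: mmetric_def D\<psi>[OF that] DZ[OF that])
  have x0B: "?x0 \<in> ?B" using r by simp
  obtain U V \<zeta> where uv: "open U" "U \<subseteq> ?B" "?x0 \<in> U" "open V" "\<psi> ?x0 \<in> V" "homeomorphism U V \<psi> \<zeta>" "smooth_on V \<zeta>"
    using smooth_inverse_plane[OF open_ball x0B s\<psi>] jac by (metis less_irrefl)
  have \<psi>0: "\<psi> ?x0 = 0" by (simp add: \<psi>_def z0 vec_eq_iff forall_2)
  have "open (V \<inter> mdom \<mu>)" "0 \<in> V \<inter> mdom \<mu>" using uv mdom_open \<psi>0 by (auto simp: mdom_def)
  then obtain \<rho> where \<rho>: "\<rho> > 0" "ball 0 \<rho> \<subseteq> V \<inter> mdom \<mu>" using open_contains_ball by blast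
  \<comment> \<open>The domain is cut down so that the image is a ball around 0. The uniqueness of
    Killing fields integrates along rays, and the potentials of closed forms need balls too.\<close>
  define U1 where "U1 = U \<inter> \<psi> -` ball 0 \<rho>"
  have c\<psi>: "continuous_on U \<psi>" using uv(6) by (simp add: homeomorphism_def)
  have oU1: "open U1" unfolding U1_def by (rule continuous_open_preimage[OF c\<psi> uv(1) open_ball])
  have imU1: "\<psi> ` U1 = ball 0 \<rho>"
  proof
    show "ball 0 \<rho> \<subseteq> \<psi> ` U1"
    proof
      fix y :: "real^2" assume y: "y \<in> ball 0 \<rho>"
      then have "y \<in> V" using \<rho> by blast
      then have "\<zeta> y \<in> U" "\<psi> (\<zeta> y) = y" using uv(6) by (auto simp: homeomorphism_def)
      then show "y \<in> \<psi> ` U1" using y unfolding U1_def by (intro image_eqI[of _ _ "\<zeta> y"]) auto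
    qed
  qed (auto simp: U1_def)
  have hom: "homeomorphism U1 (ball 0 \<rho>) \<psi> \<zeta>"
  proof -
    have "U1 \<subseteq> U" by (simp add: U1_def)
    then show ?thesis by (rule homeomorphism_of_subsets[OF uv(6) _ order_refl imU1])
  qed
  have U1B: "U1 \<subseteq> ?B" using uv(2) by (auto simp: U1_def)
  have U1\<Omega>: "U1 \<subseteq> ?\<Omega>" using U1B r by blast
  have s\<zeta>: "smooth_on (ball 0 \<rho>) \<zeta>" by (rule smooth_on_subset[OF uv(7)]) (use \<rho> in blast)
  define \<kappa> where "\<kappa> = (chart_inv \<kappa>0 ` U1, \<psi> \<circ> chart_map \<kappa>0)"
  note cc = chart_compose[OF A k oU1 U1\<Omega> open_ball hom smooth_on_subset[OF s\<psi> U1B] s\<zeta>, folded \<kappa>_def]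
  have p0\<kappa>: "p0 \<in> chart_dom \<kappa>"
  proof -
    have "?x0 \<in> U1" using uv(3) \<psi>0 \<rho> by (simp add: U1_def)
    then show ?thesis using is_chartD(3)[OF c0 p0] unfolding \<kappa>_def fst_conv by (metis imageI)
  qed
  have ck: "is_chart \<kappa>" using cc(1) by (simp add: compatible_def)
  have sc: "smooth_charts \<kappa> \<kappa>0" using cc(1) k unfolding compatible_def by blast
  have h\<zeta>: "\<zeta> y \<in> U1" "\<psi> (\<zeta> y) = y" if "y \<in> ball 0 \<rho>" for y using hom that by (auto simp: homeomorphism_def)
  have d\<zeta>: "(\<zeta> has_derivative frechet_derivative \<zeta> (at y)) (at y)" if "y \<in> ball 0 \<rho>" for y
    by (rule smooth_on_derivative[OF s\<zeta> that])
  have td: "tderiv \<kappa> \<kappa>0 p = frechet_derivative \<zeta> (at (chart_map \<kappa> p))" if p: "p \<in> chart_dom \<kappa>" for p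
  proof -
    have y: "chart_map \<kappa> p \<in> ball 0 \<rho>" using cc(2) p by blast
    have "(transition \<kappa> \<kappa>0 has_derivative frechet_derivative \<zeta> (at (chart_map \<kappa> p))) (at (chart_map \<kappa> p))"
      by (rule has_derivative_transform_within_open[OF d\<zeta>[OF y] open_ball y]) (rule cc(4)[symmetric])
    from frechet_derivative_at[OF this] show ?thesis by (simp add: tderiv_def)
  qed
  have inv: "frechet_derivative \<psi> (at (\<zeta> y)) (frechet_derivative \<zeta> (at y) v) = v" if y: "y \<in> ball 0 \<rho>" for y v
  proof -
    have z: "\<zeta> y \<in> ?B" using h\<zeta>[OF y] U1B by blast
    have "((\<lambda>y. \<psi> (\<zeta> y)) has_derivative (\<lambda>v. frechet_derivative \<psi> (at (\<zeta> y)) (frechet_derivative \<zeta> (at y) v))) (at y)"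
      by (rule has_derivative_compose[OF d\<zeta>[OF y] d\<psi>[OF z]])
    moreover have "((\<lambda>y. \<psi> (\<zeta> y)) has_derivative (\<lambda>v. v)) (at y)"
      by (rule has_derivative_transform_within_open[OF has_derivative_ident open_ball y]) (simp add: h\<zeta>)
    ultimately have "(\<lambda>v. frechet_derivative \<psi> (at (\<zeta> y)) (frechet_derivative \<zeta> (at y) v)) = (\<lambda>v. v)"
      by (rule has_derivative_unique)
    then show ?thesis by (rule fun_cong)
  qed
  have pz: "p \<in> chart_dom \<kappa>0" "chart_map \<kappa>0 p \<in> U1" "\<zeta> (chart_map \<kappa> p) = chart_map \<kappa>0 p" "chart_map \<kappa> p \<in> ball 0 \<rho>" if p: "p \<in> chart_dom \<kappa>" for p
  proof -
    show "p \<in> chart_dom \<kappa>0" using cc(3) p by blast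
    show u: "chart_map \<kappa>0 p \<in> U1" using cc(5)[OF p] by blast
    show "\<zeta> (chart_map \<kappa> p) = chart_map \<kappa>0 p" using cc(5)[OF p] hom by (auto simp: homeomorphism_def)
    show "chart_map \<kappa> p \<in> ball 0 \<rho>" using cc(2) p by blast
  qed
  have gm: "g p (tvec A \<kappa> p y) (tvec A \<kappa> p y) = mmetric \<mu> (chart_map \<kappa> p) y" if p: "p \<in> chart_dom \<kappa>" for p y
  proof -
    have "tvec A \<kappa> p y = tvec A \<kappa>0 p (tderiv \<kappa> \<kappa>0 p y)"
      by (rule tvec_change[OF A cc(1) \<kappa>0 sc p pz(1)[OF p]])
    moreover have "chart_map \<kappa>0 p \<in> ?B" using pz(2)[OF p] U1B by blast
    moreover have "frechet_derivative \<psi> (at (chart_map \<kappa>0 p)) (tderiv \<kappa> \<kappa>0 p y) = y"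
      using inv[OF pz(4)[OF p], of y] by (simp add: pz(3)[OF p] td[OF p])
    ultimately show ?thesis
      using metric_chart[OF A g \<kappa>0 pz(1)[OF p], of "tderiv \<kappa> \<kappa>0 p y" "tderiv \<kappa> \<kappa>0 p y"] metric[of "chart_map \<kappa>0 p" "tderiv \<kappa> \<kappa>0 p y"]
        cc(5)[OF p] by simp
  qed
  define \<theta>0 where "\<theta>0 x = vec_lambda (\<lambda>i. \<tau> (chart_inv \<kappa>0 x) (coord_vec A \<kappa>0 (chart_inv \<kappa>0 x) i))" for x
  have s\<theta>0: "smooth_on ?\<Omega> \<theta>0"
  proof (rule smooth_on_vec[OF is_chartD(2)[OF c0]])
    show "smooth_on ?\<Omega> (\<lambda>x. \<theta>0 x $ i)" for i using \<tau> k unfolding one_form_def \<theta>0_def by simp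
  qed
  define \<theta> where "\<theta> = form_pullback \<zeta> \<theta>0"
  have \<zeta>\<Omega>: "\<zeta> ` ball 0 \<rho> \<subseteq> ?\<Omega>" using h\<zeta>(1) U1\<Omega> by blast
  have s\<theta>: "smooth_on (ball 0 \<rho>) \<theta>" unfolding \<theta>_def by (rule form_pullback_smooth[OF open_ball is_chartD(2)[OF c0] s\<zeta> \<zeta>\<Omega> s\<theta>0])
  have t\<theta>: "\<tau> p (tvec A \<kappa> p y) = \<theta> (chart_map \<kappa> p) \<bullet> y" if p: "p \<in> chart_dom \<kappa>" for p y
  proof -
    have "\<tau> p (tvec A \<kappa> p y) = \<tau> p (tvec A \<kappa>0 p (tderiv \<kappa> \<kappa>0 p y))"
      by (simp add: tvec_change[OF A cc(1) \<kappa>0 sc p pz(1)[OF p]])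
    also have "\<dots> = \<theta>0 (chart_map \<kappa>0 p) \<bullet> tderiv \<kappa> \<kappa>0 p y"
      using one_form_chart[OF A \<tau> \<kappa>0 pz(1)[OF p]] by (simp add: \<theta>0_def is_chartD(3)[OF c0 pz(1)[OF p]])
    also have "\<dots> = \<theta> (chart_map \<kappa> p) \<bullet> y"
      unfolding \<theta>_def form_pullback_inner[OF d\<zeta>[OF pz(4)[OF p]]] by (simp add: td[OF p] pz(3)[OF p])
    finally show ?thesis .
  qed
  \<comment> \<open>The hypothesis on the exterior derivative, evaluated on the two coordinate
    vectors.\<close>
  have curl0: "curl \<theta>0 x = c * sqrt (det (?G x))" if x: "x \<in> ?\<Omega>" for x
  proof -
    let ?p = "chart_inv \<kappa>0 x"
    have p: "?p \<in> chart_dom \<kappa>0" "chart_map \<kappa>0 ?p = x" using is_chartD(4,5)[OF c0 x] by auto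
    let ?u = "\<lambda>i. tvec A \<kappa>0 ?p (axis i 1)"
    have u: "?u i \<kappa>0 = axis i 1" for i by (rule tvec_atlas[OF A at[OF p(1)]])
    have "ext_deriv A \<tau> \<kappa>0 ?p (?u 1) (?u 2) = c * volume_form A g \<kappa>0 ?p (?u 1) (?u 2)"
      by (rule d\<tau>[OF at[OF p(1)]]) (rule tvec_tangent[OF A \<kappa>0 p(1)])+
    then show ?thesis
      unfolding ext_deriv_def volume_form_def Let_def u p(2) by (simp add: sum_2 axis_def curl_def \<theta>0_def)
  qed
  \<comment> \<open>The metric determines only the square of the Jacobian. That the Jacobian of
    \<psi> is positive fixes the root, so that the constant \<open>c\<close> keeps its sign.\<close>
  have det: "sqrt (det (?G x)) = jacobian \<psi> x / mroot \<mu> (\<psi> x)" if x: "x \<in> ?B" for x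
  proof -
    interpret space_form_chart ?\<Omega> ?G \<Gamma> \<mu> by (rule sf)
    have xO: "x \<in> ?\<Omega>" using x r by blast
    let ?D = "frechet_derivative \<psi> (at x)" and ?m = "mroot \<mu> (\<psi> x)"
    define a where "a = ?D (axis 1 1)"
    define b where "b = ?D (axis 2 1)"
    have lin: "linear ?D" using d\<psi>[OF x] has_derivative_linear by blast
    have m: "?m > 0" "?m\<^sup>2 = 1 - \<mu> * ((\<psi> x $ 1)\<^sup>2 + (\<psi> x $ 2)\<^sup>2)"
      using mroot_pos mroot_sq mu(1)[OF x] by auto
    have e: "?G x $ 1 $ 1 = mmetric \<mu> (\<psi> x) a" "?G x $ 2 $ 2 = mmetric \<mu> (\<psi> x) b"
      "?G x $ 1 $ 1 + 2 * ?G x $ 1 $ 2 + ?G x $ 2 $ 2 = mmetric \<mu> (\<psi> x) (a + b)"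
      using metric[OF x, of "axis 1 1"] metric[OF x, of "axis 2 1"] metric[OF x, of "axis 1 1 + axis 2 1"] sym_G[OF xO]
      by (simp_all add: sum_2 axis_def[of _ "1::real"] a_def b_def linear_add[OF lin])
    define P where "P = (\<psi> x \<bullet> a) / ?m"
    define Q where "Q = (\<psi> x \<bullet> b) / ?m"
    have G: "?G x $ 1 $ 1 = (a $ 1)\<^sup>2 + (a $ 2)\<^sup>2 + \<mu> * P\<^sup>2" "?G x $ 2 $ 2 = (b $ 1)\<^sup>2 + (b $ 2)\<^sup>2 + \<mu> * Q\<^sup>2"
      using e(1,2) by (auto simp: mmetric_def P_def Q_def)
    have "?G x $ 1 $ 1 + 2 * ?G x $ 1 $ 2 + ?G x $ 2 $ 2 = (a $ 1 + b $ 1)\<^sup>2 + (a $ 2 + b $ 2)\<^sup>2 + \<mu> * (P + Q)\<^sup>2"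
      using e(3) by (simp add: mmetric_def P_def Q_def inner_add_right add_divide_distrib)
    then have "2 * ?G x $ 1 $ 2 = 2 * (a $ 1 * b $ 1 + a $ 2 * b $ 2 + \<mu> * P * Q)"
      unfolding G by (simp add: power2_eq_square algebra_simps)
    then have G12: "?G x $ 1 $ 2 = a $ 1 * b $ 1 + a $ 2 * b $ 2 + \<mu> * P * Q" by simp
    have PQ: "?m * P = \<psi> x $ 1 * a $ 1 + \<psi> x $ 2 * a $ 2" "?m * Q = \<psi> x $ 1 * b $ 1 + \<psi> x $ 2 * b $ 2"
      using m by (auto simp: P_def Q_def inner_vec_def sum_2)
    have "?m\<^sup>2 * det (?G x) = (a $ 1 * b $ 2 - b $ 1 * a $ 2)\<^sup>2"
      unfolding det_2 sym_G[OF xO] G G12 using det_algebra[OF PQ m(2)] by simp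
    then have "det (?G x) = (jacobian \<psi> x / ?m)\<^sup>2"
      using m(1) by (simp add: jacobian_def a_def b_def field_simps power_divide)
    then show ?thesis using jac[OF x] m(1) by simp
  qed
  have "curl \<theta> y = c / mroot \<mu> y" if y: "y \<in> ball 0 \<rho>" for y
  proof -
    have z: "\<zeta> y \<in> ?B" "\<zeta> y \<in> ?\<Omega>" using h\<zeta>[OF y] U1B U1\<Omega> by auto
    have "jacobian \<psi> (\<zeta> y) * jacobian \<zeta> y = 1"
    proof -
      let ?D = "frechet_derivative \<psi> (at (\<zeta> y))" and ?E = "frechet_derivative \<zeta> (at y)"
      have lin: "linear ?D" using d\<psi>[OF z(1)] has_derivative_linear by blast
      have D: "?D v $ j = v $ 1 * ?D (axis 1 1) $ j + v $ 2 * ?D (axis 2 1) $ j" for v j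
      proof -
        have "v = v $ 1 *\<^sub>R axis 1 1 + v $ 2 *\<^sub>R axis 2 1" by (auto simp: vec_eq_iff axis_def forall_2)
        then have "?D v = ?D (v $ 1 *\<^sub>R axis 1 1 + v $ 2 *\<^sub>R axis 2 1)" by simp
        then show ?thesis by (simp add: linear_add[OF lin] linear_cmul[OF lin])
      qed
      have e: "?E (axis i 1) $ 1 * ?D (axis 1 1) $ j + ?E (axis i 1) $ 2 * ?D (axis 2 1) $ j = (if i = j then 1 else 0)" for i j
        using inv[OF y, of "axis i 1"] unfolding D[of "?E (axis i 1)" j, symmetric] by (auto simp: axis_def)
      have "jacobian \<psi> (\<zeta> y) * jacobian \<zeta> y =
        (?E (axis 1 1) $ 1 * ?D (axis 1 1) $ 1 + ?E (axis 1 1) $ 2 * ?D (axis 2 1) $ 1) * (?E (axis 2 1) $ 1 * ?D (axis 1 1) $ 2 + ?E (axis 2 1) $ 2 * ?D (axis 2 1) $ 2)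
        - (?E (axis 2 1) $ 1 * ?D (axis 1 1) $ 1 + ?E (axis 2 1) $ 2 * ?D (axis 2 1) $ 1) * (?E (axis 1 1) $ 1 * ?D (axis 1 1) $ 2 + ?E (axis 1 1) $ 2 * ?D (axis 2 1) $ 2)"
        unfolding jacobian_def by (simp add: algebra_simps)
      then show ?thesis unfolding e by simp
    qed
    then show ?thesis
      unfolding \<theta>_def curl_pullback[OF open_ball is_chartD(2)[OF c0] s\<zeta> \<zeta>\<Omega> s\<theta>0 y] curl0[OF z(2)] det[OF z(1)] h\<zeta>(2)[OF y]
      by (simp add: mult.assoc)
  qed
  then show ?thesis
    using cc(1,2) p0\<kappa> \<rho> gm s\<theta> t\<theta> by (intro exI[of _ \<mu>] exI[of _ \<kappa>] exI[of _ \<rho>] exI[of _ \<theta>]) auto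
qed

section \<open>The Finsler distance\<close>

text \<open>A vector \<open>v\<close> is scaled to \<open>g\<close>-length 1, where the norm bound
  says that \<tau> is smaller than 1 in absolute value. Since \<open>covector_norm\<close> is a real
  supremum, the bound is informative only once the set is known to be bounded.\<close>

lemma randers_pos:
  fixes A :: "('m::topological_space, 2) chart set"
  assumes A: "oriented_atlas A" and g: "riemannian_metric A g" and \<tau>: "one_form A \<tau>"
    and n: "covector_norm A g \<tau> p < 1" and v: "v \<in> tangent_space A p" "v \<noteq> 0"
  shows "randers g \<tau> p v > 0"
proof -
  obtain \<kappa> where k: "\<kappa> \<in> charts_at A p" using atlas_charts_at[OF A] by blast
  then have \<kappa>: "compatible A \<kappa>" and p: "p \<in> chart_dom \<kappa>" using atlas_compatible[OF A] by (auto simp: charts_at_def)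
  define q where "q y = g p (tvec A \<kappa> p y) (tvec A \<kappa> p y)" for y :: "real^2"
  have q: "q y = (\<Sum>i\<in>UNIV. \<Sum>j\<in>UNIV. metric_coeff A g \<kappa> (chart_map \<kappa> p) $ i $ j * y $ i * y $ j)" for y
    unfolding q_def by (rule metric_chart[OF A g \<kappa> p])
  have qpos: "q y > 0" if "y \<noteq> 0" for y
    unfolding q_def using tvec_tangent[OF A \<kappa> p] tvec_inj[OF A \<kappa> p, of y 0] tvec_zero[OF \<kappa> p] that
    by (intro metricD(2)[OF g]) auto
  have cq: "continuous_on (sphere 0 1) q" unfolding q[abs_def] by (intro continuous_intros)
  have "sphere (0 :: real^2) 1 \<noteq> {}" by simp
  then obtain y0 where y0: "y0 \<in> sphere 0 1" "\<And>y. y \<in> sphere 0 1 \<Longrightarrow> q y0 \<le> q y"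
    using continuous_attains_inf[OF compact_sphere _ cq] by blast
  have l: "q y0 > 0" using y0 by (intro qpos) auto
  have hom: "q (s *\<^sub>R y) = s\<^sup>2 * q y" for s y by (simp add: q sum_2 power2_eq_square algebra_simps)
  have low: "q y0 * (norm y)\<^sup>2 \<le> q y" for y
  proof (cases "y = 0")
    case False
    have "q y = (norm y)\<^sup>2 * q ((1 / norm y) *\<^sub>R y)" using False by (simp add: hom power_divide)
    moreover have "q y0 \<le> q ((1 / norm y) *\<^sub>R y)" using False by (intro y0(2)) simp
    ultimately show ?thesis by (metis mult.commute mult_right_mono zero_le_power2)
  qed (simp add: q)
  define w where "w = vec_lambda (\<lambda>i. \<tau> p (coord_vec A \<kappa> p i))"
  have \<tau>w: "\<tau> p (tvec A \<kappa> p y) = w \<bullet> y" for y unfolding w_def by (rule one_form_chart[OF A \<tau> \<kappa> p])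
  let ?S = "{\<bar>\<tau> p v\<bar> | v. v \<in> tangent_space A p \<and> g p v v \<le> 1}"
  have rep: "\<exists>y. u = tvec A \<kappa> p y" if "u \<in> tangent_space A p" for u
    using tangent_tvec[OF A \<kappa> p that k] by blast
  \<comment> \<open>The minimum of \<open>q\<close> on the Euclidean unit sphere is positive and
    bounds the Euclidean length of vectors of \<open>g\<close>-length at most 1.\<close>
  have bdd: "bdd_above ?S"
  proof (rule bdd_aboveI)
    fix s assume "s \<in> ?S"
    then obtain u where u: "u \<in> tangent_space A p" "g p u u \<le> 1" "s = \<bar>\<tau> p u\<bar>" by blast
    obtain y where y: "u = tvec A \<kappa> p y" using rep[OF u(1)] by blast
    have "q y0 * (norm y)\<^sup>2 \<le> 1" using low[of y] u(2) by (simp add: q_def y)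
    then have "(norm y)\<^sup>2 \<le> 1 / q y0" using l by (simp add: field_simps)
    then have "norm y \<le> sqrt (1 / q y0)" by (rule real_le_rsqrt)
    then have "norm w * norm y \<le> norm w * sqrt (1 / q y0)" by (rule mult_left_mono) simp
    then show "s \<le> norm w * sqrt (1 / q y0)"
      using Cauchy_Schwarz_ineq2[of w y] by (simp add: u(3) y \<tau>w)
  qed
  have sup: "\<bar>\<tau> p u\<bar> < 1" if "u \<in> tangent_space A p" "g p u u \<le> 1" for u
  proof -
    have "\<bar>\<tau> p u\<bar> \<in> ?S" using that by blast
    from cSup_upper[OF this bdd] show ?thesis using n unfolding covector_norm_def by linarith
  qed
  obtain y where y: "v = tvec A \<kappa> p y" using rep[OF v(1)] by blast
  then have "y \<noteq> 0" using v(2) tvec_zero[OF \<kappa> p] by auto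
  then have qy: "q y > 0" by (rule qpos)
  let ?s = "sqrt (q y)"
  have "q ((1 / ?s) *\<^sub>R y) = 1" using qy by (simp add: hom power_divide)
  then have "\<bar>\<tau> p (tvec A \<kappa> p ((1 / ?s) *\<^sub>R y))\<bar> < 1"
    by (intro sup tvec_tangent[OF A \<kappa> p]) (simp add: q_def)
  then have "\<bar>w \<bullet> y\<bar> < ?s" using qy by (simp add: \<tau>w abs_divide)
  then show ?thesis unfolding randers_def y \<tau>w using q_def[of y] by (simp add: abs_less_iff)
qed

definition flen :: "('m::topological_space, 2) chart set \<Rightarrow> ('m \<Rightarrow> ('m, 2) tangent \<Rightarrow> real) \<Rightarrow> (real \<Rightarrow> 'm) \<Rightarrow> real" where
  "flen A F c = integral {0..1} (\<lambda>t. F (c t) (velocity A c t))"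

lemma randers_curve_continuous:
  fixes A :: "('m::topological_space, 2) chart set"
  assumes A: "oriented_atlas A" and g: "riemannian_metric A g" and \<tau>: "one_form A \<tau>" and c: "C1_curve A c"
  shows "continuous_on {0..1} (\<lambda>t. randers g \<tau> (c t) (velocity A c t))"
proof (rule continuous_on_local)
  fix t0 :: real assume t0: "t0 \<in> {0..1}"
  obtain \<kappa> where k: "\<kappa> \<in> charts_at A (c t0)" using atlas_charts_at[OF A] by blast
  then have kA: "\<kappa> \<in> A" and \<kappa>: "compatible A \<kappa>" and p: "c t0 \<in> chart_dom \<kappa>" using atlas_compatible[OF A] by (auto simp: charts_at_def)
  have ch: "is_chart \<kappa>" using \<kappa> by (simp add: compatible_def)
  let ?\<Omega> = "chart_map \<kappa> ` chart_dom \<kappa>"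
  have cc: "continuous_on {0..1} c" using c by (simp add: C1_curve_def)
  obtain T where T: "open T" "T \<inter> {0..1} = c -` chart_dom \<kappa> \<inter> {0..1}"
    using cc is_chartD(1)[OF ch] unfolding continuous_on_open_invariant by blast
  let ?S = "{0..1} \<inter> T"
  have dom: "c t \<in> chart_dom \<kappa>" "t \<in> {0..1}" if "t \<in> ?S" for t
  proof -
    have "t \<in> c -` chart_dom \<kappa> \<inter> {0..1}" using that unfolding T(2)[symmetric] by blast
    then show "c t \<in> chart_dom \<kappa>" "t \<in> {0..1}" by auto
  qed
  define x where "x t = chart_map \<kappa> (c t)" for t
  define y where "y t = vector_derivative (chart_map \<kappa> \<circ> c) (at t within {0..1})" for t
  have cx: "continuous_on ?S x"
    unfolding x_def[abs_def]
    by (rule continuous_on_compose2[OF is_chartD(6)[OF ch] continuous_on_subset[OF cc]]) (use dom in blast)+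
  have cy: "continuous_on ?S y"
    unfolding y_def[abs_def]
    by (rule continuous_on_subset[OF C1_curve_chart_continuous[OF A \<kappa> c]]) (use dom in blast)
  have xO: "x ` ?S \<subseteq> ?\<Omega>" unfolding x_def using dom by blast
  have "continuous_on ?\<Omega> (metric_coeff A g \<kappa>)"
    using g kA smooth_on_imp_continuous unfolding riemannian_metric_def by blast
  then have cG: "continuous_on ?S (\<lambda>t. metric_coeff A g \<kappa> (x t))" by (rule continuous_on_compose2[OF _ cx xO])
  have "continuous_on ?\<Omega> (\<lambda>x. \<tau> (chart_inv \<kappa> x) (coord_vec A \<kappa> (chart_inv \<kappa> x) i))" for i
    using \<tau> kA smooth_on_imp_continuous unfolding one_form_def by blast
  then have ct: "continuous_on ?S (\<lambda>t. \<tau> (chart_inv \<kappa> (x t)) (coord_vec A \<kappa> (chart_inv \<kappa> (x t)) i))" for i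
    by (rule continuous_on_compose2[OF _ cx xO])
  have "continuous_on ?S (\<lambda>t. sqrt (\<Sum>i\<in>UNIV. \<Sum>j\<in>UNIV. metric_coeff A g \<kappa> (x t) $ i $ j * y t $ i * y t $ j)
      + (\<Sum>i\<in>UNIV. \<tau> (chart_inv \<kappa> (x t)) (coord_vec A \<kappa> (chart_inv \<kappa> (x t)) i) * y t $ i))"
    by (intro continuous_intros cG cy ct)
  then have "continuous_on ?S (\<lambda>t. randers g \<tau> (c t) (velocity A c t))"
  proof (rule continuous_on_eq)
    fix t assume t: "t \<in> ?S"
    have v: "velocity A c t = tvec A \<kappa> (c t) (y t)"
      unfolding y_def by (rule C1_curve_chart(2)[OF A \<kappa> c dom(2)[OF t] dom(1)[OF t]])
    show "sqrt (\<Sum>i\<in>UNIV. \<Sum>j\<in>UNIV. metric_coeff A g \<kappa> (x t) $ i $ j * y t $ i * y t $ j)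
      + (\<Sum>i\<in>UNIV. \<tau> (chart_inv \<kappa> (x t)) (coord_vec A \<kappa> (chart_inv \<kappa> (x t)) i) * y t $ i) = randers g \<tau> (c t) (velocity A c t)"
      unfolding randers_def v metric_chart[OF A g \<kappa> dom(1)[OF t]] one_form_chart[OF A \<tau> \<kappa> dom(1)[OF t]]
      by (simp add: x_def is_chartD(3)[OF ch dom(1)[OF t]] inner_vec_def)
  qed
  moreover have "t0 \<in> T" using T(2) t0 p by blast
  ultimately show "\<exists>T. open T \<and> t0 \<in> T \<and> continuous_on ({0..1} \<inter> T) (\<lambda>t. randers g \<tau> (c t) (velocity A c t))"
    using T(1) by blast
qed

section \<open>The Finsler metric in model coordinates\<close>

definition mbilin :: "real \<Rightarrow> real^2 \<Rightarrow> real^2 \<Rightarrow> real^2 \<Rightarrow> real" where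
  "mbilin \<mu> x u v = u \<bullet> v + \<mu> * ((x \<bullet> u) / mroot \<mu> x) * ((x \<bullet> v) / mroot \<mu> x)"

lemma mbilin_self: "mbilin \<mu> x v v = mmetric \<mu> x v"
  by (simp add: mbilin_def mmetric_def inner_vec_def sum_2 power2_eq_square)

lemma mbilin_commute: "mbilin \<mu> x u v = mbilin \<mu> x v u"
  by (simp add: mbilin_def inner_commute)

lemma mbilin_diff: "mbilin \<mu> x (a *\<^sub>R u - b *\<^sub>R v) w = a * mbilin \<mu> x u w - b * mbilin \<mu> x v w"
  by (simp add: mbilin_def inner_diff_left inner_diff_right diff_divide_distrib algebra_simps)

lemma mmetric_scale: "mmetric \<mu> x (s *\<^sub>R v) = s\<^sup>2 * mmetric \<mu> x v"
  by (simp add: mmetric_def power_mult_distrib power_divide algebra_simps)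

text \<open>The axiom \<open>curl\<theta>\<close> is the hypothesis on the exterior derivative of
  \<tau> with constant \<open>\<eta>\<close>, because the volume form is
  \<open>dx dy / mroot\<close> in this chart. The bound \<open>cov\<close> is imposed on the whole
  manifold: competing curves for the distance may leave the chart, and their length must be
  nonnegative there as well.\<close>

locale model_chart =
  fixes A :: "('m::t2_space, 2) chart set" and g :: "('m, 2) metric" and \<tau> :: "'m \<Rightarrow> ('m, 2) tangent \<Rightarrow> real"
    and \<kappa> :: "('m, 2) chart" and \<mu> \<rho> \<eta> :: real and \<theta> :: "real^2 \<Rightarrow> real^2"
  assumes A: "oriented_atlas A" and g: "riemannian_metric A g" and \<tau>: "one_form A \<tau>"
    and cov: "\<And>p. covector_norm A g \<tau> p < 1"
    and \<kappa>: "compatible A \<kappa>" and im: "chart_map \<kappa> ` chart_dom \<kappa> = ball 0 \<rho>" and \<rho>: "\<rho> > 0" "ball 0 \<rho> \<subseteq> mdom \<mu>"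
    and gm: "\<And>p y. p \<in> chart_dom \<kappa> \<Longrightarrow> g p (tvec A \<kappa> p y) (tvec A \<kappa> p y) = mmetric \<mu> (chart_map \<kappa> p) y"
    and s\<theta>: "smooth_on (ball 0 \<rho>) \<theta>"
    and t\<theta>: "\<And>p y. p \<in> chart_dom \<kappa> \<Longrightarrow> \<tau> p (tvec A \<kappa> p y) = \<theta> (chart_map \<kappa> p) \<bullet> y"
    and curl\<theta>: "\<And>x. x \<in> ball 0 \<rho> \<Longrightarrow> curl \<theta> x = \<eta> / mroot \<mu> x"
begin

abbreviation "W \<equiv> chart_dom \<kappa>"
abbreviation "\<xi> \<equiv> chart_map \<kappa>"
abbreviation "\<iota> \<equiv> chart_inv \<kappa>"
abbreviation "D \<equiv> ball (0 :: real^2) \<rho>"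
abbreviation "F \<equiv> randers g \<tau>"
abbreviation "dst \<equiv> finsler_dist A F"

definition fins :: "real^2 \<Rightarrow> real^2 \<Rightarrow> real" where
  "fins x y = sqrt (mmetric \<mu> x y) + \<theta> x \<bullet> y"

lemma ch: "is_chart \<kappa>" using \<kappa> by (simp add: compatible_def)

lemma \<iota>\<xi>: "p \<in> W \<Longrightarrow> \<iota> (\<xi> p) = p" by (rule is_chartD(3)[OF ch])
lemma \<xi>\<iota>: "x \<in> D \<Longrightarrow> \<xi> (\<iota> x) = x" using is_chartD(4)[OF ch] im by blast
lemma \<iota>W: "x \<in> D \<Longrightarrow> \<iota> x \<in> W" using is_chartD(5)[OF ch] im by blast
lemma \<xi>D: "p \<in> W \<Longrightarrow> \<xi> p \<in> D" using im by blast

lemma F_fins: "p \<in> W \<Longrightarrow> F p (tvec A \<kappa> p y) = fins (\<xi> p) y"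
  by (simp add: randers_def fins_def gm t\<theta>)

lemma mmetric_pos:
  assumes "x \<in> D" "y \<noteq> 0" shows "mmetric \<mu> x y > 0"
proof -
  have "tvec A \<kappa> (\<iota> x) y \<noteq> 0"
    using tvec_inj[OF A \<kappa> \<iota>W[OF assms(1)], of y 0] tvec_zero[OF \<kappa> \<iota>W[OF assms(1)]] assms(2) by auto
  then have "g (\<iota> x) (tvec A \<kappa> (\<iota> x) y) (tvec A \<kappa> (\<iota> x) y) > 0"
    using tvec_tangent[OF A \<kappa> \<iota>W[OF assms(1)]] by (intro metricD(2)[OF g])
  then show ?thesis using gm[OF \<iota>W[OF assms(1)]] \<xi>\<iota>[OF assms(1)] by simp
qed

lemma fins_pos:
  assumes "x \<in> D" "y \<noteq> 0" shows "fins x y > 0"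
proof -
  have "tvec A \<kappa> (\<iota> x) y \<noteq> 0"
    using tvec_inj[OF A \<kappa> \<iota>W[OF assms(1)], of y 0] tvec_zero[OF \<kappa> \<iota>W[OF assms(1)]] assms(2) by auto
  then have "F (\<iota> x) (tvec A \<kappa> (\<iota> x) y) > 0"
    by (intro randers_pos[OF A g \<tau> cov] tvec_tangent[OF A \<kappa> \<iota>W[OF assms(1)]])
  then show ?thesis using F_fins[OF \<iota>W[OF assms(1)]] \<xi>\<iota>[OF assms(1)] by simp
qed

lemma fins_zero: "fins x 0 = 0" by (simp add: fins_def mmetric_def)

lemma fins_scale: "s \<ge> 0 \<Longrightarrow> fins x (s *\<^sub>R y) = s * fins x y"
  by (simp add: fins_def mmetric_scale real_sqrt_mult algebra_simps)

lemma fins_symm: "fins x y + fins x (- y) = 2 * sqrt (mmetric \<mu> x y)"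
  by (simp add: fins_def mmetric_def)

lemma mmetric_continuous: "continuous_on (D \<times> UNIV) (\<lambda>z. mmetric \<mu> (fst z) (snd z))"
proof -
  have "continuous_on (D \<times> UNIV) (\<lambda>z :: (real^2) \<times> (real^2). mroot \<mu> (fst z))"
    by (rule continuous_on_compose2[OF smooth_on_imp_continuous[OF mroot_smooth[of \<mu>]]])
      (use \<rho> in \<open>auto intro!: continuous_intros\<close>)
  moreover have "mroot \<mu> (fst z) \<noteq> 0" if "z \<in> D \<times> UNIV" for z :: "(real^2) \<times> (real^2)"
    using mroot_pos[of "fst z" \<mu>] that \<rho> by force
  ultimately show ?thesis unfolding mmetric_def by (intro continuous_intros) auto
qed

lemma fins_continuous: "continuous_on (D \<times> UNIV) (\<lambda>z. fins (fst z) (snd z))"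
proof -
  have "continuous_on (D \<times> UNIV) (\<lambda>z :: (real^2) \<times> (real^2). \<theta> (fst z))"
    by (rule continuous_on_compose2[OF smooth_on_imp_continuous[OF s\<theta>]]) (auto intro!: continuous_intros)
  then show ?thesis unfolding fins_def by (intro continuous_intros mmetric_continuous)
qed

lemma mbilin_Cauchy:
  assumes x: "x \<in> D" shows "mbilin \<mu> x u v \<le> sqrt (mmetric \<mu> x u) * sqrt (mmetric \<mu> x v)"
proof (cases "v = 0")
  case False
  let ?b = "mbilin \<mu> x"
  have nn: "?b w w \<ge> 0" for w
    using mmetric_pos[OF x, of w] by (cases "w = 0") (auto simp: mbilin_self mmetric_def)
  have v: "?b v v > 0" using mmetric_pos[OF x False] by (simp add: mbilin_self)
  have "?b (?b v v *\<^sub>R u - ?b u v *\<^sub>R v) (?b v v *\<^sub>R u - ?b u v *\<^sub>R v) = ?b v v * (?b u u * ?b v v - (?b u v)\<^sup>2)"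
    by (simp add: mbilin_diff mbilin_commute[of \<mu> x _ "_ - _"] mbilin_commute[of \<mu> x v u] algebra_simps power2_eq_square)
  with nn[of "?b v v *\<^sub>R u - ?b u v *\<^sub>R v"] v have "(?b u v)\<^sup>2 \<le> ?b u u * ?b v v"
    by (simp add: zero_le_mult_iff)
  then have "?b u v \<le> sqrt (?b u u * ?b v v)" by (rule real_le_rsqrt)
  then show ?thesis by (simp add: real_sqrt_mult mbilin_self)
qed (simp add: mbilin_def mmetric_def)

text \<open>The derivative of \<open>fins x\<close> at \<open>w\<close>, a supporting functional of
  this convex function; the bound is the Cauchy-Schwarz inequality. At \<open>w = 0\<close> the
  1-form itself serves. Such functionals calibrate lengths from below.\<close>

lemma fins_support:
  assumes x: "x \<in> D"
  shows "\<exists>l. bounded_linear l \<and> l w = fins x w \<and> (\<forall>v. l v \<le> fins x v)"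
proof (cases "w = 0")
  case True
  have "\<theta> x \<bullet> v \<le> fins x v" for v
    using mmetric_pos[OF x, of v] by (cases "v = 0") (auto simp: fins_def mmetric_def)
  then show ?thesis using True by (intro exI[of _ "\<lambda>v. \<theta> x \<bullet> v"]) (auto simp: fins_zero bounded_linear_inner_right)
next
  case False
  let ?n = "sqrt (mmetric \<mu> x w)"
  have n: "?n > 0" using mmetric_pos[OF x False] by simp
  define l where "l v = mbilin \<mu> x w v / ?n + \<theta> x \<bullet> v" for v
  have "bounded_linear l"
    unfolding linear_conv_bounded_linear[symmetric] l_def[abs_def] mbilin_def
    by (auto intro!: linearI simp: inner_add_right add_divide_distrib algebra_simps)
  moreover have "l w = fins x w"
    using n by (simp add: l_def fins_def mbilin_self real_div_sqrt)
  moreover have "l v \<le> fins x v" for v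
    using mbilin_Cauchy[OF x, of w v] n by (simp add: l_def fins_def pos_divide_le_eq mult.commute)
  ultimately show ?thesis by blast
qed

lemma fins_bounds:
  assumes "cball x0 R \<subseteq> D" "R \<ge> 0"
  obtains l L where "l > 0" "L > 0" "\<And>x y. x \<in> cball x0 R \<Longrightarrow> l * norm y \<le> fins x y \<and> fins x y \<le> L * norm y"
proof -
  let ?K = "cball x0 R \<times> sphere (0 :: real^2) 1"
  have K: "compact ?K" by (intro compact_Times) auto
  have "sphere (0 :: real^2) 1 \<noteq> {}" by simp
  then have ne: "?K \<noteq> {}" using assms(2) by auto
  have c: "continuous_on ?K (\<lambda>z. fins (fst z) (snd z))"
    by (rule continuous_on_subset[OF fins_continuous]) (use assms in auto)
  obtain z1 where z1: "z1 \<in> ?K" "\<And>z. z \<in> ?K \<Longrightarrow> fins (fst z1) (snd z1) \<le> fins (fst z) (snd z)"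
    using continuous_attains_inf[OF K ne c] by blast
  obtain z2 where z2: "z2 \<in> ?K" "\<And>z. z \<in> ?K \<Longrightarrow> fins (fst z) (snd z) \<le> fins (fst z2) (snd z2)"
    using continuous_attains_sup[OF K ne c] by blast
  have "fst z1 \<in> D" "snd z1 \<noteq> 0" "fst z2 \<in> D" "snd z2 \<noteq> 0" using z1(1) z2(1) assms(1) by auto
  then have p: "fins (fst z1) (snd z1) > 0" "fins (fst z2) (snd z2) > 0" using fins_pos by auto
  have "fins (fst z1) (snd z1) * norm y \<le> fins x y \<and> fins x y \<le> fins (fst z2) (snd z2) * norm y" if x: "x \<in> cball x0 R" for x y
  proof (cases "y = 0")
    case False
    have "(x, (1 / norm y) *\<^sub>R y) \<in> ?K" using x False by simp
    from z1(2)[OF this] z2(2)[OF this] show ?thesis using False by (simp add: fins_scale field_simps)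
  qed (simp add: fins_zero)
  then show ?thesis using that p by blast
qed

lemma fins_close:
  assumes x0: "x0 \<in> D" and e: "e > 0"
  obtains r where "r > 0" "ball x0 r \<subseteq> D" "\<And>x y. x \<in> ball x0 r \<Longrightarrow> (1 - e) * fins x0 y \<le> fins x y \<and> fins x y \<le> (1 + e) * fins x0 y"
proof -
  obtain R where R: "R > 0" "cball x0 R \<subseteq> D" using x0 open_contains_cball[of D] by blast
  obtain l L where l: "l > 0" "\<And>x y. x \<in> cball x0 R \<Longrightarrow> l * norm y \<le> fins x y \<and> fins x y \<le> L * norm y"
    using fins_bounds[OF R(2)] R(1) by (metis less_imp_le)
  let ?K = "cball x0 R \<times> sphere (0 :: real^2) 1"
  have "uniformly_continuous_on ?K (\<lambda>z. fins (fst z) (snd z))"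
    by (intro compact_uniformly_continuous compact_Times continuous_on_subset[OF fins_continuous]) (use R in auto)
  \<comment> \<open>The tolerance \<open>e * l\<close>, with \<open>l\<close> a lower bound of
    \<open>fins\<close> on unit vectors, converts an additive estimate on the compact unit sphere
    bundle into a multiplicative one, which extends to all vectors by homogeneity.\<close>
  then obtain d where d: "d > 0" "\<And>z z'. z \<in> ?K \<Longrightarrow> z' \<in> ?K \<Longrightarrow> dist z' z < d \<Longrightarrow> dist (fins (fst z') (snd z')) (fins (fst z) (snd z)) < e * l"
    unfolding uniformly_continuous_on_def using e l(1) by (metis mult_pos_pos)
  define r where "r = min R d"
  have "(1 - e) * fins x0 y \<le> fins x y \<and> fins x y \<le> (1 + e) * fins x0 y" if x: "x \<in> ball x0 r" for x y
  proof (cases "y = 0")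
    case False
    let ?y = "(1 / norm y) *\<^sub>R y"
    have "(x0, ?y) \<in> ?K" "(x, ?y) \<in> ?K" "dist (x, ?y) (x0, ?y) < d"
      using x R False by (auto simp: r_def dist_Pair_Pair dist_commute)
    from d(2)[OF this] have "\<bar>fins x ?y - fins x0 ?y\<bar> < e * l" by (simp add: dist_real_def)
    moreover have "l \<le> fins x0 ?y" using l(2)[of x0 ?y] R False by simp
    then have "e * l \<le> e * fins x0 ?y" using e by simp
    ultimately have "(1 - e) * fins x0 ?y \<le> fins x ?y \<and> fins x ?y \<le> (1 + e) * fins x0 ?y"
      by (simp add: algebra_simps abs_less_iff)
    then have "norm y * ((1 - e) * fins x0 ?y) \<le> norm y * fins x ?y \<and> norm y * fins x ?y \<le> norm y * ((1 + e) * fins x0 ?y)"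
      using mult_left_mono[of _ _ "norm y"] by simp
    then show ?thesis using False by (simp add: fins_scale)
  qed (simp add: fins_zero)
  moreover have "r > 0" "ball x0 r \<subseteq> D" using R d by (auto simp: r_def)
  ultimately show ?thesis using that by blast
qed

end

lemma randers_zero:
  assumes "oriented_atlas A" "riemannian_metric A g" "one_form A \<tau>"
  shows "randers g \<tau> p (0 :: ('m::topological_space, 2) tangent) = 0"
proof -
  have z: "(0 :: ('m, 2) tangent) \<in> tangent_space A p"
  proof -
    obtain \<kappa> where k: "\<kappa> \<in> charts_at A p" using atlas_charts_at[OF assms(1)] by blast
    then have \<kappa>: "compatible A \<kappa>" "p \<in> chart_dom \<kappa>" using atlas_compatible[OF assms(1)] by (auto simp: charts_at_def)
    show ?thesis using tvec_tangent[OF assms(1) \<kappa>, of 0] by (simp add: tvec_zero[OF \<kappa>])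
  qed
  have "g p (0 *\<^sub>R 0 + 0 *\<^sub>R 0) 0 = 0 * g p 0 0 + 0 * g p 0 0" by (rule metricD(3)[OF assms(2) z z z])
  moreover have "\<tau> p (0 *\<^sub>R 0 + 0 *\<^sub>R 0) = 0 * \<tau> p 0 + 0 * \<tau> p 0"
    using assms(3) z unfolding one_form_def by blast
  ultimately show ?thesis by (simp add: randers_def)
qed

lemma velocity_tangent:
  assumes A: "oriented_atlas A" and c: "C1_curve A c" and t: "t \<in> {0..1}"
  shows "velocity A c t \<in> tangent_space A (c t)"
proof -
  obtain \<kappa> where k: "\<kappa> \<in> charts_at A (c t)" using atlas_charts_at[OF A] by blast
  then have \<kappa>: "compatible A \<kappa>" "c t \<in> chart_dom \<kappa>" using atlas_compatible[OF A] by (auto simp: charts_at_def)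
  show ?thesis unfolding C1_curve_chart(2)[OF A \<kappa>(1) c t \<kappa>(2)] by (rule tvec_tangent[OF A \<kappa>])
qed

section \<open>Lengths of curves and the distance\<close>

context model_chart
begin

lemma speed_nonneg: "C1_curve A c \<Longrightarrow> t \<in> {0..1} \<Longrightarrow> F (c t) (velocity A c t) \<ge> 0"
  using randers_pos[OF A g \<tau> cov velocity_tangent[OF A], of c t] randers_zero[OF A g \<tau>, of "c t"]
  by (cases "velocity A c t = 0") auto

lemma flen_nonneg: "C1_curve A c \<Longrightarrow> flen A F c \<ge> 0"
  unfolding flen_def
  by (rule integral_nonneg[OF integrable_continuous_real[OF randers_curve_continuous[OF A g \<tau>]] speed_nonneg])

lemma dst_le: "C1_curve A c \<Longrightarrow> dst (c 0) (c 1) \<le> flen A F c"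
  unfolding finsler_dist_def flen_def[symmetric]
  by (rule cInf_lower) (auto intro!: bdd_belowI[of _ 0] flen_nonneg)

lemma chart_curve_lift:
  assumes z: "\<And>t. t \<in> {0..1} \<Longrightarrow> z t \<in> D" "\<And>t. t \<in> {0..1} \<Longrightarrow> (z has_vector_derivative z' t) (at t within {0..1})"
    and z': "continuous_on {0..1} z'"
  shows "C1_curve A (\<iota> \<circ> z)" and "flen A F (\<iota> \<circ> z) = integral {0..1} (\<lambda>t. fins (z t) (z' t))"
proof -
  have zi: "z t \<in> \<xi> ` W" if "t \<in> {0..1}" for t using z(1)[OF that] im by simp
  show "C1_curve A (\<iota> \<circ> z)" by (rule C1_curve_lift(1)[OF A \<kappa> zi z(2) z'])
  have l: "velocity A (\<iota> \<circ> z) t = tvec A \<kappa> (\<iota> (z t)) (z' t)" if "t \<in> {0..1}" for t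
    by (rule C1_curve_lift(2)[OF A \<kappa> zi z(2) z' that])
  show "flen A F (\<iota> \<circ> z) = integral {0..1} (\<lambda>t. fins (z t) (z' t))"
    unfolding flen_def
  proof (rule integral_cong)
    fix t :: real assume t: "t \<in> {0..1}"
    show "F ((\<iota> \<circ> z) t) (velocity A (\<iota> \<circ> z) t) = fins (z t) (z' t)"
      using F_fins[OF \<iota>W[OF z(1)[OF t]]] \<xi>\<iota>[OF z(1)[OF t]] l[OF t] by simp
  qed
qed

lemma segment_in_ball:
  fixes x :: "real^2"
  assumes "x \<in> ball x0 r" "y \<in> ball x0 r" "t \<in> {0..1}"
  shows "x + t *\<^sub>R (y - x) \<in> ball x0 r"
proof -
  have "x + t *\<^sub>R (y - x) = (1 - t) *\<^sub>R x + t *\<^sub>R y" by (simp add: algebra_simps)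
  moreover have "(1 - t) *\<^sub>R x + t *\<^sub>R y \<in> ball x0 r"
    by (rule convexD[OF convex_ball assms(1,2)]) (use assms(3) in auto)
  ultimately show ?thesis by simp
qed

lemma segment_lift:
  assumes "x \<in> D" "y \<in> D"
  defines "z \<equiv> \<lambda>t. x + t *\<^sub>R (y - x)"
  shows "C1_curve A (\<iota> \<circ> z)" "flen A F (\<iota> \<circ> z) = integral {0..1} (\<lambda>t. fins (z t) (y - x))"
    and "(\<iota> \<circ> z) 0 = \<iota> x" "(\<iota> \<circ> z) 1 = \<iota> y"
proof -
  have "z t \<in> D" if "t \<in> {0..1}" for t unfolding z_def by (rule segment_in_ball[OF assms(1,2) that])
  moreover have "(z has_vector_derivative (y - x)) (at t within {0..1})" for t
    unfolding z_def by (auto intro!: derivative_eq_intros)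
  ultimately show "C1_curve A (\<iota> \<circ> z)" "flen A F (\<iota> \<circ> z) = integral {0..1} (\<lambda>t. fins (z t) (y - x))"
    by (auto intro!: chart_curve_lift)
qed (simp_all add: z_def)

lemma dst_curve:
  assumes "x \<in> D" "y \<in> D" "e > 0"
  shows "\<exists>c. C1_curve A c \<and> c 0 = \<iota> x \<and> c 1 = \<iota> y \<and> flen A F c < dst (\<iota> x) (\<iota> y) + e"
proof -
  let ?S = "{flen A F c | c. C1_curve A c \<and> c 0 = \<iota> x \<and> c 1 = \<iota> y}"
  have "flen A F (\<iota> \<circ> (\<lambda>t. x + t *\<^sub>R (y - x))) \<in> ?S" unfolding mem_Collect_eq
    by (intro exI[of _ "\<iota> \<circ> (\<lambda>t. x + t *\<^sub>R (y - x))"] conjI refl segment_lift[OF assms(1,2)])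
  then have ne: "?S \<noteq> {}" by (rule ex_in_conv[THEN iffD1, OF exI])
  have "Inf ?S < dst (\<iota> x) (\<iota> y) + e" using assms(3) by (simp add: finsler_dist_def flen_def)
  then have "\<exists>s\<in>?S. s < dst (\<iota> x) (\<iota> y) + e" by (rule cInf_lessD[OF ne])
  then obtain s where s: "s \<in> ?S" "s < dst (\<iota> x) (\<iota> y) + e" by (elim bexE)
  from s(1) obtain c where "s = flen A F c \<and> C1_curve A c \<and> c 0 = \<iota> x \<and> c 1 = \<iota> y" unfolding mem_Collect_eq by (elim exE)
  then show ?thesis using s(2) by (intro exI[of _ c]) simp
qed

lemma chart_curve:
  assumes c: "C1_curve A c" and t: "t \<in> {0..1}" "c t \<in> W"
  defines "z' \<equiv> \<lambda>t. vector_derivative (\<xi> \<circ> c) (at t within {0..1})"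
  shows "((\<xi> \<circ> c) has_vector_derivative z' t) (at t within {0..1})"
    and "F (c t) (velocity A c t) = fins (\<xi> (c t)) (z' t)"
    and "continuous_on {t\<in>{0..1}. c t \<in> W} z'"
  unfolding z'_def C1_curve_chart(2)[OF A \<kappa> c t] F_fins[OF t(2)]
  by (fact C1_curve_chart(1)[OF A \<kappa> c t] refl C1_curve_chart_continuous[OF A \<kappa> c])+

text \<open>Calibration: the integral of \<open>l\<close> along the velocity is \<open>l\<close> of
  the displacement. The comparison stops at time \<open>s\<close>, because afterwards the curve may
  leave the chart; the rest of it has nonnegative length.\<close>

lemma length_lower:
  assumes c: "C1_curve A c" and s: "s \<in> {0..1}" and W: "\<And>t. t \<in> {0..s} \<Longrightarrow> c t \<in> W"
    and l: "bounded_linear l" "\<And>t y. t \<in> {0..s} \<Longrightarrow> l y \<le> fins (\<xi> (c t)) y"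
  shows "l (\<xi> (c s) - \<xi> (c 0)) \<le> flen A F c"
proof -
  define z' where "z' t = vector_derivative (\<xi> \<circ> c) (at t within {0..1})" for t
  have t: "t \<in> {0..1}" if "t \<in> {0..s}" for t using s that by auto
  note cc = chart_curve[OF c t W, folded z'_def]
  have sub: "{0..s} \<subseteq> {0..1}" using s by auto
  have "((\<lambda>t. l (\<xi> (c t))) has_vector_derivative l (z' t)) (at t within {0..s})" if "t \<in> {0..s}" for t
    using bounded_linear.has_vector_derivative[OF l(1) has_vector_derivative_within_subset[OF cc(1)[OF that that] sub]]
    by (simp add: o_def)
  then have hi: "((\<lambda>t. l (z' t)) has_integral l (\<xi> (c s)) - l (\<xi> (c 0))) {0..s}"
    using s by (intro fundamental_theorem_of_calculus) auto
  have i1: "(\<lambda>t. F (c t) (velocity A c t)) integrable_on {0..1}"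
    by (rule integrable_continuous_real[OF randers_curve_continuous[OF A g \<tau> c]])
  then have i: "(\<lambda>t. F (c t) (velocity A c t)) integrable_on {0..s}"
    by (rule integrable_subinterval_real[OF _ sub])
  have "l (\<xi> (c s)) - l (\<xi> (c 0)) \<le> integral {0..s} (\<lambda>t. F (c t) (velocity A c t))"
    by (rule has_integral_le[OF hi integrable_integral[OF i]]) (use cc(2) l(2) in auto)
  also have "\<dots> \<le> flen A F c"
    unfolding flen_def by (rule integral_subset_le[OF sub i i1]) (simp add: speed_nonneg[OF c])
  finally show ?thesis by (simp add: linear_diff[OF bounded_linear.linear[OF l(1)]])
qed

text \<open>Up to the first exit time the curve stays in the chart and its coordinates move at least
  the distance from the starting point to the sphere of radius \<open>R\<close>. Each unit of
  coordinate displacement costs at least \<open>l\<close>.\<close>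

lemma exit_length:
  assumes R: "cball x0 R \<subseteq> D" "R > 0" and c: "C1_curve A c" and c0: "c 0 \<in> W" "\<xi> (c 0) \<in> ball x0 R"
    and l: "l > 0" "\<And>x y. x \<in> cball x0 R \<Longrightarrow> l * norm y \<le> fins x y"
    and ex: "t0 \<in> {0..1}" "c t0 \<notin> \<iota> ` ball x0 R"
  shows "l * (R - dist x0 (\<xi> (c 0))) \<le> flen A F c"
proof -
  let ?B = "\<iota> ` ball x0 R" and ?C = "\<iota> ` cball x0 R"
  have oB: "open ?B" by (rule chart_preimage_open[OF ch]) (use R im in auto)
  have "continuous_on (cball x0 R) \<iota>"
    using is_chartD(7)[OF ch] R(1) im continuous_on_subset by metis
  \<comment> \<open>The Hausdorff property makes the image of the closed ball closed in the
    manifold, so the curve at the first exit time is still in the chart and cannot jump out of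
    it.\<close>
  then have clC: "closed ?C" by (intro compact_imp_closed compact_continuous_image compact_cball)
  have cc: "continuous_on {0..1} c" using c by (simp add: C1_curve_def)
  let ?S = "{0..1} \<inter> c -` (- ?B)"
  have clS: "closed ?S" by (rule continuous_closed_preimage[OF cc]) (use oB in auto)
  define s where "s = Inf ?S"
  have bS: "bdd_below ?S" by (rule bdd_belowI[of _ 0]) auto
  have sS: "s \<in> ?S" unfolding s_def by (rule closed_contains_Inf[OF _ bS clS]) (use ex in auto)
  have lt: "c t \<in> ?B" if "0 \<le> t" "t < s" for t
  proof (rule ccontr)
    assume "c t \<notin> ?B"
    then have "t \<in> ?S" using that sS by auto
    then show False using cInf_lower[OF _ bS, of t] that by (simp add: s_def)
  qed
  have c0B: "c 0 \<in> ?B" using c0 \<iota>\<xi> by (metis image_eqI)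
  then have s0: "s > 0" using sS by (cases "s = 0") auto
  let ?T = "{0..1} \<inter> c -` ?C"
  have clT: "closed ?T" by (rule continuous_closed_preimage[OF cc _ clC]) auto
  have "{0..<s} \<subseteq> ?T"
  proof
    fix t assume t: "t \<in> {0..<s}"
    then have "c t \<in> ?B" using lt by auto
    then show "t \<in> ?T" using t sS by auto
  qed
  then have "closure {0..<s} \<subseteq> ?T" by (rule closure_minimal[OF _ clT])
  then have T: "{0..s} \<subseteq> ?T" using s0 by simp
  have in_C: "c t \<in> W" "\<xi> (c t) \<in> cball x0 R" if "t \<in> {0..s}" for t
  proof -
    have "c t \<in> ?C" using T that by blast
    then obtain x where x: "c t = \<iota> x" "x \<in> cball x0 R" by (elim imageE)
    then have "x \<in> D" using R(1) by blast
    then show "c t \<in> W" "\<xi> (c t) \<in> cball x0 R" using x \<iota>W \<xi>\<iota> by auto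
  qed
  have "\<xi> (c s) \<notin> ball x0 R"
  proof
    assume "\<xi> (c s) \<in> ball x0 R"
    then have "c s \<in> ?B" using \<iota>\<xi>[OF in_C(1)[of s]] s0 by (metis atLeastAtMost_iff image_eqI less_eq_real_def order_refl)
    then show False using sS by blast
  qed
  then have far: "R \<le> dist x0 (\<xi> (c s))" by simp
  define w where "w = \<xi> (c s) - \<xi> (c 0)"
  have "R - dist x0 (\<xi> (c 0)) \<le> norm w"
    using far dist_triangle[of x0 "\<xi> (c s)" "\<xi> (c 0)"] by (simp add: w_def dist_norm norm_minus_commute)
  then have wpos: "norm w > 0" and le: "l * (R - dist x0 (\<xi> (c 0))) \<le> l * norm w" using c0(2) l(1) by auto
  \<comment> \<open>Calibration by \<open>l\<close> times the unit vector in the direction of the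
    displacement \<open>w\<close>.\<close>
  let ?l = "\<lambda>y. l * ((1 / norm w) *\<^sub>R w \<bullet> y)"
  have "?l (\<xi> (c s) - \<xi> (c 0)) \<le> flen A F c"
  proof (rule length_lower[OF c _ in_C(1)])
    show "bounded_linear ?l" by (intro bounded_linear_const_mult bounded_linear_inner_right)
    fix t y assume t: "t \<in> {0..s}"
    have "(1 / norm w) *\<^sub>R w \<bullet> y \<le> norm ((1 / norm w) *\<^sub>R w) * norm y" by (rule norm_cauchy_schwarz)
    also have "\<dots> = norm y" using wpos by simp
    finally have "?l y \<le> l * norm y" by (rule mult_left_mono) (use l(1) in simp)
    also have "\<dots> \<le> fins (\<xi> (c t)) y" by (rule l(2)[OF in_C(2)[OF t]])
    finally show "?l y \<le> fins (\<xi> (c t)) y" .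
  qed (use sS in auto)
  then have "l * ((1 / norm w) *\<^sub>R w \<bullet> w) \<le> flen A F c" by (simp add: w_def)
  moreover have "(1 / norm w) *\<^sub>R w \<bullet> w = norm w" using wpos by (simp add: dot_square_norm power2_eq_square)
  moreover have "l * ((1 / norm w) *\<^sub>R w \<bullet> w) = l * norm w" using calculation(2) by (rule arg_cong)
  ultimately show ?thesis using le by linarith
qed

lemma dst_upper:
  assumes "x \<in> D" "y \<in> D" and B: "\<And>t. t \<in> {0..1} \<Longrightarrow> fins (x + t *\<^sub>R (y - x)) (y - x) \<le> B"
  shows "dst (\<iota> x) (\<iota> y) \<le> B"
proof -
  note sl = segment_lift[OF assms(1,2)]
  let ?c = "\<iota> \<circ> (\<lambda>t. x + t *\<^sub>R (y - x))"
  have "dst (\<iota> x) (\<iota> y) \<le> flen A F ?c" using dst_le[OF sl(1)] sl(3,4) by simp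
  also have "\<dots> \<le> integral {0..1} (\<lambda>t :: real. B)"
    unfolding sl(2)
  proof (rule integral_le)
    let ?z = "\<lambda>t. x + t *\<^sub>R (y - x)"
    have "continuous_on {0..1} (\<lambda>t. fins (fst (?z t, y - x)) (snd (?z t, y - x)))"
      by (rule continuous_on_compose2[OF fins_continuous])
        (use segment_in_ball[OF assms(1,2)] in \<open>auto intro!: continuous_intros simp del: mem_ball\<close>)
    then show "(\<lambda>t. fins (?z t) (y - x)) integrable_on {0..1}" by (intro integrable_continuous_real) simp
  qed (use B in auto)
  finally show ?thesis by simp
qed

text \<open>Almost minimizing curves between points of the smaller ball do not leave the larger one.\<close>

definition inner_ball :: "real^2 \<Rightarrow> real \<Rightarrow> real \<Rightarrow> bool" where
  "inner_ball x0 r R \<longleftrightarrow> 0 < r \<and> r \<le> R \<and> ball x0 R \<subseteq> D \<and>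
     (\<forall>x\<in>ball x0 r. \<forall>y\<in>ball x0 r. \<forall>e>0. \<exists>c. C1_curve A c \<and> c 0 = \<iota> x \<and> c 1 = \<iota> y \<and>
        (\<forall>t\<in>{0..1}. c t \<in> \<iota> ` ball x0 R) \<and> flen A F c < dst (\<iota> x) (\<iota> y) + e)"

lemma inner_ball_exists:
  assumes R: "cball x0 R \<subseteq> D" "R > 0"
  shows "\<exists>r>0. inner_ball x0 r R"
proof -
  obtain l L where l: "l > 0" "L > 0" "\<And>x y. x \<in> cball x0 R \<Longrightarrow> l * norm y \<le> fins x y \<and> fins x y \<le> L * norm y"
    using fins_bounds[OF R(1)] R(2) by (metis less_imp_le)
  \<comment> \<open>Chosen so that \<open>2 * L * r + 2 * l * r = l * R\<close>. A segment between
    two points of the small ball costs at most \<open>2 * L * r\<close>, while leaving the large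
    ball costs more than \<open>l * (R - r)\<close>, so an excess of at most \<open>l * r\<close>
    over the distance does not suffice for leaving.\<close>
  define r where "r = l * R / (2 * L + 2 * l)"
  have r: "r > 0" using l R(2) by (simp add: r_def)
  have "2 * L + 2 * l \<noteq> 0" using l by linarith
  then have "(2 * L + 2 * l) * r = l * R" by (simp add: r_def)
  then have rR: "2 * L * r + 2 * l * r = l * R" by (simp add: algebra_simps)
  have "2 * l * r < l * R" using rR r l by (smt (verit) mult_pos_pos)
  then have rR2: "2 * r < R" using l(1) by (simp add: mult.assoc mult.left_commute)
  have "\<exists>c. C1_curve A c \<and> c 0 = \<iota> x \<and> c 1 = \<iota> y \<and> (\<forall>t\<in>{0..1}. c t \<in> \<iota> ` ball x0 R) \<and> flen A F c < dst (\<iota> x) (\<iota> y) + e"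
    if xy: "x \<in> ball x0 r" "y \<in> ball x0 r" and e: "e > 0" for x y e
  proof -
    have inb: "x \<in> ball x0 R" "y \<in> ball x0 R" using xy rR2 r by auto
    then have xD: "x \<in> D" "y \<in> D" using R(1) ball_subset_cball by blast+
    have "norm (y - x) \<le> 2 * r" using xy dist_triangle2[of x y x0] by (simp add: dist_norm norm_minus_commute)
    then have "L * norm (y - x) \<le> L * (2 * r)" using l(2) by simp
    then have ub: "dst (\<iota> x) (\<iota> y) \<le> L * (2 * r)"
      using segment_in_ball[OF inb] l(3) by (intro dst_upper[OF xD]) (smt (verit) ball_subset_cball subsetD)
    define e' where "e' = min e (l * r)"
    have e': "e' > 0" "e' \<le> e" "e' \<le> l * r" using e l r by (auto simp: e'_def)
    obtain c where c: "C1_curve A c" "c 0 = \<iota> x" "c 1 = \<iota> y" "flen A F c < dst (\<iota> x) (\<iota> y) + e'"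
      using dst_curve[OF xD e'(1)] by blast
    have "c t \<in> \<iota> ` ball x0 R" if "t \<in> {0..1}" for t
    proof (rule ccontr)
      assume out: "c t \<notin> \<iota> ` ball x0 R"
      have "l * (R - dist x0 (\<xi> (c 0))) \<le> flen A F c"
        by (rule exit_length[OF R c(1) _ _ l(1) _ that out]) (use c(2) \<iota>W \<xi>\<iota> xD inb l(3) in auto)
      moreover have "l * (R - r) < l * (R - dist x0 (\<xi> (c 0)))" using l(1) xy(1) c(2) \<xi>\<iota>[OF xD(1)] by simp
      ultimately have "l * (R - r) < L * (2 * r) + l * r" using c(4) ub e'(3) by linarith
      then show False using rR by (simp add: algebra_simps)
    qed
    then show ?thesis using c e'(2) by (intro exI[of _ c]) auto
  qed
  then show ?thesis using r rR2 R unfolding inner_ball_def by (intro exI[of _ r]) auto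
qed

text \<open>On a small ball \<open>fins\<close> is nearly independent of the base point. Segments
  give the upper estimate; for the lower one, the supporting functional of \<open>fins x0\<close> at
  \<open>y - x\<close> calibrates almost minimizing curves, which \<open>inner_ball\<close> keeps in
  the region where \<open>fins\<close> is close to \<open>fins x0\<close>.\<close>

lemma dst_asymp:
  assumes x0: "x0 \<in> D" and e: "0 < e" "e < 1"
  shows "\<exists>d>0. ball x0 d \<subseteq> D \<and> (\<forall>x\<in>ball x0 d. \<forall>y\<in>ball x0 d.
    (1 - e) * fins x0 (y - x) \<le> dst (\<iota> x) (\<iota> y) \<and> dst (\<iota> x) (\<iota> y) \<le> (1 + e) * fins x0 (y - x))"
proof -
  obtain r where r: "r > 0" "ball x0 r \<subseteq> D"
    "\<And>x y. x \<in> ball x0 r \<Longrightarrow> (1 - e) * fins x0 y \<le> fins x y \<and> fins x y \<le> (1 + e) * fins x0 y"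
    using fins_close[OF x0 e(1)] by metis
  define R where "R = r / 2"
  have "cball x0 R \<subseteq> ball x0 r" using r(1) by (auto simp: R_def)
  then have R: "cball x0 R \<subseteq> D" "R > 0" "ball x0 R \<subseteq> ball x0 r" using r by (auto simp: R_def)
  obtain d where d: "d > 0" "inner_ball x0 d R" using inner_ball_exists[OF R(1,2)] by blast
  have dR: "ball x0 d \<subseteq> ball x0 R" using d(2) by (auto simp: inner_ball_def)
  have "(1 - e) * fins x0 (y - x) \<le> dst (\<iota> x) (\<iota> y) \<and> dst (\<iota> x) (\<iota> y) \<le> (1 + e) * fins x0 (y - x)"
    if x: "x \<in> ball x0 d" and y: "y \<in> ball x0 d" for x y
  proof
    have xr: "x \<in> ball x0 r" "y \<in> ball x0 r" using x y dR R(3) by blast+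
    have xD: "x \<in> D" "y \<in> D" using xr r(2) by blast+
    show "dst (\<iota> x) (\<iota> y) \<le> (1 + e) * fins x0 (y - x)"
      using r(3) segment_in_ball[OF xr] by (intro dst_upper[OF xD]) blast
    obtain l where l: "bounded_linear l" "l (y - x) = fins x0 (y - x)" "\<And>v. l v \<le> fins x0 v"
      using fins_support[OF x0] by blast
    show "(1 - e) * fins x0 (y - x) \<le> dst (\<iota> x) (\<iota> y)"
    proof (rule field_le_epsilon)
      fix b :: real assume b: "b > 0"
      obtain c where c: "C1_curve A c" "c 0 = \<iota> x" "c 1 = \<iota> y" "\<And>t. t \<in> {0..1} \<Longrightarrow> c t \<in> \<iota> ` ball x0 R"
        "flen A F c < dst (\<iota> x) (\<iota> y) + b"
        using d(2) x y b unfolding inner_ball_def by blast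
      have cW: "c t \<in> W" "\<xi> (c t) \<in> ball x0 r" if t: "t \<in> {0..1}" for t
      proof -
        obtain w where w: "c t = \<iota> w" "w \<in> ball x0 R" using c(4)[OF t] by blast
        then have "w \<in> ball x0 r" "w \<in> D" using R(3) r(2) by blast+
        then show "c t \<in> W" "\<xi> (c t) \<in> ball x0 r" using w \<iota>W \<xi>\<iota> by auto
      qed
      have "(1 - e) * l (\<xi> (c 1) - \<xi> (c 0)) \<le> flen A F c"
      proof (rule length_lower[OF c(1) _ cW(1) bounded_linear_const_mult[OF l(1)]])
        fix t y assume t: "t \<in> {0..1::real}"
        have "(1 - e) * l y \<le> (1 - e) * fins x0 y" using l(3) e by (intro mult_left_mono) auto
        then show "(1 - e) * l y \<le> fins (\<xi> (c t)) y" using r(3)[OF cW(2)[OF t], of y] by linarith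
      qed auto
      then show "(1 - e) * fins x0 (y - x) \<le> dst (\<iota> x) (\<iota> y) + b"
        using c(2,3,5) l(2) \<xi>\<iota> xD by simp
    qed
  qed
  then show ?thesis using d dR R(3) r(2) by (intro exI[of _ d]) blast
qed

text \<open>A map that changes the Finsler metric by the differential of \<open>f\<close> changes the length of a curve by the
  increment of \<open>f\<close>.\<close>

lemma dst_map:
  assumes ib: "inner_ball x0 r R" and xy: "x \<in> ball x0 r" "y \<in> ball x0 r"
    and \<phi>: "smooth_on (ball x0 R) \<phi>" "\<phi> ` ball x0 R \<subseteq> D"
    and f: "\<And>x. x \<in> ball x0 R \<Longrightarrow> (f has_derivative f' x) (at x)"
    and F: "\<And>x v. x \<in> ball x0 R \<Longrightarrow> fins (\<phi> x) (frechet_derivative \<phi> (at x) v) = fins x v + f' x v"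
  shows "dst (\<iota> (\<phi> x)) (\<iota> (\<phi> y)) \<le> dst (\<iota> x) (\<iota> y) + (f y - f x)"
proof (rule field_le_epsilon)
  have RD: "ball x0 R \<subseteq> D" and rR: "ball x0 r \<subseteq> ball x0 R" using ib by (auto simp: inner_ball_def)
  fix b :: real assume b: "b > 0"
  obtain c where c: "C1_curve A c" "c 0 = \<iota> x" "c 1 = \<iota> y" "\<And>t. t \<in> {0..1} \<Longrightarrow> c t \<in> \<iota> ` ball x0 R"
    "flen A F c < dst (\<iota> x) (\<iota> y) + b"
    using ib xy b unfolding inner_ball_def by blast
  define z where "z = \<xi> \<circ> c"
  define z' where "z' t = vector_derivative (\<xi> \<circ> c) (at t within {0..1})" for t
  have cW: "c t \<in> W" "z t \<in> ball x0 R" if t: "t \<in> {0..1}" for t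
  proof -
    obtain w where w: "c t = \<iota> w" "w \<in> ball x0 R" using c(4)[OF t] by blast
    then have "w \<in> D" using RD by blast
    then show "c t \<in> W" "z t \<in> ball x0 R" using w \<iota>W \<xi>\<iota> by (auto simp: z_def)
  qed
  note cc = chart_curve[OF c(1) _ cW(1), folded z'_def z_def]
  have "{t \<in> {0..1}. c t \<in> W} = {0..1}" using cW by auto
  then have z': "continuous_on {0..1} z'" using cc(3)[of 0] by simp
  have z: "continuous_on {0..1} z"
    using cc(1) has_vector_derivative_continuous continuous_on_eq_continuous_within by blast
  have dz: "(\<phi> \<circ> z has_vector_derivative frechet_derivative \<phi> (at (z t)) (z' t)) (at t within {0..1})" if t: "t \<in> {0..1}" for t
    by (rule vector_derivative_diff_chain_within[OF cc(1)[OF t t]])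
      (rule has_derivative_at_withinI[OF smooth_on_derivative[OF \<phi>(1) cW(2)[OF t]]])
  have cz: "continuous_on {0..1} (\<lambda>t. frechet_derivative \<phi> (at (z t)) (z' t))"
    by (rule continuous_on_frechet_apply[OF open_ball \<phi>(1) z _ z']) (use cW(2) in blast)
  have zD: "(\<phi> \<circ> z) t \<in> D" if "t \<in> {0..1}" for t using imageI[OF cW(2)[OF that], of \<phi>] \<phi>(2) by (auto simp del: mem_ball)
  note lift = chart_curve_lift[OF zD dz cz]
  have z01: "z 0 = x" "z 1 = y" using c(2,3) \<xi>\<iota>[OF subsetD[OF RD subsetD[OF rR]]] xy by (simp_all add: z_def del: mem_ball)
  have "((\<lambda>t. f (z t)) has_vector_derivative f' (z t) (z' t)) (at t within {0..1})" if t: "t \<in> {0..1}" for t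
    using vector_derivative_diff_chain_within[OF cc(1)[OF t t] has_derivative_at_withinI[OF f[OF cW(2)[OF t]]]]
    by (simp add: o_def)
  then have "((\<lambda>t. f' (z t) (z' t)) has_integral f (z 1) - f (z 0)) {0..1}"
    by (intro fundamental_theorem_of_calculus) auto
  moreover have "((\<lambda>t. F (c t) (velocity A c t)) has_integral flen A F c) {0..1}"
    unfolding flen_def by (rule integrable_integral[OF integrable_continuous_real[OF randers_curve_continuous[OF A g \<tau> c(1)]]])
  ultimately have "((\<lambda>t. F (c t) (velocity A c t) + f' (z t) (z' t)) has_integral flen A F c + (f y - f x)) {0..1}"
    unfolding z01 by (intro has_integral_add) auto
  then have "((\<lambda>t. fins ((\<phi> \<circ> z) t) (frechet_derivative \<phi> (at (z t)) (z' t))) has_integral flen A F c + (f y - f x)) {0..1}"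
  proof (rule has_integral_eq[rotated])
    fix t :: real assume t: "t \<in> {0..1}"
    show "F (c t) (velocity A c t) + f' (z t) (z' t) = fins ((\<phi> \<circ> z) t) (frechet_derivative \<phi> (at (z t)) (z' t))"
      unfolding cc(2)[OF t t] using F[OF cW(2)[OF t]] by (simp add: z_def)
  qed
  from lift(2) integral_unique[OF this] have "flen A F (\<iota> \<circ> (\<phi> \<circ> z)) = flen A F c + (f y - f x)" by (rule trans)
  then show "dst (\<iota> (\<phi> x)) (\<iota> (\<phi> y)) \<le> dst (\<iota> x) (\<iota> y) + (f y - f x) + b"
    using dst_le[OF lift(1)] c(5) z01 by simp
qed

end

lemma curl_diff:
  assumes S: "open S" "smooth_on S \<theta>" "smooth_on S \<sigma>" and x: "x \<in> S"
  shows "curl (\<lambda>y. \<theta> y - \<sigma> y) x = curl \<theta> x - curl \<sigma> x"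
proof -
  have "partial_deriv i (\<lambda>y. (\<theta> y - \<sigma> y) $ j) x = partial_deriv i (\<lambda>y. \<theta> y $ j) x - partial_deriv i (\<lambda>y. \<sigma> y $ j) x" for i j
  proof -
    note d = smooth_on_derivative[OF smooth_on_vec_nth[OF S(1,2)] x] smooth_on_derivative[OF smooth_on_vec_nth[OF S(1,3)] x]
    have "((\<lambda>y. (\<theta> y - \<sigma> y) $ j) has_derivative
        (\<lambda>h. frechet_derivative (\<lambda>y. \<theta> y $ j) (at x) h - frechet_derivative (\<lambda>y. \<sigma> y $ j) (at x) h)) (at x)"
      using has_derivative_diff[OF d] by simp
    from fun_cong[OF frechet_derivative_at[OF this]] show ?thesis by (simp add: partial_deriv_def)
  qed
  then show ?thesis by (simp add: curl_def)
qed

section \<open>Flows of the model Killing fields are almost isometries\<close>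

context model_chart
begin

context
  fixes \<alpha> \<beta> \<gamma> :: real
begin

abbreviation (input) "flw \<equiv> mflow \<mu> \<alpha> \<beta> \<gamma>"

text \<open>The curl of the pulled-back form is \<open>\<eta> / mroot\<close> at the image point
  times the Jacobian of \<open>mflow_det\<close>, which is again \<open>\<eta> / mroot\<close> at
  the original point. So the difference of the two forms is closed, and the root term of
  \<open>fins\<close> is unchanged by the isometry property.\<close>

lemma flw_potential:
  assumes e: "\<And>t x. \<bar>t\<bar> < \<epsilon> \<Longrightarrow> x \<in> ball x0 R \<Longrightarrow> mgood \<mu> \<alpha> \<beta> \<gamma> t x \<and> flw t x \<in> D"
    and RD: "ball x0 R \<subseteq> D" and t: "\<bar>t\<bar> < \<epsilon>"
  shows "\<exists>f f'. \<forall>x\<in>ball x0 R. (f has_derivative f' x) (at x) \<and>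
    (\<forall>v. fins (flw t x) (frechet_derivative (flw t) (at x) v) = fins x v + f' x v)"
proof -
  have sm: "smooth_on (ball x0 R) (flw t)" by (rule smooth_on_subset[OF mflow_smooth]) (use RD \<rho> in blast)
  have im: "flw t ` ball x0 R \<subseteq> D" using e[OF t] by blast
  have s\<theta>': "smooth_on (ball x0 R) \<theta>" by (rule smooth_on_subset[OF s\<theta> RD])
  note sp = form_pullback_smooth[OF open_ball open_ball sm im s\<theta>]
  define \<sigma> where "\<sigma> x = form_pullback (flw t) \<theta> x - \<theta> x" for x
  have "smooth_on (ball x0 R) \<sigma>" unfolding \<sigma>_def[abs_def] by (rule smooth_on_diff[OF open_ball sp s\<theta>'])
  moreover have "curl \<sigma> x = 0" if x: "x \<in> ball x0 R" for x
  proof -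
    have xD: "x \<in> D" "x \<in> mdom \<mu>" "flw t x \<in> D" using x RD \<rho> e[OF t x] by auto
    have "jacobian (flw t) x = mroot \<mu> (flw t x) / mroot \<mu> x"
      unfolding jacobian_def by (rule mflow_det[of \<epsilon>]) (use e x t in auto)
    then have "curl (form_pullback (flw t) \<theta>) x = \<eta> / mroot \<mu> x"
      using curl_pullback[OF open_ball open_ball sm im s\<theta> x] curl\<theta>[OF xD(3)] mroot_pos[of "flw t x" \<mu>] \<rho>(2) xD(3)
      by (auto simp: less_imp_neq[symmetric])
    then show ?thesis unfolding \<sigma>_def[abs_def] curl_diff[OF open_ball sp s\<theta>' x] using curl\<theta>[OF xD(1)] by simp
  qed
  ultimately have "\<exists>f. \<forall>x\<in>ball x0 R. (f has_derivative (\<lambda>h. \<sigma> x \<bullet> h)) (at x)" by (rule curl_free_exact)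
  then obtain f where f: "\<forall>x\<in>ball x0 R. (f has_derivative (\<lambda>h. \<sigma> x \<bullet> h)) (at x)" by (elim exE)
  have "fins (flw t x) (frechet_derivative (flw t) (at x) v) = fins x v + \<sigma> x \<bullet> v" if x: "x \<in> ball x0 R" for x v
    using mflow_isometry[of \<mu> \<alpha> \<beta> \<gamma> t x v] e[OF t x] form_pullback_inner[OF smooth_on_derivative[OF sm x], of \<theta> v]
    by (simp add: fins_def \<sigma>_def inner_diff_left)
  then show ?thesis using f by (intro exI[of _ f] exI[of _ "\<lambda>x h. \<sigma> x \<bullet> h"]) (intro ballI conjI allI, simp_all)
qed

text \<open>\<open>dst_map\<close> yields one inequality. The reverse one comes from the inverse
  flow, whose potential \<open>h\<close> is related to \<open>f\<close>.\<close>

lemma flw_dst: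
  assumes e: "\<And>t x. \<bar>t\<bar> < \<epsilon> \<Longrightarrow> x \<in> ball x0 R \<Longrightarrow> mgood \<mu> \<alpha> \<beta> \<gamma> t x \<and> flw t x \<in> D"
    and ib: "inner_ball x0 r R" and \<delta>: "\<And>t x. \<bar>t\<bar> < \<epsilon> \<Longrightarrow> x \<in> ball x0 \<delta> \<Longrightarrow> flw t x \<in> ball x0 r" "ball x0 \<delta> \<subseteq> ball x0 r"
    and t: "\<bar>t\<bar> < \<epsilon>"
  shows "\<exists>f. \<forall>x\<in>ball x0 \<delta>. \<forall>y\<in>ball x0 \<delta>. dst (\<iota> (flw t x)) (\<iota> (flw t y)) = dst (\<iota> x) (\<iota> y) + (f y - f x)"
proof -
  have RD: "ball x0 R \<subseteq> D" and rR: "ball x0 r \<subseteq> ball x0 R" using ib by (auto simp: inner_ball_def)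
  have t': "\<bar>- t\<bar> < \<epsilon>" using t by simp
  have sm: "smooth_on (ball x0 R) (flw s)" for s by (rule smooth_on_subset[OF mflow_smooth]) (use RD \<rho> in blast)
  have imD: "flw t ` ball x0 R \<subseteq> D" "flw (-t) ` ball x0 R \<subseteq> D" using e[OF t] e[OF t'] by blast+
  have "\<exists>f f'. \<forall>x\<in>ball x0 R. (f has_derivative f' x) (at x) \<and>
    (\<forall>v. fins (flw t x) (frechet_derivative (flw t) (at x) v) = fins x v + f' x v)"
    by (rule flw_potential[OF _ RD t]) (rule e)
  then obtain f f' where f: "\<forall>x\<in>ball x0 R. (f has_derivative f' x) (at x) \<and>
    (\<forall>v. fins (flw t x) (frechet_derivative (flw t) (at x) v) = fins x v + f' x v)"
    by (elim exE)
  have "\<exists>h h'. \<forall>x\<in>ball x0 R. (h has_derivative h' x) (at x) \<and>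
    (\<forall>v. fins (flw (-t) x) (frechet_derivative (flw (-t)) (at x) v) = fins x v + h' x v)"
    by (rule flw_potential[OF _ RD t']) (rule e)
  then obtain h h' where h: "\<forall>x\<in>ball x0 R. (h has_derivative h' x) (at x) \<and>
    (\<forall>v. fins (flw (-t) x) (frechet_derivative (flw (-t)) (at x) v) = fins x v + h' x v)"
    by (elim exE)
  have inv: "flw (-t) (flw t x) = x" if "x \<in> ball x0 R" for x
    using mflow_inverse e[OF t that] by blast
  \<comment> \<open>Going forth and back leaves \<open>fins\<close> unchanged, so the two changes by
    differentials cancel. Hence \<open>h\<close> at the image point plus \<open>f\<close> is
    constant, and the two inequalities are opposite.\<close>
  have "((\<lambda>x. h (flw t x) + f x) has_derivative (\<lambda>v. 0)) (at x within ball x0 \<delta>)" if x: "x \<in> ball x0 \<delta>" for x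
  proof -
    have xR: "x \<in> ball x0 R" "flw t x \<in> ball x0 R" using x \<delta> t rR by blast+
    note df = smooth_on_derivative[OF sm[of t] xR(1)] and dg = smooth_on_derivative[OF sm[of "-t"] xR(2)]
    let ?A = "frechet_derivative (flw t) (at x)" and ?B = "frechet_derivative (flw (-t)) (at (flw t x))"
    have "((\<lambda>x. flw (-t) (flw t x)) has_derivative (\<lambda>v. ?B (?A v))) (at x)" by (rule has_derivative_compose[OF df dg])
    moreover have "((\<lambda>x. flw (-t) (flw t x)) has_derivative (\<lambda>v. v)) (at x)"
      by (rule has_derivative_transform_within_open[OF has_derivative_ident open_ball xR(1)]) (simp add: inv del: mem_ball)
    ultimately have "(\<lambda>v. ?B (?A v)) = (\<lambda>v. v)" by (rule has_derivative_unique)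
    from fun_cong[OF this] have BA: "?B (?A v) = v" for v .
    have 1: "fins (flw t x) (?A v) = fins x v + f' x v" for v using f xR(1) by blast
    have 2: "fins (flw (-t) (flw t x)) (?B (?A v)) = fins (flw t x) (?A v) + h' (flw t x) (?A v)" for v using h xR(2) by blast
    have z: "h' (flw t x) (?A v) + f' x v = 0" for v
      using 2[of v] unfolding 1 BA inv[OF xR(1)] by simp
    have hd: "(h has_derivative h' (flw t x)) (at (flw t x))" and fd: "(f has_derivative f' x) (at x)" using f h xR by blast+
    have "((\<lambda>x. h (flw t x) + f x) has_derivative (\<lambda>v. h' (flw t x) (?A v) + f' x v)) (at x)"
      by (rule has_derivative_add[OF has_derivative_compose[OF df hd] fd])
    then show ?thesis unfolding z by (rule has_derivative_at_withinI)
  qed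
  then obtain c where c: "\<And>x. x \<in> ball x0 \<delta> \<Longrightarrow> h (flw t x) + f x = c"
    using has_derivative_zero_constant[OF convex_ball, of x0 \<delta> "\<lambda>x. h (flw t x) + f x"] by blast
  have "dst (\<iota> (flw t x)) (\<iota> (flw t y)) = dst (\<iota> x) (\<iota> y) + (f y - f x)" if x: "x \<in> ball x0 \<delta>" and y: "y \<in> ball x0 \<delta>" for x y
  proof (rule antisym)
    have r: "x \<in> ball x0 r" "y \<in> ball x0 r" "flw t x \<in> ball x0 r" "flw t y \<in> ball x0 r" using x y \<delta> t by blast+
    show "dst (\<iota> (flw t x)) (\<iota> (flw t y)) \<le> dst (\<iota> x) (\<iota> y) + (f y - f x)"
      by (rule dst_map[OF ib r(1,2) sm imD(1)]) (use f in blast)+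
    have "dst (\<iota> (flw (-t) (flw t x))) (\<iota> (flw (-t) (flw t y))) \<le> dst (\<iota> (flw t x)) (\<iota> (flw t y)) + (h (flw t y) - h (flw t x))"
      by (rule dst_map[OF ib r(3,4) sm imD(2)]) (use h in blast)+
    moreover have "x \<in> ball x0 R" "y \<in> ball x0 R" using r rR by blast+
    ultimately show "dst (\<iota> x) (\<iota> y) + (f y - f x) \<le> dst (\<iota> (flw t x)) (\<iota> (flw t y))"
      using c[OF x] c[OF y] by (simp add: inv)
  qed
  then show ?thesis by (intro exI[of _ f]) blast
qed

lemma flw_diffeomorphism:
  assumes r: "ball x0 r \<subseteq> D" and good: "\<And>s x. s \<in> {t, -t} \<Longrightarrow> x \<in> ball x0 r \<Longrightarrow> mgood \<mu> \<alpha> \<beta> \<gamma> s x \<and> flw s x \<in> D"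
    and \<delta>: "\<And>x. x \<in> ball x0 \<delta> \<Longrightarrow> flw t x \<in> ball x0 r" "ball x0 \<delta> \<subseteq> ball x0 r"
  defines "U \<equiv> \<iota> ` ball x0 \<delta>" and "\<Phi> \<equiv> \<lambda>p. \<iota> (flw t (\<xi> p))"
  shows "diffeomorphism A U (\<Phi> ` U) \<Phi>"
proof -
  let ?B = "ball x0 \<delta>" and ?B' = "flw t ` ball x0 \<delta>"
  have BD: "?B \<subseteq> D" "?B' \<subseteq> D" using r \<delta> by blast+
  have inv: "flw (-t) (flw t x) = x" if "x \<in> ball x0 r" for x using mflow_inverse good[of t] that by blast
  have inv': "flw t (flw (-t) x) = x" if "x \<in> ball x0 r" for x
    using mflow_inverse[of \<mu> \<alpha> \<beta> \<gamma> "-t" x] good[of "-t" x] that by simp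
  have sm: "smooth_on (ball x0 r) (flw s)" for s by (rule smooth_on_subset[OF mflow_smooth]) (use r \<rho> in blast)
  \<comment> \<open>The image is open as a preimage under the inverse flow; this is why
    \<open>good\<close> covers both signs of the time.\<close>
  have "?B' = ball x0 r \<inter> flw (-t) -` ?B"
  proof (intro equalityI subsetI)
    fix y assume "y \<in> ?B'"
    then obtain x where "y = flw t x" "x \<in> ?B" by (elim imageE)
    then show "y \<in> ball x0 r \<inter> flw (-t) -` ?B" using inv \<delta> by (auto simp del: mem_ball)
  next
    fix y assume "y \<in> ball x0 r \<inter> flw (-t) -` ?B"
    then show "y \<in> ?B'" using inv'[of y] by (intro image_eqI[of _ _ "flw (-t) y"]) auto
  qed
  then have oB': "open ?B'" using continuous_open_preimage[OF smooth_on_imp_continuous[OF sm] open_ball open_ball] by metis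
  have \<xi>U: "\<xi> ` U = ?B" unfolding U_def image_image using \<xi>\<iota> BD(1) by (force simp del: mem_ball)
  have \<Phi>U: "\<Phi> ` U = \<iota> ` ?B'" using \<xi>\<iota> BD(1) by (force simp: \<Phi>_def U_def image_image simp del: mem_ball)
  have \<xi>V: "\<xi> ` (\<Phi> ` U) = ?B'" unfolding \<Phi>U image_image using \<xi>\<iota> BD(2) by (force simp del: mem_ball)
  have oU: "open U" unfolding U_def by (rule chart_preimage_open[OF ch open_ball]) (simp add: im BD)
  have oV: "open (\<Phi> ` U)" unfolding \<Phi>U by (rule chart_preimage_open[OF ch oB']) (simp add: im BD)
  have UW: "U \<subseteq> W" "\<Phi> ` U \<subseteq> W" unfolding \<Phi>U unfolding U_def using \<iota>W BD by blast+
  have inv\<Phi>: "\<iota> (flw (-t) (\<xi> (\<Phi> p))) = p" if p: "p \<in> U" for p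
  proof -
    have x: "\<xi> p \<in> ?B" using p \<xi>U by blast
    then have "flw t (\<xi> p) \<in> D" using BD(2) by blast
    then have "\<iota> (flw (-t) (\<xi> (\<Phi> p))) = \<iota> (\<xi> p)" using inv[OF subsetD[OF \<delta>(2) x]] by (simp add: \<Phi>_def \<xi>\<iota> del: mem_ball)
    then show ?thesis using \<iota>\<xi>[OF subsetD[OF UW(1) p]] by simp
  qed
  then have inj: "inj_on \<Phi> U" by (metis inj_onI)
  have "smooth_map_on A U \<Phi>"
    by (rule smooth_map_lift[OF A \<kappa> oU UW(1), of "flw t"])
      (use smooth_on_subset[OF sm \<delta>(2)] \<xi>U BD(2) im in \<open>simp_all add: \<Phi>_def\<close>)
  moreover have "smooth_map_on A (\<Phi> ` U) (inv_into U \<Phi>)"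
  proof (rule smooth_map_lift[OF A \<kappa> oV UW(2), of "flw (-t)"], unfold \<xi>V)
    show "smooth_on ?B' (flw (-t))" by (rule smooth_on_subset[OF sm]) (use \<delta>(1) in blast)
    show "flw (-t) ` ?B' \<subseteq> \<xi> ` W"
      unfolding im image_image using inv \<delta>(2) BD(1) by (force simp del: mem_ball)
    fix q assume "q \<in> \<Phi> ` U"
    then obtain p where p: "p \<in> U" "q = \<Phi> p" by (elim imageE)
    show "inv_into U \<Phi> q = \<iota> (flw (-t) (\<xi> q))" unfolding p(2) inv\<Phi>[OF p(1)] by (rule inv_into_f_f[OF inj p(1)])
  qed
  ultimately show ?thesis using oU oV inj by (simp add: diffeomorphism_def inj_on_imp_bij_betw)
qed

lemma killing_almost_Killing: "vfield A \<kappa> W (mkilling \<mu> \<alpha> \<beta> \<gamma>) \<in> almost_Killing_fields A F W"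
proof -
  let ?k = "mkilling \<mu> \<alpha> \<beta> \<gamma>"
  have oW: "open W" by (rule is_chartD(1)[OF ch])
  have "\<exists>U \<epsilon> \<Phi>. open U \<and> p \<in> U \<and> U \<subseteq> W \<and> \<epsilon> > 0 \<and> local_flow A W (vfield A \<kappa> W ?k) U \<epsilon> \<Phi> \<and>
       (\<forall>t. \<bar>t\<bar> < \<epsilon> \<longrightarrow> almost_isometry A F U (\<Phi> t ` U) (\<Phi> t))" if p: "p \<in> W" for p
  proof -
    define x0 where "x0 = \<xi> p"
    have x0: "x0 \<in> D" unfolding x0_def by (rule \<xi>D[OF p])
    obtain R0 e0 where R0: "R0 > 0" "e0 > 0" "ball x0 R0 \<subseteq> D"
      "\<forall>t x. \<bar>t\<bar> < e0 \<longrightarrow> x \<in> ball x0 R0 \<longrightarrow> mgood \<mu> \<alpha> \<beta> \<gamma> t x \<and> flw t x \<in> D"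
      using mflow_local[OF open_ball \<rho>(2) x0, of \<alpha> \<beta> \<gamma>] by (elim exE conjE)
    have g0: "mgood \<mu> \<alpha> \<beta> \<gamma> t x \<and> flw t x \<in> D" if "\<bar>t\<bar> < e0" "x \<in> ball x0 R0" for t x using R0(4) that by blast
    \<comment> \<open>The radii are nested: on radius \<open>R\<close> the flow stays in the chart,
      points of radius \<open>r\<close> have almost minimizing curves inside radius
      \<open>R\<close>, and on radius \<open>\<delta>\<close> the flow stays inside radius
      \<open>r\<close>, so that \<open>dst_map\<close> applies to the images as well.\<close>
    define R where "R = R0 / 2"
    have "cball x0 R \<subseteq> ball x0 R0" using R0(1) by (auto simp: R_def)
    then have R: "cball x0 R \<subseteq> D" "R > 0" "ball x0 R \<subseteq> ball x0 R0" using R0 ball_subset_cball by (auto simp: R_def)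
    obtain r where r: "r > 0" "inner_ball x0 r R" using inner_ball_exists[OF R(1,2)] by blast
    have rR: "ball x0 r \<subseteq> ball x0 R" "ball x0 r \<subseteq> D" using r(2) by (auto simp: inner_ball_def)
    have rm: "ball x0 r \<subseteq> mdom \<mu>" "x0 \<in> ball x0 r" using rR \<rho> r(1) by auto
    obtain \<delta> e1 where \<delta>: "\<delta> > 0" "e1 > 0" "ball x0 \<delta> \<subseteq> ball x0 r"
      "\<forall>t x. \<bar>t\<bar> < e1 \<longrightarrow> x \<in> ball x0 \<delta> \<longrightarrow> mgood \<mu> \<alpha> \<beta> \<gamma> t x \<and> flw t x \<in> ball x0 r"
      using mflow_local[OF open_ball rm, of \<alpha> \<beta> \<gamma>] by (elim exE conjE)
    define \<epsilon> where "\<epsilon> = min e0 e1"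
    have e: "\<epsilon> > 0" using R0 \<delta> by (simp add: \<epsilon>_def)
    have gR: "mgood \<mu> \<alpha> \<beta> \<gamma> t x \<and> flw t x \<in> D" if "\<bar>t\<bar> < \<epsilon>" "x \<in> ball x0 R" for t x
      using g0[of t x] that R(3) by (auto simp: \<epsilon>_def simp del: mem_ball)
    have g\<delta>: "flw t x \<in> ball x0 r" if "\<bar>t\<bar> < \<epsilon>" "x \<in> ball x0 \<delta>" for t x
      using \<delta>(4) that by (auto simp: \<epsilon>_def simp del: mem_ball)
    define U where "U = \<iota> ` ball x0 \<delta>"
    define \<Phi> where "\<Phi> t p = \<iota> (flw t (\<xi> p))" for t p
    have \<delta>D: "ball x0 \<delta> \<subseteq> D" using \<delta>(3) rR by blast
    have oU: "open U" unfolding U_def by (rule chart_preimage_open[OF ch open_ball]) (simp add: im \<delta>D)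
    have UW: "U \<subseteq> W" unfolding U_def using \<iota>W \<delta>D by blast
    have pU: "p \<in> U" unfolding U_def using \<delta>(1) by (intro image_eqI[of _ _ x0]) (auto simp: x0_def \<iota>\<xi>[OF p])
    have \<xi>U: "\<xi> q \<in> ball x0 \<delta>" if "q \<in> U" for q
    proof -
      from that have "q \<in> \<iota> ` ball x0 \<delta>" by (simp only: U_def)
      then obtain x where x: "q = \<iota> x" "x \<in> ball x0 \<delta>" by (elim imageE)
      then show ?thesis using \<xi>\<iota>[of x] \<delta>D by auto
    qed
    have "local_flow A W (vfield A \<kappa> W ?k) U \<epsilon> \<Phi>"
      unfolding local_flow_def
    proof (intro ballI conjI)
      fix q assume q: "q \<in> U"
      show "\<Phi> 0 q = q" using q UW \<iota>\<xi> by (auto simp: \<Phi>_def mflow_zero)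
      have qR: "\<xi> q \<in> ball x0 R" using \<xi>U[OF q] \<delta>(3) rR(1) by blast
      have "integral_curve A W (vfield A \<kappa> W ?k) {-\<epsilon><..<\<epsilon>} (\<iota> \<circ> (\<lambda>t. flw t (\<xi> q)))"
      proof (rule integral_curve_lift[OF A \<kappa> order_refl open_greaterThanLessThan], unfold im)
        fix t assume "t \<in> {-\<epsilon><..<\<epsilon>}"
        then have t: "\<bar>t\<bar> < \<epsilon>" by auto
        show "flw t (\<xi> q) \<in> D" using gR[OF t qR] by blast
        show "((\<lambda>t. flw t (\<xi> q)) has_vector_derivative ?k (flw t (\<xi> q))) (at t)"
          by (rule mflow_time) (use gR[OF t qR] in blast)
      qed
      then show "integral_curve A W (vfield A \<kappa> W ?k) {-\<epsilon><..<\<epsilon>} (\<lambda>t. \<Phi> t q)" by (simp add: o_def \<Phi>_def)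
    qed
    moreover have "almost_isometry A F U (\<Phi> t ` U) (\<Phi> t)" if t: "\<bar>t\<bar> < \<epsilon>" for t
    proof -
      have "diffeomorphism A U (\<Phi> t ` U) (\<Phi> t)"
        unfolding U_def \<Phi>_def
      proof (rule flw_diffeomorphism[OF rR(2) _ g\<delta>[OF t] \<delta>(3)])
        fix s x assume "s \<in> {t, -t}" "x \<in> ball x0 r"
        then show "mgood \<mu> \<alpha> \<beta> \<gamma> s x \<and> flw s x \<in> D" using t rR(1) by (intro gR) auto
      qed
      moreover have "\<exists>f. \<forall>x\<in>ball x0 \<delta>. \<forall>y\<in>ball x0 \<delta>. dst (\<iota> (flw t x)) (\<iota> (flw t y)) = dst (\<iota> x) (\<iota> y) + (f y - f x)"
        by (rule flw_dst[OF _ r(2) _ \<delta>(3) t]) (rule gR g\<delta>; assumption)+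
      then obtain f where f: "\<forall>x\<in>ball x0 \<delta>. \<forall>y\<in>ball x0 \<delta>. dst (\<iota> (flw t x)) (\<iota> (flw t y)) = dst (\<iota> x) (\<iota> y) + (f y - f x)"
        by (elim exE)
      have "dst (\<Phi> t q) (\<Phi> t q') = dst q q' + (f (\<xi> q') - f (\<xi> q))" if q: "q \<in> U" "q' \<in> U" for q q'
        using bspec[OF bspec[OF f \<xi>U[OF q(1)]] \<xi>U[OF q(2)]]
        unfolding \<Phi>_def \<iota>\<xi>[OF subsetD[OF UW q(1)]] \<iota>\<xi>[OF subsetD[OF UW q(2)]] .
      ultimately show ?thesis unfolding almost_isometry_def triangle_excess_def by simp
    qed
    ultimately show ?thesis using oU pU UW e by (intro exI[of _ U] exI[of _ \<epsilon>] exI[of _ \<Phi>]) blast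
  qed
  moreover have "smooth_on (\<xi> ` W) ?k" unfolding im by (rule smooth_on_subset[OF mkilling_smooth \<rho>(2)])
  ultimately show ?thesis
    unfolding almost_Killing_fields_def using vfield_in_vector_fields[OF A \<kappa> oW order_refl] by blast
qed

end

end

section \<open>First-order behaviour of flows in time\<close>

lemma right_derivative_iff:
  fixes f :: "real \<Rightarrow> 'a::real_normed_vector"
  shows "(f has_vector_derivative f') (at_right 0) \<longleftrightarrow> ((\<lambda>h. (1 / h) *\<^sub>R (f h - f 0)) \<longlongrightarrow> f') (at_right 0)"
proof -
  have "(f has_vector_derivative f') (at_right 0) \<longleftrightarrow>
      ((\<lambda>y. (1 / norm (y - 0)) *\<^sub>R (f y - (f 0 + (y - 0) *\<^sub>R f'))) \<longlongrightarrow> 0) (at_right 0)"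
    unfolding has_vector_derivative_def has_derivative_within by (simp add: bounded_linear_scaleR_left)
  also have "\<dots> \<longleftrightarrow> ((\<lambda>h. (1 / h) *\<^sub>R (f h - f 0) - f') \<longlongrightarrow> 0) (at_right 0)"
  proof (rule tendsto_cong)
    show "\<forall>\<^sub>F h in at_right 0. (1 / norm (h - 0)) *\<^sub>R (f h - (f 0 + (h - 0) *\<^sub>R f')) = (1 / h) *\<^sub>R (f h - f 0) - f'"
      unfolding eventually_at_filter by (rule always_eventually) (simp add: scaleR_diff_right scaleR_add_right)
  qed
  also have "\<dots> \<longleftrightarrow> ((\<lambda>h. (1 / h) *\<^sub>R (f h - f 0)) \<longlongrightarrow> f') (at_right 0)" by (rule LIM_zero_iff)
  finally show ?thesis .
qed

lemma norm_increment:
  fixes z :: "real \<Rightarrow> 'a::real_normed_vector"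
  assumes z: "\<And>\<sigma>. \<sigma> \<in> {0..s} \<Longrightarrow> (z has_vector_derivative z' \<sigma>) (at \<sigma> within {0..s})"
    and B: "\<And>\<sigma>. \<sigma> \<in> {0..s} \<Longrightarrow> norm (z' \<sigma>) \<le> B" and s: "0 \<le> s"
  shows "norm (z s - z 0) \<le> B * s"
proof -
  have "norm (z s - z 0) \<le> B * norm (s - 0)"
  proof (rule differentiable_bound[OF _ z[unfolded has_vector_derivative_def]])
    fix \<sigma> assume \<sigma>: "\<sigma> \<in> {0..s}"
    show "onorm (\<lambda>x. x *\<^sub>R z' \<sigma>) \<le> B"
      by (rule onorm_le) (use mult_left_mono[OF B[OF \<sigma>] abs_ge_zero] in \<open>simp add: mult.commute\<close>)
  qed (use s in auto)
  then show ?thesis using s by simp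
qed

text \<open>The velocity bound is available only inside the closed ball, so it is used up to the
  first time at which the distance equals \<open>\<delta>\<close>; by then the curve has moved too
  little to reach the sphere.\<close>

lemma stays_near:
  fixes z :: "real \<Rightarrow> 'a::real_normed_vector"
  assumes z: "\<And>\<sigma>. \<sigma> \<in> {0..s} \<Longrightarrow> (z has_vector_derivative z' \<sigma>) (at \<sigma> within {0..s})"
    and M: "\<And>\<sigma>. \<sigma> \<in> {0..s} \<Longrightarrow> dist x0 (z \<sigma>) \<le> \<delta> \<Longrightarrow> norm (z' \<sigma>) \<le> M" "0 \<le> M"
    and start: "dist x0 (z 0) + M * s < \<delta>" and \<sigma>: "\<sigma> \<in> {0..s}"
  shows "dist x0 (z \<sigma>) < \<delta>"
proof (rule ccontr)
  assume "\<not> dist x0 (z \<sigma>) < \<delta>"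
  define h where "h \<tau> = dist x0 (z \<tau>)" for \<tau>
  have "continuous_on {0..s} z"
    using z has_vector_derivative_continuous continuous_on_eq_continuous_within by blast
  then have ch: "continuous_on {0..s} h" unfolding h_def by (intro continuous_intros)
  have "0 \<le> M * s" using M(2) \<sigma> by simp
  then have h0: "h 0 < \<delta>" using start by (simp add: h_def)
  have reach: "\<exists>t. 0 \<le> t \<and> t \<le> \<tau> \<and> h t = \<delta>" if "\<tau> \<in> {0..s}" "\<delta> \<le> h \<tau>" for \<tau>
  proof -
    have "continuous_on {0..\<tau>} h" by (rule continuous_on_subset[OF ch]) (use that in auto)
    from IVT'[of h 0 \<delta> \<tau>, OF _ that(2) _ this] h0 that(1) show ?thesis by auto
  qed
  let ?S = "{0..s} \<inter> h -` {\<delta>}"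
  have cl: "closed ?S" by (rule continuous_closed_preimage[OF ch]) auto
  have bd: "bdd_below ?S" by (rule bdd_belowI[of _ 0]) auto
  have "?S \<noteq> {}" using reach[OF \<sigma>] \<open>\<not> _\<close> \<sigma> by (force simp: h_def)
  define t where "t = Inf ?S"
  have tS: "t \<in> ?S" unfolding t_def by (rule closed_contains_Inf[OF \<open>?S \<noteq> {}\<close> bd cl])
  have before: "h \<tau> \<le> \<delta>" if \<tau>: "\<tau> \<in> {0..t}" for \<tau>
  proof (rule ccontr)
    assume n: "\<not> h \<tau> \<le> \<delta>"
    have "\<tau> \<in> {0..s}" using \<tau> tS by auto
    then obtain t' where t': "0 \<le> t'" "t' \<le> \<tau>" "h t' = \<delta>" using reach[of \<tau>] n by auto
    then have "t' \<in> ?S" using \<open>\<tau> \<in> {0..s}\<close> by auto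
    then have "t \<le> t'" unfolding t_def by (rule cInf_lower[OF _ bd])
    then have "t' = \<tau>" using t'(2) \<tau> by auto
    then show False using n t'(3) by simp
  qed
  have sub: "{0..t} \<subseteq> {0..s}" using tS by auto
  have "norm (z t - z 0) \<le> M * t"
    by (rule norm_increment[OF has_vector_derivative_within_subset[OF z sub] M(1)])
      (use sub before tS in \<open>auto simp: h_def\<close>)
  also have "\<dots> \<le> M * s" using M(2) tS by (intro mult_left_mono) auto
  finally have "h t < \<delta>" using start dist_triangle[of x0 "z t" "z 0"] by (simp add: h_def dist_norm norm_minus_commute)
  then show False using tS by simp
qed

text \<open>The derivative of the flow of \<open>k\<close> at a fixed point of time differentiates to the derivative of \<open>k\<close>.
  Mean value estimates replace the smooth dependence of the flow on time and initial value together.\<close>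

lemma flow_linearization:
  fixes k :: "'a::euclidean_space \<Rightarrow> 'a"
  assumes D: "open D" "smooth_on D k" "x0 \<in> D" and pos: "e0 > 0" "a > 0"
    and \<phi>: "\<And>s x. 0 \<le> s \<Longrightarrow> s < e0 \<Longrightarrow> x \<in> ball x0 a \<Longrightarrow> ((\<lambda>s. \<phi> s x) has_vector_derivative k (\<phi> s x)) (at s)"
    and \<phi>0: "\<And>x. x \<in> ball x0 a \<Longrightarrow> \<phi> 0 x = x"
    and d\<phi>: "\<And>s. 0 \<le> s \<Longrightarrow> s < e0 \<Longrightarrow> (\<phi> s has_derivative \<phi>' s) (at x0)"
  shows "((\<lambda>s. (1 / s) *\<^sub>R (\<phi>' s v - v)) \<longlongrightarrow> frechet_derivative k (at x0) v) (at_right 0)"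
proof (rule tendstoI)
  fix e :: real assume e: "e > 0"
  obtain k' :: "'a \<Rightarrow> 'a \<Rightarrow>\<^sub>L 'a" where k': "\<And>x. x \<in> D \<Longrightarrow> (k has_derivative blinfun_apply (k' x)) (at x)" "continuous_on D k'"
    using smooth_on_blinfun_derivative[OF D(1,2)] by metis
  define A where "A = k' x0"
  define B where "B = norm A"
  define N where "N = norm v + 1"
  define \<omega> where "\<omega> = min 1 (e / (8 * N))"
  \<comment> \<open>A Lipschitz constant of \<open>k\<close> near \<open>x0\<close>: the derivative
    there differs from \<open>A\<close> by at most \<open>\<omega> \<le> 1\<close>. The fractions of
    \<open>e\<close> are arranged so that the final constant \<open>C\<close> is at most
    \<open>e / (2 * N)\<close>.\<close>
  define L where "L = B + 1"
  have N: "N > 0" and B: "B \<ge> 0" and L: "L > 0" by (simp_all add: N_def B_def L_def add_nonneg_pos)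
  have \<omega>: "\<omega> > 0" "\<omega> \<le> 1" "\<omega> \<le> e / (8 * N)" using e N by (auto simp: \<omega>_def)
  have "\<exists>d>0. \<forall>x\<in>D. dist x x0 < d \<longrightarrow> dist (k' x) (k' x0) < \<omega>"
    by (rule mp[OF spec[OF bspec[OF k'(2)[unfolded continuous_on_iff] D(3)]] \<omega>(1)])
  then obtain d1 where d1': "d1 > 0 \<and> (\<forall>x\<in>D. dist x x0 < d1 \<longrightarrow> dist (k' x) (k' x0) < \<omega>)" by (elim exE)
  have d1: "d1 > 0" by (rule conjunct1[OF d1'])
  have close: "dist (k' x) (k' x0) < \<omega>" if "x \<in> D" "dist x x0 < d1" for x
    by (rule mp[OF bspec[OF conjunct2[OF d1'] that(1)] that(2)])
  obtain d2 where d2: "d2 > 0" "cball x0 d2 \<subseteq> D" using D(1,3) open_contains_cball by blast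
  define \<delta> where "\<delta> = min (d1 / 2) d2"
  have \<delta>: "\<delta> > 0" "cball x0 \<delta> \<subseteq> D" using d1 d2 by (auto simp: \<delta>_def)
  have near: "norm (k' x - A) \<le> \<omega>" if "x \<in> cball x0 \<delta>" for x

  proof -
    have "x \<in> D" using that \<delta>(2) by blast
    moreover have "dist x x0 < d1" using that d1 by (simp add: \<delta>_def dist_commute)
    ultimately have "dist (k' x) (k' x0) < \<omega>" by (rule close)
    then show ?thesis by (simp add: A_def dist_norm)
  qed
  have lin: "norm (k q - k p - A (q - p)) \<le> norm (q - p) * \<omega>" if p: "p \<in> cball x0 \<delta>" and q: "q \<in> cball x0 \<delta>" for p q
    unfolding A_def
  proof (rule differentiable_bound_linearization[where S="cball x0 \<delta>" and f'="\<lambda>x. blinfun_apply (k' x)"])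
    fix t :: real assume t: "t \<in> {0..1}"
    have "(1 - t) *\<^sub>R p + t *\<^sub>R q \<in> cball x0 \<delta>" by (rule convexD[OF convex_cball p q]) (use t in auto)
    moreover have "(1 - t) *\<^sub>R p + t *\<^sub>R q = p + t *\<^sub>R (q - p)" by (simp add: algebra_simps)
    ultimately show "p + t *\<^sub>R (q - p) \<in> cball x0 \<delta>" by simp
  next
    fix x assume x: "x \<in> cball x0 \<delta>"
    show "(k has_derivative blinfun_apply (k' x)) (at x within cball x0 \<delta>)"
      by (rule has_derivative_at_withinI[OF k'(1)]) (use x \<delta>(2) in blast)
    have "onorm (blinfun_apply (k' x) - blinfun_apply (k' x0)) = norm (k' x - A)"
      by (simp add: A_def norm_blinfun.rep_eq minus_blinfun.rep_eq fun_diff_def)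
    then show "onorm (blinfun_apply (k' x) - blinfun_apply (k' x0)) \<le> \<omega>" using near[OF x] by simp
  qed (use \<delta>(1) in simp)
  have "continuous_on (cball x0 \<delta>) k" by (rule continuous_on_subset[OF smooth_on_imp_continuous[OF D(2)] \<delta>(2)])
  then have "bounded (k ` cball x0 \<delta>)" by (intro compact_imp_bounded compact_continuous_image compact_cball)
  then obtain M where M: "M > 0" "\<And>x. x \<in> cball x0 \<delta> \<Longrightarrow> norm (k x) \<le> M" unfolding bounded_pos by blast
  \<comment> \<open>For times below \<open>s1\<close>, the four bounds ensure that the flow is
    defined, that trajectories starting near \<open>x0\<close> stay in the ball of radius
    \<open>\<delta>\<close>, that \<open>L * s < 1 / 2\<close>, and that the quadratic error
    \<open>B * L * s\<close> is small.\<close>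
  define s1 where "s1 = min (min e0 (\<delta> / (4 * M))) (min (1 / (2 * L)) (e / (8 * N * (B * L + 1))))"
  have BL: "B * L + 1 > 0" using B L by (simp add: add_nonneg_pos)
  then have s1: "s1 > 0" using pos(1) \<delta>(1) M(1) L e N by (simp add: s1_def)
  have "norm ((1 / s) *\<^sub>R (\<phi>' s v - v) - A v) \<le> e / 2" if s: "0 < s" "s < s1" for s
  proof -
    have se0: "s < e0" and "s < \<delta> / (4 * M)" and "s < 1 / (2 * L)" and "s < e / (8 * N * (B * L + 1))"
      using s(2) by (auto simp: s1_def)
    moreover have "8 * N * (B * L + 1) > 0" using N BL by simp
    ultimately have sM: "M * s < \<delta> / 4" and sL: "L * s < 1 / 2" and sBL: "s * (8 * N * (B * L + 1)) < e"
      using M(1) L by (simp_all add: pos_less_divide_eq mult.commute mult.left_commute)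
    have "B * L * s \<le> s * (B * L + 1)" using s by (simp add: algebra_simps)
    also have "\<dots> < e / (8 * N)" using sBL N by (simp add: field_simps)
    finally have sBL': "B * L * s \<le> e / (8 * N)" by simp
    define C where "C = 2 * (\<omega> + B * L * s)"
    have C: "norm (\<phi> s y - \<phi> s x0 - (y - x0) - s *\<^sub>R A (y - x0)) \<le> s * C * norm (y - x0)"
      if y: "y \<in> ball x0 (min a (\<delta> / 2))" for y
    proof -
      have d: "((\<lambda>\<sigma>. \<phi> \<sigma> x) has_vector_derivative k (\<phi> \<sigma> x)) (at \<sigma> within {0..s})"
        if "x \<in> ball x0 (min a (\<delta> / 2))" "\<sigma> \<in> {0..s}" for x \<sigma>
        by (rule has_vector_derivative_at_within[OF \<phi>]) (use that se0 in auto)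
      have in\<delta>: "\<phi> \<sigma> x \<in> cball x0 \<delta>" if x: "x \<in> ball x0 (min a (\<delta> / 2))" and \<sigma>: "\<sigma> \<in> {0..s}" for x \<sigma>
      proof -
        have "dist x0 (\<phi> \<sigma> x) < \<delta>"
        proof (rule stays_near[OF d[OF x], where M=M])
          show "dist x0 (\<phi> 0 x) + M * s < \<delta>" using x \<phi>0[of x] sM \<delta>(1) by simp
        qed (use M \<sigma> in auto)
        then show ?thesis by simp
      qed
      have x0: "x0 \<in> ball x0 (min a (\<delta> / 2))" using pos \<delta> by simp
      \<comment> \<open>The difference of two trajectories. It satisfies the linearized equation up
        to the error \<open>\<omega>\<close>, and its value at the final time is the increment of
        the time-s map between the two starting points.\<close>
      define u where "u \<sigma> = \<phi> \<sigma> y - \<phi> \<sigma> x0" for \<sigma>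
      define u' where "u' \<sigma> = k (\<phi> \<sigma> y) - k (\<phi> \<sigma> x0)" for \<sigma>
      have du: "(u has_vector_derivative u' \<sigma>) (at \<sigma> within {0..s})" if "\<sigma> \<in> {0..s}" for \<sigma>
        unfolding u_def[abs_def] u'_def by (rule has_vector_derivative_diff[OF d[OF y that] d[OF x0 that]])
      have u0: "u 0 = y - x0" using \<phi>0[of y] \<phi>0[of x0] y pos by (simp add: u_def)
      have l1: "norm (u' \<sigma> - A (u \<sigma>)) \<le> norm (u \<sigma>) * \<omega>" if "\<sigma> \<in> {0..s}" for \<sigma>
        unfolding u_def u'_def by (rule lin[OF in\<delta>[OF x0 that] in\<delta>[OF y that]])
      have l2: "norm (u' \<sigma>) \<le> L * norm (u \<sigma>)" if "\<sigma> \<in> {0..s}" for \<sigma>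
      proof -
        have "norm (u' \<sigma>) \<le> norm (u' \<sigma> - A (u \<sigma>)) + norm (A (u \<sigma>))" using norm_triangle_ineq[of "u' \<sigma> - A (u \<sigma>)" "A (u \<sigma>)"] by simp
        also have "\<dots> \<le> norm (u \<sigma>) * \<omega> + B * norm (u \<sigma>)"
          by (rule add_mono[OF l1[OF that]]) (simp add: B_def norm_blinfun)
        also have "\<dots> \<le> norm (u \<sigma>) * 1 + B * norm (u \<sigma>)" by (intro add_right_mono mult_left_mono \<omega>(2) norm_ge_zero)
        finally show ?thesis by (simp add: L_def algebra_simps)
      qed
      have cu: "continuous_on {0..s} (\<lambda>\<sigma>. norm (u \<sigma>))"
        using du has_vector_derivative_continuous continuous_on_eq_continuous_within by (intro continuous_on_norm) blast
      \<comment> \<open>A maximum of the norm replaces Gronwall's inequality: since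
        \<open>L * s < 1 / 2\<close>, the maximal difference is at most twice the initial
        one.\<close>
      obtain \<tau> where \<tau>: "\<tau> \<in> {0..s}" "\<And>\<sigma>. \<sigma> \<in> {0..s} \<Longrightarrow> norm (u \<sigma>) \<le> norm (u \<tau>)"
        using continuous_attains_sup[OF compact_Icc _ cu] s by (metis atLeastAtMost_iff empty_iff less_imp_le order_refl)
      have inc: "norm (u \<sigma> - u 0) \<le> L * norm (u \<tau>) * \<sigma>" if \<sigma>: "\<sigma> \<in> {0..s}" for \<sigma>
      proof (rule norm_increment)
        have sub: "{0..\<sigma>} \<subseteq> {0..s}" using \<sigma> by auto
        fix \<rho> assume "\<rho> \<in> {0..\<sigma>}"
        then have \<rho>: "\<rho> \<in> {0..s}" using sub by blast
        show "(u has_vector_derivative u' \<rho>) (at \<rho> within {0..\<sigma>})" by (rule has_vector_derivative_within_subset[OF du[OF \<rho>] sub])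
        show "norm (u' \<rho>) \<le> L * norm (u \<tau>)" using l2[OF \<rho>] mult_left_mono[OF \<tau>(2)[OF \<rho>], of L] L by linarith
      qed (use \<sigma> in auto)
      have "L * norm (u \<tau>) * \<tau> \<le> norm (u \<tau>) * (L * s)"
        using \<tau>(1) L mult_left_mono[of \<tau> s "L * norm (u \<tau>)"] by (simp add: algebra_simps)
      also have "\<dots> \<le> norm (u \<tau>) * (1 / 2)" using sL by (intro mult_left_mono) auto
      finally have "norm (u \<tau>) \<le> 2 * norm (u 0)"
        using inc[OF \<tau>(1)] norm_triangle_ineq[of "u \<tau> - u 0" "u 0"] by simp
      then have n: "norm (u \<sigma>) \<le> 2 * norm (u 0)" if "\<sigma> \<in> {0..s}" for \<sigma> using \<tau>(2)[OF that] by simp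
      \<comment> \<open>The deviation of \<open>u\<close> from its first-order expansion in time;
        its derivative is small relative to \<open>u 0\<close>.\<close>
      define w where "w \<sigma> = u \<sigma> - \<sigma> *\<^sub>R A (u 0)" for \<sigma>
      have "norm (w s - w 0) \<le> (C * norm (u 0)) * s"
      proof (rule norm_increment)
        fix \<sigma> assume \<sigma>: "\<sigma> \<in> {0..s}"
        have "((\<lambda>\<sigma>. \<sigma> *\<^sub>R A (u 0)) has_vector_derivative A (u 0)) (at \<sigma> within {0..s})"
          by (auto intro!: derivative_eq_intros)
        then show "(w has_vector_derivative (u' \<sigma> - A (u 0))) (at \<sigma> within {0..s})"
          unfolding w_def[abs_def] by (rule has_vector_derivative_diff[OF du[OF \<sigma>]])
        have "norm (u' \<sigma> - A (u 0)) \<le> norm (u' \<sigma> - A (u \<sigma>)) + norm (A (u \<sigma> - u 0))"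
          using norm_triangle_ineq[of "u' \<sigma> - A (u \<sigma>)" "A (u \<sigma> - u 0)"] by (simp add: blinfun.diff_right)
        also have "\<dots> \<le> norm (u \<sigma>) * \<omega> + B * norm (u \<sigma> - u 0)"
          by (rule add_mono[OF l1[OF \<sigma>]]) (simp add: B_def norm_blinfun)
        also have "\<dots> \<le> (2 * norm (u 0)) * \<omega> + B * (L * (2 * norm (u 0)) * s)"
        proof (rule add_mono)
          show "norm (u \<sigma>) * \<omega> \<le> 2 * norm (u 0) * \<omega>" using n[OF \<sigma>] \<omega>(1) by simp
          have "L * norm (u \<tau>) * \<sigma> \<le> L * (2 * norm (u 0)) * s"
            using n[OF \<tau>(1)] \<sigma> L by (intro mult_mono) auto
          then have "norm (u \<sigma> - u 0) \<le> L * (2 * norm (u 0)) * s" using inc[OF \<sigma>] by linarith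
          then show "B * norm (u \<sigma> - u 0) \<le> B * (L * (2 * norm (u 0)) * s)" by (rule mult_left_mono[OF _ B])
        qed
        also have "\<dots> = C * norm (u 0)" by (simp add: C_def algebra_simps)
        finally show "norm (u' \<sigma> - A (u 0)) \<le> C * norm (u 0)" .
      qed (use s in simp)
      moreover have "w s - w 0 = \<phi> s y - \<phi> s x0 - (y - x0) - s *\<^sub>R A (y - x0)"
        unfolding w_def u0 by (simp add: u_def)
      ultimately show ?thesis by (simp add: u0 mult.commute mult.left_commute)
    qed
    \<comment> \<open>The estimate \<open>C\<close> for finite increments is divided by
      \<open>h\<close> and passes to the limit \<open>h \<rightarrow> 0\<close>, which brings in the
      derivative of the time-s map.\<close>
    have "norm (\<phi>' s v - v - s *\<^sub>R A v) \<le> s * C * norm v"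
    proof (rule tendsto_upperbound)
      have dir: "((\<lambda>h. x0 + h *\<^sub>R v) has_vector_derivative v) (at_right 0)" by (auto intro!: derivative_eq_intros)
      have "((\<phi> s \<circ> (\<lambda>h. x0 + h *\<^sub>R v)) has_vector_derivative \<phi>' s v) (at_right 0)"
        by (rule vector_derivative_diff_chain_within[OF dir]) (use d\<phi>[of s] s se0 in \<open>simp add: has_derivative_at_withinI\<close>)
      then have "((\<lambda>h. (1 / h) *\<^sub>R (\<phi> s (x0 + h *\<^sub>R v) - \<phi> s x0)) \<longlongrightarrow> \<phi>' s v) (at_right 0)"
        unfolding right_derivative_iff by simp
      then show "((\<lambda>h. norm ((1 / h) *\<^sub>R (\<phi> s (x0 + h *\<^sub>R v) - \<phi> s x0) - v - s *\<^sub>R A v)) \<longlongrightarrow> norm (\<phi>' s v - v - s *\<^sub>R A v)) (at_right 0)"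
        by (intro tendsto_intros)
      define b where "b = min a (\<delta> / 2) / N"
      have b: "b > 0" using pos \<delta> N by (simp add: b_def)
      have bound: "norm ((1 / h) *\<^sub>R (\<phi> s (x0 + h *\<^sub>R v) - \<phi> s x0) - v - s *\<^sub>R A v) \<le> s * C * norm v" if h: "0 < h" "h < b" for h
      proof -
        have "h * norm v \<le> h * N" using h by (simp add: N_def)
        also have "\<dots> < min a (\<delta> / 2)" using h(2) N unfolding b_def by (simp add: pos_less_divide_eq)
        finally have "x0 + h *\<^sub>R v \<in> ball x0 (min a (\<delta> / 2))" using h by (simp add: dist_norm)
        from C[OF this] have 1: "norm (\<phi> s (x0 + h *\<^sub>R v) - \<phi> s x0 - h *\<^sub>R v - s *\<^sub>R A (h *\<^sub>R v)) \<le> s * C * (h * norm v)" using h by simp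
        have "(1 / h) *\<^sub>R (\<phi> s (x0 + h *\<^sub>R v) - \<phi> s x0) - v - s *\<^sub>R A v
            = (1 / h) *\<^sub>R (\<phi> s (x0 + h *\<^sub>R v) - \<phi> s x0 - h *\<^sub>R v - s *\<^sub>R A (h *\<^sub>R v))"
          using h by (simp add: blinfun.scaleR_right scaleR_diff_right)
        then have "norm ((1 / h) *\<^sub>R (\<phi> s (x0 + h *\<^sub>R v) - \<phi> s x0) - v - s *\<^sub>R A v)
            = (1 / h) * norm (\<phi> s (x0 + h *\<^sub>R v) - \<phi> s x0 - h *\<^sub>R v - s *\<^sub>R A (h *\<^sub>R v))" using h by simp
        also have "\<dots> \<le> (1 / h) * (s * C * (h * norm v))" by (rule mult_left_mono[OF 1]) (use h in simp)
        finally show ?thesis using h by simp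
      qed
      show "\<forall>\<^sub>F h in at_right 0. norm ((1 / h) *\<^sub>R (\<phi> s (x0 + h *\<^sub>R v) - \<phi> s x0) - v - s *\<^sub>R A v) \<le> s * C * norm v"
        unfolding eventually_at_right_field using b bound by blast
    qed simp
    moreover have "(1 / s) *\<^sub>R (\<phi>' s v - v) - A v = (1 / s) *\<^sub>R (\<phi>' s v - v - s *\<^sub>R A v)" using s by (simp add: scaleR_diff_right)
    ultimately have 2: "norm ((1 / s) *\<^sub>R (\<phi>' s v - v) - A v) \<le> C * norm v"
      using s by (simp add: pos_divide_le_eq mult.commute mult.left_commute)
    have C4: "C \<le> e / (2 * N)" using \<omega>(3) sBL' by (simp add: C_def)
    have "C * norm v \<le> e / (2 * N) * N" by (rule mult_mono[OF C4]) (use e N in \<open>auto simp: N_def\<close>)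
    also have "\<dots> = e / 2" using N by simp
    finally show ?thesis using 2 by linarith
  qed
  moreover have "frechet_derivative k (at x0) = blinfun_apply A"
    unfolding A_def by (rule frechet_derivative_at[OF k'(1)[OF D(3)], symmetric])
  ultimately show "\<forall>\<^sub>F s in at_right 0. dist ((1 / s) *\<^sub>R (\<phi>' s v - v)) (frechet_derivative k (at x0) v) < e"
    unfolding eventually_at_right_field using s1 e by (intro exI[of _ s1]) (fastforce simp: dist_norm)
qed

lemma mmetric_deriv:
  assumes x: "x \<in> mdom \<mu>"
  shows "((\<lambda>z. mmetric \<mu> (fst z) (snd z)) has_derivative (\<lambda>h. 2 * mlie \<mu> x (fst h) v (snd h))) (at (x, v))"
proof -
  have m: "mroot \<mu> x \<noteq> 0" using mroot_pos[OF x] by simp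
  have d: "((\<lambda>z :: (real^2) \<times> (real^2). mroot \<mu> (fst z)) has_derivative (\<lambda>h. - \<mu> * (x \<bullet> fst h) / mroot \<mu> x)) (at (x, v))"
    by (rule has_derivative_compose[OF has_derivative_fst[OF has_derivative_ident]]) (use mroot_deriv[OF x] in simp)
  have "((\<lambda>z. snd z \<bullet> snd z + \<mu> * ((fst z \<bullet> snd z) * inverse (mroot \<mu> (fst z)))\<^sup>2) has_derivative (\<lambda>h. 2 * mlie \<mu> x (fst h) v (snd h))) (at (x, v))"
    by (rule derivative_eq_intros d m refl | simp add: m)+
      (auto simp: fun_eq_iff mlie_def m field_simps inner_commute power2_eq_square power3_eq_cube)
  then show ?thesis
    by (simp add: mmetric_def divide_inverse inner_vec_def sum_2 power2_eq_square)
qed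

section \<open>From almost Killing fields to Killing fields\<close>

context model_chart
begin

lemma dst_nonneg: "x \<in> D \<Longrightarrow> y \<in> D \<Longrightarrow> dst (\<iota> x) (\<iota> y) \<ge> 0"
proof (rule field_le_epsilon)
  fix e :: real assume xy: "x \<in> D" "y \<in> D" and e: "e > 0"
  have "\<exists>c. C1_curve A c \<and> c 0 = \<iota> x \<and> c 1 = \<iota> y \<and> flen A F c < dst (\<iota> x) (\<iota> y) + e" by (rule dst_curve[OF xy e])
  then obtain c where c: "C1_curve A c \<and> c 0 = \<iota> x \<and> c 1 = \<iota> y \<and> flen A F c < dst (\<iota> x) (\<iota> y) + e" by (elim exE)
  then have "0 \<le> flen A F c" by (intro flen_nonneg) (elim conjE)
  then show "0 \<le> dst (\<iota> x) (\<iota> y) + e" using c by linarith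
qed

lemma dst_refl: "x \<in> D \<Longrightarrow> dst (\<iota> x) (\<iota> x) = 0"
  using dst_upper[of x x 0] dst_nonneg[of x x] by (simp add: fins_zero del: mem_ball)

text \<open>Symmetrizing the distance cancels the 1-form, and the infinitesimal symmetrized distance is the Riemannian norm.\<close>

lemma sdist_limit:
  assumes x: "x \<in> D" and z0: "z 0 = x" and z: "(z has_vector_derivative w) (at_right 0)"
  shows "((\<lambda>h. (dst (\<iota> x) (\<iota> (z h)) + dst (\<iota> (z h)) (\<iota> x)) / h) \<longlongrightarrow> 2 * sqrt (mmetric \<mu> x w)) (at_right 0)"
proof (rule tendstoI)
  fix e :: real assume e: "e > 0"
  define N where "N v = 2 * sqrt (mmetric \<mu> x v)" for v
  define q where "q h = N ((1 / h) *\<^sub>R (z h - x))" for h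
  have m: "mroot \<mu> x \<noteq> 0" using mroot_pos[of x \<mu>] x \<rho> by force
  have "continuous_on UNIV N" unfolding N_def mmetric_def by (intro continuous_intros) (simp add: m)
  then have "isCont N w" by (simp add: continuous_on_eq_continuous_at)
  then have q: "(q \<longlongrightarrow> N w) (at_right 0)"
    unfolding q_def[abs_def] using z[unfolded right_derivative_iff z0] by (rule isCont_tendsto_compose)
  have zc: "(z \<longlongrightarrow> x) (at_right 0)"
    using has_vector_derivative_continuous[OF z] by (simp add: continuous_within z0)
  have Nw: "N w \<ge> 0" using mmetric_pos[OF x, of w] by (cases "w = 0") (auto simp: N_def mmetric_def)
  \<comment> \<open>Half of the error \<open>e\<close> is reserved for the convergence of
    \<open>q\<close>; the relative error \<open>e1\<close> of the distance, multiplied by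
    \<open>q h \<le> N w + 1\<close>, takes the other half.\<close>
  define e1 where "e1 = min (1/2) (e / (2 * (N w + 1)))"
  have e1: "0 < e1" "e1 < 1" "e1 \<le> e / (2 * (N w + 1))" using e Nw by (auto simp: e1_def)
  obtain d where d: "d > 0" "ball x d \<subseteq> D" "\<forall>p\<in>ball x d. \<forall>y\<in>ball x d.
    (1 - e1) * fins x (y - p) \<le> dst (\<iota> p) (\<iota> y) \<and> dst (\<iota> p) (\<iota> y) \<le> (1 + e1) * fins x (y - p)"
    using dst_asymp[OF x e1(1,2)] by (elim exE conjE)
  have ev1: "\<forall>\<^sub>F h in at_right 0. dist (q h) (N w) < min 1 (e / 2)" using e by (intro tendstoD[OF q]) auto
  have ev2: "\<forall>\<^sub>F h in at_right 0. dist (z h) x < d" by (rule tendstoD[OF zc d(1)])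
  have ev3: "\<forall>\<^sub>F h in at_right (0::real). 0 < h" by (rule eventually_at_right_less)
  show "\<forall>\<^sub>F h in at_right 0. dist ((dst (\<iota> x) (\<iota> (z h)) + dst (\<iota> (z h)) (\<iota> x)) / h) (2 * sqrt (mmetric \<mu> x w)) < e"
    using ev1 ev2 ev3
  proof eventually_elim
    case (elim h)
    define S where "S = dst (\<iota> x) (\<iota> (z h)) + dst (\<iota> (z h)) (\<iota> x)"
    have b: "x \<in> ball x d" "z h \<in> ball x d" using d(1) elim(2) by (auto simp: dist_commute)
    have "x - z h = - (z h - x)" by simp
    then have sum: "fins x (z h - x) + fins x (x - z h) = N (z h - x)" using fins_symm[of x "z h - x"] by (simp add: N_def)
    have hq: "N (z h - x) = h * q h" using elim(3) by (simp add: N_def q_def mmetric_scale real_sqrt_mult power_divide real_sqrt_divide)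
    note d1 = bspec[OF bspec[OF d(3) b(1)] b(2)] and d2 = bspec[OF bspec[OF d(3) b(2)] b(1)]
    have "(1 - e1) * (fins x (z h - x) + fins x (x - z h)) \<le> S" "S \<le> (1 + e1) * (fins x (z h - x) + fins x (x - z h))"
      using d1 d2 unfolding S_def distrib_left by linarith+
    then have "(1 - e1) * (h * q h) \<le> S" "S \<le> (1 + e1) * (h * q h)" by (simp_all only: sum hq)
    then have "(1 - e1) * q h \<le> S / h" "S / h \<le> (1 + e1) * q h"
      using elim(3) by (simp_all add: pos_le_divide_eq pos_divide_le_eq mult.commute mult.left_commute)
    then have 1: "\<bar>S / h - q h\<bar> \<le> e1 * q h" by (simp add: abs_le_iff algebra_simps)
    have qN: "\<bar>q h - N w\<bar> < e / 2" "q h \<le> N w + 1" using elim(1) by (auto simp: dist_real_def)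
    have "e1 * q h \<le> e1 * (N w + 1)" using e1(1) qN(2) by simp
    also have "\<dots> \<le> e / 2" using e1(3) Nw by (simp add: field_simps)
    finally have "\<bar>S / h - N w\<bar> < e" using 1 qN(1) by linarith
    then show ?case by (simp add: dist_real_def S_def N_def)
  qed
qed

text \<open>The symmetrized distances from \<open>x\<close> to \<open>x + h v\<close> and between
  the image points coincide; dividing by \<open>h\<close>, \<open>sdist_limit\<close> evaluates both
  limits as Riemannian norms.\<close>

lemma sdist_isometry:
  assumes b: "ball x a \<subseteq> D" "a > 0" and \<phi>: "\<phi> ` ball x a \<subseteq> D" "(\<phi> has_derivative \<phi>') (at x)"
    and S: "\<And>y. y \<in> ball x a \<Longrightarrow> dst (\<iota> (\<phi> x)) (\<iota> (\<phi> y)) + dst (\<iota> (\<phi> y)) (\<iota> (\<phi> x)) = dst (\<iota> x) (\<iota> y) + dst (\<iota> y) (\<iota> x)"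
  shows "mmetric \<mu> (\<phi> x) (\<phi>' v) = mmetric \<mu> x v"
proof -
  have xb: "x \<in> ball x a" using b(2) by simp
  have xD: "x \<in> D" "\<phi> x \<in> D" using xb b(1) \<phi>(1) by blast+
  define z where "z h = x + h *\<^sub>R v" for h
  have z: "(z has_vector_derivative v) (at_right 0)" unfolding z_def by (auto intro!: derivative_eq_intros)
  have z0: "z 0 = x" by (simp add: z_def)
  have "((\<phi> \<circ> z) has_vector_derivative \<phi>' v) (at_right 0)"
    by (rule vector_derivative_diff_chain_within[OF z]) (use \<phi>(2) z0 in \<open>simp add: has_derivative_at_withinI\<close>)
  from sdist_limit[OF xD(2) _ this]
  have l1: "((\<lambda>h. (dst (\<iota> (\<phi> x)) (\<iota> (\<phi> (z h))) + dst (\<iota> (\<phi> (z h))) (\<iota> (\<phi> x))) / h) \<longlongrightarrow> 2 * sqrt (mmetric \<mu> (\<phi> x) (\<phi>' v))) (at_right 0)"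
    by (simp add: z0)
  have "(z \<longlongrightarrow> x) (at_right 0)" using has_vector_derivative_continuous[OF z] by (simp add: continuous_within z0)
  then have "\<forall>\<^sub>F h in at_right 0. dist (z h) x < a" by (rule tendstoD) (rule b(2))
  then have ev: "\<forall>\<^sub>F h in at_right 0. (dst (\<iota> (\<phi> x)) (\<iota> (\<phi> (z h))) + dst (\<iota> (\<phi> (z h))) (\<iota> (\<phi> x))) / h
      = (dst (\<iota> x) (\<iota> (z h)) + dst (\<iota> (z h)) (\<iota> x)) / h"
    by (rule eventually_mono) (use S in \<open>simp add: dist_commute\<close>)
  have "2 * sqrt (mmetric \<mu> (\<phi> x) (\<phi>' v)) = 2 * sqrt (mmetric \<mu> x v)"
    by (rule tendsto_unique[OF _ l1]) (use sdist_limit[OF xD(1) z0 z] in \<open>simp_all add: tendsto_cong[OF ev]\<close>)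
  then show ?thesis by simp
qed

text \<open>The function \<open>mmetric\<close> along the flow, evaluated on the image of a fixed
  vector, is constant in time, and its right derivative at time 0 is twice
  \<open>mlie\<close>.\<close>

lemma almost_Killing_lie:
  assumes K: "vfield A \<kappa> W k \<in> almost_Killing_fields A F W" and k: "smooth_on D k" and x0: "x0 \<in> D"
  shows "mlie \<mu> x0 (k x0) v (frechet_derivative k (at x0) v) = 0"
proof -
  let ?K = "vfield A \<kappa> W k"
  have oW: "open W" by (rule is_chartD(1)[OF ch])
  have "\<forall>p\<in>W. \<exists>U \<epsilon> \<Phi>. open U \<and> p \<in> U \<and> U \<subseteq> W \<and> \<epsilon> > 0 \<and> local_flow A W ?K U \<epsilon> \<Phi> \<and>
       (\<forall>t. \<bar>t\<bar> < \<epsilon> \<longrightarrow> almost_isometry A F U (\<Phi> t ` U) (\<Phi> t))"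
    using K unfolding almost_Killing_fields_def by simp
  from bspec[OF this \<iota>W[OF x0]]
  obtain U \<epsilon> \<Phi> where U: "open U" "\<iota> x0 \<in> U" "U \<subseteq> W" "\<epsilon> > 0" and fl: "local_flow A W ?K U \<epsilon> \<Phi>"
    and ai: "\<forall>t. \<bar>t\<bar> < \<epsilon> \<longrightarrow> almost_isometry A F U (\<Phi> t ` U) (\<Phi> t)"
    by (elim exE conjE)
  have oX: "open (\<xi> ` U)" by (rule chart_image_open[OF ch U(1,3)])
  have "x0 \<in> \<xi> ` U" using U(2) \<xi>\<iota>[OF x0] by (metis image_eqI)
  then obtain a where a: "a > 0" "ball x0 a \<subseteq> \<xi> ` U" using oX open_contains_ball by blast
  have XD: "\<xi> ` U \<subseteq> D" using \<xi>D U(3) by blast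
  have aD: "ball x0 a \<subseteq> D" using a(2) XD by blast
  have \<iota>U: "\<iota> x \<in> U" if "x \<in> \<xi> ` U" for x
  proof -
    from that obtain p where "x = \<xi> p" "p \<in> U" by (elim imageE)
    then show ?thesis using \<iota>\<xi>[of p] U(3) by auto
  qed
  define \<phi> where "\<phi> s x = \<xi> (\<Phi> s (\<iota> x))" for s x
  have ic: "\<Phi> 0 p = p" "integral_curve A W ?K {-\<epsilon><..<\<epsilon>} (\<lambda>t. \<Phi> t p)" if "p \<in> U" for p
    using fl that unfolding local_flow_def by blast+
  have \<Phi>W: "\<Phi> s p \<in> W" if "p \<in> U" "\<bar>s\<bar> < \<epsilon>" for s p
  proof -
    have "(\<lambda>t. \<Phi> t p) ` {-\<epsilon><..<\<epsilon>} \<subseteq> W" using ic(2)[OF that(1)] unfolding integral_curve_def by blast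
    moreover have "s \<in> {-\<epsilon><..<\<epsilon>}" using that(2) by auto
    ultimately show ?thesis by blast
  qed
  have \<phi>D: "\<phi> s x \<in> D" "\<iota> (\<phi> s x) = \<Phi> s (\<iota> x)" if "x \<in> \<xi> ` U" "\<bar>s\<bar> < \<epsilon>" for s x
    unfolding \<phi>_def by (rule \<xi>D \<iota>\<xi>, rule \<Phi>W[OF \<iota>U[OF that(1)] that(2)])+
  have \<phi>0: "\<phi> 0 x = x" if "x \<in> \<xi> ` U" for x
    using ic(1)[OF \<iota>U[OF that]] \<xi>\<iota>[OF subsetD[OF XD that]] by (simp add: \<phi>_def)
  have d\<phi>: "((\<lambda>s. \<phi> s x) has_vector_derivative k (\<phi> s x)) (at s)" if "x \<in> \<xi> ` U" "\<bar>s\<bar> < \<epsilon>" for s x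
  proof -
    have s: "s \<in> {-\<epsilon><..<\<epsilon>}" using that(2) by auto
    from integral_curve_chart[OF A \<kappa> order_refl ic(2)[OF \<iota>U[OF that(1)]] open_greaterThanLessThan s]
    show ?thesis by (simp add: \<phi>_def o_def)
  qed
  have sm: "smooth_on (\<xi> ` U) (\<phi> s)" if s: "\<bar>s\<bar> < \<epsilon>" for s
  proof -
    have "smooth_map_on A U (\<Phi> s)" using ai s unfolding almost_isometry_def diffeomorphism_def by blast
    moreover have "\<Phi> s ` U \<subseteq> W" using \<Phi>W s by blast
    ultimately show ?thesis unfolding \<phi>_def[abs_def] by (rule smooth_map_chart[OF A \<kappa> U(1,3)])
  qed
  have x0U: "x0 \<in> \<xi> ` U" using a by auto
  let ?d = "\<lambda>s. frechet_derivative (\<phi> s) (at x0)"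
  have D\<phi>: "(\<phi> s has_derivative ?d s) (at x0)" if "\<bar>s\<bar> < \<epsilon>" for s by (rule smooth_on_derivative[OF sm[OF that] x0U])
  have iso: "mmetric \<mu> (\<phi> s x0) (?d s v) = mmetric \<mu> x0 v" if s: "\<bar>s\<bar> < \<epsilon>" for s
  proof (rule sdist_isometry[OF aD a(1) _ D\<phi>[OF s]])
    show "\<phi> s ` ball x0 a \<subseteq> D" using \<phi>D(1) s a(2) by blast
    fix y assume "y \<in> ball x0 a"
    then have y: "y \<in> \<xi> ` U" using a(2) by blast
    \<comment> \<open>Equal end points: the excess is the symmetrized distance minus the distance of
      a point to itself, which is 0.\<close>
    have T: "triangle_excess A F (\<iota> x0) (\<iota> y) (\<iota> x0) = triangle_excess A F (\<Phi> s (\<iota> x0)) (\<Phi> s (\<iota> y)) (\<Phi> s (\<iota> x0))"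
      using ai s \<iota>U[OF y] U(2) unfolding almost_isometry_def by blast
    have "dst (\<iota> x0) (\<iota> x0) = 0" "dst (\<iota> (\<phi> s x0)) (\<iota> (\<phi> s x0)) = 0"
      using dst_refl[OF x0] dst_refl[OF \<phi>D(1)[OF x0U s]] .
    then show "dst (\<iota> (\<phi> s x0)) (\<iota> (\<phi> s y)) + dst (\<iota> (\<phi> s y)) (\<iota> (\<phi> s x0)) = dst (\<iota> x0) (\<iota> y) + dst (\<iota> y) (\<iota> x0)"
      using T unfolding triangle_excess_def \<phi>D(2)[OF x0U s] \<phi>D(2)[OF y s] by simp
  qed
  \<comment> \<open>The definition of a local flow provides the time derivative of each trajectory,
    but not that of the derivative with respect to the point; \<open>flow_linearization\<close>
    supplies it at time 0.\<close>
  have lin: "((\<lambda>s. (1 / s) *\<^sub>R (?d s v - v)) \<longlongrightarrow> frechet_derivative k (at x0) v) (at_right 0)"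
  proof (rule flow_linearization[OF open_ball k x0 U(4) a(1)])
    fix s x assume s: "0 \<le> s" "s < \<epsilon>" and x: "x \<in> ball x0 a"
    show "((\<lambda>s. \<phi> s x) has_vector_derivative k (\<phi> s x)) (at s)" by (rule d\<phi>) (use s x a(2) in auto)
  next
    fix x assume "x \<in> ball x0 a"
    then show "\<phi> 0 x = x" using \<phi>0 a(2) by blast
  next
    fix s :: real assume "0 \<le> s" "s < \<epsilon>"
    then show "(\<phi> s has_derivative ?d s) (at x0)" by (intro D\<phi>) simp
  qed
  have "(\<phi> 0 has_derivative (\<lambda>v. v)) (at x0)"
    by (rule has_derivative_transform_within_open[OF has_derivative_ident oX x0U]) (simp add: \<phi>0)
  then have d0: "?d 0 v = v" using fun_cong[OF frechet_derivative_at] by metis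
  have P1: "((\<lambda>s. \<phi> s x0) has_vector_derivative k x0) (at_right 0)"
    using has_vector_derivative_at_within[OF d\<phi>[OF x0U, of 0]] U(4) \<phi>0[OF x0U] by simp
  have P2: "((\<lambda>s. ?d s v) has_vector_derivative frechet_derivative k (at x0) v) (at_right 0)"
    unfolding right_derivative_iff d0 by (rule lin)
  have xm: "x0 \<in> mdom \<mu>" using x0 \<rho>(2) by blast
  define G where "G z = mmetric \<mu> (fst z) (snd z)" for z
  have "((G \<circ> (\<lambda>s. (\<phi> s x0, ?d s v))) has_vector_derivative 2 * mlie \<mu> x0 (fst (k x0, frechet_derivative k (at x0) v)) v
      (snd (k x0, frechet_derivative k (at x0) v))) (at_right 0)"
  proof (rule vector_derivative_diff_chain_within[OF has_vector_derivative_Pair[OF P1 P2]])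
    show "(G has_derivative (\<lambda>h. 2 * mlie \<mu> x0 (fst h) v (snd h)))
        (at (\<phi> 0 x0, ?d 0 v) within (\<lambda>s. (\<phi> s x0, ?d s v)) ` {0<..})"
      unfolding d0 \<phi>0[OF x0U] G_def[abs_def] by (rule has_derivative_at_withinI[OF mmetric_deriv[OF xm]])
  qed
  then have "((\<lambda>h. (1 / h) *\<^sub>R (G (\<phi> h x0, ?d h v) - G (\<phi> 0 x0, ?d 0 v)))
      \<longlongrightarrow> 2 * mlie \<mu> x0 (k x0) v (frechet_derivative k (at x0) v)) (at_right 0)"
    unfolding right_derivative_iff by simp
  moreover have "((\<lambda>h. (1 / h) *\<^sub>R (G (\<phi> h x0, ?d h v) - G (\<phi> 0 x0, ?d 0 v))) \<longlongrightarrow> 0) (at_right 0)"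
  proof (rule tendsto_eventually)
    have "(1 / h) *\<^sub>R (G (\<phi> h x0, ?d h v) - G (\<phi> 0 x0, ?d 0 v)) = 0" if "0 < h" "h < \<epsilon>" for h
      using iso[of h] iso[of 0] that by (simp add: G_def)
    then show "\<forall>\<^sub>F h in at_right 0. (1 / h) *\<^sub>R (G (\<phi> h x0, ?d h v) - G (\<phi> 0 x0, ?d 0 v)) = 0"
      unfolding eventually_at_right_field using U(4) by blast
  qed
  ultimately have "2 * mlie \<mu> x0 (k x0) v (frechet_derivative k (at x0) v) = 0"
    by (rule tendsto_unique[OF trivial_limit_at_right_real])
  then show ?thesis by simp
qed

lemma vfield_cong: "(\<And>x. x \<in> D \<Longrightarrow> k x = k' x) \<Longrightarrow> vfield A \<kappa> W k = vfield A \<kappa> W k'"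
  using \<xi>D by (auto simp: vfield_def fun_eq_iff simp del: mem_ball)

lemma almost_Killing_killing:
  assumes K: "K \<in> almost_Killing_fields A F W"
  shows "\<exists>\<alpha> \<beta> \<gamma>. K = vfield A \<kappa> W (mkilling \<mu> \<alpha> \<beta> \<gamma>)"
proof -
  have oW: "open W" by (rule is_chartD(1)[OF ch])
  have "K \<in> vector_fields A W" using K unfolding almost_Killing_fields_def by blast
  from vector_field_chart[OF A \<kappa> oW order_refl this]
  obtain k where "smooth_on (\<xi> ` W) k \<and> K = vfield A \<kappa> W k" by (elim exE)
  then have k: "smooth_on D k" and Kk: "K = vfield A \<kappa> W k" unfolding im by blast+
  have "\<exists>\<alpha> \<beta> \<gamma>. \<forall>x\<in>D. k x = mkilling \<mu> \<alpha> \<beta> \<gamma> x"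
    by (rule mkilling_unique[OF \<rho>(2,1) k almost_Killing_lie[OF K[unfolded Kk] k]])
  then obtain \<alpha> \<beta> \<gamma> where "\<forall>x\<in>D. k x = mkilling \<mu> \<alpha> \<beta> \<gamma> x" by (elim exE)
  then have "K = vfield A \<kappa> W (mkilling \<mu> \<alpha> \<beta> \<gamma>)" unfolding Kk by (intro vfield_cong) (elim bspec)
  then show ?thesis by (intro exI)
qed

section \<open>Dimension count\<close>

definition basis_field :: "nat \<Rightarrow> 'm \<Rightarrow> ('m, 2) tangent" where
  "basis_field i = vfield A \<kappa> W (mkilling \<mu> (of_bool (i = 0)) (of_bool (i = 1)) (of_bool (i = 2)))"

lemma killing_combination:
  "vfield A \<kappa> W (mkilling \<mu> \<alpha> \<beta> \<gamma>) = \<alpha> *\<^sub>R basis_field 0 + \<beta> *\<^sub>R basis_field 1 + \<gamma> *\<^sub>R basis_field 2"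
proof (rule ext)
  fix p
  show "vfield A \<kappa> W (mkilling \<mu> \<alpha> \<beta> \<gamma>) p = (\<alpha> *\<^sub>R basis_field 0 + \<beta> *\<^sub>R basis_field 1 + \<gamma> *\<^sub>R basis_field 2) p"
  proof (cases "p \<in> W")
    case True
    let ?x = "\<xi> p"
    have add: "tvec A \<kappa> p (u + v) = tvec A \<kappa> p u + tvec A \<kappa> p v" for u v
      using tvec_linear[OF \<kappa> True, of 1 u 1 v] by simp
    have scale: "tvec A \<kappa> p (a *\<^sub>R u) = a *\<^sub>R tvec A \<kappa> p u" for a u
      using tvec_linear[OF \<kappa> True, of a u 0 0] by simp
    have "mkilling \<mu> \<alpha> \<beta> \<gamma> ?x = \<alpha> *\<^sub>R mkilling \<mu> 1 0 0 ?x + \<beta> *\<^sub>R mkilling \<mu> 0 1 0 ?x + \<gamma> *\<^sub>R mkilling \<mu> 0 0 1 ?x"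
      by (simp add: mkilling_def vec_eq_iff forall_2)
    then have "tvec A \<kappa> p (mkilling \<mu> \<alpha> \<beta> \<gamma> ?x)
        = \<alpha> *\<^sub>R tvec A \<kappa> p (mkilling \<mu> 1 0 0 ?x) + \<beta> *\<^sub>R tvec A \<kappa> p (mkilling \<mu> 0 1 0 ?x) + \<gamma> *\<^sub>R tvec A \<kappa> p (mkilling \<mu> 0 0 1 ?x)"
      by (simp only: add scale)
    then show ?thesis using True by (simp add: basis_field_def vfield_def plus_fun_def scaleR_fun_def)
  next
    case False
    then show ?thesis by (simp add: basis_field_def vfield_def plus_fun_def scaleR_fun_def zero_fun_def)
  qed
qed

lemma almost_Killing_eq: "almost_Killing_fields A F W = range (\<lambda>(\<alpha>, \<beta>, \<gamma>). \<alpha> *\<^sub>R basis_field 0 + \<beta> *\<^sub>R basis_field 1 + \<gamma> *\<^sub>R basis_field 2)"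
proof (intro equalityI subsetI)
  fix K assume "K \<in> almost_Killing_fields A F W"
  from almost_Killing_killing[OF this] obtain \<alpha> \<beta> \<gamma> where "K = vfield A \<kappa> W (mkilling \<mu> \<alpha> \<beta> \<gamma>)" by (elim exE)
  then show "K \<in> range (\<lambda>(\<alpha>, \<beta>, \<gamma>). \<alpha> *\<^sub>R basis_field 0 + \<beta> *\<^sub>R basis_field 1 + \<gamma> *\<^sub>R basis_field 2)"
    unfolding killing_combination by (intro image_eqI[of _ _ "(\<alpha>, \<beta>, \<gamma>)"]) simp_all
next
  fix K assume "K \<in> range (\<lambda>(\<alpha>, \<beta>, \<gamma>). \<alpha> *\<^sub>R basis_field 0 + \<beta> *\<^sub>R basis_field 1 + \<gamma> *\<^sub>R basis_field 2)"
  then obtain z where z: "K = (\<lambda>(\<alpha>, \<beta>, \<gamma>). \<alpha> *\<^sub>R basis_field 0 + \<beta> *\<^sub>R basis_field 1 + \<gamma> *\<^sub>R basis_field 2) z" by (elim rangeE)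
  obtain \<alpha> \<beta> \<gamma> where "z = (\<alpha>, \<beta>, \<gamma>)" by (rule prod_cases3)
  then have "K = vfield A \<kappa> W (mkilling \<mu> \<alpha> \<beta> \<gamma>)" unfolding killing_combination z by simp
  then show "K \<in> almost_Killing_fields A F W" using killing_almost_Killing by simp
qed

lemma basis_field_combination_zero:
  assumes "\<alpha> *\<^sub>R basis_field 0 + \<beta> *\<^sub>R basis_field 1 + \<gamma> *\<^sub>R basis_field 2 = 0"
  shows "\<alpha> = 0 \<and> \<beta> = 0 \<and> \<gamma> = 0"
proof -
  have z: "mkilling \<mu> \<alpha> \<beta> \<gamma> x = 0" if x: "x \<in> D" for x
  proof -
    have "tvec A \<kappa> (\<iota> x) (mkilling \<mu> \<alpha> \<beta> \<gamma> x) = tvec A \<kappa> (\<iota> x) 0"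
      using fun_cong[OF assms[folded killing_combination], of "\<iota> x"] \<iota>W[OF x] \<xi>\<iota>[OF x]
      by (simp add: vfield_def zero_fun_def tvec_zero[OF \<kappa> \<iota>W[OF x], unfolded zero_fun_def])
    then show ?thesis by (rule tvec_inj[OF A \<kappa> \<iota>W[OF x]])
  qed
  \<comment> \<open>At the centre the rotation vanishes and \<open>mroot\<close> is positive, which
    isolates \<alpha> and \<beta>; any other point, here on the first axis, then detects the
    rotation coefficient \<gamma>.\<close>
  have "(0 :: real^2) \<in> D" using \<rho>(1) by simp
  from z[OF this] mroot_pos[OF subsetD[OF \<rho>(2) this]] have ab: "\<alpha> = 0" "\<beta> = 0"
    by (simp_all add: mkilling_def vec_eq_iff forall_2)
  have "axis 1 (\<rho> / 2) = (\<rho> / 2) *\<^sub>R (axis 1 1 :: real^2)" by (simp add: vec_eq_iff axis_def)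
  then have "axis 1 (\<rho> / 2) \<in> D" using \<rho>(1) by simp
  from z[OF this] have "\<gamma> * (\<rho> / 2) = 0" by (simp add: mkilling_def vec_eq_iff forall_2 ab axis_def)
  then show ?thesis using ab \<rho>(1) by simp
qed

lemma almost_Killing_dim:
  "subspace (almost_Killing_fields A F W) \<and> dim (almost_Killing_fields A F W) = 3"
proof -
  let ?b = basis_field
  define B where "B = {?b 0, ?b 1, ?b 2}"
  have c0: "\<alpha> = 0 \<and> \<beta> = 0 \<and> \<gamma> = 0" if "\<alpha> *\<^sub>R ?b 0 + \<beta> *\<^sub>R ?b 1 + \<gamma> *\<^sub>R ?b 2 = 0" for \<alpha> \<beta> \<gamma>
    using that by (rule basis_field_combination_zero)
  have ne: "?b 0 \<noteq> ?b 1" "?b 0 \<noteq> ?b 2" "?b 1 \<noteq> ?b 2"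
    using c0[of 1 "-1" 0] c0[of 1 0 "-1"] c0[of 0 1 "-1"] by auto
  have span: "almost_Killing_fields A F W = span B"
  proof (intro equalityI subsetI)
    fix K assume "K \<in> almost_Killing_fields A F W"
    then obtain \<alpha> \<beta> \<gamma> where "K = \<alpha> *\<^sub>R ?b 0 + \<beta> *\<^sub>R ?b 1 + \<gamma> *\<^sub>R ?b 2" unfolding almost_Killing_eq by auto
    then show "K \<in> span B" by (simp add: B_def span_add span_scale span_base)
  next
    fix K assume "K \<in> span B"
    then obtain u where "K = (\<Sum>v\<in>B. u v *\<^sub>R v)" by (auto simp: span_finite B_def)
    also have "\<dots> = u (?b 0) *\<^sub>R ?b 0 + u (?b 1) *\<^sub>R ?b 1 + u (?b 2) *\<^sub>R ?b 2" using ne by (simp add: B_def add.assoc)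
    finally show "K \<in> almost_Killing_fields A F W"
      unfolding almost_Killing_eq by (intro image_eqI[of _ _ "(u (?b 0), u (?b 1), u (?b 2))"]) simp_all
  qed
  have "independent B"
  proof (rule independent_if_scalars_zero)
    fix u v assume "(\<Sum>v\<in>B. u v *\<^sub>R v) = 0" "v \<in> B"
    moreover have "(\<Sum>v\<in>B. u v *\<^sub>R v) = u (?b 0) *\<^sub>R ?b 0 + u (?b 1) *\<^sub>R ?b 1 + u (?b 2) *\<^sub>R ?b 2"
      using ne by (simp add: B_def add.assoc)
    ultimately show "u v = 0" using c0[of "u (?b 0)" "u (?b 1)" "u (?b 2)"] by (auto simp: B_def)
  qed (simp add: B_def)
  moreover have "card B = 3" using ne by (simp add: B_def)
  ultimately show ?thesis unfolding span by (simp add: dim_eq_card_independent)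
qed

end

theorem mainTheorem5:
  fixes A :: "('m::{t2_space, second_countable_topology}, 2) chart set"
    and g :: "('m, 2) metric"
    and \<tau> :: "'m \<Rightarrow> ('m, 2) tangent \<Rightarrow> real"
    and c :: real
  assumes "connected (UNIV :: 'm set)"
    and "oriented_atlas A"
    and "riemannian_metric A g"
    and "constant_sectional_curvature A g"
    and "one_form A \<tau>"
    and "\<forall>p. \<forall>\<kappa>\<in>charts_at A p. \<forall>u\<in>tangent_space A p. \<forall>v\<in>tangent_space A p.
           ext_deriv A \<tau> \<kappa> p u v = c * volume_form A g \<kappa> p u v"
    and "\<forall>p. covector_norm A g \<tau> p < 1"
  shows "\<forall>p. \<exists>W. open W \<and> p \<in> W \<and>
           subspace (almost_Killing_fields A (randers g \<tau>) W) \<and>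
           dim (almost_Killing_fields A (randers g \<tau>) W) = 3"
proof
  fix p0
  have "\<exists>\<mu> \<kappa> \<rho> \<theta>. compatible A \<kappa> \<and> p0 \<in> chart_dom \<kappa> \<and> chart_map \<kappa> ` chart_dom \<kappa> = ball 0 \<rho> \<and> \<rho> > 0 \<and> ball 0 \<rho> \<subseteq> mdom \<mu> \<and>
    (\<forall>p\<in>chart_dom \<kappa>. \<forall>y. g p (tvec A \<kappa> p y) (tvec A \<kappa> p y) = mmetric \<mu> (chart_map \<kappa> p) y) \<and>
    smooth_on (ball 0 \<rho>) \<theta> \<and> (\<forall>p\<in>chart_dom \<kappa>. \<forall>y. \<tau> p (tvec A \<kappa> p y) = \<theta> (chart_map \<kappa> p) \<bullet> y) \<and>
    (\<forall>x\<in>ball 0 \<rho>. curl \<theta> x = c / mroot \<mu> x)"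
  proof (rule model_chart_exists[OF assms(2-5)])
    fix p \<kappa> u v
    assume "\<kappa> \<in> charts_at A p" "u \<in> tangent_space A p" "v \<in> tangent_space A p"
    then show "ext_deriv A \<tau> \<kappa> p u v = c * volume_form A g \<kappa> p u v" using assms(6) by blast
  qed
  then obtain \<mu> \<kappa> \<rho> \<theta> where *: "compatible A \<kappa>" "p0 \<in> chart_dom \<kappa>" "chart_map \<kappa> ` chart_dom \<kappa> = ball 0 \<rho>" "\<rho> > 0" "ball 0 \<rho> \<subseteq> mdom \<mu>"
    "\<forall>p\<in>chart_dom \<kappa>. \<forall>y. g p (tvec A \<kappa> p y) (tvec A \<kappa> p y) = mmetric \<mu> (chart_map \<kappa> p) y"
    "smooth_on (ball 0 \<rho>) \<theta>" "\<forall>p\<in>chart_dom \<kappa>. \<forall>y. \<tau> p (tvec A \<kappa> p y) = \<theta> (chart_map \<kappa> p) \<bullet> y"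
    "\<forall>x\<in>ball 0 \<rho>. curl \<theta> x = c / mroot \<mu> x"
    by (elim exE conjE)
  \<comment> \<open>The neighbourhood sought is the domain of this model chart, and the constant
    \<open>\<eta>\<close> of the locale is \<open>c\<close>.\<close>
  interpret model_chart A g \<tau> \<kappa> \<mu> \<rho> c \<theta>
  proof (unfold_locales, rule assms(2), rule assms(3), rule assms(5), rule spec[OF assms(7)], rule *(1), rule *(3), rule *(4), rule *(5))
    show "g p (tvec A \<kappa> p y) (tvec A \<kappa> p y) = mmetric \<mu> (chart_map \<kappa> p) y" if "p \<in> chart_dom \<kappa>" for p y
      by (rule spec[OF bspec[OF *(6) that]])
    show "smooth_on (ball 0 \<rho>) \<theta>" by (rule *(7))
    show "\<tau> p (tvec A \<kappa> p y) = \<theta> (chart_map \<kappa> p) \<bullet> y" if "p \<in> chart_dom \<kappa>" for p y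
      by (rule spec[OF bspec[OF *(8) that]])
    show "curl \<theta> x = c / mroot \<mu> x" if "x \<in> ball 0 \<rho>" for x by (rule bspec[OF *(9) that])
  qed
  have "open (chart_dom \<kappa>)" by (rule is_chartD(1)[OF ch])
  then show "\<exists>W. open W \<and> p0 \<in> W \<and> subspace (almost_Killing_fields A (randers g \<tau>) W) \<and> dim (almost_Killing_fields A (randers g \<tau>) W) = 3"
    using *(2) almost_Killing_dim by (intro exI[of _ "chart_dom \<kappa>"] conjI) simp_all
qed

end
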